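(* Let $P\to M$ be a principal $K$-bundle over an oriented spin manifold $M$ of arbitrary dimension. Let $(g,H,\theta,\eta)$ consist of a Riemannian metric $g$ on $M$, a three-form $H\in\Omega^3(M)$, a principal connection $\theta$ on $P$ and a spinor $\eta\in\Omega^0(S)$ satisfying $$\nabla^+\eta=0,\qquad F_\theta\cdot\eta=0,\qquad dH-\langle F_\theta\wedge F_\theta\rangle=0 .$$ Then $(g,H,\theta,\eta)$ solves the coupled instanton system $$(R_{\nabla^-}-\mathbb F^\dagger\wedge\mathbb F)\cdot\eta=0,\qquad (\nabla^{\theta,+}F_\theta)\cdot\eta=0,\qquad [F_\theta\cdot\eta,\,\cdot\,]-(\mathbb F\wedge\mathbb F^\dagger)\cdot\eta=0,\qquad dH-\langle F_\theta\wedge F_\theta\rangle=0,$$ and consequently the connection on $TM\oplus\mathrm{ad}P$ $$D=\begin{pmatrix}\nabla^-&\mathbb F^\dagger\\-\mathbb F&d^\theta\end{pmatrix}$$ is an instanton with respect to $\eta$, i.e. $F_D\cdot\eta=0$. In particular, if $\zeta\in\Omega^1(M)$, $\lambda\in\mathbb R$ and $(g,H,\theta,\eta,\zeta)$ satisfies $\nabla^+\eta=0$, $F_\theta\cdot\eta=0$, $\bigl(\slash\!\!\!\!\nabla^{1/3}-\tfrac12\zeta\bigr)\cdot\eta=\lambda\eta$ and $dH=\langle F_\theta\wedge F_\theta\rangle$, then $(g,H,\theta,\eta)$ solves the coupled instanton system.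
   Context: $K$ is a real Lie group whose Lie algebra $\mathfrak k$ carries a non-degenerate bi-invariant symmetric bilinear form $\langle\cdot,\cdot\rangle$ (any signature); the same symbol denotes the induced pairing on $\mathrm{ad}P$. $F_\theta\in\Omega^2(M,\mathrm{ad}P)$ is the curvature of $\theta$, $d^\theta$ the induced covariant derivative on $\mathrm{ad}P$, and $\langle F_\theta\wedge F_\theta\rangle\in\Omega^4(M)$ is the wedge product combined with $\langle\cdot,\cdot\rangle$. $\nabla^g$ is the Levi-Civita connection, and $\nabla^{\pm}_XY=\nabla^g_XY\pm\tfrac12 g^{-1}H(X,Y,\cdot)$, $\nabla^{1/3}_XY=\nabla^g_XY+\tfrac16 g^{-1}H(X,Y,\cdot)$. $R_{\nabla^-}$ is the curvature of $\nabla^-$. $S$ is a real spinor bundle of $(TM,g)$ (from an irreducible real representation of the Clifford algebra with $X\cdot X=-g(X,X)$); metric connections are lifted to $S$; $\slash\!\!\!\!\nabla^{1/3}$ is the Dirac operator of $\nabla^{1/3}$. A two-form $\alpha$, possibly with values in a vector bundle $W$, acts on $\eta$ by $\alpha\cdot\eta=\tfrac14\sum_{i,j}\alpha(e_i,e_j)\,e_i\cdot e_j\cdot\eta\in\Omega^0(W\otimes S)$, for $\{e_i\}$ a local $g$-orthonormal frame. $\mathbb F\in\Omega^1(\mathrm{Hom}(TM,\mathrm{ad}P))$ is $(i_X\mathbb F)(Y)=F_\theta(X,Y)$ and $\mathbb F^\dagger\in\Omega^1(\mathrm{Hom}(\mathrm{ad}P,TM))$ is $(i_X\mathbb F^\dagger)(r)=-g^{-1}\langle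 i_XF_\theta,r\rangle$ (the adjoint of $\mathbb F$ for the metric $g(X,X)-\langle r,r\rangle$ on $TM\oplus\mathrm{ad}P$). Thus $D_Y(X+r)=\bigl(\nabla^-_YX-g^{-1}\langle i_YF_\theta,r\rangle\bigr)+\bigl(d^\theta_Yr-F_\theta(Y,X)\bigr)$; $F_D\in\Omega^2(\mathrm{End}(TM\oplus\mathrm{ad}P))$ is its curvature. Moreover $(\mathbb F^\dagger\wedge\mathbb F)(X,Y)Z=g^{-1}\langle i_YF_\theta,F_\theta(X,Z)\rangle-g^{-1}\langle i_XF_\theta,F_\theta(Y,Z)\rangle$, $(\mathbb F\wedge\mathbb F^\dagger)(X,Y)r=F_\theta(Y,g^{-1}\langle i_XF_\theta,r\rangle)-F_\theta(X,g^{-1}\langle i_YF_\theta,r\rangle)$. $\nabla^{\theta,+}$ is the connection on $\Lambda^2T^*M\otimes\mathrm{ad}P$ induced by $\theta$ and $\nabla^+$; $(\nabla^{\theta,+}F_\theta)\cdot\eta=0$ means $(\nabla_Z^{\theta,+}F_\theta)\cdot\eta=0$ for all $Z$. $[F_\theta\cdot\eta,\cdot\,]$ is $r\mapsto[F_\theta,r]\cdot\eta$. *)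

theory Defs
  imports "HOL-Analysis.Analysis" "HOL-Algebra.Group"
begin

section \<open>Smooth manifolds\<close>

text \<open>On an open set of a finite-dimensional space, \<open>Ck_on\<close> is the usual class of $k$ times
  continuously differentiable maps, expressed with iterated directional derivatives.\<close>

primrec Ck_on :: "nat \<Rightarrow> ('e::real_normed_vector \<Rightarrow> 'b::real_normed_vector) \<Rightarrow> 'e set \<Rightarrow> bool" where
  "Ck_on 0 f S \<longleftrightarrow> continuous_on S f"
| "Ck_on (Suc k) f S \<longleftrightarrow>
     (\<forall>x\<in>S. f differentiable (at x)) \<and> (\<forall>v. Ck_on k (\<lambda>x. frechet_derivative f (at x) v) S)"

definition smooth_on :: "'e::real_normed_vector set \<Rightarrow> ('e \<Rightarrow> 'b::real_normed_vector) \<Rightarrow> bool" where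
  "smooth_on S f \<longleftrightarrow> (\<forall>k. Ck_on k f S)"

type_synonym ('m, 'e) atlas = "('m set \<times> ('m \<Rightarrow> 'e)) set"

text \<open>The underlying space is the whole type; the model space is meant to be
  finite-dimensional. The atlas need not be maximal.\<close>

definition smooth_atlas ::
    "('m::{t2_space, second_countable_topology}, 'e::real_normed_vector) atlas \<Rightarrow> bool" where
  "smooth_atlas A \<longleftrightarrow>
     (\<forall>(U, \<phi>)\<in>A. open U \<and> open (\<phi> ` U) \<and> homeomorphism U (\<phi> ` U) \<phi> (inv_into U \<phi>)) \<and>
     (\<Union>(U, \<phi>)\<in>A. U) = UNIV \<and>
     (\<forall>(U, \<phi>)\<in>A. \<forall>(V, \<psi>)\<in>A. smooth_on (\<phi> ` (U \<inter> V)) (\<psi> \<circ> inv_into U \<phi>))"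

definition oriented_atlas :: "('m::topological_space, real^'n) atlas \<Rightarrow> bool" where
  "oriented_atlas A \<longleftrightarrow>
     (\<forall>(U, \<phi>)\<in>A. \<forall>(V, \<psi>)\<in>A. \<forall>x\<in>U \<inter> V.
        det (matrix (frechet_derivative (\<psi> \<circ> inv_into U \<phi>) (at (\<phi> x)))) > 0)"

definition prod_atlas :: "('m, 'e) atlas \<Rightarrow> ('k, 'f) atlas \<Rightarrow> ('m \<times> 'k, 'e \<times> 'f) atlas" where
  "prod_atlas A B = {(U \<times> V, map_prod \<phi> \<psi>) | U \<phi> V \<psi>. (U, \<phi>) \<in> A \<and> (V, \<psi>) \<in> B}"

definition smooth_fun ::
    "('m::topological_space, 'e::real_normed_vector) atlas \<Rightarrow> 'm set \<Rightarrow>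
     ('m \<Rightarrow> 'b::real_normed_vector) \<Rightarrow> bool" where
  "smooth_fun A W f \<longleftrightarrow>
     open W \<and> (\<forall>(U, \<phi>)\<in>A. smooth_on (\<phi> ` (U \<inter> W)) (f \<circ> inv_into U \<phi>))"

definition smooth_near ::
    "('m::topological_space, 'e::real_normed_vector) atlas \<Rightarrow> 'm \<Rightarrow> ('m \<Rightarrow> real) \<Rightarrow> bool" where
  "smooth_near A x f \<longleftrightarrow> (\<exists>W. x \<in> W \<and> smooth_fun A W f)"

definition smooth_map ::
    "('m::topological_space, 'e::real_normed_vector) atlas \<Rightarrow>
     ('k::topological_space, 'f::real_normed_vector) atlas \<Rightarrow> 'm set \<Rightarrow> ('m \<Rightarrow> 'k) \<Rightarrow> bool" where
  "smooth_map A B W f \<longleftrightarrow>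
     open W \<and> continuous_on W f \<and>
     (\<forall>(U, \<phi>)\<in>A. \<forall>(V, \<psi>)\<in>B. smooth_on (\<phi> ` (U \<inter> W \<inter> f -` V)) (\<psi> \<circ> f \<circ> inv_into U \<phi>))"


section \<open>Tangent vectors and vector fields\<close>

text \<open>A tangent vector at \<open>x\<close> is identified with its directional derivative operator on functions
  that are smooth near \<open>x\<close>; its value on all other functions is fixed to be \<open>0\<close>, so that equal
  tangent vectors are equal operators.\<close>

type_synonym 'm tvec = "('m \<Rightarrow> real) \<Rightarrow> real"
type_synonym 'm field = "'m \<Rightarrow> 'm tvec"

definition tangent_space ::
    "('m::topological_space, 'e::real_normed_vector) atlas \<Rightarrow> 'm \<Rightarrow> 'm tvec set" where
  "tangent_space A x =
     {v. \<exists>(U, \<phi>)\<in>A. x \<in> U \<and> (\<exists>w. v = (\<lambda>f. if smooth_near A x f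
            then frechet_derivative (f \<circ> inv_into U \<phi>) (at (\<phi> x)) w else 0))}"

definition tlin :: "real \<Rightarrow> 'm tvec \<Rightarrow> real \<Rightarrow> 'm tvec \<Rightarrow> 'm tvec" where
  "tlin a u b v = (\<lambda>f. a * u f + b * v f)"

text \<open>The differential of \<open>f\<close> applied to a tangent vector, where \<open>y\<close> is the image of the base
  point and \<open>B\<close> the atlas of the target.\<close>

definition push ::
    "('k::topological_space, 'f::real_normed_vector) atlas \<Rightarrow> 'k \<Rightarrow> ('m \<Rightarrow> 'k) \<Rightarrow>
     'm tvec \<Rightarrow> 'k tvec" where
  "push B y f v = (\<lambda>h. if smooth_near B y h then v (h \<circ> f) else 0)"

text \<open>Derivative of a function with values in a finite-dimensional inner product space.\<close>

definition tder :: "'m tvec \<Rightarrow> ('m \<Rightarrow> 'l::real_inner) \<Rightarrow> 'l" where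
  "tder v f = (THE w. \<forall>z. w \<bullet> z = v (\<lambda>y. f y \<bullet> z))"

text \<open>Smooth vector fields on the open set \<open>U\<close>; values outside \<open>U\<close> are irrelevant.\<close>

definition vfield ::
    "('m::topological_space, 'e::real_normed_vector) atlas \<Rightarrow> 'm set \<Rightarrow> 'm field \<Rightarrow> bool" where
  "vfield A U X \<longleftrightarrow>
     open U \<and> (\<forall>x\<in>U. X x \<in> tangent_space A x) \<and>
     (\<forall>V f. V \<subseteq> U \<and> smooth_fun A V f \<longrightarrow> smooth_fun A V (\<lambda>x. X x f))"

definition lie_bracket ::
    "('m::topological_space, 'e::real_normed_vector) atlas \<Rightarrow> 'm field \<Rightarrow> 'm field \<Rightarrow> 'm field" where
  "lie_bracket A X Y x =
     (\<lambda>f. if smooth_near A x f then X x (\<lambda>y. Y y f) - Y x (\<lambda>y. X y f) else 0)"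


section \<open>Riemannian metrics, forms and affine connections\<close>

type_synonym 'm metric = "'m \<Rightarrow> 'm tvec \<Rightarrow> 'm tvec \<Rightarrow> real"

definition riemannian_metric ::
    "('m::topological_space, 'e::real_normed_vector) atlas \<Rightarrow> 'm metric \<Rightarrow> bool" where
  "riemannian_metric A g \<longleftrightarrow>
     (\<forall>x. \<forall>u\<in>tangent_space A x. \<forall>v\<in>tangent_space A x.
        g x u v = g x v u \<and> (u \<noteq> (\<lambda>_. 0) \<longrightarrow> g x u u > 0) \<and>
        (\<forall>w\<in>tangent_space A x. \<forall>a b. g x (tlin a u b v) w = a * g x u w + b * g x v w)) \<and>
     (\<forall>U X Y. vfield A U X \<and> vfield A U Y \<longrightarrow> smooth_fun A U (\<lambda>x. g x (X x) (Y x)))"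

definition one_form ::
    "('m::topological_space, 'e::real_normed_vector) atlas \<Rightarrow> ('m \<Rightarrow> 'm tvec \<Rightarrow> real) \<Rightarrow> bool" where
  "one_form A \<zeta> \<longleftrightarrow>
     (\<forall>x. \<forall>u\<in>tangent_space A x. \<forall>v\<in>tangent_space A x. \<forall>a b.
        \<zeta> x (tlin a u b v) = a * \<zeta> x u + b * \<zeta> x v) \<and>
     (\<forall>U X. vfield A U X \<longrightarrow> smooth_fun A U (\<lambda>x. \<zeta> x (X x)))"

definition three_form ::
    "('m::topological_space, 'e::real_normed_vector) atlas \<Rightarrow>
     ('m \<Rightarrow> 'm tvec \<Rightarrow> 'm tvec \<Rightarrow> 'm tvec \<Rightarrow> real) \<Rightarrow> bool" where
  "three_form A H \<longleftrightarrow>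
     (\<forall>x. \<forall>u\<in>tangent_space A x. \<forall>v\<in>tangent_space A x. \<forall>w\<in>tangent_space A x.
        H x u v w = - H x v u w \<and> H x u v w = - H x u w v \<and>
        (\<forall>u'\<in>tangent_space A x. \<forall>a b.
           H x (tlin a u b u') v w = a * H x u v w + b * H x u' v w)) \<and>
     (\<forall>U X Y Z. vfield A U X \<and> vfield A U Y \<and> vfield A U Z
        \<longrightarrow> smooth_fun A U (\<lambda>x. H x (X x) (Y x) (Z x)))"

definition ext_d3 ::
    "('m::topological_space, 'e::real_normed_vector) atlas \<Rightarrow>
     ('m \<Rightarrow> 'm tvec \<Rightarrow> 'm tvec \<Rightarrow> 'm tvec \<Rightarrow> real) \<Rightarrow>
     'm field \<Rightarrow> 'm field \<Rightarrow> 'm field \<Rightarrow> 'm field \<Rightarrow> 'm \<Rightarrow> real" where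
  "ext_d3 A H X0 X1 X2 X3 x =
     (let h = (\<lambda>X Y Z y. H y (X y) (Y y) (Z y)); br = lie_bracket A in
        X0 x (h X1 X2 X3) - X1 x (h X0 X2 X3) + X2 x (h X0 X1 X3) - X3 x (h X0 X1 X2)
        - h (br X0 X1) X2 X3 x + h (br X0 X2) X1 X3 x - h (br X0 X3) X1 X2 x
        - h (br X1 X2) X0 X3 x + h (br X1 X3) X0 X2 x - h (br X2 X3) X0 X1 x)"

text \<open>\<open>sharp A g \<omega> x\<close> is $g^{-1}\omega$ at \<open>x\<close>, for a one-form given by the value at \<open>x\<close> of its
  pairing with vector fields defined near \<open>x\<close>.\<close>

definition sharp ::
    "('m::topological_space, 'e::real_normed_vector) atlas \<Rightarrow> 'm metric \<Rightarrow> ('m field \<Rightarrow> real) \<Rightarrow>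
     'm field" where
  "sharp A g \<omega> x =
     (THE v. v \<in> tangent_space A x \<and> (\<forall>U W. vfield A U W \<and> x \<in> U \<longrightarrow> g x v (W x) = \<omega> W))"

type_synonym 'm conn = "'m field \<Rightarrow> 'm field \<Rightarrow> 'm field"

text \<open>Connections on the tangent bundle as local operators: they act on vector fields over arbitrary
  open sets, compatibly with restriction (last clause).\<close>

definition affine_connection ::
    "('m::topological_space, 'e::real_normed_vector) atlas \<Rightarrow> 'm conn \<Rightarrow> bool" where
  "affine_connection A nab \<longleftrightarrow>
     (\<forall>U X Y. vfield A U X \<and> vfield A U Y \<longrightarrow> vfield A U (nab X Y)) \<and>
     (\<forall>U X X' Y f. vfield A U X \<and> vfield A U X' \<and> vfield A U Y \<and> smooth_fun A U f \<longrightarrow>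
        (\<forall>x\<in>U. nab (\<lambda>y. tlin (f y) (X y) 1 (X' y)) Y x = tlin (f x) (nab X Y x) 1 (nab X' Y x))) \<and>
     (\<forall>U X Y Y' f. vfield A U X \<and> vfield A U Y \<and> vfield A U Y' \<and> smooth_fun A U f \<longrightarrow>
        (\<forall>x\<in>U. nab X (\<lambda>y. tlin (f y) (Y y) 1 (Y' y)) x =
           tlin (X x f) (Y x) 1 (tlin (f x) (nab X Y x) 1 (nab X Y' x)))) \<and>
     (\<forall>U X Y X' Y'. vfield A U X \<and> vfield A U Y \<and> vfield A U X' \<and> vfield A U Y' \<and>
        (\<forall>x\<in>U. X x = X' x \<and> Y x = Y' x) \<longrightarrow> (\<forall>x\<in>U. nab X Y x = nab X' Y' x))"

definition levi_civita ::
    "('m::topological_space, 'e::real_normed_vector) atlas \<Rightarrow> 'm metric \<Rightarrow> 'm conn \<Rightarrow> bool" where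
  "levi_civita A g nab \<longleftrightarrow>
     affine_connection A nab \<and>
     (\<forall>U X Y. vfield A U X \<and> vfield A U Y \<longrightarrow>
        (\<forall>x\<in>U. tlin 1 (nab X Y x) (-1) (nab Y X x) = lie_bracket A X Y x)) \<and>
     (\<forall>U X Y Z. vfield A U X \<and> vfield A U Y \<and> vfield A U Z \<longrightarrow>
        (\<forall>x\<in>U. X x (\<lambda>y. g y (Y y) (Z y)) = g x (nab X Y x) (Z x) + g x (Y x) (nab X Z x)))"

text \<open>\<open>torsion_conn A g H nab t\<close> is $\nabla_X Y + t\, g^{-1}H(X,Y,\cdot)$, so that $t = \pm\frac12$
  gives $\nabla^\pm$ and $t = \frac16$ gives $\nabla^{1/3}$.\<close>

definition torsion_conn ::
    "('m::topological_space, 'e::real_normed_vector) atlas \<Rightarrow> 'm metric \<Rightarrow>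
     ('m \<Rightarrow> 'm tvec \<Rightarrow> 'm tvec \<Rightarrow> 'm tvec \<Rightarrow> real) \<Rightarrow> 'm conn \<Rightarrow> real \<Rightarrow> 'm conn" where
  "torsion_conn A g H nab t X Y x =
     tlin 1 (nab X Y x) t (sharp A g (\<lambda>W. H x (X x) (Y x) (W x)) x)"

definition conn_curvature ::
    "('m::topological_space, 'e::real_normed_vector) atlas \<Rightarrow> 'm conn \<Rightarrow>
     'm field \<Rightarrow> 'm field \<Rightarrow> 'm field \<Rightarrow> 'm field" where
  "conn_curvature A nab X Y Z x =
     (\<lambda>f. nab X (nab Y Z) x f - nab Y (nab X Z) x f - nab (lie_bracket A X Y) Z x f)"

definition on_frame ::
    "('m::topological_space, real^'n) atlas \<Rightarrow> 'm metric \<Rightarrow> 'm set \<Rightarrow> ('n \<Rightarrow> 'm field) \<Rightarrow> bool" where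
  "on_frame A g U e \<longleftrightarrow>
     (\<forall>i. vfield A U (e i)) \<and>
     (\<forall>x\<in>U. \<forall>i j. g x (e i x) (e j x) = (if i = j then 1 else 0))"


section \<open>Lie groups\<close>

text \<open>\<open>lalg\<close> identifies the vector space \<open>'l\<close> with the tangent space at the identity. The model
  space is only required to be a finite-dimensional inner product space (not a
  \<open>euclidean_space\<close>) so that zero-dimensional groups are included; the inner product is auxiliary.\<close>

record ('k, 'l) lie_data = "'k monoid" +
  latlas :: "('k, 'l) atlas"
  lalg :: "'l \<Rightarrow> 'k tvec"

definition lie_group ::
    "('k::{t2_space, second_countable_topology}, 'l::real_inner) lie_data \<Rightarrow> bool" where
  "lie_group G \<longleftrightarrow>
     group G \<and> carrier G = UNIV \<and> smooth_atlas (latlas G) \<and>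
     (\<exists>S::'l set. finite S \<and> span S = UNIV) \<and>
     smooth_map (prod_atlas (latlas G) (latlas G)) (latlas G) UNIV (\<lambda>(a, b). a \<otimes>\<^bsub>G\<^esub> b) \<and>
     smooth_map (latlas G) (latlas G) UNIV (\<lambda>a. inv\<^bsub>G\<^esub> a) \<and>
     bij_betw (lalg G) UNIV (tangent_space (latlas G) \<one>\<^bsub>G\<^esub>) \<and>
     (\<forall>a b \<xi> \<upsilon>. lalg G (a *\<^sub>R \<xi> + b *\<^sub>R \<upsilon>) = tlin a (lalg G \<xi>) b (lalg G \<upsilon>))"

definition left_invariant ::
    "('k::topological_space, 'l::real_inner) lie_data \<Rightarrow> 'l \<Rightarrow> 'k field" where
  "left_invariant G \<xi> a = push (latlas G) a (\<lambda>b. a \<otimes>\<^bsub>G\<^esub> b) (lalg G \<xi>)"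

definition lbr :: "('k::topological_space, 'l::real_inner) lie_data \<Rightarrow> 'l \<Rightarrow> 'l \<Rightarrow> 'l" where
  "lbr G \<xi> \<upsilon> = (THE \<omega>. lalg G \<omega> =
     lie_bracket (latlas G) (left_invariant G \<xi>) (left_invariant G \<upsilon>) \<one>\<^bsub>G\<^esub>)"

definition Ad :: "('k::topological_space, 'l::real_inner) lie_data \<Rightarrow> 'k \<Rightarrow> 'l \<Rightarrow> 'l" where
  "Ad G a \<xi> = (THE \<upsilon>. lalg G \<upsilon> =
     push (latlas G) \<one>\<^bsub>G\<^esub> (\<lambda>b. a \<otimes>\<^bsub>G\<^esub> b \<otimes>\<^bsub>G\<^esub> inv\<^bsub>G\<^esub> a) (lalg G \<xi>))"

definition biinvariant_form ::
    "('k::topological_space, 'l::real_inner) lie_data \<Rightarrow> ('l \<Rightarrow> 'l \<Rightarrow> real) \<Rightarrow> bool" where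
  "biinvariant_form G B \<longleftrightarrow>
     bilinear B \<and> (\<forall>\<xi> \<upsilon>. B \<xi> \<upsilon> = B \<upsilon> \<xi>) \<and> (\<forall>\<xi>. (\<forall>\<upsilon>. B \<xi> \<upsilon> = 0) \<longrightarrow> \<xi> = 0) \<and>
     (\<forall>a \<xi> \<upsilon>. B (Ad G a \<xi>) (Ad G a \<upsilon>) = B \<xi> \<upsilon>)"


section \<open>Principal bundles and principal connections\<close>

record ('p, 'ep, 'm, 'k) pbundle =
  patlas :: "('p, 'ep) atlas"
  pproj :: "'p \<Rightarrow> 'm"
  pact :: "'p \<Rightarrow> 'k \<Rightarrow> 'p"

text \<open>In the last clause \<open>p \<mapsto> (\<pi>(p), \<tau>(p))\<close> is a local trivialisation, with inverse
  \<open>(y, a) \<mapsto> s(y) a\<close>.\<close>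

definition principal_bundle ::
    "('m::{t2_space, second_countable_topology}, real^'n) atlas \<Rightarrow>
     ('k::{t2_space, second_countable_topology}, 'l::real_inner) lie_data \<Rightarrow>
     ('p::{t2_space, second_countable_topology}, 'ep::euclidean_space, 'm, 'k) pbundle \<Rightarrow> bool" where
  "principal_bundle A G P \<longleftrightarrow>
     smooth_atlas (patlas P) \<and>
     smooth_map (patlas P) A UNIV (pproj P) \<and>
     smooth_map (prod_atlas (patlas P) (latlas G)) (patlas P) UNIV (\<lambda>(p, a). pact P p a) \<and>
     (\<forall>p. pact P p \<one>\<^bsub>G\<^esub> = p) \<and>
     (\<forall>p a b. pact P (pact P p a) b = pact P p (a \<otimes>\<^bsub>G\<^esub> b)) \<and>
     (\<forall>p a. pproj P (pact P p a) = pproj P p) \<and>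
     (\<forall>p p'. pproj P p = pproj P p' \<longrightarrow> (\<exists>!a. p' = pact P p a)) \<and>
     (\<forall>x. \<exists>U s \<tau>. x \<in> U \<and> smooth_map A (patlas P) U s \<and> (\<forall>y\<in>U. pproj P (s y) = y) \<and>
        smooth_map (patlas P) (latlas G) (pproj P -` U) \<tau> \<and>
        (\<forall>p\<in>pproj P -` U. p = pact P (s (pproj P p)) (\<tau> p)))"

definition principal_connection ::
    "('k::topological_space, 'l::real_inner) lie_data \<Rightarrow>
     ('p::topological_space, 'ep::euclidean_space, 'm, 'k) pbundle \<Rightarrow> ('p \<Rightarrow> 'p tvec \<Rightarrow> 'l) \<Rightarrow> bool" where
  "principal_connection G P \<theta> \<longleftrightarrow>
     (\<forall>p. \<forall>u\<in>tangent_space (patlas P) p. \<forall>v\<in>tangent_space (patlas P) p. \<forall>a b.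
        \<theta> p (tlin a u b v) = a *\<^sub>R \<theta> p u + b *\<^sub>R \<theta> p v) \<and>
     (\<forall>U X. vfield (patlas P) U X \<longrightarrow> smooth_fun (patlas P) U (\<lambda>p. \<theta> p (X p))) \<and>
     (\<forall>p \<xi>. \<theta> p (push (patlas P) p (\<lambda>a. pact P p a) (lalg G \<xi>)) = \<xi>) \<and>
     (\<forall>p a. \<forall>v\<in>tangent_space (patlas P) p.
        \<theta> (pact P p a) (push (patlas P) (pact P p a) (\<lambda>p'. pact P p' a) v) =
        Ad G (inv\<^bsub>G\<^esub> a) (\<theta> p v))"

text \<open>Local sections of \<open>ad P\<close> over \<open>U\<close> as equivariant functions on the part of \<open>P\<close> over \<open>U\<close>.\<close>

definition ad_section ::
    "('k::topological_space, 'l::real_inner) lie_data \<Rightarrow>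
     ('p::topological_space, 'ep::euclidean_space, 'm::topological_space, 'k) pbundle \<Rightarrow>
     'm set \<Rightarrow> ('p \<Rightarrow> 'l) \<Rightarrow> bool" where
  "ad_section G P U r \<longleftrightarrow>
     open U \<and> smooth_fun (patlas P) (pproj P -` U) r \<and>
     (\<forall>p a. pproj P p \<in> U \<longrightarrow> r (pact P p a) = Ad G (inv\<^bsub>G\<^esub> a) (r p))"

definition hlift ::
    "('m::topological_space, real^'n) atlas \<Rightarrow>
     ('p::topological_space, 'ep::euclidean_space, 'm, 'k) pbundle \<Rightarrow>
     ('p \<Rightarrow> 'p tvec \<Rightarrow> 'l::real_inner) \<Rightarrow> 'm field \<Rightarrow> 'p field" where
  "hlift A P \<theta> X p =
     (THE v. v \<in> tangent_space (patlas P) p \<and> push A (pproj P p) (pproj P) v = X (pproj P p) \<and>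
        \<theta> p v = 0)"

definition d_theta ::
    "('m::topological_space, real^'n) atlas \<Rightarrow>
     ('p::topological_space, 'ep::euclidean_space, 'm, 'k) pbundle \<Rightarrow>
     ('p \<Rightarrow> 'p tvec \<Rightarrow> 'l::real_inner) \<Rightarrow> 'm field \<Rightarrow> ('p \<Rightarrow> 'l) \<Rightarrow> ('p \<Rightarrow> 'l)" where
  "d_theta A P \<theta> X r p = tder (hlift A P \<theta> X p) r"

text \<open>$d\theta + \frac12[\theta\wedge\theta]$ on \<open>P\<close>, and the \<open>ad P\<close>-valued two-form on \<open>M\<close> it defines.\<close>

definition conn_form_curvature ::
    "('k::topological_space, 'l::real_inner) lie_data \<Rightarrow>
     ('p::topological_space, 'ep::euclidean_space, 'm, 'k) pbundle \<Rightarrow> ('p \<Rightarrow> 'p tvec \<Rightarrow> 'l) \<Rightarrow>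
     'p field \<Rightarrow> 'p field \<Rightarrow> ('p \<Rightarrow> 'l)" where
  "conn_form_curvature G P \<theta> V W p =
     tder (V p) (\<lambda>q. \<theta> q (W q)) - tder (W p) (\<lambda>q. \<theta> q (V q))
     - \<theta> p (lie_bracket (patlas P) V W p) + lbr G (\<theta> p (V p)) (\<theta> p (W p))"

definition F_theta ::
    "('m::topological_space, real^'n) atlas \<Rightarrow> ('k::topological_space, 'l::real_inner) lie_data \<Rightarrow>
     ('p::topological_space, 'ep::euclidean_space, 'm, 'k) pbundle \<Rightarrow> ('p \<Rightarrow> 'p tvec \<Rightarrow> 'l) \<Rightarrow>
     'm field \<Rightarrow> 'm field \<Rightarrow> ('p \<Rightarrow> 'l)" where
  "F_theta A G P \<theta> X Y = conn_form_curvature G P \<theta> (hlift A P \<theta> X) (hlift A P \<theta> Y)"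

text \<open>The induced pairing on \<open>ad P\<close>; by Ad-invariance the choice of point in the fibre is
  immaterial.\<close>

definition ad_pair ::
    "('p, 'ep, 'm, 'k) pbundle \<Rightarrow> ('l \<Rightarrow> 'l \<Rightarrow> real) \<Rightarrow> ('p \<Rightarrow> 'l) \<Rightarrow> ('p \<Rightarrow> 'l) \<Rightarrow> 'm \<Rightarrow> real" where
  "ad_pair P B r s x = (let p = (SOME p. pproj P p = x) in B (r p) (s p))"

text \<open>\<open>\<langle>F \<and> F\<rangle>\<close>: the sum over the six (2,2)-shuffles.\<close>

definition FF_wedge ::
    "('m::topological_space, real^'n) atlas \<Rightarrow> ('k::topological_space, 'l::real_inner) lie_data \<Rightarrow>
     ('l \<Rightarrow> 'l \<Rightarrow> real) \<Rightarrow> ('p::topological_space, 'ep::euclidean_space, 'm, 'k) pbundle \<Rightarrow>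
     ('p \<Rightarrow> 'p tvec \<Rightarrow> 'l) \<Rightarrow>
     'm field \<Rightarrow> 'm field \<Rightarrow> 'm field \<Rightarrow> 'm field \<Rightarrow> 'm \<Rightarrow> real" where
  "FF_wedge A G B P \<theta> X0 X1 X2 X3 x =
     (let F = F_theta A G P \<theta>; pr = (\<lambda>r s. ad_pair P B r s x) in
        pr (F X0 X1) (F X2 X3) - pr (F X0 X2) (F X1 X3) + pr (F X0 X3) (F X1 X2)
      + pr (F X1 X2) (F X0 X3) - pr (F X1 X3) (F X0 X2) + pr (F X2 X3) (F X0 X1))"

definition bianchi_identity ::
    "('m::topological_space, real^'n) atlas \<Rightarrow> ('k::topological_space, 'l::real_inner) lie_data \<Rightarrow>
     ('l \<Rightarrow> 'l \<Rightarrow> real) \<Rightarrow> ('p::topological_space, 'ep::euclidean_space, 'm, 'k) pbundle \<Rightarrow>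
     ('m \<Rightarrow> 'm tvec \<Rightarrow> 'm tvec \<Rightarrow> 'm tvec \<Rightarrow> real) \<Rightarrow> ('p \<Rightarrow> 'p tvec \<Rightarrow> 'l) \<Rightarrow> bool" where
  "bianchi_identity A G B P H \<theta> \<longleftrightarrow>
     (\<forall>U X0 X1 X2 X3. vfield A U X0 \<and> vfield A U X1 \<and> vfield A U X2 \<and> vfield A U X3 \<longrightarrow>
        (\<forall>x\<in>U. ext_d3 A H X0 X1 X2 X3 x - FF_wedge A G B P \<theta> X0 X1 X2 X3 x = 0))"


section \<open>Spin structures and spinors\<close>

definition clifford_rep :: "(real^'n \<Rightarrow> real^'s^'s) \<Rightarrow> bool" where
  "clifford_rep c \<longleftrightarrow> linear c \<and> (\<forall>v. c v ** c v = - ((v \<bullet> v) *\<^sub>R mat 1))"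

definition irreducible_rep :: "(real^'n \<Rightarrow> real^'s^'s) \<Rightarrow> bool" where
  "irreducible_rep c \<longleftrightarrow>
     (\<forall>V. subspace V \<and> (\<forall>v. \<forall>\<sigma>\<in>V. c v *v \<sigma> \<in> V) \<longrightarrow> V = {0} \<or> V = UNIV)"

text \<open>Products of an even number of unit vectors. The even Clifford algebra acts faithfully on an
  irreducible module, so this matrix group is the spin group itself.\<close>

definition spin_group :: "(real^'n \<Rightarrow> real^'s^'s) \<Rightarrow> (real^'s^'s) set" where
  "spin_group c =
     {foldr (\<lambda>v h. c v ** h) vs (mat 1) | vs. even (length vs) \<and> (\<forall>v\<in>set vs. norm v = 1)}"

definition spin_rotation :: "(real^'n \<Rightarrow> real^'s^'s) \<Rightarrow> real^'s^'s \<Rightarrow> real^'n \<Rightarrow> real^'n" where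
  "spin_rotation c h v = (THE w. c w = h ** c v ** matrix_inv h)"

text \<open>\<open>sproj\<close>, \<open>sact\<close> and \<open>sgauge\<close> describe a principal bundle with group \<open>spin_group sclif\<close>, its
  smooth structure being given by a bundle atlas of local sections; \<open>sframe\<close> is the bundle map to
  oriented orthonormal frames. The spinor bundle is associated to the module \<open>real^'s\<close>.\<close>

record ('q, 'm, 'n, 's) spin_data =
  sproj :: "'q \<Rightarrow> 'm"
  sact :: "'q \<Rightarrow> real^'s^'s \<Rightarrow> 'q"
  sframe :: "'q \<Rightarrow> 'n \<Rightarrow> 'm tvec"
  sgauge :: "('m set \<times> ('m \<Rightarrow> 'q)) set"
  sclif :: "real^'n \<Rightarrow> real^'s^'s"

definition spin_structure ::
    "('m::topological_space, real^'n) atlas \<Rightarrow> 'm metric \<Rightarrow>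
     ('q, 'm, 'n::finite, 's::finite) spin_data \<Rightarrow> bool" where
  "spin_structure A g Q \<longleftrightarrow>
     clifford_rep (sclif Q) \<and> irreducible_rep (sclif Q) \<and>
     (\<forall>q. sact Q q (mat 1) = q) \<and>
     (\<forall>q. \<forall>h\<in>spin_group (sclif Q). \<forall>h'\<in>spin_group (sclif Q).
        sact Q (sact Q q h) h' = sact Q q (h ** h')) \<and>
     (\<forall>q. \<forall>h\<in>spin_group (sclif Q). sproj Q (sact Q q h) = sproj Q q) \<and>
     (\<forall>q q'. sproj Q q = sproj Q q' \<longrightarrow> (\<exists>!h. h \<in> spin_group (sclif Q) \<and> q' = sact Q q h)) \<and>
     (\<forall>q i. sframe Q q i \<in> tangent_space A (sproj Q q)) \<and>
     (\<forall>q i j. g (sproj Q q) (sframe Q q i) (sframe Q q j) = (if i = j then 1 else 0)) \<and>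
     (\<forall>q. \<forall>(U, \<phi>)\<in>A. sproj Q q \<in> U \<longrightarrow> det (\<chi> i j. sframe Q q i (\<lambda>y. \<phi> y $ j)) > 0) \<and>
     (\<forall>q i. \<forall>h\<in>spin_group (sclif Q). sframe Q (sact Q q h) i =
        (\<lambda>f. \<Sum>j\<in>UNIV. spin_rotation (sclif Q) h (axis i 1) $ j * sframe Q q j f)) \<and>
     (\<Union>(U, s)\<in>sgauge Q. U) = UNIV \<and>
     (\<forall>(U, s)\<in>sgauge Q. open U \<and> (\<forall>x\<in>U. sproj Q (s x) = x) \<and>
        (\<forall>i. vfield A U (\<lambda>x. sframe Q (s x) i))) \<and>
     (\<forall>(U, s)\<in>sgauge Q. \<forall>(V, t)\<in>sgauge Q. \<exists>h. smooth_fun A (U \<inter> V) h \<and>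
        (\<forall>x\<in>U \<inter> V. h x \<in> spin_group (sclif Q) \<and> t x = sact Q (s x) (h x)))"

text \<open>Sections of the spinor bundle as equivariant functions on the spin bundle.\<close>

definition spinor ::
    "('m::topological_space, real^'n) atlas \<Rightarrow> ('q, 'm, 'n::finite, 's::finite) spin_data \<Rightarrow>
     ('q \<Rightarrow> real^'s) \<Rightarrow> bool" where
  "spinor A Q \<eta> \<longleftrightarrow>
     (\<forall>q. \<forall>h\<in>spin_group (sclif Q). \<eta> (sact Q q h) = matrix_inv h *v \<eta> q) \<and>
     (\<forall>(U, s)\<in>sgauge Q. smooth_fun A U (\<eta> \<circ> s))"

text \<open>Clifford multiplication by a tangent vector, on the fibre of the spinor bundle identified with
  \<open>real^'s\<close> by means of \<open>q\<close>.\<close>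

definition clif ::
    "'m metric \<Rightarrow> ('q, 'm, 'n::finite, 's::finite) spin_data \<Rightarrow> 'q \<Rightarrow> 'm tvec \<Rightarrow> real^'s \<Rightarrow> real^'s" where
  "clif g Q q v \<sigma> = sclif Q (\<chi> i. g (sproj Q q) v (sframe Q q i)) *v \<sigma>"

text \<open>The lift to the spinor bundle of a metric connection \<open>nab\<close>, in the local trivialisation
  given by \<open>s\<close>:
  $\nabla_X\eta = X(\eta) + \frac14\sum_{i,j} g(\nabla_X e_i, e_j)\, e_i\cdot e_j\cdot\eta$
  for the frame underlying \<open>s\<close>. Expressions in different trivialisations are related by the spin
  group, so vanishing conditions do not depend on the trivialisation.\<close>

definition spin_nabla ::
    "'m metric \<Rightarrow> ('q, 'm, 'n::finite, 's::finite) spin_data \<Rightarrow> 'm conn \<Rightarrow> ('m \<Rightarrow> 'q) \<Rightarrow>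
     'm field \<Rightarrow> ('q \<Rightarrow> real^'s) \<Rightarrow> 'm \<Rightarrow> real^'s" where
  "spin_nabla g Q nab s X \<eta> x =
     (let e = (\<lambda>i y. sframe Q (s y) i) in
        tder (X x) (\<eta> \<circ> s) + (1/4) *\<^sub>R (\<Sum>i\<in>UNIV. \<Sum>j\<in>UNIV.
          g x (nab X (e i) x) (e j x) *\<^sub>R clif g Q (s x) (e i x) (clif g Q (s x) (e j x) (\<eta> (s x)))))"

definition spin_parallel ::
    "('m::topological_space, real^'n) atlas \<Rightarrow> 'm metric \<Rightarrow>
     ('q, 'm, 'n::finite, 's::finite) spin_data \<Rightarrow> 'm conn \<Rightarrow> ('q \<Rightarrow> real^'s) \<Rightarrow> bool" where
  "spin_parallel A g Q nab \<eta> \<longleftrightarrow>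
     (\<forall>(U, s)\<in>sgauge Q. \<forall>V X. V \<subseteq> U \<and> vfield A V X \<longrightarrow> (\<forall>x\<in>V. spin_nabla g Q nab s X \<eta> x = 0))"

definition dirac ::
    "'m metric \<Rightarrow> ('q, 'm, 'n::finite, 's::finite) spin_data \<Rightarrow> 'm conn \<Rightarrow> ('m \<Rightarrow> 'q) \<Rightarrow>
     ('q \<Rightarrow> real^'s) \<Rightarrow> 'm \<Rightarrow> real^'s" where
  "dirac g Q nab s \<eta> x =
     (\<Sum>i\<in>UNIV. clif g Q (s x) (sframe Q (s x) i)
        (spin_nabla g Q nab s (\<lambda>y. sframe Q (s y) i) \<eta> x))"

text \<open>\<open>(\<^bold>D - \<zeta>/2) \<cdot> \<eta> = \<mu> \<eta>\<close> for the Dirac operator of \<open>nab\<close>; the one-form acts through the metric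
  identification with vectors.\<close>

definition dirac_eigen ::
    "('m::topological_space, real^'n) atlas \<Rightarrow> 'm metric \<Rightarrow>
     ('q, 'm, 'n::finite, 's::finite) spin_data \<Rightarrow> 'm conn \<Rightarrow> ('m \<Rightarrow> 'm tvec \<Rightarrow> real) \<Rightarrow> real \<Rightarrow>
     ('q \<Rightarrow> real^'s) \<Rightarrow> bool" where
  "dirac_eigen A g Q nab \<zeta> \<mu> \<eta> \<longleftrightarrow>
     (\<forall>(U, s)\<in>sgauge Q. \<forall>x\<in>U.
        dirac g Q nab s \<eta> x
        - (1/2) *\<^sub>R clif g Q (s x) (sharp A g (\<lambda>W. \<zeta> x (W x)) x) (\<eta> (s x)) = \<mu> *\<^sub>R \<eta> (s x))"

text \<open>Vanishing over \<open>U\<close> of $\alpha\cdot\eta = \frac14\sum_{i,j}\alpha(e_i,e_j)\,e_i\cdot e_j\cdot\eta$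
  for a two-form \<open>\<alpha>\<close> with values in \<open>TM\<close>, resp. \<open>ad P\<close>. A fibre of $W\otimes S$ is
  identified with $W^s$ through \<open>q\<close>, and \<open>a\<close> runs over the components. For a two-form with values in
  an endomorphism bundle, the vanishing is tested on all local sections.\<close>

definition annihilates_T ::
    "('m::topological_space, real^'n) atlas \<Rightarrow> 'm metric \<Rightarrow>
     ('q, 'm, 'n::finite, 's::finite) spin_data \<Rightarrow> ('q \<Rightarrow> real^'s) \<Rightarrow> 'm set \<Rightarrow>
     ('m field \<Rightarrow> 'm field \<Rightarrow> 'm field) \<Rightarrow> bool" where
  "annihilates_T A g Q \<eta> U \<alpha> \<longleftrightarrow>
     (\<forall>V e. V \<subseteq> U \<and> on_frame A g V e \<longrightarrow>
        (\<forall>q a. sproj Q q \<in> V \<longrightarrow> (let x = sproj Q q in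
           (\<lambda>f. (1/4) * (\<Sum>i\<in>UNIV. \<Sum>j\<in>UNIV.
              (clif g Q q (e i x) (clif g Q q (e j x) (\<eta> q)) $ a) * \<alpha> (e i) (e j) x f)) = (\<lambda>_. 0))))"

definition annihilates_ad ::
    "('m::topological_space, real^'n) atlas \<Rightarrow> 'm metric \<Rightarrow> ('p, 'ep, 'm, 'k) pbundle \<Rightarrow>
     ('q, 'm, 'n::finite, 's::finite) spin_data \<Rightarrow> ('q \<Rightarrow> real^'s) \<Rightarrow> 'm set \<Rightarrow>
     ('m field \<Rightarrow> 'm field \<Rightarrow> ('p \<Rightarrow> 'l::real_inner)) \<Rightarrow> bool" where
  "annihilates_ad A g P Q \<eta> U \<alpha> \<longleftrightarrow>
     (\<forall>V e. V \<subseteq> U \<and> on_frame A g V e \<longrightarrow>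
        (\<forall>p q a. sproj Q q \<in> V \<and> pproj P p = sproj Q q \<longrightarrow> (let x = sproj Q q in
           (1/4) *\<^sub>R (\<Sum>i\<in>UNIV. \<Sum>j\<in>UNIV.
              (clif g Q q (e i x) (clif g Q q (e j x) (\<eta> q)) $ a) *\<^sub>R \<alpha> (e i) (e j) p) = 0)))"


section \<open>The coupled instanton system\<close>

text \<open>The endomorphism-valued one-form $\mathbb F^\dagger$; $\mathbb F$ itself is \<open>F_theta\<close>.\<close>

definition F_dagger ::
    "('m::topological_space, real^'n) atlas \<Rightarrow> ('k::topological_space, 'l::real_inner) lie_data \<Rightarrow>
     ('l \<Rightarrow> 'l \<Rightarrow> real) \<Rightarrow> ('p::topological_space, 'ep::euclidean_space, 'm, 'k) pbundle \<Rightarrow>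
     'm metric \<Rightarrow> ('p \<Rightarrow> 'p tvec \<Rightarrow> 'l) \<Rightarrow> 'm field \<Rightarrow> ('p \<Rightarrow> 'l) \<Rightarrow> 'm field" where
  "F_dagger A G B P g \<theta> X r x =
     (\<lambda>f. - sharp A g (\<lambda>W. ad_pair P B (F_theta A G P \<theta> X W) r x) x f)"

definition FdF ::
    "('m::topological_space, real^'n) atlas \<Rightarrow> ('k::topological_space, 'l::real_inner) lie_data \<Rightarrow>
     ('l \<Rightarrow> 'l \<Rightarrow> real) \<Rightarrow> ('p::topological_space, 'ep::euclidean_space, 'm, 'k) pbundle \<Rightarrow>
     'm metric \<Rightarrow> ('p \<Rightarrow> 'p tvec \<Rightarrow> 'l) \<Rightarrow> 'm field \<Rightarrow> 'm field \<Rightarrow> 'm field \<Rightarrow> 'm field" where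
  "FdF A G B P g \<theta> X Y Z x =
     (\<lambda>f. F_dagger A G B P g \<theta> X (F_theta A G P \<theta> Y Z) x f
        - F_dagger A G B P g \<theta> Y (F_theta A G P \<theta> X Z) x f)"

definition FFd ::
    "('m::topological_space, real^'n) atlas \<Rightarrow> ('k::topological_space, 'l::real_inner) lie_data \<Rightarrow>
     ('l \<Rightarrow> 'l \<Rightarrow> real) \<Rightarrow> ('p::topological_space, 'ep::euclidean_space, 'm, 'k) pbundle \<Rightarrow>
     'm metric \<Rightarrow> ('p \<Rightarrow> 'p tvec \<Rightarrow> 'l) \<Rightarrow> 'm field \<Rightarrow> 'm field \<Rightarrow> ('p \<Rightarrow> 'l) \<Rightarrow> ('p \<Rightarrow> 'l)" where
  "FFd A G B P g \<theta> X Y r p =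
     F_theta A G P \<theta> X (F_dagger A G B P g \<theta> Y r) p - F_theta A G P \<theta> Y (F_dagger A G B P g \<theta> X r) p"

definition nabla_F ::
    "('m::topological_space, real^'n) atlas \<Rightarrow> ('k::topological_space, 'l::real_inner) lie_data \<Rightarrow>
     ('p::topological_space, 'ep::euclidean_space, 'm, 'k) pbundle \<Rightarrow> ('p \<Rightarrow> 'p tvec \<Rightarrow> 'l) \<Rightarrow>
     'm conn \<Rightarrow> 'm field \<Rightarrow> 'm field \<Rightarrow> 'm field \<Rightarrow> ('p \<Rightarrow> 'l)" where
  "nabla_F A G P \<theta> nab Z X Y p =
     d_theta A P \<theta> Z (F_theta A G P \<theta> X Y) p
     - F_theta A G P \<theta> (nab Z X) Y p - F_theta A G P \<theta> X (nab Z Y) p"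

definition coupled_instanton ::
    "('m::topological_space, real^'n) atlas \<Rightarrow> ('k::topological_space, 'l::real_inner) lie_data \<Rightarrow>
     ('l \<Rightarrow> 'l \<Rightarrow> real) \<Rightarrow> ('p::topological_space, 'ep::euclidean_space, 'm, 'k) pbundle \<Rightarrow>
     ('q, 'm, 'n::finite, 's::finite) spin_data \<Rightarrow> 'm metric \<Rightarrow>
     ('m \<Rightarrow> 'm tvec \<Rightarrow> 'm tvec \<Rightarrow> 'm tvec \<Rightarrow> real) \<Rightarrow> 'm conn \<Rightarrow> ('p \<Rightarrow> 'p tvec \<Rightarrow> 'l) \<Rightarrow>
     ('q \<Rightarrow> real^'s) \<Rightarrow> bool" where
  "coupled_instanton A G B P Q g H nab \<theta> \<eta> \<longleftrightarrow>
     (\<forall>U Z. vfield A U Z \<longrightarrow> annihilates_T A g Q \<eta> U (\<lambda>X Y x.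
        tlin 1 (conn_curvature A (torsion_conn A g H nab (-1/2)) X Y Z x)
          (-1) (FdF A G B P g \<theta> X Y Z x))) \<and>
     (\<forall>U Z. vfield A U Z \<longrightarrow> annihilates_ad A g P Q \<eta> U
        (nabla_F A G P \<theta> (torsion_conn A g H nab (1/2)) Z)) \<and>
     (\<forall>U r. ad_section G P U r \<longrightarrow> annihilates_ad A g P Q \<eta> U (\<lambda>X Y p.
        lbr G (F_theta A G P \<theta> X Y p) (r p) - FFd A G B P g \<theta> X Y r p)) \<and>
     bianchi_identity A G B P H \<theta>"

text \<open>The connection \<open>D\<close> on $TM\oplus \mathrm{ad}P$ and its curvature, acting on pairs of local
  sections.\<close>

definition D_conn ::
    "('m::topological_space, real^'n) atlas \<Rightarrow> ('k::topological_space, 'l::real_inner) lie_data \<Rightarrow>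
     ('l \<Rightarrow> 'l \<Rightarrow> real) \<Rightarrow> ('p::topological_space, 'ep::euclidean_space, 'm, 'k) pbundle \<Rightarrow>
     'm metric \<Rightarrow> ('m \<Rightarrow> 'm tvec \<Rightarrow> 'm tvec \<Rightarrow> 'm tvec \<Rightarrow> real) \<Rightarrow> 'm conn \<Rightarrow>
     ('p \<Rightarrow> 'p tvec \<Rightarrow> 'l) \<Rightarrow> 'm field \<Rightarrow> 'm field \<times> ('p \<Rightarrow> 'l) \<Rightarrow> 'm field \<times> ('p \<Rightarrow> 'l)" where
  "D_conn A G B P g H nab \<theta> Y = (\<lambda>(X, r).
     (\<lambda>x. tlin 1 (torsion_conn A g H nab (-1/2) Y X x) 1 (F_dagger A G B P g \<theta> Y r x),
      \<lambda>p. d_theta A P \<theta> Y r p - F_theta A G P \<theta> Y X p))"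

definition D_curvature ::
    "('m::topological_space, real^'n) atlas \<Rightarrow> ('k::topological_space, 'l::real_inner) lie_data \<Rightarrow>
     ('l \<Rightarrow> 'l \<Rightarrow> real) \<Rightarrow> ('p::topological_space, 'ep::euclidean_space, 'm, 'k) pbundle \<Rightarrow>
     'm metric \<Rightarrow> ('m \<Rightarrow> 'm tvec \<Rightarrow> 'm tvec \<Rightarrow> 'm tvec \<Rightarrow> real) \<Rightarrow> 'm conn \<Rightarrow>
     ('p \<Rightarrow> 'p tvec \<Rightarrow> 'l) \<Rightarrow> 'm field \<Rightarrow> 'm field \<Rightarrow>
     'm field \<times> ('p \<Rightarrow> 'l) \<Rightarrow> 'm field \<times> ('p \<Rightarrow> 'l)" where
  "D_curvature A G B P g H nab \<theta> X Y u =
     (let D = D_conn A G B P g H nab \<theta>;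
          a = D X (D Y u); b = D Y (D X u); c = D (lie_bracket A X Y) u in
        (\<lambda>x f. fst a x f - fst b x f - fst c x f, \<lambda>p. snd a p - snd b p - snd c p))"

definition D_instanton ::
    "('m::topological_space, real^'n) atlas \<Rightarrow> ('k::topological_space, 'l::real_inner) lie_data \<Rightarrow>
     ('l \<Rightarrow> 'l \<Rightarrow> real) \<Rightarrow> ('p::topological_space, 'ep::euclidean_space, 'm, 'k) pbundle \<Rightarrow>
     ('q, 'm, 'n::finite, 's::finite) spin_data \<Rightarrow> 'm metric \<Rightarrow>
     ('m \<Rightarrow> 'm tvec \<Rightarrow> 'm tvec \<Rightarrow> 'm tvec \<Rightarrow> real) \<Rightarrow> 'm conn \<Rightarrow> ('p \<Rightarrow> 'p tvec \<Rightarrow> 'l) \<Rightarrow>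
     ('q \<Rightarrow> real^'s) \<Rightarrow> bool" where
  "D_instanton A G B P Q g H nab \<theta> \<eta> \<longleftrightarrow>
     (\<forall>U Z r. vfield A U Z \<and> ad_section G P U r \<longrightarrow>
        annihilates_T A g Q \<eta> U (\<lambda>X Y. fst (D_curvature A G B P g H nab \<theta> X Y (Z, r))) \<and>
        annihilates_ad A g P Q \<eta> U (\<lambda>X Y. snd (D_curvature A G B P g H nab \<theta> X Y (Z, r))))"

end

theory Submission
  imports Defs
begin

text \<open>The spinor is parallel for \<open>\<nabla>\<^sup>+\<close>, so the curvature \<open>R\<^sup>+(Z, W)\<close> annihilates it. The exchange formula
  \<open>g(R\<^sup>+(Z, W)X, Y) = g(R\<^sup>-(X, Y)Z, W) + dH(Z, W, X, Y)/2\<close>, with \<open>dH = \<langle>F \<and> F\<rangle>\<close> expanded, shows that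
  \<open>R\<^sup>-\<close> minus the quadratic term in \<open>F\<close> differs from \<open>R\<^sup>+\<close> with exchanged pairs by \<open>\<langle>F(Z, W), F\<rangle>\<close>, and
  both annihilate the spinor. Differentiating \<open>F \<cdot> \<eta> = 0\<close> along the parallel spinor gives the second
  equation. For the third, \<open>F \<cdot> \<eta> = 0\<close> says that all components of \<open>F\<close> lie in the Lie algebra of the
  stabiliser of \<open>\<eta>\<close>, which is closed under commutators. Finally the diagonal blocks of \<open>F\<^sub>D\<close> are
  the expressions of the first and third equation, while by the Bianchi identity for \<open>\<theta>\<close> and
  \<open>\<nabla>\<^sup>-\<^sub>X Y = \<nabla>\<^sup>+\<^sub>Y X + [X, Y]\<close> the off-diagonal ones are given by \<open>\<nabla>\<^sup>+ F\<close>.\<close>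

section \<open>Calculus on open sets\<close>

text \<open>The six shuffles in \<open><F \<and> F>\<close> coincide in pairs, so the factor 1/2 of
  the exchange formula leaves three products: two of them are the quadratic term of the first
  equation, the third is the multiple of \<open>F\<close> that the spinor kills anyway. In the third
  equation the two terms vanish separately, the bracket because it is linear in \<open>F\<close>.

  What shapes the proof is that the data live on different spaces: vector fields are operators on
  germs over M, curvature and sections of ad P are functions on P, the spinor is a function on the
  spin bundle that can be differentiated only along a gauge, while the equations are tested in every
  orthonormal frame and at every point of both fibres. Hence three recurring moves: restrict to a
  common open set before differentiating an identity; test with a real linear functional of the
  spinor, or pair with a vector field or a fixed vector, so that only scalars remain; transport the
  outcome to other frames by tensoriality and to other fibre points by a fixed matrix.\<close>

lemma frechet_derivative_cong_open:
  assumes "open S" "x \<in> S" "\<And>y. y \<in> S \<Longrightarrow> f y = g y"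
  shows "frechet_derivative f (at x) = frechet_derivative g (at x)"
proof -
  have "(f has_derivative D) (at x) \<longleftrightarrow> (g has_derivative D) (at x)" for D
    using has_derivative_transform_within_open[of f D x UNIV S g]
      has_derivative_transform_within_open[of g D x UNIV S f] assms by auto
  then show ?thesis unfolding frechet_derivative_def by simp
qed

lemma differentiable_cong_open:
  assumes "open S" "x \<in> S" "\<And>y. y \<in> S \<Longrightarrow> f y = g y" "f differentiable (at x)"
  shows "g differentiable (at x)"
  using assms has_derivative_transform_within_open[of f _ x UNIV S g]
  unfolding differentiable_def by blast

lemma Ck_on_cong:
  assumes "open S" "\<And>y. y \<in> S \<Longrightarrow> f y = g y" "Ck_on k f S"
  shows "Ck_on k g S"
  using assms
proof (induction k arbitrary: f g)
  case 0
  then show ?case using continuous_on_cong[of S S f g] by simp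
next
  case (Suc k)
  have "Ck_on k (\<lambda>x. frechet_derivative g (at x) v) S" for v
    by (rule Suc.IH[of "\<lambda>x. frechet_derivative f (at x) v"])
      (use Suc.prems in \<open>auto simp: frechet_derivative_cong_open[of S _ f g]\<close>)
  moreover have "g differentiable (at x)" if "x \<in> S" for x
    using Suc.prems that by (auto intro: differentiable_cong_open[of S x f g])
  ultimately show ?case by simp
qed

lemma Ck_on_subset: "Ck_on k f S \<Longrightarrow> T \<subseteq> S \<Longrightarrow> Ck_on k f T"
  by (induction k arbitrary: f) (auto intro: continuous_on_subset)

text \<open>Induction works because \<open>Ck_on\<close> differentiates the function itself, not its
  restriction, so passing to \<open>T \<inter> S\<close> changes no derivative.\<close>

lemma Ck_on_local:
  assumes "\<And>x. x \<in> S \<Longrightarrow> \<exists>T. open T \<and> x \<in> T \<and> Ck_on k f (T \<inter> S)" "open S"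
  shows "Ck_on k f S"
  using assms
proof (induction k arbitrary: f)
  case 0
  have "isCont f x" if xS: "x \<in> S" for x
  proof -
    obtain T where T: "open T" "x \<in> T" "continuous_on (T \<inter> S) f"
      using 0(1)[OF xS] by auto
    then show ?thesis
      using that \<open>open S\<close> continuous_on_eq_continuous_at[of "T \<inter> S" f] by auto
  qed
  then show ?case by (simp add: continuous_at_imp_continuous_on)
next
  case (Suc k)
  have "Ck_on k (\<lambda>x. frechet_derivative f (at x) v) S" for v
  proof (rule Suc.IH[OF _ Suc.prems(2)])
    fix x assume "x \<in> S"
    then obtain T where "open T" "x \<in> T" "Ck_on (Suc k) f (T \<inter> S)"
      using Suc.prems(1) by blast
    then show "\<exists>T. open T \<and> x \<in> T \<and> Ck_on k (\<lambda>x. frechet_derivative f (at x) v) (T \<inter> S)"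
      by auto
  qed
  moreover have "f differentiable (at x)" if "x \<in> S" for x
    using Suc.prems(1)[OF that] that by auto
  ultimately show ?case by simp
qed

lemma Ck_on_Suc_imp: "Ck_on (Suc k) f S \<Longrightarrow> Ck_on k f S"
proof (induction k arbitrary: f)
  case 0
  then show ?case
    by (simp add: continuous_at_imp_continuous_on differentiable_imp_continuous_within)
next
  case (Suc k)
  then show ?case by (metis Ck_on.simps(2))
qed

lemma Ck_on_const: "Ck_on k (\<lambda>x. c) S"
  by (induction k arbitrary: c) auto

lemma Ck_on_bounded_linear:
  assumes "bounded_linear L" "Ck_on k f S" "open S"
  shows "Ck_on k (\<lambda>x. L (f x)) S"
  using assms(2)
proof (induction k arbitrary: f)
  case 0
  then show ?case
    using bounded_linear.continuous_on[OF assms(1)] by auto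
next
  case (Suc k)
  have der: "((\<lambda>x. L (f x)) has_derivative (\<lambda>v. L (frechet_derivative f (at x) v))) (at x)"
    if "x \<in> S" for x
    using Suc.prems that
    by (intro bounded_linear.has_derivative[OF assms(1)]) (simp add: frechet_derivative_works)
  have fd: "L (frechet_derivative f (at x) v) = frechet_derivative (\<lambda>x. L (f x)) (at x) v"
    if "x \<in> S" for x v
    using frechet_derivative_at[OF der[OF that]] by metis
  have "Ck_on k (\<lambda>x. frechet_derivative (\<lambda>x. L (f x)) (at x) v) S" for v
    by (rule Ck_on_cong[OF assms(3) fd]) (use Suc in auto)
  then show ?case using differentiableI[OF der] by simp
qed

lemma Ck_on_add:
  assumes "Ck_on k f S" "Ck_on k g S" "open S"
  shows "Ck_on k (\<lambda>x. f x + g x) S"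
  using assms(1,2)
proof (induction k arbitrary: f g)
  case 0
  then show ?case by (auto intro: continuous_on_add)
next
  case (Suc k)
  have der: "((\<lambda>x. f x + g x) has_derivative
      (\<lambda>v. frechet_derivative f (at x) v + frechet_derivative g (at x) v)) (at x)"
    if "x \<in> S" for x
    using Suc.prems that by (intro has_derivative_add) (auto simp: frechet_derivative_works[symmetric])
  have fd: "frechet_derivative f (at x) v + frechet_derivative g (at x) v
      = frechet_derivative (\<lambda>x. f x + g x) (at x) v" if "x \<in> S" for x v
    using frechet_derivative_at[OF der[OF that]] by metis
  have "Ck_on k (\<lambda>x. frechet_derivative (\<lambda>x. f x + g x) (at x) v) S" for v
    by (rule Ck_on_cong[OF assms(3) fd]) (use Suc in auto)
  then show ?case using differentiableI[OF der] by simp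
qed

lemma Ck_on_scaleR:
  fixes f :: "'e::real_normed_vector \<Rightarrow> real"
  assumes "Ck_on k f S" "Ck_on k g S" "open S"
  shows "Ck_on k (\<lambda>x. f x *\<^sub>R g x) S"
  using assms(1,2)
proof (induction k arbitrary: f g)
  case 0
  then show ?case by (auto intro: continuous_on_scaleR)
next
  case (Suc k)
  have der: "((\<lambda>x. f x *\<^sub>R g x) has_derivative
      (\<lambda>v. f x *\<^sub>R frechet_derivative g (at x) v + frechet_derivative f (at x) v *\<^sub>R g x)) (at x)"
    if "x \<in> S" for x
    using Suc.prems that
    by (intro has_derivative_scaleR) (auto simp: frechet_derivative_works[symmetric])
  have fd: "f x *\<^sub>R frechet_derivative g (at x) v + frechet_derivative f (at x) v *\<^sub>R g x
      = frechet_derivative (\<lambda>x. f x *\<^sub>R g x) (at x) v" if "x \<in> S" for x v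
    using frechet_derivative_at[OF der[OF that]] by metis
  have "Ck_on k (\<lambda>x. frechet_derivative (\<lambda>x. f x *\<^sub>R g x) (at x) v) S" for v
    by (rule Ck_on_cong[OF assms(3) fd], assumption, intro Ck_on_add[OF _ _ assms(3)] Suc.IH)
      (use Suc.prems Ck_on_Suc_imp[of k f S] Ck_on_Suc_imp[of k g S] in auto)
  then show ?case using differentiableI[OF der] by simp
qed

lemma Ck_on_sum:
  assumes "\<And>i. i \<in> I \<Longrightarrow> Ck_on k (f i) S" "open S"
  shows "Ck_on k (\<lambda>x. \<Sum>i\<in>I. f i x) S"
  using assms(1)
  by (induction I rule: infinite_finite_induct) (auto simp: Ck_on_const intro!: Ck_on_add assms(2))

text \<open>Replaces \<open>Basis\<close> for inner product spaces that may be zero-dimensional.\<close>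

definition orthobasis :: "'a::real_inner set \<Rightarrow> bool" where
  "orthobasis b \<longleftrightarrow> finite b \<and> (\<forall>i\<in>b. \<forall>j\<in>b. i \<bullet> j = (if i = j then 1 else 0)) \<and>
     (\<forall>x. (\<Sum>i\<in>b. (x \<bullet> i) *\<^sub>R i) = x)"

lemma orthobasis_Basis: "orthobasis (Basis :: 'a::euclidean_space set)"
  by (auto simp: orthobasis_def inner_Basis euclidean_representation)

lemma orthobasis_sum: "orthobasis b \<Longrightarrow> (\<Sum>i\<in>b. (x \<bullet> i) *\<^sub>R i) = x"
  by (simp add: orthobasis_def)

text \<open>Gram-Schmidt, then 0 is discarded and the rest normalised. A finite spanning set is all
  that \<open>lie_group\<close> provides.\<close>

lemma orthobasis_exists:
  assumes "finite S" "span S = (UNIV :: 'a::real_inner set)"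
  shows "\<exists>b :: 'a set. orthobasis b"
proof -
  obtain C :: "'a set" where C: "finite C" "span C = UNIV" "pairwise orthogonal C"
    using basis_orthogonal[OF assms(1)] assms(2) by metis
  define b where "b = (\<lambda>x. x /\<^sub>R norm x) ` (C - {0})"
  have fin: "finite b" using C by (simp add: b_def)
  have orth: "i \<bullet> j = (if i = j then 1 else 0)" if ij: "i \<in> b" "j \<in> b" for i j
  proof -
    obtain x y where xy: "x \<in> C" "x \<noteq> 0" "i = x /\<^sub>R norm x" "y \<in> C" "y \<noteq> 0" "j = y /\<^sub>R norm y"
      using ij unfolding b_def by blast
    show ?thesis
    proof (cases "x = y")
      case True
      then show ?thesis using xy
        by (simp add: dot_square_norm power2_eq_square)
    next
      case False
      then have "x \<bullet> y = 0" using C(3) xy by (auto simp: pairwise_def orthogonal_def)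
      then have z: "i \<bullet> j = 0" using xy by simp
      have "j \<bullet> j \<noteq> 0" using xy by simp
      then show ?thesis using z by auto
    qed
  qed
  have sp: "x \<in> span b" for x
  proof -
    have "y \<in> span b" if "y \<in> C" for y
    proof (cases "y = 0")
      case False
      then have "y /\<^sub>R norm y \<in> span b" using that by (auto simp: b_def intro!: span_base)
      then have "norm y *\<^sub>R (y /\<^sub>R norm y) \<in> span b" by (rule span_scale)
      then show ?thesis using False by simp
    qed (simp add: span_zero)
    then have "span C \<subseteq> span b" by (simp add: span_minimal subsetI)
    then show ?thesis using C by auto
  qed
  have "(\<Sum>i\<in>b. (x \<bullet> i) *\<^sub>R i) = x" for x
    using sp[of x]
  proof (induction rule: span_induct_alt)
    case (step c x y)
    have "(\<Sum>i\<in>b. (x \<bullet> i) *\<^sub>R i) = (\<Sum>i\<in>b. if i = x then x else 0)"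
      by (rule sum.cong) (use step orth in auto)
    also have "\<dots> = x" using step fin by simp
    finally have "(\<Sum>i\<in>b. (x \<bullet> i) *\<^sub>R i) = x" .
    moreover have "(\<Sum>i\<in>b. ((c *\<^sub>R x + y) \<bullet> i) *\<^sub>R i)
        = c *\<^sub>R (\<Sum>i\<in>b. (x \<bullet> i) *\<^sub>R i) + (\<Sum>i\<in>b. (y \<bullet> i) *\<^sub>R i)"
      by (simp add: scaleR_sum_right sum.distrib[symmetric] inner_add_left scaleR_add_left)
    ultimately show ?case using step by simp
  qed simp
  then show ?thesis unfolding orthobasis_def using fin orth by blast
qed

lemma orthobasis_prod:
  fixes b :: "'a::real_inner set" and c :: "'b::real_inner set"
  assumes "orthobasis b" "orthobasis c"
  shows "orthobasis ((\<lambda>i. (i, 0)) ` b \<union> (\<lambda>j. (0, j)) ` c)" (is "orthobasis (?B \<union> ?C)")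
proof -
  have fin: "finite b" "finite c" using assms by (auto simp: orthobasis_def)
  have nz: "0 \<notin> b" "0 \<notin> c" using assms unfolding orthobasis_def
    by (metis inner_zero_left zero_neq_one)+
  have "(\<Sum>i\<in>?B \<union> ?C. (x \<bullet> i) *\<^sub>R i) = x" for x :: "'a \<times> 'b"
  proof -
    have "(\<Sum>i\<in>?B \<union> ?C. (x \<bullet> i) *\<^sub>R i)
        = (\<Sum>i\<in>?B. (x \<bullet> i) *\<^sub>R i) + (\<Sum>i\<in>?C. (x \<bullet> i) *\<^sub>R i)"
      by (rule sum.union_disjoint) (use fin nz in auto)
    also have "\<dots> = (\<Sum>i\<in>b. (fst x \<bullet> i) *\<^sub>R (i, 0)) + (\<Sum>j\<in>c. (snd x \<bullet> j) *\<^sub>R (0, j))"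
      by (cases x) (simp add: sum.reindex inj_on_def inner_prod_def)
    also have "\<dots> = (\<Sum>i\<in>b. (fst x \<bullet> i) *\<^sub>R i, 0) + (0, \<Sum>j\<in>c. (snd x \<bullet> j) *\<^sub>R j)"
      by (simp add: prod_eq_iff fst_sum snd_sum)
    finally show ?thesis by (simp add: orthobasis_sum[OF assms(1)] orthobasis_sum[OF assms(2)])
  qed
  moreover have "finite (?B \<union> ?C)" using fin by simp
  moreover have "i \<bullet> j = (if i = j then 1 else 0)" if "i \<in> ?B \<union> ?C" "j \<in> ?B \<union> ?C" for i j
    using that assms(1)[unfolded orthobasis_def] assms(2)[unfolded orthobasis_def] nz
    by (auto; metis)
  ultimately show ?thesis unfolding orthobasis_def by blast
qed

lemma orthobasis_linear_bounded:
  fixes b :: "'a::real_inner set" and L :: "'a \<Rightarrow> 'b::real_normed_vector"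
  assumes "orthobasis b" "linear L" shows "bounded_linear L"
proof -
  have eq: "L x = (\<Sum>i\<in>b. (x \<bullet> i) *\<^sub>R L i)" for x
  proof -
    have "L x = L (\<Sum>i\<in>b. (x \<bullet> i) *\<^sub>R i)" by (simp only: orthobasis_sum[OF assms(1)])
    then show ?thesis by (simp add: linear_sum[OF assms(2)] linear_scale[OF assms(2)])
  qed
  have "L = (\<lambda>x. \<Sum>i\<in>b. (x \<bullet> i) *\<^sub>R L i)" by (rule ext) (rule eq)
  moreover have "bounded_linear (\<lambda>x. \<Sum>i\<in>b. (x \<bullet> i) *\<^sub>R L i)"
    by (intro bounded_linear_sum bounded_linear_scaleR_const bounded_linear_inner_left)
  ultimately show ?thesis by (rule ssubst[where P = bounded_linear])
qed

text \<open>By the chain rule a directional derivative of the composite is a finite sum of products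
  of a component of \<open>g'\<close> with a derivative of \<open>f\<close> in a fixed direction,
  composed with \<open>g\<close>. \<open>Ck_on\<close> speaks only of fixed directions, so the
  middle space needs a finite basis.\<close>

lemma Ck_on_compose:
  fixes g :: "'e::real_normed_vector \<Rightarrow> 'b::real_inner" and b :: "'b set"
  assumes "Ck_on k f T" "Ck_on k g S" "open S" "open T" "g ` S \<subseteq> T" "orthobasis b"
  shows "Ck_on k (\<lambda>x. f (g x)) S"
  using assms(1,2)
proof (induction k arbitrary: f)
  case 0
  then show ?case unfolding Ck_on.simps by (rule continuous_on_compose2[OF _ _ assms(5)])
next
  case (Suc k)
  have der: "((\<lambda>x. f (g x)) has_derivative
      (\<lambda>v. frechet_derivative f (at (g x)) (frechet_derivative g (at x) v))) (at x)"
    if "x \<in> S" for x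
  proof -
    have "(g has_derivative frechet_derivative g (at x)) (at x)"
      "(f has_derivative frechet_derivative f (at (g x))) (at (g x))"
      using Suc.prems that assms(5) unfolding frechet_derivative_works[symmetric] by auto
    from diff_chain_at[OF this] show ?thesis by (simp add: o_def)
  qed
  have eq: "(\<Sum>i\<in>b. (frechet_derivative g (at x) v \<bullet> i) *\<^sub>R frechet_derivative f (at (g x)) i)
      = frechet_derivative (\<lambda>x. f (g x)) (at x) v"
    if "x \<in> S" for x v
  proof -
    have lin: "linear (frechet_derivative f (at (g x)))"
      using Suc.prems that assms(5) by (auto intro!: linear_frechet_derivative)
    have "frechet_derivative (\<lambda>x. f (g x)) (at x) v
        = frechet_derivative f (at (g x)) (frechet_derivative g (at x) v)"
      using fun_cong[OF frechet_derivative_at[OF der[OF that]], of v] by (rule sym)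
    also have "\<dots> = frechet_derivative f (at (g x)) (\<Sum>i\<in>b. (frechet_derivative g (at x) v \<bullet> i) *\<^sub>R i)"
      by (simp only: orthobasis_sum[OF assms(6)])
    also have "\<dots> = (\<Sum>i\<in>b. (frechet_derivative g (at x) v \<bullet> i) *\<^sub>R frechet_derivative f (at (g x)) i)"
      by (simp add: linear_sum[OF lin] linear_scale[OF lin])
    finally show ?thesis by (rule sym)
  qed
  have "Ck_on k (\<lambda>x. frechet_derivative (\<lambda>x. f (g x)) (at x) v) S" for v
  proof (rule Ck_on_cong[OF assms(3) eq], assumption, intro Ck_on_sum Ck_on_scaleR assms(3))
    fix i
    show "Ck_on k (\<lambda>x. frechet_derivative g (at x) v \<bullet> i) S"
      using Suc.prems by (intro Ck_on_bounded_linear[OF bounded_linear_inner_left] assms(3)) simp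
    show "Ck_on k (\<lambda>x. frechet_derivative f (at (g x)) i) S"
      by (rule Suc.IH) (use Suc.prems Ck_on_Suc_imp[of k g] in simp_all)
  qed
  then show ?case using differentiableI[OF der] by simp
qed

lemma smooth_on_cong:
  "open S \<Longrightarrow> (\<And>y. y \<in> S \<Longrightarrow> f y = g y) \<Longrightarrow> smooth_on S f \<Longrightarrow> smooth_on S g"
  unfolding smooth_on_def using Ck_on_cong[of S f g] by blast

lemma smooth_on_subset: "smooth_on S f \<Longrightarrow> T \<subseteq> S \<Longrightarrow> smooth_on T f"
  unfolding smooth_on_def using Ck_on_subset by blast

lemma smooth_on_local:
  assumes "\<And>x. x \<in> S \<Longrightarrow> \<exists>T. open T \<and> x \<in> T \<and> smooth_on (T \<inter> S) f" "open S"
  shows "smooth_on S f"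
  unfolding smooth_on_def
proof
  fix k
  show "Ck_on k f S"
    by (rule Ck_on_local[OF _ assms(2)]) (use assms(1) in \<open>unfold smooth_on_def, blast\<close>)
qed

lemma smooth_on_const: "smooth_on S (\<lambda>x. c)"
  by (simp add: smooth_on_def Ck_on_const)

lemma smooth_on_bounded_linear:
  "bounded_linear L \<Longrightarrow> smooth_on S f \<Longrightarrow> open S \<Longrightarrow> smooth_on S (\<lambda>x. L (f x))"
  by (simp add: smooth_on_def Ck_on_bounded_linear)

lemma smooth_on_add:
  "smooth_on S f \<Longrightarrow> smooth_on S g \<Longrightarrow> open S \<Longrightarrow> smooth_on S (\<lambda>x. f x + g x)"
  by (simp add: smooth_on_def Ck_on_add)

lemma smooth_on_scaleR:
  fixes f :: "'e::real_normed_vector \<Rightarrow> real"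
  shows "smooth_on S f \<Longrightarrow> smooth_on S g \<Longrightarrow> open S \<Longrightarrow> smooth_on S (\<lambda>x. f x *\<^sub>R g x)"
  by (simp add: smooth_on_def Ck_on_scaleR)

lemma smooth_on_compose:
  fixes g :: "'e::real_normed_vector \<Rightarrow> 'b::real_inner" and b :: "'b set"
  assumes "smooth_on T f" "smooth_on S g" "open S" "open T" "g ` S \<subseteq> T" "orthobasis b"
  shows "smooth_on S (\<lambda>x. f (g x))"
  using assms Ck_on_compose[of _ f T g S b] by (simp add: smooth_on_def)

lemma smooth_on_ident: "smooth_on S (\<lambda>x. x)"
proof -
  have "Ck_on k (\<lambda>x. x) S" for k
    by (cases k) (auto simp: Ck_on_const)
  then show ?thesis by (simp add: smooth_on_def)
qed

lemma smooth_on_linear: "bounded_linear L \<Longrightarrow> open S \<Longrightarrow> smooth_on S L"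
  by (rule smooth_on_bounded_linear[OF _ smooth_on_ident])

lemma smooth_on_Pair:
  fixes f :: "'e::real_normed_vector \<Rightarrow> 'b::real_normed_vector"
    and g :: "'e \<Rightarrow> 'c::real_normed_vector"
  assumes "smooth_on S f" "smooth_on S g" "open S"
  shows "smooth_on S (\<lambda>x. (f x, g x))"
proof -
  have "smooth_on S (\<lambda>x. (f x, 0::'c) + (0::'b, g x))"
    by (intro smooth_on_add assms smooth_on_bounded_linear[OF _ assms(1)] smooth_on_bounded_linear[OF _ assms(2)])
      (auto intro!: bounded_linear_Pair bounded_linear_ident bounded_linear_zero)
  then show ?thesis by simp
qed

lemma smooth_on_differentiable: "smooth_on S f \<Longrightarrow> x \<in> S \<Longrightarrow> f differentiable (at x)"
  using Ck_on.simps(2)[of 0 f S] unfolding smooth_on_def by blast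

lemma smooth_on_continuous: "smooth_on S f \<Longrightarrow> continuous_on S f"
  using Ck_on.simps(1)[of f S] unfolding smooth_on_def by blast

lemma smooth_on_derivative:
  "smooth_on S f \<Longrightarrow> smooth_on S (\<lambda>x. frechet_derivative f (at x) v)"
  unfolding smooth_on_def using Ck_on.simps(2)[of _ f S] by blast

section \<open>Symmetry of second derivatives\<close>

text \<open>Two applications of the mean value theorem, along \<open>u\<close> and then along
  \<open>v\<close>, turn the quotient into the mixed derivative at an interior point of a small
  parallelogram; continuity gives the limit. The quotient is symmetric in \<open>u\<close> and
  \<open>v\<close>, whence the next lemma.\<close>

lemma second_difference_limit:
  fixes f :: "'e::real_normed_vector \<Rightarrow> real"
  assumes f: "smooth_on S f" and "open S" "x \<in> S"
  shows "((\<lambda>h. (f (x + h *\<^sub>R u + h *\<^sub>R v) - f (x + h *\<^sub>R u) - f (x + h *\<^sub>R v) + f x) / h\<^sup>2)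
    \<longlongrightarrow> frechet_derivative (\<lambda>y. frechet_derivative f (at y) u) (at x) v) (at_right 0)"
proof -
  define g where "g = (\<lambda>y. frechet_derivative f (at y) u)"
  define k where "k = (\<lambda>y. frechet_derivative g (at y) v)"
  have g: "smooth_on S g" and k: "smooth_on S k"
    unfolding g_def k_def by (intro smooth_on_derivative f)+
  have df: "((\<lambda>s. f (c + s *\<^sub>R u)) has_real_derivative g (c + s *\<^sub>R u)) (at s)"
    if "c + s *\<^sub>R u \<in> S" for c s
  proof -
    have F: "(f has_derivative frechet_derivative f (at (c + s *\<^sub>R u))) (at (c + s *\<^sub>R u))"
      using smooth_on_differentiable[OF f that] by (simp add: frechet_derivative_works)
    have "((\<lambda>s. c + s *\<^sub>R u) has_derivative (\<lambda>s. s *\<^sub>R u)) (at s)"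
      by (auto intro!: derivative_eq_intros)
    from diff_chain_at[OF this F]
    have "((\<lambda>s. f (c + s *\<^sub>R u)) has_derivative
        (\<lambda>t. frechet_derivative f (at (c + s *\<^sub>R u)) (t *\<^sub>R u))) (at s)"
      by (simp add: o_def)
    moreover have "(\<lambda>t. frechet_derivative f (at (c + s *\<^sub>R u)) (t *\<^sub>R u))
        = (*) (g (c + s *\<^sub>R u))"
      using linear_scale[OF has_derivative_linear[OF F]] by (auto simp: g_def mult.commute)
    ultimately show ?thesis unfolding has_field_derivative_def by simp
  qed
  have dg: "((\<lambda>s. g (c + s *\<^sub>R v)) has_real_derivative k (c + s *\<^sub>R v)) (at s)"
    if "c + s *\<^sub>R v \<in> S" for c s
  proof -
    have F: "(g has_derivative frechet_derivative g (at (c + s *\<^sub>R v))) (at (c + s *\<^sub>R v))"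
      using smooth_on_differentiable[OF g that] by (simp add: frechet_derivative_works)
    have "((\<lambda>s. c + s *\<^sub>R v) has_derivative (\<lambda>s. s *\<^sub>R v)) (at s)"
      by (auto intro!: derivative_eq_intros)
    from diff_chain_at[OF this F]
    have "((\<lambda>s. g (c + s *\<^sub>R v)) has_derivative
        (\<lambda>t. frechet_derivative g (at (c + s *\<^sub>R v)) (t *\<^sub>R v))) (at s)"
      by (simp add: o_def)
    moreover have "(\<lambda>t. frechet_derivative g (at (c + s *\<^sub>R v)) (t *\<^sub>R v))
        = (*) (k (c + s *\<^sub>R v))"
      using linear_scale[OF has_derivative_linear[OF F]] by (auto simp: k_def mult.commute)
    ultimately show ?thesis unfolding has_field_derivative_def by simp
  qed
  have "\<exists>d>0. \<forall>h>0. h < d \<longrightarrow>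
      \<bar>(f (x + h *\<^sub>R u + h *\<^sub>R v) - f (x + h *\<^sub>R u) - f (x + h *\<^sub>R v) + f x) / h\<^sup>2 - k x\<bar> < r"
    if "r > 0" for r
  proof -
    obtain e1 where e1: "e1 > 0" "ball x e1 \<subseteq> S"
      using assms open_contains_ball by blast
    obtain e2 where e2: "e2 > 0" "\<And>y. y \<in> S \<Longrightarrow> dist y x < e2 \<Longrightarrow> \<bar>k y - k x\<bar> < r"
      using smooth_on_continuous[OF k] \<open>x \<in> S\<close> \<open>r > 0\<close> unfolding continuous_on_iff dist_real_def by metis
    define e where "e = min e1 e2"
    \<comment> \<open>The bound on \<open>h\<close> keeps the whole parallelogram inside the ball of
      radius \<open>e\<close>; the summand 1 keeps the denominator positive when \<open>u\<close>
      and \<open>v\<close> vanish.\<close>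
    have near: "x + s *\<^sub>R u + t *\<^sub>R v \<in> S \<and> \<bar>k (x + s *\<^sub>R u + t *\<^sub>R v) - k x\<bar> < r"
      if "0 \<le> s" "s \<le> h" "0 \<le> t" "t \<le> h" "h < e / (norm u + norm v + 1)" for s t h
    proof -
      have "0 \<le> h" using that by linarith
      have "norm (s *\<^sub>R u + t *\<^sub>R v) \<le> s * norm u + t * norm v"
        using that norm_triangle_ineq[of "s *\<^sub>R u" "t *\<^sub>R v"] by simp
      also have "\<dots> \<le> h * norm u + h * norm v"
        using that by (intro add_mono mult_right_mono) auto
      also have "\<dots> \<le> h * (norm u + norm v + 1)" using \<open>0 \<le> h\<close> by (simp add: algebra_simps)
      also have "\<dots> < e"
        using that(5) pos_less_divide_eq[of "norm u + norm v + 1" h e]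
          norm_ge_zero[of u] norm_ge_zero[of v] by linarith
      finally have "dist (x + s *\<^sub>R u + t *\<^sub>R v) x < e" by (simp add: dist_norm algebra_simps)
      then show ?thesis using e1 e2 by (auto simp: e_def dist_commute subset_iff)
    qed
    define d where "d = e / (norm u + norm v + 1)"
    have "d > 0" using e1 e2 unfolding d_def e_def
      by (intro divide_pos_pos) (auto intro: add_nonneg_pos)
    moreover have "\<bar>(f (x + h *\<^sub>R u + h *\<^sub>R v) - f (x + h *\<^sub>R u) - f (x + h *\<^sub>R v) + f x) / h\<^sup>2 - k x\<bar> < r"
      if "h > 0" "h < d" for h
    proof -
      have near': "x + s *\<^sub>R u + t *\<^sub>R v \<in> S" "\<bar>k (x + s *\<^sub>R u + t *\<^sub>R v) - k x\<bar> < r"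
        if "0 \<le> s" "s \<le> h" "0 \<le> t" "t \<le> h" for s t
        using near[of s h t] that \<open>h < d\<close> by (auto simp: d_def)
      have "\<exists>z>0. z < h \<and> (f (x + h *\<^sub>R v + h *\<^sub>R u) - f (x + h *\<^sub>R u))
          - (f (x + h *\<^sub>R v + 0 *\<^sub>R u) - f (x + 0 *\<^sub>R u))
          = (h - 0) * (g (x + h *\<^sub>R v + z *\<^sub>R u) - g (x + z *\<^sub>R u))"
      proof (rule MVT2[OF \<open>h > 0\<close>])
        fix s assume s: "0 \<le> s" "s \<le> h"
        show "((\<lambda>s. f (x + h *\<^sub>R v + s *\<^sub>R u) - f (x + s *\<^sub>R u)) has_real_derivative
            g (x + h *\<^sub>R v + s *\<^sub>R u) - g (x + s *\<^sub>R u)) (at s)"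
          using near'(1)[of s h] near'(1)[of s 0] s \<open>h > 0\<close>
          by (intro DERIV_diff df) (auto simp: algebra_simps)
      qed
      then obtain z where z: "0 < z" "z < h"
        "f (x + h *\<^sub>R u + h *\<^sub>R v) - f (x + h *\<^sub>R u) - f (x + h *\<^sub>R v) + f x
          = h * (g (x + z *\<^sub>R u + h *\<^sub>R v) - g (x + z *\<^sub>R u + 0 *\<^sub>R v))"
        by (auto simp: algebra_simps)
      have "\<exists>w>0. w < h \<and> g (x + z *\<^sub>R u + h *\<^sub>R v) - g (x + z *\<^sub>R u + 0 *\<^sub>R v)
          = (h - 0) * k (x + z *\<^sub>R u + w *\<^sub>R v)"
        using near'(1)[of z] z by (intro MVT2[OF \<open>h > 0\<close>] dg) auto
      then obtain w where w: "0 < w" "w < h"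
        "g (x + z *\<^sub>R u + h *\<^sub>R v) - g (x + z *\<^sub>R u + 0 *\<^sub>R v) = h * k (x + z *\<^sub>R u + w *\<^sub>R v)"
        by auto
      have "(f (x + h *\<^sub>R u + h *\<^sub>R v) - f (x + h *\<^sub>R u) - f (x + h *\<^sub>R v) + f x) / h\<^sup>2
          = k (x + z *\<^sub>R u + w *\<^sub>R v)"
        using z(3) w(3) \<open>h > 0\<close> by (simp add: power2_eq_square)
      then show ?thesis using near'(2)[of z w] z w by auto
    qed
    ultimately show ?thesis by blast
  qed
  then have "((\<lambda>h. (f (x + h *\<^sub>R u + h *\<^sub>R v) - f (x + h *\<^sub>R u) - f (x + h *\<^sub>R v) + f x) / h\<^sup>2)
    \<longlongrightarrow> k x) (at_right 0)"
    unfolding tendsto_iff eventually_at_right_field dist_real_def by blast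
  then show ?thesis by (simp add: k_def g_def)
qed

lemma symmetric_second_derivative:
  fixes f :: "'e::real_normed_vector \<Rightarrow> real"
  assumes "smooth_on S f" "open S" "x \<in> S"
  shows "frechet_derivative (\<lambda>y. frechet_derivative f (at y) u) (at x) v
       = frechet_derivative (\<lambda>y. frechet_derivative f (at y) v) (at x) u"
proof (rule tendsto_unique[OF _ second_difference_limit[OF assms]])
  show "((\<lambda>h. (f (x + h *\<^sub>R u + h *\<^sub>R v) - f (x + h *\<^sub>R u) - f (x + h *\<^sub>R v) + f x) / h\<^sup>2)
    \<longlongrightarrow> frechet_derivative (\<lambda>y. frechet_derivative f (at y) v) (at x) u) (at_right 0)"
    using second_difference_limit[OF assms, of v u] by (simp add: algebra_simps)
qed simp

section \<open>Smooth functions on a manifold\<close>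

lemma tlin_apply: "tlin a u b v f = a * u f + b * v f"
  by (simp add: tlin_def)

text \<open>The model space is an inner product space with an orthobasis, so that the base, the
  bundle, the group and their products are all instances.\<close>

locale manifold =
  fixes A :: "('m::{t2_space, second_countable_topology}, 'e::real_inner) atlas" and bs :: "'e set"
  assumes atlas: "smooth_atlas A" and basis: "orthobasis bs"

section \<open>Germs of smooth functions\<close>

text \<open>The vector-valued version of \<open>smooth_near\<close>. Working with germs avoids
  tracking domains through every sum and product.\<close>

definition smooth_at ::
    "('m::topological_space, 'e::real_normed_vector) atlas \<Rightarrow> 'm \<Rightarrow>
     ('m \<Rightarrow> 'b::real_normed_vector) \<Rightarrow> bool" where
  "smooth_at A x f \<longleftrightarrow> (\<exists>W. x \<in> W \<and> smooth_fun A W f)"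

lemma smooth_near_iff: "smooth_near A x f \<longleftrightarrow> smooth_at A x f"
  by (simp add: smooth_near_def smooth_at_def)

lemma smooth_atI: "smooth_fun A W f \<Longrightarrow> x \<in> W \<Longrightarrow> smooth_at A x f"
  unfolding smooth_at_def by blast

lemma smooth_fun_open: "smooth_fun A W f \<Longrightarrow> open W"
  by (simp add: smooth_fun_def)

context manifold
begin

lemma chart_open: "(U, \<phi>) \<in> A \<Longrightarrow> open U"
  using atlas unfolding smooth_atlas_def by blast

lemma chart_homeo: "(U, \<phi>) \<in> A \<Longrightarrow> homeomorphism U (\<phi> ` U) \<phi> (inv_into U \<phi>)"
  using atlas unfolding smooth_atlas_def by blast

lemma chart_inv: "(U, \<phi>) \<in> A \<Longrightarrow> x \<in> U \<Longrightarrow> inv_into U \<phi> (\<phi> x) = x"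
  using homeomorphism_apply1[OF chart_homeo] by blast

lemma chart_transition:
  "(U, \<phi>) \<in> A \<Longrightarrow> (V, \<psi>) \<in> A \<Longrightarrow> smooth_on (\<phi> ` (U \<inter> V)) (\<psi> \<circ> inv_into U \<phi>)"
  using atlas unfolding smooth_atlas_def by blast

lemma chart_exists: obtains U \<phi> where "(U, \<phi>) \<in> A" "x \<in> U"
proof -
  have "x \<in> (\<Union>(U, \<phi>)\<in>A. U)" using atlas unfolding smooth_atlas_def by blast
  then show ?thesis using that by blast
qed

lemma chart_image_open:
  assumes c: "(U, \<phi>) \<in> A" and "open W" shows "open (\<phi> ` (U \<inter> W))"
proof -
  have "open (\<phi> ` U)" using c atlas unfolding smooth_atlas_def by blast
  moreover have "openin (top_of_set (\<phi> ` U)) (\<phi> ` (U \<inter> W))"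
    by (rule homeomorphism_imp_open_map[OF chart_homeo[OF c]])
      (simp add: openin_open_Int assms(2))
  ultimately show ?thesis by (simp add: openin_open_eq)
qed

lemma smooth_fun_subset:
  assumes "smooth_fun A W f" "open W'" "W' \<subseteq> W" shows "smooth_fun A W' f"
proof -
  have "smooth_on (\<phi> ` (U \<inter> W')) (f \<circ> inv_into U \<phi>)" if "(U, \<phi>) \<in> A" for U \<phi>
  proof (rule smooth_on_subset)
    show "smooth_on (\<phi> ` (U \<inter> W)) (f \<circ> inv_into U \<phi>)"
      using assms(1) that unfolding smooth_fun_def by blast
  qed (use assms(3) in blast)
  then show ?thesis using assms(2) unfolding smooth_fun_def by blast
qed

lemma smooth_fun_cong:
  assumes "smooth_fun A W f" "\<And>x. x \<in> W \<Longrightarrow> f x = g x" shows "smooth_fun A W g"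
proof -
  have W: "open W" using assms(1) by (rule smooth_fun_open)
  have "smooth_on (\<phi> ` (U \<inter> W)) (g \<circ> inv_into U \<phi>)" if c: "(U, \<phi>) \<in> A" for U \<phi>
  proof (rule smooth_on_cong[OF chart_image_open[OF c W]])
    show "smooth_on (\<phi> ` (U \<inter> W)) (f \<circ> inv_into U \<phi>)"
      using assms(1) c unfolding smooth_fun_def by blast
  qed (use assms(2) chart_inv[OF c] in auto)
  then show ?thesis using W unfolding smooth_fun_def by blast
qed

text \<open>Any other chart differs by a smooth transition map, so one chart around each point is
  enough although the definition quantifies over all of them.\<close>

lemma smooth_fun_chartI:
  assumes W: "open W"
    and loc: "\<And>x. x \<in> W \<Longrightarrow> \<exists>U \<phi> T. (U, \<phi>) \<in> A \<and> x \<in> U \<and> open T \<and> x \<in> T \<and>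
      smooth_on (\<phi> ` (U \<inter> (W \<inter> T))) (f \<circ> inv_into U \<phi>)"
  shows "smooth_fun A W f"
proof -
  have "smooth_on (\<psi> ` (V \<inter> W)) (f \<circ> inv_into V \<psi>)" if d: "(V, \<psi>) \<in> A" for V \<psi>
  proof (rule smooth_on_local)
    fix z assume "z \<in> \<psi> ` (V \<inter> W)"
    then obtain x where x: "x \<in> V" "x \<in> W" "z = \<psi> x" by blast
    obtain U \<phi> T where c: "(U, \<phi>) \<in> A" "x \<in> U" "open T" "x \<in> T"
      "smooth_on (\<phi> ` (U \<inter> (W \<inter> T))) (f \<circ> inv_into U \<phi>)" using loc[OF x(2)] by blast
    let ?N = "\<psi> ` (V \<inter> (W \<inter> T \<inter> U))"
    have oN: "open ?N"
      by (intro chart_image_open[OF d] open_Int W c(3) chart_open[OF c(1)])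
    have "smooth_on ?N (\<lambda>z. (f \<circ> inv_into U \<phi>) ((\<phi> \<circ> inv_into V \<psi>) z))"
    proof (rule smooth_on_compose[OF c(5) _ oN _ _ basis])
      show "smooth_on ?N (\<phi> \<circ> inv_into V \<psi>)"
        by (rule smooth_on_subset[OF chart_transition[OF d c(1)]]) blast
      show "open (\<phi> ` (U \<inter> (W \<inter> T)))"
        by (intro chart_image_open[OF c(1)] open_Int W c(3))
      show "(\<phi> \<circ> inv_into V \<psi>) ` ?N \<subseteq> \<phi> ` (U \<inter> (W \<inter> T))"
        using chart_inv[OF d] by auto
    qed
    then have "smooth_on ?N (f \<circ> inv_into V \<psi>)"
      by (rule smooth_on_cong[OF oN, rotated]) (use chart_inv[OF d] chart_inv[OF c(1)] in auto)
    moreover have "?N \<inter> \<psi> ` (V \<inter> W) = ?N" by blast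
    moreover have "z \<in> ?N" using x c by blast
    ultimately show "\<exists>N. open N \<and> z \<in> N \<and> smooth_on (N \<inter> \<psi> ` (V \<inter> W)) (f \<circ> inv_into V \<psi>)"
      using oN by metis
  qed (rule chart_image_open[OF d W])
  then show ?thesis using W unfolding smooth_fun_def by blast
qed

lemma smooth_fun_on_chart:
  "smooth_fun A W f \<Longrightarrow> (U, \<phi>) \<in> A \<Longrightarrow> smooth_on (\<phi> ` (U \<inter> W)) (f \<circ> inv_into U \<phi>)"
  unfolding smooth_fun_def by blast

lemma smooth_fun_local:
  assumes "\<And>x. x \<in> W \<Longrightarrow> smooth_at A x f" "open W" shows "smooth_fun A W f"
proof (rule smooth_fun_chartI[OF assms(2)])
  fix x assume "x \<in> W"
  then obtain T where T: "x \<in> T" "smooth_fun A T f" using assms(1) unfolding smooth_at_def by blast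
  obtain U \<phi> where c: "(U, \<phi>) \<in> A" "x \<in> U" using chart_exists .
  have "smooth_on (\<phi> ` (U \<inter> (W \<inter> T))) (f \<circ> inv_into U \<phi>)"
    by (rule smooth_on_subset[OF smooth_fun_on_chart[OF T(2) c(1)]]) blast
  then show "\<exists>U \<phi> T. (U, \<phi>) \<in> A \<and> x \<in> U \<and> open T \<and> x \<in> T \<and>
      smooth_on (\<phi> ` (U \<inter> (W \<inter> T))) (f \<circ> inv_into U \<phi>)"
    using T c smooth_fun_open[OF T(2)] by blast
qed

lemma smooth_fun_const: "open W \<Longrightarrow> smooth_fun A W (\<lambda>x. c)"
  unfolding smooth_fun_def by (auto simp: o_def smooth_on_const)

lemma smooth_fun_bounded_linear:
  assumes "smooth_fun A W f" "bounded_linear L" shows "smooth_fun A W (\<lambda>x. L (f x))"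
proof -
  have "smooth_on (\<phi> ` (U \<inter> W)) ((\<lambda>x. L (f x)) \<circ> inv_into U \<phi>)" if c: "(U, \<phi>) \<in> A" for U \<phi>
    using smooth_on_bounded_linear[OF assms(2) smooth_fun_on_chart[OF assms(1) c]
        chart_image_open[OF c smooth_fun_open[OF assms(1)]]] by (simp add: o_def)
  then show ?thesis using smooth_fun_open[OF assms(1)] unfolding smooth_fun_def by blast
qed

lemma smooth_fun_add:
  assumes "smooth_fun A W f" "smooth_fun A W g" shows "smooth_fun A W (\<lambda>x. f x + g x)"
proof -
  have "smooth_on (\<phi> ` (U \<inter> W)) ((\<lambda>x. f x + g x) \<circ> inv_into U \<phi>)" if c: "(U, \<phi>) \<in> A" for U \<phi>
    using smooth_on_add[OF smooth_fun_on_chart[OF assms(1) c] smooth_fun_on_chart[OF assms(2) c]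
        chart_image_open[OF c smooth_fun_open[OF assms(1)]]] by (simp add: o_def)
  then show ?thesis using smooth_fun_open[OF assms(1)] unfolding smooth_fun_def by blast
qed

lemma smooth_fun_scaleR:
  fixes f :: "'m \<Rightarrow> real"
  assumes "smooth_fun A W f" "smooth_fun A W g" shows "smooth_fun A W (\<lambda>x. f x *\<^sub>R g x)"
proof -
  have "smooth_on (\<phi> ` (U \<inter> W)) ((\<lambda>x. f x *\<^sub>R g x) \<circ> inv_into U \<phi>)"
    if c: "(U, \<phi>) \<in> A" for U \<phi>
    using smooth_on_scaleR[OF smooth_fun_on_chart[OF assms(1) c] smooth_fun_on_chart[OF assms(2) c]
        chart_image_open[OF c smooth_fun_open[OF assms(1)]]] by (simp add: o_def)
  then show ?thesis using smooth_fun_open[OF assms(1)] unfolding smooth_fun_def by blast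
qed

lemma smooth_fun_Pair:
  fixes f :: "'m \<Rightarrow> 'b::real_normed_vector" and g :: "'m \<Rightarrow> 'c::real_normed_vector"
  assumes "smooth_fun A W f" "smooth_fun A W g" shows "smooth_fun A W (\<lambda>x. (f x, g x))"
proof -
  have "smooth_on (\<phi> ` (U \<inter> W)) ((\<lambda>x. (f x, g x)) \<circ> inv_into U \<phi>)"
    if c: "(U, \<phi>) \<in> A" for U \<phi>
    using smooth_on_Pair[OF smooth_fun_on_chart[OF assms(1) c] smooth_fun_on_chart[OF assms(2) c]
        chart_image_open[OF c smooth_fun_open[OF assms(1)]]] by (simp add: o_def)
  then show ?thesis using smooth_fun_open[OF assms(1)] unfolding smooth_fun_def by blast
qed

lemma smooth_fun_chart: "(U, \<phi>) \<in> A \<Longrightarrow> smooth_fun A U \<phi>"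
  unfolding smooth_fun_def
  using chart_open chart_transition by (auto simp: Int_commute)

lemma smooth_at_common:
  assumes "smooth_at A x f" "smooth_at A x g"
  obtains W where "x \<in> W" "smooth_fun A W f" "smooth_fun A W g"
proof -
  obtain W1 W2 where W: "x \<in> W1" "smooth_fun A W1 f" "x \<in> W2" "smooth_fun A W2 g"
    using assms unfolding smooth_at_def by blast
  then have "open (W1 \<inter> W2)" by (blast intro: open_Int smooth_fun_open)
  then show ?thesis using that[of "W1 \<inter> W2"] W
    by (meson IntI inf_le1 inf_le2 smooth_fun_subset)
qed

lemma smooth_at_const: "smooth_at A x (\<lambda>x. c)"
  by (rule smooth_atI[OF smooth_fun_const[of UNIV]]) auto

lemma smooth_at_add: "smooth_at A x f \<Longrightarrow> smooth_at A x g \<Longrightarrow> smooth_at A x (\<lambda>x. f x + g x)"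
  by (rule smooth_at_common, assumption, assumption, rule smooth_atI[OF smooth_fun_add])

lemma smooth_at_scaleR:
  fixes f :: "'m \<Rightarrow> real"
  shows "smooth_at A x f \<Longrightarrow> smooth_at A x g \<Longrightarrow> smooth_at A x (\<lambda>x. f x *\<^sub>R g x)"
  by (rule smooth_at_common, assumption, assumption, rule smooth_atI[OF smooth_fun_scaleR])

lemma smooth_at_bounded_linear:
  "smooth_at A x f \<Longrightarrow> bounded_linear L \<Longrightarrow> smooth_at A x (\<lambda>x. L (f x))"
  unfolding smooth_at_def using smooth_fun_bounded_linear by blast

lemma smooth_at_mult:
  fixes f g :: "'m \<Rightarrow> real"
  shows "smooth_at A x f \<Longrightarrow> smooth_at A x g \<Longrightarrow> smooth_at A x (\<lambda>x. f x * g x)"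
  using smooth_at_scaleR[of x f g] by simp

lemma smooth_at_minus: "smooth_at A x f \<Longrightarrow> smooth_at A x (\<lambda>x. - f x)"
  by (rule smooth_at_bounded_linear[OF _ bounded_linear_minus[OF bounded_linear_ident]])

lemma smooth_at_diff:
  "smooth_at A x f \<Longrightarrow> smooth_at A x g \<Longrightarrow> smooth_at A x (\<lambda>x. f x - g x)"
  using smooth_at_add[of x f "\<lambda>x. - g x"] smooth_at_minus[of x g] by simp

lemma smooth_at_inner: "smooth_at A x f \<Longrightarrow> smooth_at A x (\<lambda>x. f x \<bullet> z)"
  by (rule smooth_at_bounded_linear[OF _ bounded_linear_inner_left])

lemma smooth_at_sum:
  assumes "\<And>i. i \<in> I \<Longrightarrow> smooth_at A x (f i)" shows "smooth_at A x (\<lambda>x. \<Sum>i\<in>I. f i x)"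
  using assms
  by (induction I rule: infinite_finite_induct) (auto intro: smooth_at_const smooth_at_add)

lemma smooth_at_cong:
  assumes "smooth_at A x f" "open W" "x \<in> W" "\<And>y. y \<in> W \<Longrightarrow> f y = g y"
  shows "smooth_at A x g"
proof -
  obtain V where V: "x \<in> V" "smooth_fun A V f" using assms(1) unfolding smooth_at_def by blast
  have "smooth_fun A (V \<inter> W) g"
  proof (rule smooth_fun_cong)
    show "smooth_fun A (V \<inter> W) f"
      by (rule smooth_fun_subset[OF V(2) open_Int[OF smooth_fun_open[OF V(2)] assms(2)]]) blast
  qed (use assms(4) in blast)
  then show ?thesis by (rule smooth_atI) (use V assms(3) in blast)
qed

lemma smooth_at_chart: "(U, \<phi>) \<in> A \<Longrightarrow> x \<in> U \<Longrightarrow> smooth_at A x \<phi>"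
  by (rule smooth_atI[OF smooth_fun_chart])

lemma smooth_at_neighbourhood:
  assumes "smooth_at A x f"
  obtains W where "open W" "x \<in> W" "\<And>y. y \<in> W \<Longrightarrow> smooth_at A y f"
  using assms smooth_fun_open smooth_atI unfolding smooth_at_def by metis

section \<open>Tangent vectors as derivations\<close>

definition pd :: "'m set \<Rightarrow> ('m \<Rightarrow> 'e) \<Rightarrow> 'e \<Rightarrow> ('m \<Rightarrow> real) \<Rightarrow> 'm \<Rightarrow> real" where
  "pd U \<phi> w f x = frechet_derivative (f \<circ> inv_into U \<phi>) (at (\<phi> x)) w"

lemma chart_differentiable:
  assumes "(U, \<phi>) \<in> A" "x \<in> U" "smooth_at A x f"
  shows "(f \<circ> inv_into U \<phi>) differentiable (at (\<phi> x))"
proof -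
  obtain W where W: "x \<in> W" "smooth_fun A W f" using assms(3) unfolding smooth_at_def by blast
  show ?thesis
    by (rule smooth_on_differentiable[OF smooth_fun_on_chart[OF W(2) assms(1)]])
      (use W assms(2) in blast)
qed

lemma pd_cong:
  assumes "(U, \<phi>) \<in> A" "x \<in> U" "open W" "x \<in> W" "\<And>y. y \<in> W \<Longrightarrow> f y = g y"
  shows "pd U \<phi> w f x = pd U \<phi> w g x"
proof -
  have "frechet_derivative (f \<circ> inv_into U \<phi>) (at (\<phi> x))
      = frechet_derivative (g \<circ> inv_into U \<phi>) (at (\<phi> x))"
    by (rule frechet_derivative_cong_open[OF chart_image_open[OF assms(1,3)]])
      (use assms chart_inv[OF assms(1)] in auto)
  then show ?thesis by (simp add: pd_def)
qed

lemma pd_smooth_fun: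
  assumes c: "(U, \<phi>) \<in> A" and f: "smooth_fun A W f"
  shows "smooth_fun A (U \<inter> W) (pd U \<phi> w f)"
proof (rule smooth_fun_chartI)
  have W: "open (U \<inter> W)" using chart_open[OF c] smooth_fun_open[OF f] by blast
  then show "open (U \<inter> W)" .
  fix x assume x: "x \<in> U \<inter> W"
  have "smooth_on (\<phi> ` (U \<inter> (U \<inter> W))) (\<lambda>z. frechet_derivative (f \<circ> inv_into U \<phi>) (at z) w)"
    using smooth_on_derivative[OF smooth_fun_on_chart[OF f c]] by simp
  then have "smooth_on (\<phi> ` (U \<inter> (U \<inter> W))) (pd U \<phi> w f \<circ> inv_into U \<phi>)"
    by (rule smooth_on_cong[OF chart_image_open[OF c W], rotated])
      (use chart_inv[OF c] in \<open>auto simp: pd_def\<close>)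
  then show "\<exists>V \<psi> T. (V, \<psi>) \<in> A \<and> x \<in> V \<and> open T \<and> x \<in> T \<and>
      smooth_on (\<psi> ` (V \<inter> (U \<inter> W \<inter> T))) (pd U \<phi> w f \<circ> inv_into V \<psi>)"
    using c x W by (intro exI[of _ U] exI[of _ \<phi>] exI[of _ UNIV]) auto
qed

lemma pd_smooth_at:
  assumes "(U, \<phi>) \<in> A" "x \<in> U" "smooth_at A x f" shows "smooth_at A x (pd U \<phi> w f)"
  using assms pd_smooth_fun[OF assms(1)] unfolding smooth_at_def by blast

lemma pd_linear:
  assumes "(U, \<phi>) \<in> A" "x \<in> U" "smooth_at A x f"
  shows "linear (\<lambda>w. pd U \<phi> w f x)"
  unfolding pd_def by (rule linear_frechet_derivative[OF chart_differentiable[OF assms]])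

lemma pd_commute:
  assumes c: "(U, \<phi>) \<in> A" and x: "x \<in> U" and f: "smooth_at A x f"
  shows "pd U \<phi> v (pd U \<phi> w f) x = pd U \<phi> w (pd U \<phi> v f) x"
proof -
  obtain W where W: "x \<in> W" "smooth_fun A W f" using f unfolding smooth_at_def by blast
  have oW: "open W" using W(2) by (rule smooth_fun_open)
  have xi: "\<phi> x \<in> \<phi> ` (U \<inter> W)" using x W by blast
  have eq: "pd U \<phi> v (pd U \<phi> w f) x
      = frechet_derivative (\<lambda>z. frechet_derivative (f \<circ> inv_into U \<phi>) (at z) w) (at (\<phi> x)) v" for v w
  proof -
    have "frechet_derivative (pd U \<phi> w f \<circ> inv_into U \<phi>) (at (\<phi> x))
        = frechet_derivative (\<lambda>z. frechet_derivative (f \<circ> inv_into U \<phi>) (at z) w) (at (\<phi> x))"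
      by (rule frechet_derivative_cong_open[OF chart_image_open[OF c oW] xi])
        (use chart_inv[OF c] in \<open>auto simp: pd_def\<close>)
    then show ?thesis unfolding pd_def[of U \<phi> v] by simp
  qed
  show ?thesis unfolding eq
    by (rule symmetric_second_derivative[OF smooth_fun_on_chart[OF W(2) c] chart_image_open[OF c oW] xi])
qed

definition tvec_of :: "'m set \<Rightarrow> ('m \<Rightarrow> 'e) \<Rightarrow> 'm \<Rightarrow> 'e \<Rightarrow> 'm tvec" where
  "tvec_of U \<phi> x w = (\<lambda>f. if smooth_at A x f then pd U \<phi> w f x else 0)"

lemma tvec_of_tangent: "(U, \<phi>) \<in> A \<Longrightarrow> x \<in> U \<Longrightarrow> tvec_of U \<phi> x w \<in> tangent_space A x"
  unfolding tangent_space_def tvec_of_def pd_def smooth_near_iff by blast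

text \<open>Serves twice: with \<open>F\<close> the identity it changes charts, with
  \<open>F\<close> a smooth map it identifies the pushforward of a tangent vector.\<close>

lemma pd_chain:
  fixes F :: "'n::{t2_space, second_countable_topology} \<Rightarrow> 'm"
    and B :: "('n, 'f::real_inner) atlas"
  assumes c: "(U, \<phi>) \<in> A" "F x \<in> U" and f: "smooth_at A (F x) f"
    and B: "manifold B bb" and d: "(V, \<psi>) \<in> B" "x \<in> V"
    and W: "open W" "x \<in> W" "\<And>y. y \<in> W \<Longrightarrow> F y \<in> U" "smooth_at B x (\<lambda>y. \<phi> (F y))"
  shows "manifold.pd V \<psi> w (\<lambda>y. f (F y)) x
    = pd U \<phi> (frechet_derivative ((\<lambda>y. \<phi> (F y)) \<circ> inv_into V \<psi>) (at (\<psi> x)) w) f (F x)"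
proof -
  interpret B: manifold B bb by (rule B)
  let ?g = "(\<lambda>y. \<phi> (F y)) \<circ> inv_into V \<psi>"
  have xi: "?g (\<psi> x) = \<phi> (F x)" using B.chart_inv[OF d] by simp
  have "frechet_derivative ((\<lambda>y. f (F y)) \<circ> inv_into V \<psi>) (at (\<psi> x))
      = frechet_derivative ((f \<circ> inv_into U \<phi>) \<circ> ?g) (at (\<psi> x))"
    by (rule frechet_derivative_cong_open[OF B.chart_image_open[OF d(1) W(1)]])
      (use d W(2,3) B.chart_inv[OF d(1)] chart_inv[OF c(1)] in auto)
  also have "\<dots> = frechet_derivative (f \<circ> inv_into U \<phi>) (at (?g (\<psi> x)))
      \<circ> frechet_derivative ?g (at (\<psi> x))"
  proof (rule frechet_derivative_compose)
    obtain T where T: "x \<in> T" "smooth_fun B T (\<lambda>y. \<phi> (F y))"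
      using W(4) unfolding smooth_at_def by blast
    show "?g differentiable (at (\<psi> x))"
      by (rule smooth_on_differentiable[OF B.smooth_fun_on_chart[OF T(2) d(1)]])
        (use T d in blast)
    show "(f \<circ> inv_into U \<phi>) differentiable (at (?g (\<psi> x)))"
      unfolding xi by (rule chart_differentiable[OF c f])
  qed
  finally show ?thesis unfolding pd_def B.pd_def xi by simp
qed

text \<open>\<open>tangent_space\<close> admits any chart at the point; the derivative of the
  transition map supplies the components in the prescribed one. Afterwards every proof may pick its
  chart.\<close>

lemma tangent_rep:
  assumes v: "v \<in> tangent_space A x" and c: "(U, \<phi>) \<in> A" "x \<in> U"
  obtains w where "v = tvec_of U \<phi> x w"
proof -
  obtain V \<psi> u where d: "(V, \<psi>) \<in> A" "x \<in> V" "v = tvec_of V \<psi> x u"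
    using v unfolding tangent_space_def tvec_of_def pd_def smooth_near_iff by blast
  have "tvec_of V \<psi> x u = tvec_of U \<phi> x (frechet_derivative ((\<lambda>y. \<phi> y) \<circ> inv_into V \<psi>) (at (\<psi> x)) u)"
    unfolding tvec_of_def
    using pd_chain[OF c(1), where F = "\<lambda>y. y" and x = x, OF c(2) _ manifold_axioms d(1,2)
        chart_open[OF c(1)] c(2) _ smooth_at_chart[OF c]] by auto
  then show ?thesis using that d(3) by blast
qed

lemma tangent_undefined: "v \<in> tangent_space A x \<Longrightarrow> \<not> smooth_at A x f \<Longrightarrow> v f = 0"
  unfolding tangent_space_def smooth_near_iff by auto

lemma tangent_eqI:
  assumes "v \<in> tangent_space A x" "w \<in> tangent_space A x" "\<And>f. smooth_at A x f \<Longrightarrow> v f = w f"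
  shows "v = w"
proof
  fix f show "v f = w f"
    using assms tangent_undefined[of v x f] tangent_undefined[of w x f] by (cases "smooth_at A x f") auto
qed

text \<open>Smoothness of a germ is itself local, so the default value 0 is taken for both functions
  or for neither.\<close>

lemma tangent_cong:
  assumes v: "v \<in> tangent_space A x" and W: "open W" "x \<in> W" "\<And>y. y \<in> W \<Longrightarrow> f y = g y"
  shows "v f = v g"
proof -
  obtain U \<phi> where c: "(U, \<phi>) \<in> A" "x \<in> U" using chart_exists .
  obtain w where w: "v = tvec_of U \<phi> x w" using tangent_rep[OF v c] .
  have "smooth_at A x f \<longleftrightarrow> smooth_at A x g"
    using smooth_at_cong[OF _ W(1,2), of f g] smooth_at_cong[OF _ W(1,2), of g f] W(3) by metis
  then show ?thesis unfolding w tvec_of_def using pd_cong[OF c W] by simp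
qed

lemma tangent_const: assumes v: "v \<in> tangent_space A x" shows "v (\<lambda>y. k) = 0"
proof -
  obtain U \<phi> where c: "(U, \<phi>) \<in> A" "x \<in> U" using chart_exists .
  obtain w where w: "v = tvec_of U \<phi> x w" using tangent_rep[OF v c] .
  show ?thesis unfolding w tvec_of_def pd_def by (simp add: o_def)
qed

lemma tangent_add:
  assumes v: "v \<in> tangent_space A x" and f: "smooth_at A x f" and g: "smooth_at A x g"
  shows "v (\<lambda>y. f y + g y) = v f + v g"
proof -
  obtain U \<phi> where c: "(U, \<phi>) \<in> A" "x \<in> U" using chart_exists .
  obtain w where w: "v = tvec_of U \<phi> x w" using tangent_rep[OF v c] .
  let ?F = "f \<circ> inv_into U \<phi>" and ?G = "g \<circ> inv_into U \<phi>"
  have "(?F has_derivative frechet_derivative ?F (at (\<phi> x))) (at (\<phi> x))"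
    "(?G has_derivative frechet_derivative ?G (at (\<phi> x))) (at (\<phi> x))"
    using chart_differentiable[OF c] f g by (simp_all add: frechet_derivative_works[symmetric])
  from frechet_derivative_at[OF has_derivative_add[OF this]]
  have "pd U \<phi> w (\<lambda>y. f y + g y) x = pd U \<phi> w f x + pd U \<phi> w g x"
    unfolding pd_def by (auto simp: o_def dest: fun_cong[where x = w])
  then show ?thesis unfolding w tvec_of_def using f g smooth_at_add[OF f g] by simp
qed

lemma tangent_mult:
  assumes v: "v \<in> tangent_space A x" and f: "smooth_at A x f" and g: "smooth_at A x g"
  shows "v (\<lambda>y. f y * g y) = v f * g x + f x * v g"
proof -
  obtain U \<phi> where c: "(U, \<phi>) \<in> A" "x \<in> U" using chart_exists .
  obtain w where w: "v = tvec_of U \<phi> x w" using tangent_rep[OF v c] .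
  let ?F = "f \<circ> inv_into U \<phi>" and ?G = "g \<circ> inv_into U \<phi>"
  have "(?F has_derivative frechet_derivative ?F (at (\<phi> x))) (at (\<phi> x))"
    "(?G has_derivative frechet_derivative ?G (at (\<phi> x))) (at (\<phi> x))"
    using chart_differentiable[OF c] f g by (simp_all add: frechet_derivative_works[symmetric])
  from frechet_derivative_at[OF has_derivative_mult[OF this]]
  have "pd U \<phi> w (\<lambda>y. f y * g y) x = f x * pd U \<phi> w g x + pd U \<phi> w f x * g x"
    unfolding pd_def using chart_inv[OF c] by (auto simp: o_def dest: fun_cong[where x = w])
  then show ?thesis unfolding w tvec_of_def using f g smooth_at_mult[OF f g] by simp
qed

lemma tangent_cmult:
  assumes v: "v \<in> tangent_space A x" and f: "smooth_at A x f"
  shows "v (\<lambda>y. k * f y) = k * v f"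
  using tangent_mult[OF v smooth_at_const[of x k] f] tangent_const[OF v] by simp

lemma tangent_minus:
  assumes v: "v \<in> tangent_space A x" and f: "smooth_at A x f"
  shows "v (\<lambda>y. - f y) = - v f"
  using tangent_cmult[OF v f, of "-1"] by simp

lemma tangent_diff:
  assumes v: "v \<in> tangent_space A x" and f: "smooth_at A x f" and g: "smooth_at A x g"
  shows "v (\<lambda>y. f y - g y) = v f - v g"
  using tangent_add[OF v f smooth_at_minus[OF g]] tangent_minus[OF v g] by simp

lemma tangent_sum:
  assumes v: "v \<in> tangent_space A x" and f: "\<And>i. i \<in> I \<Longrightarrow> smooth_at A x (f i)"
  shows "v (\<lambda>y. \<Sum>i\<in>I. f i y) = (\<Sum>i\<in>I. v (f i))"
  using f
proof (induction I rule: infinite_finite_induct)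
  case (insert i I)
  have "v (\<lambda>y. f i y + (\<Sum>i\<in>I. f i y)) = v (f i) + v (\<lambda>y. \<Sum>i\<in>I. f i y)"
    by (intro tangent_add[OF v] smooth_at_sum insert.prems) simp_all
  then show ?case using insert by simp
qed (use tangent_const[OF v, of 0] in simp_all)

lemma tangent_zero: "(\<lambda>_. 0) \<in> tangent_space A x"
proof -
  obtain U \<phi> where c: "(U, \<phi>) \<in> A" "x \<in> U" using chart_exists .
  have "tvec_of U \<phi> x 0 = (\<lambda>_. 0)"
    unfolding tvec_of_def using linear_0[OF pd_linear[OF c]] by auto
  then show ?thesis using tvec_of_tangent[OF c, of 0] by simp
qed

lemma tangent_tlin:
  assumes u: "u \<in> tangent_space A x" and v: "v \<in> tangent_space A x"
  shows "tlin a u b v \<in> tangent_space A x"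
proof -
  obtain U \<phi> where c: "(U, \<phi>) \<in> A" "x \<in> U" using chart_exists .
  obtain s t where s: "u = tvec_of U \<phi> x s" and t: "v = tvec_of U \<phi> x t"
    using tangent_rep[OF u c] tangent_rep[OF v c] by metis
  have "tlin a u b v = tvec_of U \<phi> x (a *\<^sub>R s + b *\<^sub>R t)"
    unfolding s t tlin_def tvec_of_def
    using linear_add[OF pd_linear[OF c]] linear_scale[OF pd_linear[OF c]] by auto
  then show ?thesis using tvec_of_tangent[OF c] by simp
qed

lemma tangent_lin_sum:
  assumes "\<And>i. i \<in> I \<Longrightarrow> v i \<in> tangent_space A x"
  shows "(\<lambda>f. \<Sum>i\<in>I. k i * v i f) \<in> tangent_space A x"
  using assms
proof (induction I rule: infinite_finite_induct)
  case (insert i I)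
  have "tlin (k i) (v i) 1 (\<lambda>f. \<Sum>i\<in>I. k i * v i f) \<in> tangent_space A x"
    by (rule tangent_tlin) (use insert in auto)
  then show ?case using insert by (simp add: tlin_def)
qed (simp_all add: tangent_zero)

lemma tvec_of_expand:
  assumes c: "(U, \<phi>) \<in> A" "x \<in> U" and f: "smooth_at A x f"
  shows "tvec_of U \<phi> x w f = (\<Sum>i\<in>bs. (w \<bullet> i) * pd U \<phi> i f x)"
proof -
  have "pd U \<phi> w f x = pd U \<phi> (\<Sum>i\<in>bs. (w \<bullet> i) *\<^sub>R i) f x"
    by (simp only: orthobasis_sum[OF basis])
  also have "\<dots> = (\<Sum>i\<in>bs. (w \<bullet> i) * pd U \<phi> i f x)"
    by (simp add: linear_sum[OF pd_linear[OF c f]] linear_scale[OF pd_linear[OF c f]])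
  finally show ?thesis using f by (simp add: tvec_of_def)
qed

lemma tvec_of_coordinate:
  assumes c: "(U, \<phi>) \<in> A" "x \<in> U"
  shows "tvec_of U \<phi> x w (\<lambda>y. \<phi> y \<bullet> z) = w \<bullet> z"
proof -
  have "frechet_derivative ((\<lambda>y. \<phi> y \<bullet> z) \<circ> inv_into U \<phi>) (at (\<phi> x))
      = frechet_derivative (\<lambda>w. w \<bullet> z) (at (\<phi> x))"
    by (rule frechet_derivative_cong_open[OF chart_image_open[OF c(1) open_UNIV]])
      (use c chart_inv[OF c(1)] in auto)
  also have "\<dots> = (\<lambda>w. w \<bullet> z)"
    by (rule frechet_derivative_at[symmetric])
      (rule bounded_linear_imp_has_derivative[OF bounded_linear_inner_left])
  finally show ?thesis unfolding tvec_of_def pd_def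
    using smooth_at_inner[OF smooth_at_chart[OF c]] by simp
qed

text \<open>The coefficients are values of \<open>v\<close> on the coordinate functions. For a
  vector field they therefore vary smoothly, and the expansion can be differentiated.\<close>

lemma tangent_expand:
  assumes v: "v \<in> tangent_space A x" and c: "(U, \<phi>) \<in> A" "x \<in> U" and f: "smooth_at A x f"
  shows "v f = (\<Sum>i\<in>bs. v (\<lambda>y. \<phi> y \<bullet> i) * pd U \<phi> i f x)"
proof -
  obtain w where w: "v = tvec_of U \<phi> x w" using tangent_rep[OF v c] .
  show ?thesis unfolding w tvec_of_coordinate[OF c] by (rule tvec_of_expand[OF c f])
qed

section \<open>Vector fields and the Lie bracket\<close>

lemma vfield_open: "vfield A U X \<Longrightarrow> open U"
  by (simp add: vfield_def)

lemma vfield_tangent: "vfield A U X \<Longrightarrow> x \<in> U \<Longrightarrow> X x \<in> tangent_space A x"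
  by (simp add: vfield_def)

lemma vfield_smooth_at:
  assumes X: "vfield A U X" and x: "x \<in> U" and f: "smooth_at A x f"
  shows "smooth_at A x (\<lambda>y. X y f)"
proof -
  obtain W where W: "x \<in> W" "smooth_fun A W f" using f unfolding smooth_at_def by blast
  have "open (W \<inter> U)" using vfield_open[OF X] smooth_fun_open[OF W(2)] by blast
  then have "smooth_fun A (W \<inter> U) f" by (rule smooth_fun_subset[OF W(2)]) blast
  then have "smooth_fun A (W \<inter> U) (\<lambda>y. X y f)" using X unfolding vfield_def by blast
  then show ?thesis by (rule smooth_atI) (use W x in blast)
qed

lemma vfieldI:
  assumes "open U" "\<And>x. x \<in> U \<Longrightarrow> X x \<in> tangent_space A x"
    and "\<And>x f. x \<in> U \<Longrightarrow> smooth_at A x f \<Longrightarrow> smooth_at A x (\<lambda>y. X y f)"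
  shows "vfield A U X"
  unfolding vfield_def
proof (intro conjI allI impI)
  fix V and f :: "'m \<Rightarrow> real" assume V: "V \<subseteq> U \<and> smooth_fun A V f"
  show "smooth_fun A V (\<lambda>x. X x f)"
    by (rule smooth_fun_local) (use V assms(3) smooth_atI smooth_fun_open in blast)+
qed (use assms in blast)+

lemma vfield_subset: "vfield A U X \<Longrightarrow> open V \<Longrightarrow> V \<subseteq> U \<Longrightarrow> vfield A V X"
  by (rule vfieldI) (use vfield_tangent vfield_smooth_at in blast)+

lemma vfield_local:
  assumes "open U" "\<And>x. x \<in> U \<Longrightarrow> \<exists>V. x \<in> V \<and> vfield A V X" shows "vfield A U X"
  by (rule vfieldI[OF assms(1)]) (use assms(2) vfield_tangent vfield_smooth_at in blast)+

lemma vfield_cong: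
  assumes X: "vfield A U X" and eq: "\<And>x. x \<in> U \<Longrightarrow> X x = Y x" shows "vfield A U Y"
proof (rule vfieldI[OF vfield_open[OF X]])
  fix x assume x: "x \<in> U"
  show "Y x \<in> tangent_space A x" using vfield_tangent[OF X x] eq[OF x] by simp
  fix f :: "'m \<Rightarrow> real" assume f: "smooth_at A x f"
  show "smooth_at A x (\<lambda>y. Y y f)"
    by (rule smooth_at_cong[OF vfield_smooth_at[OF X x f] vfield_open[OF X] x]) (simp add: eq)
qed

lemma vfield_lin_sum:
  assumes "open U" "\<And>i. i \<in> I \<Longrightarrow> vfield A U (X i)" "\<And>i. i \<in> I \<Longrightarrow> smooth_fun A U (k i)"
  shows "vfield A U (\<lambda>x f. \<Sum>i\<in>I. k i x * X i x f)"
proof (rule vfieldI[OF assms(1)])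
  fix x assume x: "x \<in> U"
  show "(\<lambda>f. \<Sum>i\<in>I. k i x * X i x f) \<in> tangent_space A x"
    by (rule tangent_lin_sum) (use assms(2) x vfield_tangent in blast)
  fix f :: "'m \<Rightarrow> real" assume f: "smooth_at A x f"
  show "smooth_at A x (\<lambda>y. \<Sum>i\<in>I. k i y * X i y f)"
    by (intro smooth_at_sum smooth_at_mult)
      (use assms x f vfield_smooth_at smooth_atI in blast)+
qed

lemma vfield_tlin:
  assumes "vfield A U X" "vfield A U Y" "smooth_fun A U h" "smooth_fun A U k"
  shows "vfield A U (\<lambda>x. tlin (h x) (X x) (k x) (Y x))"
proof (rule vfieldI[OF vfield_open[OF assms(1)]])
  fix x assume x: "x \<in> U"
  show "tlin (h x) (X x) (k x) (Y x) \<in> tangent_space A x"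
    using vfield_tangent[OF assms(1) x] vfield_tangent[OF assms(2) x] by (rule tangent_tlin)
  fix f :: "'m \<Rightarrow> real" assume f: "smooth_at A x f"
  show "smooth_at A x (\<lambda>y. tlin (h y) (X y) (k y) (Y y) f)"
    unfolding tlin_def
    by (intro smooth_at_add smooth_at_mult)
      (use assms x f vfield_smooth_at smooth_atI in blast)+
qed

lemma vfield_tlin_const:
  assumes "vfield A U X" "vfield A U Y"
  shows "vfield A U (\<lambda>x. tlin h (X x) k (Y x))"
  using vfield_tlin[OF assms, of "\<lambda>_. h" "\<lambda>_. k"] smooth_fun_const[OF vfield_open[OF assms(1)]]
  by blast

lemma vfield_zero: "open U \<Longrightarrow> vfield A U (\<lambda>x f. 0)"
  by (rule vfieldI) (auto simp: tangent_zero smooth_at_const)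

lemma lie_bracket_apply:
  "smooth_at A x f \<Longrightarrow> lie_bracket A X Y x f = X x (\<lambda>y. Y y f) - Y x (\<lambda>y. X y f)"
  by (simp add: lie_bracket_def smooth_near_iff)

text \<open>The coordinate expansion of \<open>Y f\<close> holds on a neighbourhood, so
  \<open>X\<close> may be applied to it by the product rule. This isolates the second-order part,
  which is what must cancel in the bracket.\<close>

lemma vfield_iterate_chart:
  assumes X: "vfield A W X" and Y: "vfield A W Y" and x: "x \<in> W"
    and c: "(U, \<phi>) \<in> A" "x \<in> U" and f: "smooth_at A x f"
  shows "X x (\<lambda>y. Y y f) = (\<Sum>i\<in>bs. X x (\<lambda>y. Y y (\<lambda>z. \<phi> z \<bullet> i)) * pd U \<phi> i f x)
    + (\<Sum>i\<in>bs. \<Sum>j\<in>bs. Y x (\<lambda>z. \<phi> z \<bullet> i) * X x (\<lambda>z. \<phi> z \<bullet> j) * pd U \<phi> j (pd U \<phi> i f) x)"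
proof -
  obtain N where N: "open N" "x \<in> N" "\<And>y. y \<in> N \<Longrightarrow> smooth_at A y f"
    using smooth_at_neighbourhood[OF f] by blast
  let ?M = "N \<inter> U \<inter> W"
  have M: "open ?M" "x \<in> ?M" using N c x chart_open[OF c(1)] vfield_open[OF X] by blast+
  have Xx: "X x \<in> tangent_space A x" using vfield_tangent[OF X x] .
  have sY: "smooth_at A x (\<lambda>y. Y y (\<lambda>z. \<phi> z \<bullet> i))" for i
    by (rule vfield_smooth_at[OF Y x smooth_at_inner[OF smooth_at_chart[OF c]]])
  have sp: "smooth_at A x (pd U \<phi> i f)" for i by (rule pd_smooth_at[OF c f])
  have "X x (\<lambda>y. Y y f) = X x (\<lambda>y. \<Sum>i\<in>bs. Y y (\<lambda>z. \<phi> z \<bullet> i) * pd U \<phi> i f y)"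
  proof (rule tangent_cong[OF Xx M])
    fix y assume y: "y \<in> ?M"
    show "Y y f = (\<Sum>i\<in>bs. Y y (\<lambda>z. \<phi> z \<bullet> i) * pd U \<phi> i f y)"
      by (rule tangent_expand) (use y vfield_tangent[OF Y] c N in auto)
  qed
  also have "\<dots> = (\<Sum>i\<in>bs. X x (\<lambda>y. Y y (\<lambda>z. \<phi> z \<bullet> i) * pd U \<phi> i f y))"
    by (rule tangent_sum[OF Xx smooth_at_mult[OF sY sp]])
  also have "\<dots> = (\<Sum>i\<in>bs. X x (\<lambda>y. Y y (\<lambda>z. \<phi> z \<bullet> i)) * pd U \<phi> i f x
      + Y x (\<lambda>z. \<phi> z \<bullet> i) * (\<Sum>j\<in>bs. X x (\<lambda>z. \<phi> z \<bullet> j) * pd U \<phi> j (pd U \<phi> i f) x))"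
    by (simp add: tangent_mult[OF Xx sY sp] tangent_expand[OF Xx c sp])
  finally show ?thesis by (simp add: sum.distrib sum_distrib_left mult.assoc)
qed

text \<open>The second-order terms of \<open>X (Y f) - Y (X f)\<close> cancel by symmetry of second derivatives.\<close>

lemma lie_bracket_tangent:
  assumes X: "vfield A W X" and Y: "vfield A W Y" and x: "x \<in> W"
  shows "lie_bracket A X Y x \<in> tangent_space A x"
proof -
  obtain U \<phi> where c: "(U, \<phi>) \<in> A" "x \<in> U" using chart_exists .
  \<comment> \<open>The components of the bracket: its values on the coordinate functions.\<close>
  let ?k = "\<lambda>i. X x (\<lambda>y. Y y (\<lambda>z. \<phi> z \<bullet> i)) - Y x (\<lambda>y. X y (\<lambda>z. \<phi> z \<bullet> i))"
  have "lie_bracket A X Y x f = (\<Sum>i\<in>bs. ?k i * tvec_of U \<phi> x i f)" for f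
  proof (cases "smooth_at A x f")
    case True
    have "(\<Sum>i\<in>bs. \<Sum>j\<in>bs. Y x (\<lambda>z. \<phi> z \<bullet> i) * X x (\<lambda>z. \<phi> z \<bullet> j) * pd U \<phi> j (pd U \<phi> i f) x)
        = (\<Sum>j\<in>bs. \<Sum>i\<in>bs. Y x (\<lambda>z. \<phi> z \<bullet> i) * X x (\<lambda>z. \<phi> z \<bullet> j) * pd U \<phi> j (pd U \<phi> i f) x)"
      by (rule sum.swap)
    also have "\<dots> = (\<Sum>i\<in>bs. \<Sum>j\<in>bs. X x (\<lambda>z. \<phi> z \<bullet> i) * Y x (\<lambda>z. \<phi> z \<bullet> j) * pd U \<phi> j (pd U \<phi> i f) x)"
      by (intro sum.cong refl) (simp add: pd_commute[OF c True] mult.commute)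
    finally show ?thesis
      unfolding lie_bracket_apply[OF True] vfield_iterate_chart[OF X Y x c True]
        vfield_iterate_chart[OF Y X x c True]
      using True by (simp add: tvec_of_def left_diff_distrib sum_subtractf)
  qed (simp add: lie_bracket_def smooth_near_iff tvec_of_def)
  then have "lie_bracket A X Y x = (\<lambda>f. \<Sum>i\<in>bs. ?k i * tvec_of U \<phi> x i f)" by blast
  moreover have "(\<lambda>f. \<Sum>i\<in>bs. ?k i * tvec_of U \<phi> x i f) \<in> tangent_space A x"
    by (intro tangent_lin_sum tvec_of_tangent c)
  ultimately show ?thesis by simp
qed

lemma lie_bracket_vfield:
  assumes X: "vfield A W X" and Y: "vfield A W Y"
  shows "vfield A W (lie_bracket A X Y)"
proof (rule vfieldI[OF vfield_open[OF X]])
  fix x assume x: "x \<in> W"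
  show "lie_bracket A X Y x \<in> tangent_space A x" by (rule lie_bracket_tangent[OF X Y x])
  fix f :: "'m \<Rightarrow> real" assume f: "smooth_at A x f"
  obtain N where N: "open N" "x \<in> N" "\<And>y. y \<in> N \<Longrightarrow> smooth_at A y f"
    using smooth_at_neighbourhood[OF f] by blast
  have "smooth_at A x (\<lambda>y. X y (\<lambda>z. Y z f) - Y y (\<lambda>z. X z f))"
    by (intro smooth_at_diff vfield_smooth_at[OF X x] vfield_smooth_at[OF Y x] f)
  then show "smooth_at A x (\<lambda>y. lie_bracket A X Y y f)"
    by (rule smooth_at_cong[OF _ N(1,2)]) (simp add: lie_bracket_apply N(3))
qed

lemma lie_bracket_cong:
  assumes X: "X x \<in> tangent_space A x" and Y: "Y x \<in> tangent_space A x"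
    and W: "open W" "x \<in> W" "\<And>y. y \<in> W \<Longrightarrow> X y = X' y" "\<And>y. y \<in> W \<Longrightarrow> Y y = Y' y"
  shows "lie_bracket A X Y x = lie_bracket A X' Y' x"
proof -
  have "X x (\<lambda>y. Y y f) = X x (\<lambda>y. Y' y f)" "Y x (\<lambda>y. X y f) = Y x (\<lambda>y. X' y f)" for f
    using W(3,4) by (auto intro!: tangent_cong[OF X W(1,2)] tangent_cong[OF Y W(1,2)])
  then have e: "X x (\<lambda>y. Y y f) - Y x (\<lambda>y. X y f) = X' x (\<lambda>y. Y' y f) - Y' x (\<lambda>y. X' y f)" for f
    using W(3,4)[OF W(2)] by simp
  show ?thesis unfolding lie_bracket_def e ..
qed

lemma lie_bracket_cong_on:
  assumes X: "vfield A W X" and Y: "vfield A W Y" and x: "x \<in> W"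
    and eq: "\<And>y. y \<in> W \<Longrightarrow> X y = X' y" "\<And>y. y \<in> W \<Longrightarrow> Y y = Y' y"
  shows "lie_bracket A X Y x = lie_bracket A X' Y' x"
  by (rule lie_bracket_cong[of X x Y W X' Y', OF vfield_tangent[OF X x] vfield_tangent[OF Y x]
        vfield_open[OF X] x eq])

lemma lie_bracket_antisym: "lie_bracket A Y X x f = - lie_bracket A X Y x f"
  by (simp add: lie_bracket_def)

text \<open>The bracket is a commutator only on smooth germs, so the formula has to be inserted on a
  neighbourhood before \<open>X\<close> is applied.\<close>

lemma lie_bracket_iterate:
  assumes X: "vfield A W X" and Y: "vfield A W Y" and Z: "vfield A W Z" and x: "x \<in> W"
    and f: "smooth_at A x f"
  shows "X x (\<lambda>y. lie_bracket A Y Z y f)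
    = X x (\<lambda>y. Y y (\<lambda>z. Z z f)) - X x (\<lambda>y. Z y (\<lambda>z. Y z f))"
proof -
  obtain N where N: "open N" "x \<in> N" "\<And>y. y \<in> N \<Longrightarrow> smooth_at A y f"
    using smooth_at_neighbourhood[OF f] by blast
  have "X x (\<lambda>y. lie_bracket A Y Z y f) = X x (\<lambda>y. Y y (\<lambda>z. Z z f) - Z y (\<lambda>z. Y z f))"
    by (rule tangent_cong[OF vfield_tangent[OF X x] N(1,2)]) (simp add: lie_bracket_apply N(3))
  also have "\<dots> = X x (\<lambda>y. Y y (\<lambda>z. Z z f)) - X x (\<lambda>y. Z y (\<lambda>z. Y z f))"
    by (rule tangent_diff[OF vfield_tangent[OF X x]])
      (intro vfield_smooth_at[OF Y x] vfield_smooth_at[OF Z x] f)+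
  finally show ?thesis .
qed

lemma jacobi_identity:
  assumes X: "vfield A W X" and Y: "vfield A W Y" and Z: "vfield A W Z" and x: "x \<in> W"
  shows "lie_bracket A X (lie_bracket A Y Z) x f + lie_bracket A Y (lie_bracket A Z X) x f
    + lie_bracket A Z (lie_bracket A X Y) x f = 0"
proof (cases "smooth_at A x f")
  case True
  have s: "smooth_at A x (\<lambda>y. X y f)" "smooth_at A x (\<lambda>y. Y y f)" "smooth_at A x (\<lambda>y. Z y f)"
    by (intro vfield_smooth_at[OF X x] vfield_smooth_at[OF Y x] vfield_smooth_at[OF Z x] True)+
  show ?thesis
    by (simp add: lie_bracket_apply True s lie_bracket_iterate[OF X Y Z x True]
        lie_bracket_iterate[OF Y Z X x True] lie_bracket_iterate[OF Z X Y x True])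
qed (simp add: lie_bracket_def smooth_near_iff)

text \<open>Additivity and the Leibniz rule in one statement: the same combination
  \<open>tlin (h y) (Y y) 1 (Y' y)\<close> occurs in the axioms for connections and in
  \<open>tensorial\<close>.\<close>

lemma lie_bracket_leibniz:
  assumes X: "vfield A W X" and Y: "vfield A W Y" and Y': "vfield A W Y'"
    and h: "smooth_fun A W h" and x: "x \<in> W"
  shows "lie_bracket A X (\<lambda>y. tlin (h y) (Y y) 1 (Y' y)) x
    = tlin (h x) (lie_bracket A X Y x) 1 (tlin (X x h) (Y x) 1 (lie_bracket A X Y' x))"
proof
  fix f
  show "lie_bracket A X (\<lambda>y. tlin (h y) (Y y) 1 (Y' y)) x f
    = tlin (h x) (lie_bracket A X Y x) 1 (tlin (X x h) (Y x) 1 (lie_bracket A X Y' x)) f"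
  proof (cases "smooth_at A x f")
    case True
    note s = vfield_smooth_at[OF Y x True] vfield_smooth_at[OF Y' x True] smooth_atI[OF h x]
    have Xx: "X x \<in> tangent_space A x" using vfield_tangent[OF X x] .
    have "X x (\<lambda>y. h y * Y y f + Y' y f) = X x h * Y x f + h x * X x (\<lambda>y. Y y f) + X x (\<lambda>y. Y' y f)"
      by (simp add: tangent_add[OF Xx smooth_at_mult[OF s(3,1)] s(2)] tangent_mult[OF Xx s(3,1)])
    then show ?thesis by (simp add: lie_bracket_apply True tlin_def algebra_simps)
  next
    case False
    then show ?thesis using tangent_undefined[OF vfield_tangent[OF Y x] False]
      by (simp add: lie_bracket_def smooth_near_iff tlin_def)
  qed
qed

section \<open>Derivatives of vector-valued functions\<close>

lemma tder_eqI: "(\<And>z. w \<bullet> z = v (\<lambda>y. f y \<bullet> z)) \<Longrightarrow> tder v f = w"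
  unfolding tder_def
  by (rule the_equality, blast) (metis vector_eq_rdot)

text \<open>\<open>tder\<close> is a definite description; a witness is assembled from the
  derivatives of the components in an orthobasis.\<close>

lemma tder_inner:
  fixes f :: "'m \<Rightarrow> 'l::real_inner"
  assumes c: "orthobasis (c :: 'l set)" and v: "v \<in> tangent_space A x" and f: "smooth_at A x f"
  shows "tder v f \<bullet> z = v (\<lambda>y. f y \<bullet> z)"
proof -
  define w where "w = (\<Sum>i\<in>c. v (\<lambda>y. f y \<bullet> i) *\<^sub>R i)"
  have w: "w \<bullet> z = v (\<lambda>y. f y \<bullet> z)" for z
  proof -
    have "f y \<bullet> z = (\<Sum>i\<in>c. (i \<bullet> z) * (f y \<bullet> i))" for y
    proof -
      have "f y \<bullet> z = (\<Sum>i\<in>c. (f y \<bullet> i) *\<^sub>R i) \<bullet> z" by (simp only: orthobasis_sum[OF c])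
      then show ?thesis by (simp add: inner_sum_left mult.commute)
    qed
    then have "v (\<lambda>y. f y \<bullet> z) = v (\<lambda>y. \<Sum>i\<in>c. (i \<bullet> z) * (f y \<bullet> i))" by simp
    also have "\<dots> = (\<Sum>i\<in>c. (i \<bullet> z) * v (\<lambda>y. f y \<bullet> i))"
      by (subst tangent_sum[OF v])
        (auto intro!: smooth_at_mult smooth_at_const smooth_at_inner f sum.cong tangent_cmult[OF v])
    also have "\<dots> = w \<bullet> z" by (simp add: w_def inner_sum_left mult.commute)
    finally show ?thesis by simp
  qed
  then have "tder v f = w" by (rule tder_eqI)
  then show ?thesis using w by simp
qed

lemma tder_cong:
  assumes "v \<in> tangent_space A x" "open W" "x \<in> W" "\<And>y. y \<in> W \<Longrightarrow> f y = g y"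
  shows "tder v f = tder v g"
proof -
  have "v (\<lambda>y. f y \<bullet> z) = v (\<lambda>y. g y \<bullet> z)" for z
    by (rule tangent_cong[OF assms(1-3)]) (simp add: assms(4))
  then show ?thesis unfolding tder_def by simp
qed

lemma tder_const:
  assumes "v \<in> tangent_space A x" shows "tder v (\<lambda>y. k) = 0"
  by (rule tder_eqI) (simp add: tangent_const[OF assms])

lemma tder_diff:
  fixes f g :: "'m \<Rightarrow> 'l::real_inner"
  assumes c: "orthobasis (c :: 'l set)" and v: "v \<in> tangent_space A x"
    and f: "smooth_at A x f" and g: "smooth_at A x g"
  shows "tder v (\<lambda>y. f y - g y) = tder v f - tder v g"
  by (rule tder_eqI) (simp add: inner_diff_left tder_inner[OF c v f] tder_inner[OF c v g]
      tangent_diff[OF v smooth_at_inner[OF f] smooth_at_inner[OF g]])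

lemma tder_minus:
  fixes f :: "'m \<Rightarrow> 'l::real_inner"
  assumes c: "orthobasis (c :: 'l set)" and v: "v \<in> tangent_space A x" and f: "smooth_at A x f"
  shows "tder v (\<lambda>y. - f y) = - tder v f"
  by (rule tder_eqI) (simp add: tder_inner[OF c v f] tangent_minus[OF v smooth_at_inner[OF f]])

lemma tder_sum:
  fixes f :: "'i \<Rightarrow> 'm \<Rightarrow> 'l::real_inner"
  assumes c: "orthobasis (c :: 'l set)" and v: "v \<in> tangent_space A x"
    and f: "\<And>i. i \<in> I \<Longrightarrow> smooth_at A x (f i)"
  shows "tder v (\<lambda>y. \<Sum>i\<in>I. f i y) = (\<Sum>i\<in>I. tder v (f i))"
  by (rule tder_eqI) (simp add: inner_sum_left tder_inner[OF c v f]
      tangent_sum[OF v smooth_at_inner[OF f]])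

lemma tder_real: 
  fixes f :: "'m \<Rightarrow> real"
  assumes v: "v \<in> tangent_space A x" and f: "smooth_at A x f"
  shows "tder v f = v f"
  by (rule tder_eqI) (use tangent_cmult[OF v f] in \<open>simp add: mult.commute\<close>)

section \<open>Product rules for bilinear maps\<close>

lemma bilinear_expand:
  fixes \<beta> :: "'a::real_inner \<Rightarrow> 'b::real_inner \<Rightarrow> 'c::real_vector"
  assumes ca: "orthobasis (ca :: 'a set)" and cb: "orthobasis (cb :: 'b set)" and \<beta>: "bilinear \<beta>"
  shows "\<beta> x y = (\<Sum>i\<in>ca. \<Sum>j\<in>cb. ((x \<bullet> i) * (y \<bullet> j)) *\<^sub>R \<beta> i j)"
proof -
  have l: "linear (\<lambda>x. \<beta> x y)" for y using \<beta> by (simp add: bilinear_def)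
  have r: "linear (\<beta> x)" for x using \<beta> by (simp add: bilinear_def)
  have "\<beta> x y = \<beta> (\<Sum>i\<in>ca. (x \<bullet> i) *\<^sub>R i) (\<Sum>j\<in>cb. (y \<bullet> j) *\<^sub>R j)"
    by (simp only: orthobasis_sum[OF ca] orthobasis_sum[OF cb])
  also have "\<dots> = (\<Sum>i\<in>ca. (x \<bullet> i) *\<^sub>R (\<Sum>j\<in>cb. (y \<bullet> j) *\<^sub>R \<beta> i j))"
    by (subst linear_sum[OF l]) (simp add: linear_scale[OF l] linear_sum[OF r] linear_scale[OF r]
        scaleR_sum_right mult.commute)
  finally show ?thesis by (simp add: scaleR_sum_right)
qed

lemma smooth_at_bilinear:
  fixes \<beta> :: "'a::real_inner \<Rightarrow> 'b::real_inner \<Rightarrow> 'c::real_normed_vector"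
  assumes ca: "orthobasis (ca :: 'a set)" and cb: "orthobasis (cb :: 'b set)" and \<beta>: "bilinear \<beta>"
    and f: "smooth_at A x f" and g: "smooth_at A x g"
  shows "smooth_at A x (\<lambda>y. \<beta> (f y) (g y))"
proof -
  have eq: "(\<lambda>y. \<beta> (f y) (g y))
      = (\<lambda>y. \<Sum>i\<in>ca. \<Sum>j\<in>cb. ((f y \<bullet> i) * (g y \<bullet> j)) *\<^sub>R \<beta> i j)"
    by (rule ext) (rule bilinear_expand[OF assms(1-3)])
  show ?thesis unfolding eq
    by (intro smooth_at_sum smooth_at_scaleR smooth_at_mult smooth_at_inner smooth_at_const f g)
qed

text \<open>Expansion in bases reduces the claim to products of real functions. It is applied to the
  invariant form \<open>B\<close> and to scalar multiplication.\<close>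

lemma tder_bilinear:
  fixes \<beta> :: "'a::real_inner \<Rightarrow> 'b::real_inner \<Rightarrow> 'c::real_inner"
  assumes ca: "orthobasis (ca :: 'a set)" and cb: "orthobasis (cb :: 'b set)" and \<beta>: "bilinear \<beta>"
    and v: "v \<in> tangent_space A x" and f: "smooth_at A x f" and g: "smooth_at A x g"
  shows "tder v (\<lambda>y. \<beta> (f y) (g y)) = \<beta> (tder v f) (g x) + \<beta> (f x) (tder v g)"
proof (rule tder_eqI)
  fix z
  define b where "b i j = \<beta> i j \<bullet> z" for i j
  have s: "smooth_at A x (\<lambda>y. f y \<bullet> i)" "smooth_at A x (\<lambda>y. g y \<bullet> i')" for i i'
    by (intro smooth_at_inner f g)+
  have ex: "\<beta> p q \<bullet> z = (\<Sum>i\<in>ca. \<Sum>j\<in>cb. b i j * ((p \<bullet> i) * (q \<bullet> j)))" for p q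
    unfolding b_def bilinear_expand[OF ca cb \<beta>, of p q] inner_sum_left inner_scaleR_left
    by (simp only: mult.commute)
  have "v (\<lambda>y. \<beta> (f y) (g y) \<bullet> z)
      = (\<Sum>i\<in>ca. \<Sum>j\<in>cb. b i j * (v (\<lambda>y. f y \<bullet> i) * (g x \<bullet> j) + (f x \<bullet> i) * v (\<lambda>y. g y \<bullet> j)))"
    unfolding ex
    by (simp add: tangent_sum[OF v] tangent_cmult[OF v] tangent_mult[OF v] s
        smooth_at_sum smooth_at_mult smooth_at_const)
  also have "\<dots> = (\<beta> (tder v f) (g x) + \<beta> (f x) (tder v g)) \<bullet> z"
    unfolding inner_add_left ex tder_inner[OF ca v f] tder_inner[OF cb v g]
    by (simp add: sum.distrib distrib_left)
  finally show "(\<beta> (tder v f) (g x) + \<beta> (f x) (tder v g)) \<bullet> z = v (\<lambda>y. \<beta> (f y) (g y) \<bullet> z)"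
    by simp
qed

end

section \<open>Smooth maps and products\<close>

lemma smooth_map_open: "smooth_map A B W F \<Longrightarrow> open W"
  by (simp add: smooth_map_def)

lemma smooth_map_continuous: "smooth_map A B W F \<Longrightarrow> continuous_on W F"
  by (simp add: smooth_map_def)

lemma smooth_map_preimage_open: "smooth_map A B W F \<Longrightarrow> open V \<Longrightarrow> open (W \<inter> F -` V)"
  by (rule continuous_open_preimage[OF smooth_map_continuous smooth_map_open])

lemma smooth_fun_compose:
  assumes A: "manifold A ba" and B: "manifold B bb"
    and F: "smooth_map A B W F" and f: "smooth_fun B W' f"
  shows "smooth_fun A (W \<inter> F -` W') (\<lambda>x. f (F x))"
proof -
  interpret A: manifold A ba by (rule A)
  interpret B: manifold B bb by (rule B)
  show ?thesis
  proof (rule A.smooth_fun_chartI)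
    show "open (W \<inter> F -` W')" by (rule smooth_map_preimage_open[OF F smooth_fun_open[OF f]])
    fix x assume x: "x \<in> W \<inter> F -` W'"
    obtain U \<phi> where c: "(U, \<phi>) \<in> A" "x \<in> U" using A.chart_exists .
    obtain V \<psi> where d: "(V, \<psi>) \<in> B" "F x \<in> V" using B.chart_exists .
    let ?T = "W \<inter> F -` V" and ?N = "\<phi> ` (U \<inter> (W \<inter> F -` W' \<inter> (W \<inter> F -` V)))"
    have oT: "open ?T" by (rule smooth_map_preimage_open[OF F B.chart_open[OF d(1)]])
    have oN: "open ?N"
      by (intro A.chart_image_open[OF c(1)] open_Int[OF _ oT]
          smooth_map_preimage_open[OF F smooth_fun_open[OF f]])
    have "smooth_on ?N (\<lambda>z. (f \<circ> inv_into V \<psi>) ((\<psi> \<circ> F \<circ> inv_into U \<phi>) z))"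
    proof (rule smooth_on_compose[OF B.smooth_fun_on_chart[OF f d(1)] _ oN _ _ B.basis])
      have "smooth_on (\<phi> ` (U \<inter> W \<inter> F -` V)) (\<psi> \<circ> F \<circ> inv_into U \<phi>)"
        using F c(1) d(1) unfolding smooth_map_def by blast
      then show "smooth_on ?N (\<psi> \<circ> F \<circ> inv_into U \<phi>)" by (rule smooth_on_subset) blast
      show "open (\<psi> ` (V \<inter> W'))" by (rule B.chart_image_open[OF d(1) smooth_fun_open[OF f]])
      show "(\<psi> \<circ> F \<circ> inv_into U \<phi>) ` ?N \<subseteq> \<psi> ` (V \<inter> W')"
        using A.chart_inv[OF c(1)] by auto
    qed
    then have "smooth_on ?N ((\<lambda>x. f (F x)) \<circ> inv_into U \<phi>)"
      by (rule smooth_on_cong[OF oN, rotated])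
        (use A.chart_inv[OF c(1)] B.chart_inv[OF d(1)] in auto)
    moreover have "x \<in> ?T" using x d(2) by blast
    ultimately show "\<exists>U \<phi> T. (U, \<phi>) \<in> A \<and> x \<in> U \<and> open T \<and> x \<in> T \<and>
        smooth_on (\<phi> ` (U \<inter> (W \<inter> F -` W' \<inter> T))) ((\<lambda>x. f (F x)) \<circ> inv_into U \<phi>)"
      using c oT by blast
  qed
qed

lemma smooth_at_compose:
  assumes "manifold A ba" "manifold B bb" "smooth_map A B W F" "x \<in> W" "smooth_at B (F x) f"
  shows "smooth_at A x (\<lambda>y. f (F y))"
proof -
  obtain W' where W': "F x \<in> W'" "smooth_fun B W' f" using assms(5) unfolding smooth_at_def by blast
  show ?thesis
    by (rule smooth_atI[OF smooth_fun_compose[OF assms(1-3) W'(2)]]) (use W' assms(4) in blast)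
qed

lemma smooth_mapI:
  assumes A: "manifold A ba" and "open W" "continuous_on W F"
    and "\<And>V \<psi>. (V, \<psi>) \<in> B \<Longrightarrow> smooth_fun A (W \<inter> F -` V) (\<lambda>x. \<psi> (F x))"
  shows "smooth_map A B W F"
  unfolding smooth_map_def
proof (intro conjI assms(2,3) ballI, clarify)
  interpret A: manifold A ba by (rule A)
  fix U \<phi> V \<psi> assume c: "(U, \<phi>) \<in> A" and d: "(V, \<psi>) \<in> B"
  show "smooth_on (\<phi> ` (U \<inter> W \<inter> F -` V)) (\<psi> \<circ> F \<circ> inv_into U \<phi>)"
    using A.smooth_fun_on_chart[OF assms(4)[OF d] c] by (simp add: o_def Int_assoc)
qed

lemma smooth_map_compose:
  assumes A: "manifold A ba" and B: "manifold B bb" and C: "manifold C bc"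
    and F: "smooth_map A B W F" and G: "smooth_map B C W' G"
  shows "smooth_map A C (W \<inter> F -` W') (\<lambda>x. G (F x))"
proof (rule smooth_mapI[OF A])
  interpret C: manifold C bc by (rule C)
  show "open (W \<inter> F -` W')" by (rule smooth_map_preimage_open[OF F smooth_map_open[OF G]])
  show "continuous_on (W \<inter> F -` W') (\<lambda>x. G (F x))"
    by (rule continuous_on_compose2[OF smooth_map_continuous[OF G]
          continuous_on_subset[OF smooth_map_continuous[OF F]]]) auto
  fix V \<psi> assume d: "(V, \<psi>) \<in> C"
  have "smooth_fun A (W \<inter> F -` (W' \<inter> G -` V)) (\<lambda>x. \<psi> (G (F x)))"
    by (rule smooth_fun_compose[OF A B F smooth_fun_compose[OF B C G C.smooth_fun_chart[OF d]]])
  moreover have "W \<inter> F -` (W' \<inter> G -` V) = W \<inter> F -` W' \<inter> (\<lambda>x. G (F x)) -` V" by blast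
  ultimately show "smooth_fun A (W \<inter> F -` W' \<inter> (\<lambda>x. G (F x)) -` V) (\<lambda>x. \<psi> (G (F x)))" by simp
qed

lemma smooth_map_compose':
  assumes "manifold A ba" "manifold B bb" "manifold C bc"
    and F: "smooth_map A B W F" and "smooth_map B C W' G" and "F ` W \<subseteq> W'"
  shows "smooth_map A C W (\<lambda>x. G (F x))"
proof -
  have "W \<inter> F -` W' = W" using assms(6) by blast
  then show ?thesis using smooth_map_compose[OF assms(1-5)] by simp
qed

context manifold
begin

lemma smooth_map_subset:
  assumes F: "smooth_map A B W F" and W': "open W'" "W' \<subseteq> W" shows "smooth_map A B W' F"
proof -
  have "smooth_on (\<phi> ` (U \<inter> W' \<inter> F -` V)) (\<psi> \<circ> F \<circ> inv_into U \<phi>)"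
    if "(U, \<phi>) \<in> A" "(V, \<psi>) \<in> B" for U \<phi> V \<psi>
  proof (rule smooth_on_subset)
    show "smooth_on (\<phi> ` (U \<inter> W \<inter> F -` V)) (\<psi> \<circ> F \<circ> inv_into U \<phi>)"
      using F that unfolding smooth_map_def by blast
  qed (use W'(2) in blast)
  moreover have "continuous_on W' F" by (rule continuous_on_subset[OF smooth_map_continuous[OF F] W'(2)])
  ultimately show ?thesis using W'(1) unfolding smooth_map_def by blast
qed

lemma smooth_map_ident: "open W \<Longrightarrow> smooth_map A A W (\<lambda>x. x)"
  by (rule smooth_mapI[OF manifold_axioms])
    (auto intro: continuous_on_id smooth_fun_subset[OF smooth_fun_chart] chart_open)

end

lemma smooth_map_const:
  assumes A: "manifold A ba" and B: "manifold B bb" and "open W"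
  shows "smooth_map A B W (\<lambda>x. y)"
proof (rule smooth_mapI[OF A assms(3) continuous_on_const])
  interpret A: manifold A ba by (rule A)
  fix V \<psi> assume "(V, \<psi>) \<in> B"
  have "(\<lambda>x. y) -` V = (if y \<in> V then UNIV else {})" by auto
  then show "smooth_fun A (W \<inter> (\<lambda>x. y) -` V) (\<lambda>x. \<psi> y)"
    using assms(3) by (auto intro!: A.smooth_fun_const)
qed

lemma push_apply: "smooth_at B y f \<Longrightarrow> push B y F v f = v (\<lambda>x. f (F x))"
  by (simp add: push_def smooth_near_iff o_def)

text \<open>By the chain rule the image is the coordinate vector whose components come from the
  derivative of \<open>F\<close> read in charts.\<close>

lemma push_tangent:
  assumes A: "manifold A ba" and B: "manifold B bb"
    and F: "smooth_map A B W F" and x: "x \<in> W" and v: "v \<in> tangent_space A x"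
  shows "push B (F x) F v \<in> tangent_space B (F x)"
proof -
  interpret A: manifold A ba by (rule A)
  interpret B: manifold B bb by (rule B)
  obtain U \<phi> where c: "(U, \<phi>) \<in> A" "x \<in> U" using A.chart_exists .
  obtain V \<psi> where d: "(V, \<psi>) \<in> B" "F x \<in> V" using B.chart_exists .
  obtain w where w: "v = A.tvec_of U \<phi> x w" using A.tangent_rep[OF v c] .
  let ?w = "frechet_derivative ((\<lambda>y. \<psi> (F y)) \<circ> inv_into U \<phi>) (at (\<phi> x)) w"
  let ?T = "W \<inter> F -` V"
  have T: "open ?T" "x \<in> ?T"
    using smooth_map_preimage_open[OF F B.chart_open[OF d(1)]] x d by auto
  have "push B (F x) F v f = B.tvec_of V \<psi> (F x) ?w f" for f
  proof (cases "smooth_at B (F x) f")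
    case True
    have "smooth_at A x (\<lambda>y. \<psi> (F y))"
      by (rule smooth_at_compose[OF A B F x B.smooth_at_chart[OF d]])
    from B.pd_chain[OF d True A c T _ this, of w]
    show ?thesis using True smooth_at_compose[OF A B F x True]
      by (simp add: push_apply w A.tvec_of_def B.tvec_of_def)
  qed (simp add: push_def smooth_near_iff B.tvec_of_def)
  then have "push B (F x) F v = B.tvec_of V \<psi> (F x) ?w" by blast
  then show ?thesis using B.tvec_of_tangent[OF d] by simp
qed

section \<open>Products of manifolds and partial derivatives\<close>

locale manifold_pair = A: manifold A ba + B: manifold B bb
  for A :: "('m::{t2_space, second_countable_topology}, 'e::real_inner) atlas" and ba
    and B :: "('k::{t2_space, second_countable_topology}, 'f::real_inner) atlas" and bb
begin

definition pb :: "('e \<times> 'f) set" where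
  "pb = (\<lambda>i. (i, 0)) ` ba \<union> (\<lambda>j. (0, j)) ` bb"

lemma prod_chart_inv:
  assumes c: "(U, \<phi>) \<in> A" and d: "(V, \<psi>) \<in> B" and z: "z \<in> \<phi> ` U \<times> \<psi> ` V"
  shows "inv_into (U \<times> V) (map_prod \<phi> \<psi>) z = (inv_into U \<phi> (fst z), inv_into V \<psi> (snd z))"
proof -
  obtain x y where xy: "x \<in> U" "y \<in> V" "z = (\<phi> x, \<psi> y)" using z by blast
  have "inj_on \<phi> U" "inj_on \<psi> V"
    using A.chart_inv[OF c] B.chart_inv[OF d] by (auto intro: inj_on_inverseI)
  then have "inj_on (map_prod \<phi> \<psi>) (U \<times> V)" by (rule map_prod_inj_on)
  from inv_into_f_f[OF this, of "(x, y)"] show ?thesis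
    using xy A.chart_inv[OF c] B.chart_inv[OF d] by simp
qed

lemma smooth_on_fst:
  assumes "smooth_on S h" "open S" "open T" shows "smooth_on (S \<times> T) (\<lambda>z::'e \<times> 'f. h (fst z))"
  by (rule smooth_on_compose[OF assms(1) smooth_on_linear[OF bounded_linear_fst] _ assms(2) _ A.basis])
    (use assms in \<open>auto intro: open_Times\<close>)

lemma smooth_on_snd:
  assumes "smooth_on T h" "open S" "open T" shows "smooth_on (S \<times> T) (\<lambda>z::'e \<times> 'f. h (snd z))"
  by (rule smooth_on_compose[OF assms(1) smooth_on_linear[OF bounded_linear_snd] _ assms(3) _ B.basis])
    (use assms in \<open>auto intro: open_Times\<close>)

lemma prod_image: "map_prod \<phi> \<psi> ` (U \<times> V \<inter> U' \<times> V') = \<phi> ` (U \<inter> U') \<times> \<psi> ` (V \<inter> V')"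
  by auto

lemma prod_smooth_atlas: "smooth_atlas (prod_atlas A B)"
proof -
  have 1: "open (U \<times> V) \<and> open (map_prod \<phi> \<psi> ` (U \<times> V)) \<and>
      homeomorphism (U \<times> V) (map_prod \<phi> \<psi> ` (U \<times> V)) (map_prod \<phi> \<psi>) (inv_into (U \<times> V) (map_prod \<phi> \<psi>))"
    if c: "(U, \<phi>) \<in> A" and d: "(V, \<psi>) \<in> B" for U \<phi> V \<psi>
  proof (intro conjI)
    have im: "map_prod \<phi> \<psi> ` (U \<times> V) = \<phi> ` U \<times> \<psi> ` V" by auto
    show "open (U \<times> V)" by (intro open_Times A.chart_open[OF c] B.chart_open[OF d])
    show "open (map_prod \<phi> \<psi> ` (U \<times> V))"
      unfolding im using A.chart_image_open[OF c open_UNIV] B.chart_image_open[OF d open_UNIV]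
      by (simp add: open_Times)
    note ha = A.chart_homeo[OF c] and hb = B.chart_homeo[OF d]
    show "homeomorphism (U \<times> V) (map_prod \<phi> \<psi> ` (U \<times> V)) (map_prod \<phi> \<psi>)
        (inv_into (U \<times> V) (map_prod \<phi> \<psi>))"
    proof (rule homeomorphismI)
      have "continuous_on (U \<times> V) (\<lambda>p. (\<phi> (fst p), \<psi> (snd p)))"
        by (intro continuous_on_Pair continuous_on_compose2[OF homeomorphism_cont1[OF ha]]
            continuous_on_compose2[OF homeomorphism_cont1[OF hb]] continuous_on_fst
            continuous_on_snd continuous_on_id) auto
      then show "continuous_on (U \<times> V) (map_prod \<phi> \<psi>)"
        by (simp add: map_prod_def case_prod_beta)
      have "continuous_on (\<phi> ` U \<times> \<psi> ` V) (\<lambda>p. (inv_into U \<phi> (fst p), inv_into V \<psi> (snd p)))"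
        by (intro continuous_on_Pair continuous_on_compose2[OF homeomorphism_cont2[OF ha]]
            continuous_on_compose2[OF homeomorphism_cont2[OF hb]] continuous_on_fst
            continuous_on_snd continuous_on_id) auto
      then show "continuous_on (map_prod \<phi> \<psi> ` (U \<times> V)) (inv_into (U \<times> V) (map_prod \<phi> \<psi>))"
        unfolding im
        by (rule continuous_on_cong[THEN iffD1, OF refl, rotated])
          (rule prod_chart_inv[OF c d, symmetric])
      show "inv_into (U \<times> V) (map_prod \<phi> \<psi>) (map_prod \<phi> \<psi> p) = p" if "p \<in> U \<times> V" for p
        using that prod_chart_inv[OF c d, of "map_prod \<phi> \<psi> p"] A.chart_inv[OF c] B.chart_inv[OF d]
        by auto
      then show "inv_into (U \<times> V) (map_prod \<phi> \<psi>) ` map_prod \<phi> \<psi> ` (U \<times> V) \<subseteq> U \<times> V"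
        by force
      show "map_prod \<phi> \<psi> (inv_into (U \<times> V) (map_prod \<phi> \<psi>) z) = z"
        if "z \<in> map_prod \<phi> \<psi> ` (U \<times> V)" for z
        using that by (rule f_inv_into_f)
    qed simp
  qed
  have 2: "smooth_on (map_prod \<phi> \<psi> ` (U \<times> V \<inter> U' \<times> V'))
      (map_prod \<phi>' \<psi>' \<circ> inv_into (U \<times> V) (map_prod \<phi> \<psi>))"
    if c: "(U, \<phi>) \<in> A" and d: "(V, \<psi>) \<in> B" and c': "(U', \<phi>') \<in> A" and d': "(V', \<psi>') \<in> B"
    for U \<phi> V \<psi> U' \<phi>' V' \<psi>'
  proof -
    note o = A.chart_image_open[OF c A.chart_open[OF c']] B.chart_image_open[OF d B.chart_open[OF d']]
    have "smooth_on (\<phi> ` (U \<inter> U') \<times> \<psi> ` (V \<inter> V'))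
        (\<lambda>z. ((\<phi>' \<circ> inv_into U \<phi>) (fst z), (\<psi>' \<circ> inv_into V \<psi>) (snd z)))"
      by (intro smooth_on_Pair smooth_on_fst smooth_on_snd A.chart_transition B.chart_transition
          c d c' d' o open_Times)
    then show ?thesis unfolding prod_image
      by (rule smooth_on_cong[OF open_Times[OF o], rotated])
        (use prod_chart_inv[OF c d] in \<open>auto simp: A.chart_inv[OF c] B.chart_inv[OF d]\<close>)
  qed
  have 3: "\<exists>W \<rho>. (W, \<rho>) \<in> prod_atlas A B \<and> p \<in> W" for p
  proof -
    obtain U \<phi> where "(U, \<phi>) \<in> A" "fst p \<in> U" using A.chart_exists .
    moreover obtain V \<psi> where "(V, \<psi>) \<in> B" "snd p \<in> V" using B.chart_exists .
    ultimately show ?thesis unfolding prod_atlas_def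
      by (intro exI[of _ "U \<times> V"] exI[of _ "map_prod \<phi> \<psi>"]) (auto simp: mem_Times_iff)
  qed
  show ?thesis unfolding smooth_atlas_def
  proof (intro conjI)
    show "\<forall>(W, \<rho>)\<in>prod_atlas A B. open W \<and> open (\<rho> ` W) \<and> homeomorphism W (\<rho> ` W) \<rho> (inv_into W \<rho>)"
      unfolding prod_atlas_def using 1 by blast
    show "(\<Union>(W, \<rho>)\<in>prod_atlas A B. W) = UNIV" using 3 by fast
    show "\<forall>(W, \<rho>)\<in>prod_atlas A B. \<forall>(W', \<rho>')\<in>prod_atlas A B.
        smooth_on (\<rho> ` (W \<inter> W')) (\<rho>' \<circ> inv_into W \<rho>)"
      unfolding prod_atlas_def using 2 by blast
  qed
qed

sublocale P: manifold "prod_atlas A B" pb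
  by unfold_locales (use prod_smooth_atlas orthobasis_prod[OF A.basis B.basis] in \<open>simp_all add: pb_def\<close>)

lemma prod_chart: "(U, \<phi>) \<in> A \<Longrightarrow> (V, \<psi>) \<in> B \<Longrightarrow> (U \<times> V, map_prod \<phi> \<psi>) \<in> prod_atlas A B"
  unfolding prod_atlas_def by blast

lemma smooth_fun_fst:
  assumes f: "smooth_fun A W f" shows "smooth_fun (prod_atlas A B) (fst -` W) (\<lambda>p. f (fst p))"
proof (rule P.smooth_fun_chartI)
  have W: "open W" using f by (rule smooth_fun_open)
  show oW: "open (fst -` W)" by (rule open_vimage_fst[OF W])
  fix p :: "'m \<times> 'k" assume p: "p \<in> fst -` W"
  obtain U \<phi> where c: "(U, \<phi>) \<in> A" "fst p \<in> U" using A.chart_exists .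
  obtain V \<psi> where d: "(V, \<psi>) \<in> B" "snd p \<in> V" using B.chart_exists .
  have eq: "map_prod \<phi> \<psi> ` (U \<times> V \<inter> fst -` W) = \<phi> ` (U \<inter> W) \<times> \<psi> ` V" by auto
  have o: "open (\<phi> ` (U \<inter> W))" "open (\<psi> ` V)"
    using A.chart_image_open[OF c(1) W] B.chart_image_open[OF d(1) open_UNIV] by simp_all
  have "smooth_on (\<phi> ` (U \<inter> W) \<times> \<psi> ` V) (\<lambda>z. (f \<circ> inv_into U \<phi>) (fst z))"
    by (rule smooth_on_fst[OF A.smooth_fun_on_chart[OF f c(1)] o])
  then have "smooth_on (\<phi> ` (U \<inter> W) \<times> \<psi> ` V)
      ((\<lambda>p. f (fst p)) \<circ> inv_into (U \<times> V) (map_prod \<phi> \<psi>))"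
    by (rule smooth_on_cong[OF open_Times[OF o], rotated])
      (use prod_chart_inv[OF c(1) d(1)] in auto)
  then have "smooth_on (map_prod \<phi> \<psi> ` (U \<times> V \<inter> (fst -` W \<inter> UNIV)))
      ((\<lambda>p. f (fst p)) \<circ> inv_into (U \<times> V) (map_prod \<phi> \<psi>))" by (simp add: eq)
  moreover have "p \<in> U \<times> V" using c d by (simp add: mem_Times_iff)
  ultimately show "\<exists>V \<psi> T. (V, \<psi>) \<in> prod_atlas A B \<and> p \<in> V \<and> open T \<and> p \<in> T \<and>
      smooth_on (\<psi> ` (V \<inter> (fst -` W \<inter> T))) ((\<lambda>p. f (fst p)) \<circ> inv_into V \<psi>)"
    using prod_chart[OF c(1) d(1)] by (meson UNIV_I open_UNIV)
qed

lemma smooth_fun_snd: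
  assumes f: "smooth_fun B W f" shows "smooth_fun (prod_atlas A B) (snd -` W) (\<lambda>p. f (snd p))"
proof (rule P.smooth_fun_chartI)
  have W: "open W" using f by (rule smooth_fun_open)
  show oW: "open (snd -` W)" by (rule open_vimage_snd[OF W])
  fix p :: "'m \<times> 'k" assume p: "p \<in> snd -` W"
  obtain U \<phi> where c: "(U, \<phi>) \<in> A" "fst p \<in> U" using A.chart_exists .
  obtain V \<psi> where d: "(V, \<psi>) \<in> B" "snd p \<in> V" using B.chart_exists .
  have eq: "map_prod \<phi> \<psi> ` (U \<times> V \<inter> snd -` W) = \<phi> ` U \<times> \<psi> ` (V \<inter> W)" by auto
  have o: "open (\<phi> ` U)" "open (\<psi> ` (V \<inter> W))"
    using A.chart_image_open[OF c(1) open_UNIV] B.chart_image_open[OF d(1) W] by simp_all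
  have "smooth_on (\<phi> ` U \<times> \<psi> ` (V \<inter> W)) (\<lambda>z. (f \<circ> inv_into V \<psi>) (snd z))"
    by (rule smooth_on_snd[OF B.smooth_fun_on_chart[OF f d(1)] o])
  then have "smooth_on (\<phi> ` U \<times> \<psi> ` (V \<inter> W))
      ((\<lambda>p. f (snd p)) \<circ> inv_into (U \<times> V) (map_prod \<phi> \<psi>))"
    by (rule smooth_on_cong[OF open_Times[OF o], rotated])
      (use prod_chart_inv[OF c(1) d(1)] in auto)
  then have "smooth_on (map_prod \<phi> \<psi> ` (U \<times> V \<inter> (snd -` W \<inter> UNIV)))
      ((\<lambda>p. f (snd p)) \<circ> inv_into (U \<times> V) (map_prod \<phi> \<psi>))" by (simp add: eq)
  moreover have "p \<in> U \<times> V" using c d by (simp add: mem_Times_iff)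
  ultimately show "\<exists>V \<psi> T. (V, \<psi>) \<in> prod_atlas A B \<and> p \<in> V \<and> open T \<and> p \<in> T \<and>
      smooth_on (\<psi> ` (V \<inter> (snd -` W \<inter> T))) ((\<lambda>p. f (snd p)) \<circ> inv_into V \<psi>)"
    using prod_chart[OF c(1) d(1)] by (meson UNIV_I open_UNIV)
qed

lemma smooth_at_fst: "smooth_at A x f \<Longrightarrow> smooth_at (prod_atlas A B) (x, y) (\<lambda>p. f (fst p))"
  unfolding smooth_at_def[of A] by (auto intro!: smooth_atI[OF smooth_fun_fst])

lemma smooth_at_snd: "smooth_at B y f \<Longrightarrow> smooth_at (prod_atlas A B) (x, y) (\<lambda>p. f (snd p))"
  unfolding smooth_at_def[of B] by (auto intro!: smooth_atI[OF smooth_fun_snd])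

lemma smooth_map_Pair:
  assumes C: "manifold C bc" and F: "smooth_map C A W F" and G: "smooth_map C B W G"
  shows "smooth_map C (prod_atlas A B) W (\<lambda>x. (F x, G x))"
proof (rule smooth_mapI[OF C smooth_map_open[OF F]])
  interpret C: manifold C bc by (rule C)
  show "continuous_on W (\<lambda>x. (F x, G x))"
    by (intro continuous_on_Pair smooth_map_continuous[OF F] smooth_map_continuous[OF G])
  fix V \<psi> assume "(V, \<psi>) \<in> prod_atlas A B"
  then obtain V1 \<psi>1 V2 \<psi>2 where c: "(V1, \<psi>1) \<in> A" "(V2, \<psi>2) \<in> B" "V = V1 \<times> V2" "\<psi> = map_prod \<psi>1 \<psi>2"
    unfolding prod_atlas_def by blast
  have 1: "smooth_fun C (W \<inter> F -` V1) (\<lambda>x. \<psi>1 (F x))"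
    by (rule smooth_fun_compose[OF C A.manifold_axioms F A.smooth_fun_chart[OF c(1)]])
  have 2: "smooth_fun C (W \<inter> G -` V2) (\<lambda>x. \<psi>2 (G x))"
    by (rule smooth_fun_compose[OF C B.manifold_axioms G B.smooth_fun_chart[OF c(2)]])
  let ?N = "(W \<inter> F -` V1) \<inter> (W \<inter> G -` V2)"
  have N: "open ?N" using smooth_fun_open[OF 1] smooth_fun_open[OF 2] by blast
  have "smooth_fun C ?N (\<lambda>x. (\<psi>1 (F x), \<psi>2 (G x)))"
    by (rule C.smooth_fun_Pair) (rule C.smooth_fun_subset[OF 1 N] C.smooth_fun_subset[OF 2 N]; blast)+
  moreover have "?N = W \<inter> (\<lambda>x. (F x, G x)) -` V" using c(3) by blast
  ultimately show "smooth_fun C (W \<inter> (\<lambda>x. (F x, G x)) -` V) (\<lambda>x. \<psi> (F x, G x))"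
    using c(4) by simp
qed

lemma smooth_map_fst: "smooth_map (prod_atlas A B) A UNIV fst"
  by (rule smooth_mapI[OF P.manifold_axioms])
    (simp_all add: continuous_on_fst continuous_on_id smooth_fun_fst[OF A.smooth_fun_chart])

lemma smooth_map_snd: "smooth_map (prod_atlas A B) B UNIV snd"
  by (rule smooth_mapI[OF P.manifold_axioms])
    (simp_all add: continuous_on_snd continuous_on_id smooth_fun_snd[OF B.smooth_fun_chart])

lemma smooth_at_slice1:
  assumes "smooth_at (prod_atlas A B) (x, y) h" shows "smooth_at A x (\<lambda>s. h (s, y))"
  using smooth_at_compose[OF A.manifold_axioms P.manifold_axioms
      smooth_map_Pair[OF A.manifold_axioms A.smooth_map_ident[OF open_UNIV]
        smooth_map_const[OF A.manifold_axioms B.manifold_axioms open_UNIV]] UNIV_I assms] .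

lemma smooth_at_slice2:
  assumes "smooth_at (prod_atlas A B) (x, y) h" shows "smooth_at B y (\<lambda>t. h (x, t))"
  using smooth_at_compose[OF B.manifold_axioms P.manifold_axioms
      smooth_map_Pair[OF B.manifold_axioms smooth_map_const[OF B.manifold_axioms A.manifold_axioms open_UNIV]
        B.smooth_map_ident[OF open_UNIV]] UNIV_I assms] .

lemma pd_slice1:
  assumes c: "(U, \<phi>) \<in> A" "x \<in> U" and d: "(V, \<psi>) \<in> B" "y \<in> V"
    and h: "smooth_at (prod_atlas A B) (x, y) h"
  shows "A.pd U \<phi> w (\<lambda>s. h (s, y)) x = P.pd (U \<times> V) (map_prod \<phi> \<psi>) (w, 0) h (x, y)"
proof -
  let ?H = "h \<circ> inv_into (U \<times> V) (map_prod \<phi> \<psi>)" and ?j = "\<lambda>z. (z, \<psi> y)"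
  have j: "(?j has_derivative (\<lambda>w. (w, 0))) (at (\<phi> x))"
    by (intro has_derivative_Pair has_derivative_ident has_derivative_const)
  have "frechet_derivative ((\<lambda>s. h (s, y)) \<circ> inv_into U \<phi>) (at (\<phi> x))
      = frechet_derivative (?H \<circ> ?j) (at (\<phi> x))"
    by (rule frechet_derivative_cong_open[OF A.chart_image_open[OF c(1) open_UNIV]])
      (use c d prod_chart_inv[OF c(1) d(1)] in \<open>auto simp: B.chart_inv[OF d]\<close>)
  also have "\<dots> = frechet_derivative ?H (at (?j (\<phi> x))) \<circ> frechet_derivative ?j (at (\<phi> x))"
    using P.chart_differentiable[OF prod_chart[OF c(1) d(1)] _ h] c d
    by (intro frechet_derivative_compose differentiableI[OF j]) auto
  finally show ?thesis
    unfolding A.pd_def P.pd_def frechet_derivative_at[OF j, symmetric] by simp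
qed

lemma pd_slice2:
  assumes c: "(U, \<phi>) \<in> A" "x \<in> U" and d: "(V, \<psi>) \<in> B" "y \<in> V"
    and h: "smooth_at (prod_atlas A B) (x, y) h"
  shows "B.pd V \<psi> w (\<lambda>t. h (x, t)) y = P.pd (U \<times> V) (map_prod \<phi> \<psi>) (0, w) h (x, y)"
proof -
  let ?H = "h \<circ> inv_into (U \<times> V) (map_prod \<phi> \<psi>)" and ?j = "\<lambda>z. (\<phi> x, z)"
  have j: "(?j has_derivative (\<lambda>w. (0, w))) (at (\<psi> y))"
    by (intro has_derivative_Pair has_derivative_ident has_derivative_const)
  have "frechet_derivative ((\<lambda>t. h (x, t)) \<circ> inv_into V \<psi>) (at (\<psi> y))
      = frechet_derivative (?H \<circ> ?j) (at (\<psi> y))"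
    by (rule frechet_derivative_cong_open[OF B.chart_image_open[OF d(1) open_UNIV]])
      (use c d prod_chart_inv[OF c(1) d(1)] in \<open>auto simp: A.chart_inv[OF c]\<close>)
  also have "\<dots> = frechet_derivative ?H (at (?j (\<psi> y))) \<circ> frechet_derivative ?j (at (\<psi> y))"
    using P.chart_differentiable[OF prod_chart[OF c(1) d(1)] _ h] c d
    by (intro frechet_derivative_compose differentiableI[OF j]) auto
  finally show ?thesis
    unfolding B.pd_def P.pd_def frechet_derivative_at[OF j, symmetric] by simp
qed

lemma pd_fst:
  assumes c: "(U, \<phi>) \<in> A" "x \<in> U" and d: "(V, \<psi>) \<in> B" "y \<in> V" and f: "smooth_at A x f"
  shows "P.pd (U \<times> V) (map_prod \<phi> \<psi>) w (\<lambda>p. f (fst p)) (x, y) = A.pd U \<phi> (fst w) f x"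
proof -
  have "P.pd (U \<times> V) (map_prod \<phi> \<psi>) w (\<lambda>p. f (fst p)) (x, y)
      = P.pd (U \<times> V) (map_prod \<phi> \<psi>) (fst w, 0) (\<lambda>p. f (fst p)) (x, y)
      + P.pd (U \<times> V) (map_prod \<phi> \<psi>) (0, snd w) (\<lambda>p. f (fst p)) (x, y)"
    using linear_add[OF P.pd_linear[OF prod_chart[OF c(1) d(1)] _ smooth_at_fst[OF f]],
        of y "(fst w, 0)" "(0, snd w)"] c d by simp
  then show ?thesis
    using pd_slice1[OF c d smooth_at_fst[OF f], of "fst w"] pd_slice2[OF c d smooth_at_fst[OF f], of "snd w"]
    by (simp add: B.pd_def o_def)
qed

lemma pd_snd:
  assumes c: "(U, \<phi>) \<in> A" "x \<in> U" and d: "(V, \<psi>) \<in> B" "y \<in> V" and f: "smooth_at B y f"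
  shows "P.pd (U \<times> V) (map_prod \<phi> \<psi>) w (\<lambda>p. f (snd p)) (x, y) = B.pd V \<psi> (snd w) f y"
proof -
  have "P.pd (U \<times> V) (map_prod \<phi> \<psi>) w (\<lambda>p. f (snd p)) (x, y)
      = P.pd (U \<times> V) (map_prod \<phi> \<psi>) (fst w, 0) (\<lambda>p. f (snd p)) (x, y)
      + P.pd (U \<times> V) (map_prod \<phi> \<psi>) (0, snd w) (\<lambda>p. f (snd p)) (x, y)"
    using linear_add[OF P.pd_linear[OF prod_chart[OF c(1) d(1)] _ smooth_at_snd[OF f]],
        of x "(fst w, 0)" "(0, snd w)"] c d by simp
  then show ?thesis
    using pd_slice1[OF c d smooth_at_snd[OF f], of "fst w"] pd_slice2[OF c d smooth_at_snd[OF f], of "snd w"]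
    by (simp add: A.pd_def o_def)
qed

text \<open>Linearity of the derivative applied to
  \<open>(w1, w2) = (w1, 0) + (0, w2)\<close>.\<close>

lemma tangent_prod_split:
  assumes u: "u \<in> tangent_space (prod_atlas A B) (x, y)" and h: "smooth_at (prod_atlas A B) (x, y) h"
  shows "u h = u (\<lambda>p. h (fst p, y)) + u (\<lambda>p. h (x, snd p))"
proof -
  obtain U \<phi> where c: "(U, \<phi>) \<in> A" "x \<in> U" using A.chart_exists .
  obtain V \<psi> where d: "(V, \<psi>) \<in> B" "y \<in> V" using B.chart_exists .
  have cd: "(U \<times> V, map_prod \<phi> \<psi>) \<in> prod_atlas A B" "(x, y) \<in> U \<times> V"
    using prod_chart[OF c(1) d(1)] c d by auto
  obtain w where w: "u = P.tvec_of (U \<times> V) (map_prod \<phi> \<psi>) (x, y) w" using P.tangent_rep[OF u cd] .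
  note s = smooth_at_slice1[OF h] smooth_at_slice2[OF h]
  have "P.pd (U \<times> V) (map_prod \<phi> \<psi>) w h (x, y)
      = P.pd (U \<times> V) (map_prod \<phi> \<psi>) (fst w, 0) h (x, y)
      + P.pd (U \<times> V) (map_prod \<phi> \<psi>) (0, snd w) h (x, y)"
    using linear_add[OF P.pd_linear[OF cd h], of "(fst w, 0)" "(0, snd w)"] by simp
  then show ?thesis unfolding w P.tvec_of_def
    using h smooth_at_fst[OF s(1), of y] smooth_at_snd[OF s(2), of x]
      pd_fst[OF c d s(1), of w] pd_snd[OF c d s(2), of w]
      pd_slice1[OF c d h, of "fst w"] pd_slice2[OF c d h, of "snd w"] by simp
qed

text \<open>The previous splitting for the pushforward under \<open>(F, G)\<close>. In a
  trivialisation it separates motion in the base from motion in the fibre.\<close>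

lemma tangent_pair_map:
  assumes C: "manifold C bc" and F: "smooth_map C A W F" and G: "smooth_map C B W G"
    and z: "z \<in> W" and u: "u \<in> tangent_space C z" and h: "smooth_at (prod_atlas A B) (F z, G z) h"
  shows "u (\<lambda>c. h (F c, G c)) = u (\<lambda>c. h (F c, G z)) + u (\<lambda>c. h (F z, G c))"
proof -
  let ?j = "\<lambda>x. (F x, G x)"
  note j = smooth_map_Pair[OF C F G]
  have t: "push (prod_atlas A B) (?j z) ?j u \<in> tangent_space (prod_atlas A B) (F z, G z)"
    using push_tangent[OF C P.manifold_axioms j z u] .
  have a: "push (prod_atlas A B) (?j z) ?j u f = u (\<lambda>c. f (F c, G c))"
    if "smooth_at (prod_atlas A B) (F z, G z) f" for f
    by (rule push_apply[OF that])
  show ?thesis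
    using tangent_prod_split[OF t h] a[OF h] a[OF smooth_at_fst[OF smooth_at_slice1[OF h]]]
      a[OF smooth_at_snd[OF smooth_at_slice2[OF h]]] by simp
qed

section \<open>Differentiating in one factor with the other as parameter\<close>

text \<open>The point is that \<open>N\<close> is uniform: the fibrewise derivative is a partial
  derivative in one product chart for all parameters near \<open>x\<close>, so it can be
  differentiated in the parameter.\<close>

lemma fibre_derivative:
  assumes c: "(U, \<phi>) \<in> A" "x \<in> U" and d: "(V, \<psi>) \<in> B" "y \<in> V"
    and h: "smooth_at (prod_atlas A B) (x, y) h"
  obtains N where "open N" "x \<in> N"
    "\<And>s b. s \<in> N \<Longrightarrow> B.tvec_of V \<psi> y b (\<lambda>t. h (s, t)) = P.pd (U \<times> V) (map_prod \<phi> \<psi>) (0, b) h (s, y)"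
proof -
  obtain M where M: "open M" "(x, y) \<in> M" "\<And>p. p \<in> M \<Longrightarrow> smooth_at (prod_atlas A B) p h"
    using P.smooth_at_neighbourhood[OF h] by blast
  have "open ((\<lambda>s. (s, y)) -` M)"
    by (rule open_vimage[OF M(1)]) (intro continuous_intros)
  then have N: "open ((\<lambda>s. (s, y)) -` M \<inter> U)" "x \<in> (\<lambda>s. (s, y)) -` M \<inter> U"
    using M c A.chart_open[OF c(1)] by auto
  show ?thesis
  proof (rule that[OF N])
    fix s b assume s: "s \<in> (\<lambda>s. (s, y)) -` M \<inter> U"
    then have hs: "smooth_at (prod_atlas A B) (s, y) h" using M by auto
    show "B.tvec_of V \<psi> y b (\<lambda>t. h (s, t)) = P.pd (U \<times> V) (map_prod \<phi> \<psi>) (0, b) h (s, y)"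
      using pd_slice2[OF c(1) _ d hs] s smooth_at_slice2[OF hs] by (simp add: B.tvec_of_def)
  qed
qed

lemma smooth_at_fibre_derivative:
  assumes h: "smooth_at (prod_atlas A B) (x, y) h" and v: "v \<in> tangent_space B y"
  shows "smooth_at A x (\<lambda>s. v (\<lambda>t. h (s, t)))"
proof -
  obtain U \<phi> where c: "(U, \<phi>) \<in> A" "x \<in> U" using A.chart_exists .
  obtain V \<psi> where d: "(V, \<psi>) \<in> B" "y \<in> V" using B.chart_exists .
  obtain b where b: "v = B.tvec_of V \<psi> y b" using B.tangent_rep[OF v d] .
  obtain N where N: "open N" "x \<in> N"
    "\<And>s b. s \<in> N \<Longrightarrow> B.tvec_of V \<psi> y b (\<lambda>t. h (s, t)) = P.pd (U \<times> V) (map_prod \<phi> \<psi>) (0, b) h (s, y)"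
    using fibre_derivative[OF c d h] by blast
  have cd: "(U \<times> V, map_prod \<phi> \<psi>) \<in> prod_atlas A B" "(x, y) \<in> U \<times> V"
    using prod_chart[OF c(1) d(1)] c d by auto
  show ?thesis
    by (rule A.smooth_at_cong[OF smooth_at_slice1[OF P.pd_smooth_at[OF cd h, of "(0, b)"]] N(1,2)])
      (simp add: b N(3))
qed

text \<open>Symmetry of second derivatives in a product chart. It will make horizontal lifts commute
  with fundamental fields.\<close>

lemma mixed_derivative:
  assumes h: "smooth_at (prod_atlas A B) (x, y) h"
    and u: "u \<in> tangent_space A x" and v: "v \<in> tangent_space B y"
  shows "u (\<lambda>s. v (\<lambda>t. h (s, t))) = v (\<lambda>t. u (\<lambda>s. h (s, t)))"
proof -
  obtain U \<phi> where c: "(U, \<phi>) \<in> A" "x \<in> U" using A.chart_exists .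
  obtain V \<psi> where d: "(V, \<psi>) \<in> B" "y \<in> V" using B.chart_exists .
  obtain a where a: "u = A.tvec_of U \<phi> x a" using A.tangent_rep[OF u c] .
  obtain b where b: "v = B.tvec_of V \<psi> y b" using B.tangent_rep[OF v d] .
  let ?d = "P.pd (U \<times> V) (map_prod \<phi> \<psi>)"
  have cd: "(U \<times> V, map_prod \<phi> \<psi>) \<in> prod_atlas A B" "(x, y) \<in> U \<times> V"
    using prod_chart[OF c(1) d(1)] c d by auto
  obtain N where N: "open N" "x \<in> N"
    "\<And>s b. s \<in> N \<Longrightarrow> B.tvec_of V \<psi> y b (\<lambda>t. h (s, t)) = ?d (0, b) h (s, y)"
    using fibre_derivative[OF c d h] by blast
  have s1: "smooth_at (prod_atlas A B) (x, y) (?d w h)" for w by (rule P.pd_smooth_at[OF cd h])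
  have "u (\<lambda>s. v (\<lambda>t. h (s, t))) = u (\<lambda>s. ?d (0, b) h (s, y))"
    by (rule A.tangent_cong[OF u N(1,2)]) (simp add: b N(3))
  also have "\<dots> = ?d (a, 0) (?d (0, b) h) (x, y)"
    using pd_slice1[OF c d s1] smooth_at_slice1[OF s1] by (simp add: a A.tvec_of_def)
  also have "\<dots> = ?d (0, b) (?d (a, 0) h) (x, y)" by (rule P.pd_commute[OF cd h])
  also have "\<dots> = v (\<lambda>t. ?d (a, 0) h (x, t))"
    using pd_slice2[OF c d s1] smooth_at_slice2[OF s1] by (simp add: b B.tvec_of_def)
  also have "\<dots> = v (\<lambda>t. u (\<lambda>s. h (s, t)))"
  proof -
    obtain M where M: "open M" "(x, y) \<in> M" "\<And>p. p \<in> M \<Longrightarrow> smooth_at (prod_atlas A B) p h"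
      using P.smooth_at_neighbourhood[OF h] by blast
    have "open ((\<lambda>t. (x, t)) -` M)"
      by (rule open_vimage[OF M(1)]) (intro continuous_intros)
    then have o: "open ((\<lambda>t. (x, t)) -` M \<inter> V)" "y \<in> (\<lambda>t. (x, t)) -` M \<inter> V"
      using M d B.chart_open[OF d(1)] by auto
    show ?thesis
    proof (rule B.tangent_cong[OF v o])
      fix t assume t: "t \<in> (\<lambda>t. (x, t)) -` M \<inter> V"
      then have ht: "smooth_at (prod_atlas A B) (x, t) h" using M by auto
      show "?d (a, 0) h (x, t) = u (\<lambda>s. h (s, t))"
        using pd_slice1[OF c d(1) _ ht] t smooth_at_slice1[OF ht] by (simp add: a A.tvec_of_def)
    qed
  qed
  finally show ?thesis .
qed

text \<open>Joint smoothness when a field acts in the first variable alone; this is what makes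
  horizontal lifts smooth.\<close>

lemma smooth_at_partial_vfield:
  assumes h: "smooth_at (prod_atlas A B) (x, y) h" and X: "vfield A W X" and x: "x \<in> W"
  shows "smooth_at (prod_atlas A B) (x, y) (\<lambda>p. X (fst p) (\<lambda>s. h (s, snd p)))"
proof -
  obtain U \<phi> where c: "(U, \<phi>) \<in> A" "x \<in> U" using A.chart_exists .
  obtain V \<psi> where d: "(V, \<psi>) \<in> B" "y \<in> V" using B.chart_exists .
  let ?d = "P.pd (U \<times> V) (map_prod \<phi> \<psi>)"
  have cd: "(U \<times> V, map_prod \<phi> \<psi>) \<in> prod_atlas A B" "(x, y) \<in> U \<times> V"
    using prod_chart[OF c(1) d(1)] c d by auto
  obtain M where M: "open M" "(x, y) \<in> M" "\<And>p. p \<in> M \<Longrightarrow> smooth_at (prod_atlas A B) p h"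
    using P.smooth_at_neighbourhood[OF h] by blast
  let ?N = "M \<inter> (U \<inter> W) \<times> V"
  have N: "open ?N" "(x, y) \<in> ?N"
    using M c d x A.chart_open[OF c(1)] B.chart_open[OF d(1)] A.vfield_open[OF X]
    by (auto intro!: open_Int open_Times)
  have sX: "smooth_at A x (\<lambda>s. X s (\<lambda>z. \<phi> z \<bullet> i))" for i
    by (rule A.vfield_smooth_at[OF X x A.smooth_at_inner[OF A.smooth_at_chart[OF c]]])
  have "smooth_at (prod_atlas A B) (x, y) (\<lambda>p. \<Sum>i\<in>ba. X (fst p) (\<lambda>z. \<phi> z \<bullet> i) * ?d (i, 0) h p)"
    by (intro P.smooth_at_sum P.smooth_at_mult smooth_at_fst[OF sX] P.pd_smooth_at[OF cd h])
  then show ?thesis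
  proof (rule P.smooth_at_cong[OF _ N])
    fix p assume p: "p \<in> ?N"
    obtain s t where st: "p = (s, t)" by (cases p)
    have hp: "smooth_at (prod_atlas A B) (s, t) h" and s: "s \<in> U" "s \<in> W" and t: "t \<in> V"
      using p M st by auto
    show "(\<Sum>i\<in>ba. X (fst p) (\<lambda>z. \<phi> z \<bullet> i) * ?d (i, 0) h p) = X (fst p) (\<lambda>s. h (s, snd p))"
      using A.tangent_expand[OF A.vfield_tangent[OF X s(2)] c(1) s(1) smooth_at_slice1[OF hp]]
        pd_slice1[OF c(1) s(1) d(1) t hp] st by simp
  qed
qed

end

section \<open>Lie groups\<close>

locale lie_grp =
  fixes G :: "('k::{t2_space, second_countable_topology}, 'l::real_inner) lie_data" and lb :: "'l set"
  assumes lie: "lie_group G" and lie_basis: "orthobasis lb"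
begin

sublocale LM: manifold "latlas G" lb
  by unfold_locales (use lie lie_basis in \<open>simp_all add: lie_group_def\<close>)

sublocale LL: manifold_pair "latlas G" lb "latlas G" lb
  by unfold_locales

lemma lie_group: "group G"
  using lie by (simp add: lie_group_def)

lemma lie_carrier: "a \<in> carrier G"
  using lie by (simp add: lie_group_def)

lemma lie_one: "a \<otimes>\<^bsub>G\<^esub> \<one>\<^bsub>G\<^esub> = a" "\<one>\<^bsub>G\<^esub> \<otimes>\<^bsub>G\<^esub> a = a"
  using monoid.r_one[OF group.is_monoid[OF lie_group] lie_carrier]
    monoid.l_one[OF group.is_monoid[OF lie_group] lie_carrier] by simp_all

lemma lie_inv: "inv\<^bsub>G\<^esub> a \<otimes>\<^bsub>G\<^esub> a = \<one>\<^bsub>G\<^esub>" "a \<otimes>\<^bsub>G\<^esub> inv\<^bsub>G\<^esub> a = \<one>\<^bsub>G\<^esub>"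
  using group.l_inv[OF lie_group lie_carrier] group.r_inv[OF lie_group lie_carrier] by simp_all

lemma mult_smooth: "smooth_map (prod_atlas (latlas G) (latlas G)) (latlas G) UNIV (\<lambda>p. fst p \<otimes>\<^bsub>G\<^esub> snd p)"
  using lie by (simp add: lie_group_def case_prod_unfold)

lemma lmult_smooth: "smooth_map (latlas G) (latlas G) UNIV (\<lambda>b. a \<otimes>\<^bsub>G\<^esub> b)"
  using smooth_map_compose'[OF LM.manifold_axioms LL.P.manifold_axioms LM.manifold_axioms
    LL.smooth_map_Pair[OF LM.manifold_axioms
      smooth_map_const[OF LM.manifold_axioms LM.manifold_axioms open_UNIV, of a]
      LM.smooth_map_ident[OF open_UNIV]] mult_smooth] by simp

lemma rmult_smooth: "smooth_map (latlas G) (latlas G) UNIV (\<lambda>b. b \<otimes>\<^bsub>G\<^esub> a)"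
  using smooth_map_compose'[OF LM.manifold_axioms LL.P.manifold_axioms LM.manifold_axioms
    LL.smooth_map_Pair[OF LM.manifold_axioms LM.smooth_map_ident[OF open_UNIV]
      smooth_map_const[OF LM.manifold_axioms LM.manifold_axioms open_UNIV, of a]] mult_smooth] by simp

lemma lalg_tangent: "lalg G \<xi> \<in> tangent_space (latlas G) \<one>\<^bsub>G\<^esub>"
  using lie unfolding lie_group_def bij_betw_def by auto

lemma lalg_ex: "v \<in> tangent_space (latlas G) \<one>\<^bsub>G\<^esub> \<Longrightarrow> \<exists>\<xi>. v = lalg G \<xi>"
  using lie unfolding lie_group_def bij_betw_def by auto

lemma lalg_inject: "lalg G \<xi> = lalg G \<zeta> \<Longrightarrow> \<xi> = \<zeta>"
  using lie unfolding lie_group_def bij_betw_def by (auto dest: injD)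

lemma lalg_lin: "lalg G (a *\<^sub>R \<xi> + b *\<^sub>R \<zeta>) = tlin a (lalg G \<xi>) b (lalg G \<zeta>)"
  using lie by (simp add: lie_group_def)

lemma lalg_linear: "linear (\<lambda>\<xi>. lalg G \<xi> f)"
  by (rule linearI)
    (use lalg_lin[of 1 _ 1] lalg_lin[of _ _ 0] in \<open>simp_all add: tlin_def\<close>)

lemma left_invariant_apply:
  "smooth_at (latlas G) a f \<Longrightarrow> left_invariant G \<xi> a f = lalg G \<xi> (\<lambda>b. f (a \<otimes>\<^bsub>G\<^esub> b))"
  unfolding left_invariant_def by (rule push_apply)

text \<open>The field differentiates \<open>f (a \<otimes> b)\<close> in \<open>b\<close> at the
  identity, so its smoothness in \<open>a\<close> is that of a derivative with parameter.\<close>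

lemma left_invariant_vfield: "vfield (latlas G) UNIV (left_invariant G \<xi>)"
proof (rule LM.vfieldI[OF open_UNIV])
  fix a
  show "left_invariant G \<xi> a \<in> tangent_space (latlas G) a"
    unfolding left_invariant_def
    using push_tangent[OF LM.manifold_axioms LM.manifold_axioms lmult_smooth UNIV_I lalg_tangent, of a \<xi>]
    by (simp add: lie_one)
  fix f :: "'k \<Rightarrow> real" assume f: "smooth_at (latlas G) a f"
  obtain N where N: "open N" "a \<in> N" "\<And>y. y \<in> N \<Longrightarrow> smooth_at (latlas G) y f"
    using LM.smooth_at_neighbourhood[OF f] by blast
  have "smooth_at (prod_atlas (latlas G) (latlas G)) (a, \<one>\<^bsub>G\<^esub>) (\<lambda>p. f (fst p \<otimes>\<^bsub>G\<^esub> snd p))"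
    by (rule smooth_at_compose[OF LL.P.manifold_axioms LM.manifold_axioms mult_smooth UNIV_I])
      (simp add: lie_one f)
  from LL.smooth_at_fibre_derivative[OF this lalg_tangent, of \<xi>]
  show "smooth_at (latlas G) a (\<lambda>y. left_invariant G \<xi> y f)"
    by (rule LM.smooth_at_cong[OF _ N(1,2)]) (simp add: left_invariant_apply N(3))
qed

lemma left_invariant_lin:
  "left_invariant G (a *\<^sub>R \<xi> + b *\<^sub>R \<zeta>) x = tlin a (left_invariant G \<xi> x) b (left_invariant G \<zeta> x)"
  by (auto simp: left_invariant_def push_def lalg_lin tlin_def)

lemma lalg_lbr:
  "lalg G (lbr G \<xi> \<zeta>) = lie_bracket (latlas G) (left_invariant G \<xi>) (left_invariant G \<zeta>) \<one>\<^bsub>G\<^esub>"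
proof -
  obtain \<omega> where "lie_bracket (latlas G) (left_invariant G \<xi>) (left_invariant G \<zeta>) \<one>\<^bsub>G\<^esub> = lalg G \<omega>"
    using lalg_ex[OF LM.lie_bracket_tangent[OF left_invariant_vfield left_invariant_vfield UNIV_I]]
    by blast
  then show ?thesis unfolding lbr_def
    by (metis (mono_tags, lifting) lalg_inject theI)
qed

text \<open>Left-invariant fields depend linearly on the Lie algebra element, and a constant
  coefficient has derivative 0 in \<open>lie_bracket_leibniz\<close>. Antisymmetry carries the
  result from the second slot to the first.\<close>

lemma lbr_linear: "linear (\<lambda>\<xi>. lbr G \<xi> \<zeta>)"
proof -
  have eq: "lbr G (a *\<^sub>R \<xi> + \<xi>') \<zeta> = a *\<^sub>R lbr G \<xi> \<zeta> + lbr G \<xi>' \<zeta>" for a \<xi> \<xi>'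
  proof (rule lalg_inject, rule ext)
    fix f
    let ?L = "left_invariant G" and ?b = "lie_bracket (latlas G)"
    have L: "?L (a *\<^sub>R \<xi> + \<xi>') = (\<lambda>y. tlin a (?L \<xi> y) 1 (?L \<xi>' y))"
      using left_invariant_lin[of a \<xi> 1 \<xi>'] by auto
    have "?b (?L \<zeta>) (\<lambda>y. tlin a (?L \<xi> y) 1 (?L \<xi>' y)) \<one>\<^bsub>G\<^esub>
        = tlin a (?b (?L \<zeta>) (?L \<xi>) \<one>\<^bsub>G\<^esub>)
          1 (tlin (?L \<zeta> \<one>\<^bsub>G\<^esub> (\<lambda>y. a)) (?L \<xi> \<one>\<^bsub>G\<^esub>) 1 (?b (?L \<zeta>) (?L \<xi>') \<one>\<^bsub>G\<^esub>))"
      by (rule LM.lie_bracket_leibniz[OF left_invariant_vfield left_invariant_vfield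
            left_invariant_vfield LM.smooth_fun_const[OF open_UNIV] UNIV_I])
    moreover have "?L \<zeta> \<one>\<^bsub>G\<^esub> (\<lambda>y. a) = 0"
      by (rule LM.tangent_const[OF LM.vfield_tangent[OF left_invariant_vfield UNIV_I]])
    ultimately have "?b (?L \<zeta>) (?L (a *\<^sub>R \<xi> + \<xi>')) \<one>\<^bsub>G\<^esub> f
        = a * ?b (?L \<zeta>) (?L \<xi>) \<one>\<^bsub>G\<^esub> f + ?b (?L \<zeta>) (?L \<xi>') \<one>\<^bsub>G\<^esub> f"
      unfolding L by (simp add: tlin_def)
    then show "lalg G (lbr G (a *\<^sub>R \<xi> + \<xi>') \<zeta>) f = lalg G (a *\<^sub>R lbr G \<xi> \<zeta> + lbr G \<xi>' \<zeta>) f"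
      unfolding linear_add[OF lalg_linear] linear_scale[OF lalg_linear] lalg_lbr
      unfolding LM.lie_bracket_antisym[of _ "?L \<zeta>"] by simp
  qed
  \<comment> \<open>With \<open>a = -1\<close> the two terms on the right cancel.\<close>
  have z: "lbr G 0 \<zeta> = 0" using eq[of "-1" 0 0] by simp
  show ?thesis
  proof (rule linearI)
    show "lbr G (x + y) \<zeta> = lbr G x \<zeta> + lbr G y \<zeta>" for x y using eq[of 1 x y] by simp
    show "lbr G (r *\<^sub>R x) \<zeta> = r *\<^sub>R lbr G x \<zeta>" for r x using eq[of r x 0] z by simp
  qed
qed

lemma conj_smooth: "smooth_map (latlas G) (latlas G) UNIV (\<lambda>b. a \<otimes>\<^bsub>G\<^esub> b \<otimes>\<^bsub>G\<^esub> inv\<^bsub>G\<^esub> a)"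
  using smooth_map_compose'[OF LM.manifold_axioms LM.manifold_axioms LM.manifold_axioms
      lmult_smooth rmult_smooth] by simp

lemma lalg_Ad:
  "lalg G (Ad G a \<xi>) = push (latlas G) \<one>\<^bsub>G\<^esub> (\<lambda>b. a \<otimes>\<^bsub>G\<^esub> b \<otimes>\<^bsub>G\<^esub> inv\<^bsub>G\<^esub> a) (lalg G \<xi>)"
proof -
  obtain \<omega> where "push (latlas G) \<one>\<^bsub>G\<^esub> (\<lambda>b. a \<otimes>\<^bsub>G\<^esub> b \<otimes>\<^bsub>G\<^esub> inv\<^bsub>G\<^esub> a) (lalg G \<xi>) = lalg G \<omega>"
    using lalg_ex push_tangent[OF LM.manifold_axioms LM.manifold_axioms conj_smooth UNIV_I lalg_tangent, of a \<xi>]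
    by (auto simp: lie_one lie_inv)
  then show ?thesis unfolding Ad_def
    by (metis (mono_tags, lifting) lalg_inject theI)
qed

lemma Ad_linear: "linear (Ad G a)"
proof (rule linearI; rule lalg_inject; rule ext)
  fix \<xi> \<zeta> f
  show "lalg G (Ad G a (\<xi> + \<zeta>)) f = lalg G (Ad G a \<xi> + Ad G a \<zeta>) f"
    unfolding linear_add[OF lalg_linear] lalg_Ad push_def by (simp add: linear_add[OF lalg_linear])
next
  fix r \<xi> f
  show "lalg G (Ad G a (r *\<^sub>R \<xi>)) f = lalg G (r *\<^sub>R Ad G a \<xi>) f"
    unfolding linear_scale[OF lalg_linear] lalg_Ad push_def by (simp add: linear_scale[OF lalg_linear])
qed

end

section \<open>Principal bundles and horizontal lifts\<close>

locale principal =
  lie_grp G lb for G :: "('k::{t2_space, second_countable_topology}, 'l::real_inner) lie_data" and lb +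
  fixes A :: "('m::{t2_space, second_countable_topology}, real^'n) atlas"
    and P :: "('p::{t2_space, second_countable_topology}, 'ep::euclidean_space, 'm, 'k) pbundle"
    and \<theta> :: "'p \<Rightarrow> 'p tvec \<Rightarrow> 'l"
  assumes base_atlas: "smooth_atlas A" and princ: "principal_bundle A G P"
    and connection: "principal_connection G P \<theta>"
begin

sublocale M: manifold A Basis
  by unfold_locales (simp_all add: base_atlas orthobasis_Basis)

sublocale E: manifold "patlas P" Basis
  by unfold_locales (use princ in \<open>simp_all add: principal_bundle_def orthobasis_Basis\<close>)

sublocale EG: manifold_pair "patlas P" Basis "latlas G" lb
  by unfold_locales

sublocale MG: manifold_pair A Basis "latlas G" lb
  by unfold_locales

abbreviation "\<pi> \<equiv> pproj P"

lemma proj_smooth: "smooth_map (patlas P) A UNIV \<pi>"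
  using princ by (simp add: principal_bundle_def)

lemma act_smooth: "smooth_map (prod_atlas (patlas P) (latlas G)) (patlas P) UNIV (\<lambda>q. pact P (fst q) (snd q))"
  using princ by (simp add: principal_bundle_def case_prod_unfold)

lemma act_one: "pact P p \<one>\<^bsub>G\<^esub> = p"
  using princ by (simp add: principal_bundle_def)

lemma act_act: "pact P (pact P p a) b = pact P p (a \<otimes>\<^bsub>G\<^esub> b)"
  using princ by (simp add: principal_bundle_def)

lemma proj_act: "\<pi> (pact P p a) = \<pi> p"
  using princ by (simp add: principal_bundle_def)

lemma act_transitive: "\<pi> p = \<pi> p' \<Longrightarrow> \<exists>a. p' = pact P p a"
proof -
  assume pp: "\<pi> p = \<pi> p'"
  have "\<forall>p p'. \<pi> p = \<pi> p' \<longrightarrow> (\<exists>!a. p' = pact P p a)"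
    using princ unfolding principal_bundle_def by (elim conjE)
  then show "\<exists>a. p' = pact P p a" using pp by blast
qed

lemma local_section:
  obtains U s \<tau> where "x \<in> U" "smooth_map A (patlas P) U s" "\<And>y. y \<in> U \<Longrightarrow> \<pi> (s y) = y"
    "smooth_map (patlas P) (latlas G) (\<pi> -` U) \<tau>"
    "\<And>p. \<pi> p \<in> U \<Longrightarrow> pact P (s (\<pi> p)) (\<tau> p) = p"
proof -
  have "\<forall>x. \<exists>U s \<tau>. x \<in> U \<and> smooth_map A (patlas P) U s \<and> (\<forall>y\<in>U. \<pi> (s y) = y) \<and>
      smooth_map (patlas P) (latlas G) (\<pi> -` U) \<tau> \<and> (\<forall>p\<in>\<pi> -` U. p = pact P (s (\<pi> p)) (\<tau> p))"
    using princ unfolding principal_bundle_def by (elim conjE)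
  then obtain U s \<tau> where 1: "x \<in> U" "smooth_map A (patlas P) U s" "\<forall>y\<in>U. \<pi> (s y) = y"
    "smooth_map (patlas P) (latlas G) (\<pi> -` U) \<tau>" "\<forall>p\<in>\<pi> -` U. p = pact P (s (\<pi> p)) (\<tau> p)"
    by metis
  show ?thesis by (rule that[OF 1(1,2) _ 1(4)]) (use 1(3,5) in auto)
qed

lemma proj_surj: obtains p where "\<pi> p = x"
proof -
  obtain U s \<tau> where "x \<in> U" "smooth_map A (patlas P) U s" "\<And>y. y \<in> U \<Longrightarrow> \<pi> (s y) = y"
    "smooth_map (patlas P) (latlas G) (\<pi> -` U) \<tau>"
    "\<And>q. \<pi> q \<in> U \<Longrightarrow> pact P (s (\<pi> q)) (\<tau> q) = q"
    by (rule local_section[of x], rule that)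
  then have "\<pi> (s x) = x" by blast
  then show ?thesis by (rule that)
qed

lemma proj_open: "open U \<Longrightarrow> open (\<pi> -` U)"
  using smooth_map_preimage_open[OF proj_smooth] by simp

lemma smooth_at_proj: "smooth_at A (\<pi> p) f \<Longrightarrow> smooth_at (patlas P) p (\<lambda>q. f (\<pi> q))"
  by (rule smooth_at_compose[OF E.manifold_axioms M.manifold_axioms proj_smooth UNIV_I])

lemma orbit_smooth: "smooth_map (latlas G) (patlas P) UNIV (\<lambda>a. pact P p a)"
  using smooth_map_compose'[OF LM.manifold_axioms EG.P.manifold_axioms E.manifold_axioms
    EG.smooth_map_Pair[OF LM.manifold_axioms
      smooth_map_const[OF LM.manifold_axioms E.manifold_axioms open_UNIV, of p]
      LM.smooth_map_ident[OF open_UNIV]] act_smooth] by simp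

lemma translate_smooth: "smooth_map (patlas P) (patlas P) UNIV (\<lambda>p. pact P p a)"
  using smooth_map_compose'[OF E.manifold_axioms EG.P.manifold_axioms E.manifold_axioms
    EG.smooth_map_Pair[OF E.manifold_axioms E.smooth_map_ident[OF open_UNIV]
      smooth_map_const[OF E.manifold_axioms LM.manifold_axioms open_UNIV, of a]] act_smooth] by simp

section \<open>Fundamental vector fields of the action\<close>

definition vert :: "'l \<Rightarrow> 'p field" where
  "vert \<xi> p = push (patlas P) p (\<lambda>a. pact P p a) (lalg G \<xi>)"

lemma vert_apply: "smooth_at (patlas P) p f \<Longrightarrow> vert \<xi> p f = lalg G \<xi> (\<lambda>a. f (pact P p a))"
  unfolding vert_def by (rule push_apply)

lemma vert_tangent: "vert \<xi> p \<in> tangent_space (patlas P) p"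
  using push_tangent[OF LM.manifold_axioms E.manifold_axioms orbit_smooth UNIV_I lalg_tangent, of p \<xi>]
  unfolding vert_def by (simp add: act_one)

lemma act_smooth_at: "smooth_at (patlas P) p f \<Longrightarrow>
    smooth_at (prod_atlas (patlas P) (latlas G)) (p, \<one>\<^bsub>G\<^esub>) (\<lambda>q. f (pact P (fst q) (snd q)))"
  by (rule smooth_at_compose[OF EG.P.manifold_axioms E.manifold_axioms act_smooth UNIV_I])
    (simp add: act_one)

lemma vert_vfield: "vfield (patlas P) UNIV (vert \<xi>)"
proof (rule E.vfieldI[OF open_UNIV])
  fix p
  show "vert \<xi> p \<in> tangent_space (patlas P) p" by (rule vert_tangent)
  fix f :: "'p \<Rightarrow> real" assume f: "smooth_at (patlas P) p f"
  obtain N where N: "open N" "p \<in> N" "\<And>y. y \<in> N \<Longrightarrow> smooth_at (patlas P) y f"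
    using E.smooth_at_neighbourhood[OF f] by blast
  from EG.smooth_at_fibre_derivative[OF act_smooth_at[OF f] lalg_tangent, of \<xi>]
  show "smooth_at (patlas P) p (\<lambda>y. vert \<xi> y f)"
    by (rule E.smooth_at_cong[OF _ N(1,2)]) (simp add: vert_apply N(3))
qed

lemma vert_linear: "linear (\<lambda>\<xi>. vert \<xi> p f)"
  unfolding vert_def push_def
  using linear_add[OF lalg_linear] linear_scale[OF lalg_linear] by (auto intro!: linearI)

text \<open>Reduces vertical fields with variable parameter to finitely many fixed ones with smooth
  coefficients.\<close>

lemma vert_expand: "vert \<xi> p f = (\<Sum>i\<in>lb. (\<xi> \<bullet> i) * vert i p f)"
proof -
  have "vert \<xi> p f = vert (\<Sum>i\<in>lb. (\<xi> \<bullet> i) *\<^sub>R i) p f" by (simp only: orthobasis_sum[OF lie_basis])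
  then show ?thesis by (simp add: linear_sum[OF vert_linear] linear_scale[OF vert_linear])
qed

lemma vert_proj: assumes "smooth_at A (\<pi> p) f" shows "vert \<xi> p (\<lambda>q. f (\<pi> q)) = 0"
  using LM.tangent_const[OF lalg_tangent] by (simp add: vert_apply smooth_at_proj assms proj_act)

lemma theta_vert: "\<theta> p (vert \<xi> p) = \<xi>"
  using connection by (simp add: principal_connection_def vert_def)

lemma theta_lin:
  "u \<in> tangent_space (patlas P) p \<Longrightarrow> v \<in> tangent_space (patlas P) p \<Longrightarrow>
    \<theta> p (tlin a u b v) = a *\<^sub>R \<theta> p u + b *\<^sub>R \<theta> p v"
  using connection by (simp add: principal_connection_def)

lemma theta_smooth: "vfield (patlas P) U X \<Longrightarrow> smooth_fun (patlas P) U (\<lambda>p. \<theta> p (X p))"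
  using connection by (simp add: principal_connection_def)

lemma theta_translate:
  "v \<in> tangent_space (patlas P) p \<Longrightarrow>
    \<theta> (pact P p a) (push (patlas P) (pact P p a) (\<lambda>p'. pact P p' a) v) = Ad G (inv\<^bsub>G\<^esub> a) (\<theta> p v)"
  using connection by (simp add: principal_connection_def)

lemma theta_zero: "\<theta> p (\<lambda>_. 0) = 0"
  using theta_lin[OF E.tangent_zero E.tangent_zero, of p 0 0] by (simp add: tlin_def)

lemma trivialised_smooth_at:
  assumes s: "smooth_map A (patlas P) U s" and y: "y \<in> U" and f: "smooth_at (patlas P) (pact P (s y) a) f"
  shows "smooth_at (prod_atlas A (latlas G)) (y, a) (\<lambda>q. f (pact P (s (fst q)) (snd q)))"
proof -
  let ?W = "UNIV \<inter> fst -` U :: ('m \<times> 'k) set"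
  have 1: "smooth_map (prod_atlas A (latlas G)) (patlas P) ?W (\<lambda>q. s (fst q))"
    by (rule smooth_map_compose[OF MG.P.manifold_axioms M.manifold_axioms E.manifold_axioms
          MG.smooth_map_fst s])
  have 2: "smooth_map (prod_atlas A (latlas G)) (latlas G) ?W snd"
    by (rule MG.P.smooth_map_subset[OF MG.smooth_map_snd smooth_map_open[OF 1]]) simp
  have 3: "smooth_map (prod_atlas A (latlas G)) (patlas P) ?W (\<lambda>q. pact P (s (fst q)) (snd q))"
    using smooth_map_compose'[OF MG.P.manifold_axioms EG.P.manifold_axioms E.manifold_axioms
        EG.smooth_map_Pair[OF MG.P.manifold_axioms 1 2] act_smooth] by simp
  show ?thesis
    by (rule smooth_at_compose[OF MG.P.manifold_axioms E.manifold_axioms 3]) (use y f in auto)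
qed

text \<open>In a local trivialisation a curve with constant projection moves along the fibre only.\<close>

lemma kernel_proj_vert:
  assumes v: "v \<in> tangent_space (patlas P) p"
    and ker: "\<And>f. smooth_at A (\<pi> p) f \<Longrightarrow> v (\<lambda>q. f (\<pi> q)) = 0"
  shows "\<exists>\<xi>. v = vert \<xi> p"
proof -
  obtain U s \<tau> where U: "\<pi> p \<in> U" "smooth_map A (patlas P) U s" "\<And>y. y \<in> U \<Longrightarrow> \<pi> (s y) = y"
    and \<tau>: "smooth_map (patlas P) (latlas G) (\<pi> -` U) \<tau>" "\<And>q. \<pi> q \<in> U \<Longrightarrow> pact P (s (\<pi> q)) (\<tau> q) = q"
    by (rule local_section[of "\<pi> p"], rule that)
  have W: "open (\<pi> -` U)" "p \<in> \<pi> -` U" using smooth_map_open[OF \<tau>(1)] U by auto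
  let ?i = "inv\<^bsub>G\<^esub> (\<tau> p)"
  have sp: "s (\<pi> p) = pact P p ?i"
  proof -
    have "pact P p ?i = pact P (pact P (s (\<pi> p)) (\<tau> p)) ?i" using \<tau>(2) U(1) by simp
    then show ?thesis by (simp add: act_act lie_inv act_one)
  qed
  have L: "smooth_map (patlas P) (latlas G) (\<pi> -` U) (\<lambda>c. ?i \<otimes>\<^bsub>G\<^esub> \<tau> c)"
    using smooth_map_compose'[OF E.manifold_axioms LM.manifold_axioms LM.manifold_axioms \<tau>(1) lmult_smooth]
    by simp
  \<comment> \<open>The fibre component of \<open>v\<close>, left-translated to the identity so that
    it becomes an element of the Lie algebra.\<close>
  define w where "w = push (latlas G) \<one>\<^bsub>G\<^esub> (\<lambda>c. ?i \<otimes>\<^bsub>G\<^esub> \<tau> c) v"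
  have "w \<in> tangent_space (latlas G) \<one>\<^bsub>G\<^esub>"
    using push_tangent[OF E.manifold_axioms LM.manifold_axioms L W(2) v] by (simp add: w_def lie_inv)
  then obtain \<xi> where \<xi>: "w = lalg G \<xi>" using lalg_ex by blast
  have "v = vert \<xi> p"
  proof (rule E.tangent_eqI[OF v vert_tangent])
    fix f :: "'p \<Rightarrow> real" assume f: "smooth_at (patlas P) p f"
    let ?h = "\<lambda>q. f (pact P (s (fst q)) (snd q))"
    have h: "smooth_at (prod_atlas A (latlas G)) (\<pi> p, \<tau> p) ?h"
      by (rule trivialised_smooth_at[OF U(2,1)]) (simp add: \<tau>(2) U(1) f)
    have pU: "smooth_map (patlas P) A (\<pi> -` U) \<pi>"
      by (rule E.smooth_map_subset[OF proj_smooth W(1)]) simp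
    have "v f = v (\<lambda>c. ?h (\<pi> c, \<tau> c))"
      by (rule E.tangent_cong[OF v W]) (simp add: \<tau>(2))
    also have "\<dots> = v (\<lambda>c. ?h (\<pi> c, \<tau> p)) + v (\<lambda>c. ?h (\<pi> p, \<tau> c))"
      by (rule MG.tangent_pair_map[OF E.manifold_axioms pU \<tau>(1) W(2) v h])
    also have "v (\<lambda>c. ?h (\<pi> c, \<tau> p)) = 0"
      by (rule ker[OF MG.smooth_at_slice1[OF h]])
    also have "0 + v (\<lambda>c. ?h (\<pi> p, \<tau> c)) = v (\<lambda>c. f (pact P p (?i \<otimes>\<^bsub>G\<^esub> \<tau> c)))"
      by (simp add: sp act_act)
    also have "\<dots> = w (\<lambda>a. f (pact P p a))"
    proof -
      have "smooth_at (latlas G) \<one>\<^bsub>G\<^esub> (\<lambda>a. f (pact P p a))"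
        by (rule smooth_at_compose[OF LM.manifold_axioms E.manifold_axioms orbit_smooth UNIV_I])
          (simp add: act_one f)
      then show ?thesis unfolding w_def by (simp add: push_apply)
    qed
    finally show "v f = vert \<xi> p f" by (simp add: \<xi> vert_apply f)
  qed
  then show ?thesis by blast
qed

section \<open>Horizontal lifts\<close>

text \<open>The difference is vertical, say \<open>vert \<xi> p\<close>, and \<open>\<theta>\<close>
  recovers \<open>\<xi> = 0\<close>. Besides the uniqueness of lifts, this is how identities between
  vectors on P are verified: compare projections and connection form.\<close>

lemma horizontal_unique:
  assumes u: "u \<in> tangent_space (patlas P) p" and v: "v \<in> tangent_space (patlas P) p"
    and eq: "\<And>f. smooth_at A (\<pi> p) f \<Longrightarrow> u (\<lambda>q. f (\<pi> q)) = v (\<lambda>q. f (\<pi> q))"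
    and th: "\<theta> p u = \<theta> p v"
  shows "u = v"
proof -
  have d: "tlin 1 u (-1) v \<in> tangent_space (patlas P) p" by (rule E.tangent_tlin[OF u v])
  obtain \<xi> where \<xi>: "tlin 1 u (-1) v = vert \<xi> p"
    using kernel_proj_vert[OF d] eq by (auto simp: tlin_def)
  have "\<xi> = 0" using theta_vert[of p \<xi>] theta_lin[OF u v, of 1 "-1"] th unfolding \<xi>[symmetric] by simp
  then have "tlin 1 u (-1) v f = 0" for f
    unfolding \<xi> using linear_0[OF vert_linear] by simp
  then show ?thesis by (auto simp: tlin_def)
qed

lemma proj_push_iff:
  assumes "v \<in> tangent_space (patlas P) p" "u \<in> tangent_space A (\<pi> p)"
  shows "push A (\<pi> p) \<pi> v = u \<longleftrightarrow> (\<forall>f. smooth_at A (\<pi> p) f \<longrightarrow> v (\<lambda>q. f (\<pi> q)) = u f)"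
proof -
  have "push A (\<pi> p) \<pi> v f = v (\<lambda>q. f (\<pi> q))" if "smooth_at A (\<pi> p) f" for f
    by (rule push_apply[OF that])
  then show ?thesis
    using M.tangent_eqI[OF push_tangent[OF E.manifold_axioms M.manifold_axioms proj_smooth UNIV_I assms(1)] assms(2)]
    by auto
qed

lemma hlift_eqI:
  assumes X: "X (\<pi> p) \<in> tangent_space A (\<pi> p)" and v: "v \<in> tangent_space (patlas P) p"
    and "\<And>f. smooth_at A (\<pi> p) f \<Longrightarrow> v (\<lambda>q. f (\<pi> q)) = X (\<pi> p) f" and "\<theta> p v = 0"
  shows "hlift A P \<theta> X p = v"
  unfolding hlift_def
proof (rule the_equality)
  show "v \<in> tangent_space (patlas P) p \<and> push A (\<pi> p) \<pi> v = X (\<pi> p) \<and> \<theta> p v = 0"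
    using proj_push_iff[OF v X] assms by blast
  fix u assume u: "u \<in> tangent_space (patlas P) p \<and> push A (\<pi> p) \<pi> u = X (\<pi> p) \<and> \<theta> p u = 0"
  then show "u = v"
    using horizontal_unique[of u p v] proj_push_iff[of u p, OF _ X] assms by auto
qed

text \<open>Existence of the lift: the local section, translated so as to pass through
  \<open>p\<close>, transports \<open>X\<close>, and the vertical part detected by
  \<open>\<theta>\<close> is subtracted. The formula is explicit because smoothness is read off from
  it.\<close>

lemma hlift_formula:
  assumes s: "smooth_map A (patlas P) U s" "\<And>y. y \<in> U \<Longrightarrow> \<pi> (s y) = y"
    and \<tau>: "\<And>p. \<pi> p \<in> U \<Longrightarrow> pact P (s (\<pi> p)) (\<tau> p) = p"
    and p: "\<pi> p \<in> U" and X: "X (\<pi> p) \<in> tangent_space A (\<pi> p)"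
  defines "W \<equiv> push (patlas P) p (\<lambda>y. pact P (s y) (\<tau> p)) (X (\<pi> p))"
  shows "W \<in> tangent_space (patlas P) p"
    and "hlift A P \<theta> X p = tlin 1 W (-1) (vert (\<theta> p W) p)"
    and "tlin 1 W (-1) (vert (\<theta> p W) p) \<in> tangent_space (patlas P) p"
    and "smooth_at A (\<pi> p) f \<Longrightarrow> tlin 1 W (-1) (vert (\<theta> p W) p) (\<lambda>q. f (\<pi> q)) = X (\<pi> p) f"
    and "\<theta> p (tlin 1 W (-1) (vert (\<theta> p W) p)) = 0"
proof -
  have 1: "smooth_map A (patlas P) U (\<lambda>y. pact P (s y) (\<tau> p))"
    using smooth_map_compose'[OF M.manifold_axioms E.manifold_axioms E.manifold_axioms s(1)
        translate_smooth] by simp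
  show W: "W \<in> tangent_space (patlas P) p"
    using push_tangent[OF M.manifold_axioms E.manifold_axioms 1 p X] by (simp add: \<tau>[OF p] W_def)
  show t: "tlin 1 W (-1) (vert (\<theta> p W) p) \<in> tangent_space (patlas P) p"
    by (rule E.tangent_tlin[OF W vert_tangent])
  show pr: "tlin 1 W (-1) (vert (\<theta> p W) p) (\<lambda>q. f (\<pi> q)) = X (\<pi> p) f" if f: "smooth_at A (\<pi> p) f" for f
  proof -
    have "W (\<lambda>q. f (\<pi> q)) = X (\<pi> p) (\<lambda>y. f (\<pi> (pact P (s y) (\<tau> p))))"
      unfolding W_def by (rule push_apply[OF smooth_at_proj[OF f]])
    also have "\<dots> = X (\<pi> p) f"
      by (rule M.tangent_cong[OF X smooth_map_open[OF s(1)] p]) (simp add: proj_act s(2))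
    finally show ?thesis by (simp add: tlin_def vert_proj f)
  qed
  show th: "\<theta> p (tlin 1 W (-1) (vert (\<theta> p W) p)) = 0"
    by (simp add: theta_lin[OF W vert_tangent] theta_vert)
  show "hlift A P \<theta> X p = tlin 1 W (-1) (vert (\<theta> p W) p)"
    by (rule hlift_eqI[of X p, OF X t pr th])
qed

lemma hlift:
  assumes X: "X (\<pi> p) \<in> tangent_space A (\<pi> p)"
  shows hlift_tangent: "hlift A P \<theta> X p \<in> tangent_space (patlas P) p"
    and hlift_proj: "smooth_at A (\<pi> p) f \<Longrightarrow> hlift A P \<theta> X p (\<lambda>q. f (\<pi> q)) = X (\<pi> p) f"
    and theta_hlift: "\<theta> p (hlift A P \<theta> X p) = 0"
proof -
  obtain U s \<tau> where *: "\<pi> p \<in> U" "smooth_map A (patlas P) U s" "\<And>y. y \<in> U \<Longrightarrow> \<pi> (s y) = y"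
    "smooth_map (patlas P) (latlas G) (\<pi> -` U) \<tau>"
    "\<And>q. \<pi> q \<in> U \<Longrightarrow> pact P (s (\<pi> q)) (\<tau> q) = q"
    by (rule local_section[of "\<pi> p"], rule that)
  note F = hlift_formula[where \<tau> = \<tau> and X = X and p = p, OF *(2,3,5,1) X]
  show "hlift A P \<theta> X p \<in> tangent_space (patlas P) p"
    "smooth_at A (\<pi> p) f \<Longrightarrow> hlift A P \<theta> X p (\<lambda>q. f (\<pi> q)) = X (\<pi> p) f"
    "\<theta> p (hlift A P \<theta> X p) = 0"
    using F by simp_all
qed

text \<open>In the explicit formula \<open>W\<close> is a derivative in the base with the fibre
  coordinate as parameter, and the vertical correction is expanded in a basis of the Lie
  algebra.\<close>

lemma hlift_vfield:
  assumes X: "vfield A U X" shows "vfield (patlas P) (\<pi> -` U) (hlift A P \<theta> X)"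
proof (rule E.vfield_local[OF proj_open[OF M.vfield_open[OF X]]])
  fix p assume p: "p \<in> \<pi> -` U"
  obtain V s \<tau> where *: "\<pi> p \<in> V" "smooth_map A (patlas P) V s" "\<And>y. y \<in> V \<Longrightarrow> \<pi> (s y) = y"
    "smooth_map (patlas P) (latlas G) (\<pi> -` V) \<tau>" "\<And>q. \<pi> q \<in> V \<Longrightarrow> pact P (s (\<pi> q)) (\<tau> q) = q"
    by (rule local_section[of "\<pi> p"], rule that)
  define W where "W = (\<lambda>p. push (patlas P) p (\<lambda>y. pact P (s y) (\<tau> p)) (X (\<pi> p)))"
  let ?N = "\<pi> -` (U \<inter> V)"
  have N: "open ?N" "p \<in> ?N"
    using proj_open M.vfield_open[OF X] smooth_map_open[OF *(2)] p * by auto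
  have XT: "X (\<pi> q) \<in> tangent_space A (\<pi> q)" if "q \<in> ?N" for q
    using M.vfield_tangent[OF X] that by simp
  note F = hlift_formula[where \<tau> = \<tau> and X = X, OF *(2,3,5)]
  have Wv: "vfield (patlas P) ?N W"
  proof (rule E.vfieldI[OF N(1)])
    fix q assume q: "q \<in> ?N"
    show "W q \<in> tangent_space (patlas P) q" unfolding W_def using F(1)[of q, OF _ _ _ XT[OF q]] q by simp
    fix f :: "'p \<Rightarrow> real" assume f: "smooth_at (patlas P) q f"
    obtain O' where O': "open O'" "q \<in> O'" "\<And>y. y \<in> O' \<Longrightarrow> smooth_at (patlas P) y f"
      using E.smooth_at_neighbourhood[OF f] by blast
    have "smooth_at (prod_atlas A (latlas G)) (\<pi> q, \<tau> q) (\<lambda>q. f (pact P (s (fst q)) (snd q)))"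
      by (rule trivialised_smooth_at[OF *(2)]) (use q f *(5) in auto)
    from MG.smooth_at_partial_vfield[OF this X]
    have K: "smooth_at (prod_atlas A (latlas G)) (\<pi> q, \<tau> q)
        (\<lambda>q. X (fst q) (\<lambda>y. f (pact P (s y) (snd q))))" using q by simp
    have "smooth_map (patlas P) (prod_atlas A (latlas G)) (\<pi> -` V) (\<lambda>q. (\<pi> q, \<tau> q))"
      by (rule MG.smooth_map_Pair[OF E.manifold_axioms
            E.smooth_map_subset[OF proj_smooth smooth_map_open[OF *(4)]] *(4)]) simp
    from smooth_at_compose[OF E.manifold_axioms MG.P.manifold_axioms this _ K]
    have "smooth_at (patlas P) q (\<lambda>q. X (\<pi> q) (\<lambda>y. f (pact P (s y) (\<tau> q))))" using q by simp
    then show "smooth_at (patlas P) q (\<lambda>y. W y f)"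
      by (rule E.smooth_at_cong[OF _ O'(1,2)]) (simp add: W_def push_apply O'(3))
  qed
  have V1: "vfield (patlas P) ?N (\<lambda>q f. \<Sum>i\<in>lb. (\<theta> q (W q) \<bullet> i) * vert i q f)"
    by (intro E.vfield_lin_sum[OF N(1)] E.vfield_subset[OF vert_vfield N(1)] subset_UNIV
        E.smooth_fun_bounded_linear[OF theta_smooth[OF Wv]] bounded_linear_inner_left)
  have V2: "vfield (patlas P) ?N (\<lambda>q. vert (\<theta> q (W q)) q)"
    by (rule E.vfield_cong[OF V1]) (rule ext, rule vert_expand[symmetric])
  have "vfield (patlas P) ?N (hlift A P \<theta> X)"
  proof (rule E.vfield_cong[OF E.vfield_tlin_const[OF Wv V2, of 1 "-1"]])
    fix q assume q: "q \<in> ?N"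
    have "hlift A P \<theta> X q = tlin 1 (W q) (-1) (vert (\<theta> q (W q)) q)"
      unfolding W_def by (rule F(2)[OF _ _ _ XT[OF q]]) (use q in auto)
    then show "tlin 1 (W q) (-1) (vert (\<theta> q (W q)) q) = hlift A P \<theta> X q" by (rule sym)
  qed
  with N(2) show "\<exists>V. p \<in> V \<and> vfield (patlas P) V (hlift A P \<theta> X)"
    by (intro exI[of _ ?N] conjI)
qed

lemma hlift_cong: "X (\<pi> p) = Y (\<pi> p) \<Longrightarrow> hlift A P \<theta> X p = hlift A P \<theta> Y p"
  by (simp add: hlift_def)

lemma hlift_tlin:
  assumes X: "X (\<pi> p) \<in> tangent_space A (\<pi> p)" and Y: "Y (\<pi> p) \<in> tangent_space A (\<pi> p)"
  shows "hlift A P \<theta> (\<lambda>x. tlin (f x) (X x) (h x) (Y x)) p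
    = tlin (f (\<pi> p)) (hlift A P \<theta> X p) (h (\<pi> p)) (hlift A P \<theta> Y p)"
proof (rule hlift_eqI)
  show "\<theta> p (tlin (f (\<pi> p)) (hlift A P \<theta> X p) (h (\<pi> p)) (hlift A P \<theta> Y p)) = 0"
    by (simp add: theta_lin hlift_tangent X Y theta_hlift)
  show "tlin (f (\<pi> p)) (X (\<pi> p)) (h (\<pi> p)) (Y (\<pi> p)) \<in> tangent_space A (\<pi> p)"
    by (rule M.tangent_tlin[OF X Y])
  show "tlin (f (\<pi> p)) (hlift A P \<theta> X p) (h (\<pi> p)) (hlift A P \<theta> Y p) \<in> tangent_space (patlas P) p"
    by (rule E.tangent_tlin[OF hlift_tangent[of X p, OF X] hlift_tangent[of Y p, OF Y]])
qed (simp add: tlin_def hlift_proj[of X p, OF X] hlift_proj[of Y p, OF Y])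

lemma hlift_translate:
  assumes X: "X (\<pi> p) \<in> tangent_space A (\<pi> p)"
  shows "hlift A P \<theta> X (pact P p a)
    = push (patlas P) (pact P p a) (\<lambda>q. pact P q a) (hlift A P \<theta> X p)"
proof (rule hlift_eqI)
  note v = hlift_tangent[of X p, OF X]
  show "X (\<pi> (pact P p a)) \<in> tangent_space A (\<pi> (pact P p a))" using X by (simp add: proj_act)
  show "push (patlas P) (pact P p a) (\<lambda>q. pact P q a) (hlift A P \<theta> X p) \<in> tangent_space (patlas P) (pact P p a)"
    by (rule push_tangent[OF E.manifold_axioms E.manifold_axioms translate_smooth UNIV_I v])
  show "push (patlas P) (pact P p a) (\<lambda>q. pact P q a) (hlift A P \<theta> X p) (\<lambda>q. f (\<pi> q)) = X (\<pi> (pact P p a)) f"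
    if "smooth_at A (\<pi> (pact P p a)) f" for f
    using that by (simp add: push_apply[OF smooth_at_proj[OF that]] hlift_proj[of X p, OF X] proj_act)
  show "\<theta> (pact P p a) (push (patlas P) (pact P p a) (\<lambda>q. pact P q a) (hlift A P \<theta> X p)) = 0"
    by (simp add: theta_translate[OF v] theta_hlift[of X p, OF X] linear_0[OF Ad_linear])
qed

end

section \<open>Curvature of a principal connection\<close>

context principal
begin

abbreviation "hl \<equiv> hlift A P \<theta>"
abbreviation "F \<equiv> F_theta A G P \<theta>"
abbreviation "d\<theta> \<equiv> d_theta A P \<theta>"
abbreviation "bracketP \<equiv> lie_bracket (patlas P)"

lemma theta_minus: "v \<in> tangent_space (patlas P) p \<Longrightarrow> \<theta> p (\<lambda>f. - v f) = - \<theta> p v"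
  using theta_lin[of v p v "-1" 0] by (simp add: tlin_def)

lemma theta_hlift_on: "vfield A U X \<Longrightarrow> \<pi> p \<in> U \<Longrightarrow> \<theta> p (hl X p) = 0"
  by (rule theta_hlift[of X p]) (rule M.vfield_tangent)

lemma hlift_tangent_on: "vfield A U X \<Longrightarrow> \<pi> p \<in> U \<Longrightarrow> hl X p \<in> tangent_space (patlas P) p"
  by (rule hlift_tangent[of X p]) (rule M.vfield_tangent)

lemma hlift_proj_on:
  "vfield A U X \<Longrightarrow> \<pi> p \<in> U \<Longrightarrow> smooth_at A (\<pi> p) f \<Longrightarrow> hl X p (\<lambda>q. f (\<pi> q)) = X (\<pi> p) f"
  by (rule hlift_proj[of X p]) (rule M.vfield_tangent)

lemma hlift_bracket_tangent:
  assumes "vfield A U X" "vfield A U Y" "\<pi> p \<in> U"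
  shows "bracketP (hl X) (hl Y) p \<in> tangent_space (patlas P) p"
  by (rule E.lie_bracket_tangent[OF hlift_vfield[OF assms(1)] hlift_vfield[OF assms(2)]])
    (use assms(3) in simp)

text \<open>\<open>\<theta>\<close> vanishes on horizontal lifts over a whole open set, so of the
  structure equation only the bracket term survives.\<close>

lemma F_eq:
  assumes X: "vfield A U X" and Y: "vfield A U Y" and p: "\<pi> p \<in> U"
  shows "F X Y p = - \<theta> p (bracketP (hl X) (hl Y) p)"
proof -
  have "tder (hl X p) (\<lambda>q. \<theta> q (hl Y q)) = 0" if X: "vfield A U X" and Y: "vfield A U Y" for X Y
  proof -
    have "tder (hl X p) (\<lambda>q. \<theta> q (hl Y q)) = tder (hl X p) (\<lambda>q. 0)"
      by (rule E.tder_cong[OF hlift_tangent_on[OF X p] proj_open[OF M.vfield_open[OF X]]])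
        (use p theta_hlift_on[OF Y] in auto)
    then show ?thesis by (simp add: E.tder_const[OF hlift_tangent_on[OF X p]])
  qed
  then show ?thesis using X Y linear_0[OF lbr_linear]
    by (simp add: F_theta_def conn_form_curvature_def theta_hlift_on[OF X p] theta_hlift_on[OF Y p])
qed

lemma F_antisym:
  assumes X: "vfield A U X" and Y: "vfield A U Y" and p: "\<pi> p \<in> U"
  shows "F Y X p = - F X Y p"
proof -
  have "bracketP (hl Y) (hl X) p = (\<lambda>f. - bracketP (hl X) (hl Y) p f)"
    by (rule ext) (rule E.lie_bracket_antisym)
  then show ?thesis
    using theta_minus[OF hlift_bracket_tangent[OF X Y p]] by (simp add: F_eq[OF X Y p] F_eq[OF Y X p])
qed

lemma F_cong:
  assumes X: "vfield A U X" and Y: "vfield A U Y" and p: "\<pi> p \<in> U"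
    and eq: "\<And>x. x \<in> U \<Longrightarrow> X x = X' x" "\<And>x. x \<in> U \<Longrightarrow> Y x = Y' x"
  shows "F X Y p = F X' Y' p"
proof -
  have "bracketP (hl X) (hl Y) p = bracketP (hl X') (hl Y') p"
    by (rule E.lie_bracket_cong_on[OF hlift_vfield[OF X] hlift_vfield[OF Y]])
      (use p eq in \<open>auto intro: hlift_cong\<close>)
  then show ?thesis
    by (simp add: F_eq[OF X Y p] F_eq[OF M.vfield_cong[OF X eq(1)] M.vfield_cong[OF Y eq(2)] p])
qed

text \<open>The term in which \<open>f\<close> is differentiated is horizontal and is killed by
  \<open>\<theta>\<close>; the curvature is therefore tensorial.\<close>

lemma F_leibniz:
  assumes X: "vfield A U X" and Y: "vfield A U Y" and Y': "vfield A U Y'"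
    and f: "smooth_fun A U f" and p: "\<pi> p \<in> U"
  shows "F X (\<lambda>x. tlin (f x) (Y x) 1 (Y' x)) p = f (\<pi> p) *\<^sub>R F X Y p + F X Y' p"
proof -
  have Z: "vfield A U (\<lambda>x. tlin (f x) (Y x) 1 (Y' x))"
    by (rule M.vfield_tlin[OF Y Y' f M.smooth_fun_const[OF M.vfield_open[OF X]]])
  have fs: "smooth_fun (patlas P) (\<pi> -` U) (\<lambda>q. f (\<pi> q))"
    using smooth_fun_compose[OF E.manifold_axioms M.manifold_axioms proj_smooth f] by simp
  have "bracketP (hl X) (hl (\<lambda>x. tlin (f x) (Y x) 1 (Y' x))) p
      = bracketP (hl X) (\<lambda>q. tlin (f (\<pi> q)) (hl Y q) 1 (hl Y' q)) p"
  proof (rule E.lie_bracket_cong_on[OF hlift_vfield[OF X] hlift_vfield[OF Z]])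
    fix q assume q: "q \<in> \<pi> -` U"
    show "hl (\<lambda>x. tlin (f x) (Y x) 1 (Y' x)) q = tlin (f (\<pi> q)) (hl Y q) 1 (hl Y' q)"
      using hlift_tlin[of Y q Y' f "\<lambda>_. 1"] M.vfield_tangent[OF Y] M.vfield_tangent[OF Y'] q by simp
  qed (use p in auto)
  also have "\<dots> = tlin (f (\<pi> p)) (bracketP (hl X) (hl Y) p) 1
      (tlin (hl X p (\<lambda>q. f (\<pi> q))) (hl Y p) 1 (bracketP (hl X) (hl Y') p))"
    by (rule E.lie_bracket_leibniz[OF hlift_vfield[OF X] hlift_vfield[OF Y] hlift_vfield[OF Y'] fs])
      (use p in simp)
  finally show ?thesis
    by (simp add: F_eq[OF X Z p] F_eq[OF X Y p] F_eq[OF X Y' p] theta_lin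
        hlift_bracket_tangent[OF X Y p] hlift_bracket_tangent[OF X Y' p]
        E.tangent_tlin hlift_tangent_on[OF Y p] theta_hlift_on[OF Y p])
qed

lemma F_add:
  assumes X: "vfield A U X" and Y: "vfield A U Y" and Z: "vfield A U Z" and p: "\<pi> p \<in> U"
  shows "F X (\<lambda>y. tlin 1 (Y y) 1 (Z y)) p = F X Y p + F X Z p"
  using F_leibniz[OF X Y Z M.smooth_fun_const[OF M.vfield_open[OF X]] p, of 1] by simp

text \<open>The curvature is the obstruction to the horizontal lift being a Lie algebra homomorphism.\<close>

lemma bracket_hlift:
  assumes X: "vfield A U X" and Y: "vfield A U Y" and p: "\<pi> p \<in> U"
  shows "bracketP (hl X) (hl Y) p f = hl (lie_bracket A X Y) p f - vert (F X Y p) p f"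
proof -
  have XY: "vfield A U (lie_bracket A X Y)" by (rule M.lie_bracket_vfield[OF X Y])
  have t: "tlin 1 (hl (lie_bracket A X Y) p) (-1) (vert (F X Y p) p) \<in> tangent_space (patlas P) p"
    by (rule E.tangent_tlin[OF hlift_tangent_on[OF XY p] vert_tangent])
  have "bracketP (hl X) (hl Y) p = tlin 1 (hl (lie_bracket A X Y) p) (-1) (vert (F X Y p) p)"
  proof (rule horizontal_unique[OF hlift_bracket_tangent[OF X Y p] t])
    fix f :: "'m \<Rightarrow> real" assume f: "smooth_at A (\<pi> p) f"
    obtain N where N: "open N" "\<pi> p \<in> N" "\<And>y. y \<in> N \<Longrightarrow> smooth_at A y f"
      using M.smooth_at_neighbourhood[OF f] by blast
    have it: "hl X p (\<lambda>q. hl Y q (\<lambda>q. f (\<pi> q))) = X (\<pi> p) (\<lambda>y. Y y f)"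
      if X: "vfield A U X" and Y: "vfield A U Y" for X Y
    proof -
      have "hl X p (\<lambda>q. hl Y q (\<lambda>q. f (\<pi> q))) = hl X p (\<lambda>q. Y (\<pi> q) f)"
        by (rule E.tangent_cong[OF hlift_tangent_on[OF X p], of "\<pi> -` (N \<inter> U)"])
          (use N p proj_open[OF open_Int[OF N(1) M.vfield_open[OF X]]] hlift_proj_on[OF Y] in auto)
      also have "\<dots> = X (\<pi> p) (\<lambda>y. Y y f)"
        by (rule hlift_proj_on[OF X p M.vfield_smooth_at[OF Y p f]])
      finally show ?thesis .
    qed
    show "bracketP (hl X) (hl Y) p (\<lambda>q. f (\<pi> q))
        = tlin 1 (hl (lie_bracket A X Y) p) (-1) (vert (F X Y p) p) (\<lambda>q. f (\<pi> q))"
      by (simp add: E.lie_bracket_apply smooth_at_proj f it[OF X Y] it[OF Y X] tlin_def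
          vert_proj hlift_proj_on[OF XY p f] M.lie_bracket_apply)
  next
    show "\<theta> p (bracketP (hl X) (hl Y) p)
        = \<theta> p (tlin 1 (hl (lie_bracket A X Y) p) (-1) (vert (F X Y p) p))"
      by (simp add: theta_lin hlift_tangent_on[OF XY p] vert_tangent theta_vert
          theta_hlift_on[OF XY p] F_eq[OF X Y p])
  qed
  then show ?thesis by (simp add: tlin_def)
qed

lemma F_smooth:
  assumes X: "vfield A U X" and Y: "vfield A U Y" shows "smooth_fun (patlas P) (\<pi> -` U) (F X Y)"
proof (rule E.smooth_fun_cong)
  show "smooth_fun (patlas P) (\<pi> -` U) (\<lambda>p. - \<theta> p (bracketP (hl X) (hl Y) p))"
    by (rule E.smooth_fun_bounded_linear[OF theta_smooth[OF
            E.lie_bracket_vfield[OF hlift_vfield[OF X] hlift_vfield[OF Y]]]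
          bounded_linear_minus[OF bounded_linear_ident]])
qed (simp add: F_eq[OF X Y])

section \<open>Invariance of horizontal lifts and equivariance of the curvature\<close>

lemma hlift_translate_apply:
  assumes X: "vfield A U X" and p: "\<pi> p \<in> U" and f: "smooth_at (patlas P) (pact P p a) f"
  shows "hl X (pact P p a) f = hl X p (\<lambda>q. f (pact P q a))"
  using hlift_translate[of X p a, OF M.vfield_tangent[OF X p]] push_apply[OF f] by simp

text \<open>Right translations carry horizontal lifts to themselves, hence also their brackets.
  Equivariance of \<open>F\<close> then comes from that of \<open>\<theta>\<close>.\<close>

lemma bracket_hlift_translate:
  assumes X: "vfield A U X" and Y: "vfield A U Y" and p: "\<pi> p \<in> U"
  shows "bracketP (hl X) (hl Y) (pact P p a)
    = push (patlas P) (pact P p a) (\<lambda>q. pact P q a) (bracketP (hl X) (hl Y) p)"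
proof (rule E.tangent_eqI)
  show "bracketP (hl X) (hl Y) (pact P p a) \<in> tangent_space (patlas P) (pact P p a)"
    by (rule hlift_bracket_tangent[OF X Y]) (simp add: proj_act p)
  show "push (patlas P) (pact P p a) (\<lambda>q. pact P q a) (bracketP (hl X) (hl Y) p)
      \<in> tangent_space (patlas P) (pact P p a)"
    by (rule push_tangent[OF E.manifold_axioms E.manifold_axioms translate_smooth UNIV_I
          hlift_bracket_tangent[OF X Y p]])
  fix f :: "'p \<Rightarrow> real" assume f: "smooth_at (patlas P) (pact P p a) f"
  obtain N where N: "open N" "pact P p a \<in> N" "\<And>y. y \<in> N \<Longrightarrow> smooth_at (patlas P) y f"
    using E.smooth_at_neighbourhood[OF f] by blast
  have fa: "smooth_at (patlas P) p (\<lambda>q. f (pact P q a))"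
    by (rule smooth_at_compose[OF E.manifold_axioms E.manifold_axioms translate_smooth UNIV_I f])
  have oN: "open ((\<lambda>q. pact P q a) -` N \<inter> \<pi> -` U)"
    using smooth_map_preimage_open[OF translate_smooth N(1), of a] proj_open[OF M.vfield_open[OF X]]
    by auto
  have it: "hl X (pact P p a) (\<lambda>q. hl Y q f) = hl X p (\<lambda>q. hl Y q (\<lambda>q. f (pact P q a)))"
    if X: "vfield A U X" and Y: "vfield A U Y" for X Y
  proof -
    have "smooth_at (patlas P) (pact P p a) (\<lambda>q. hl Y q f)"
      by (rule E.vfield_smooth_at[OF hlift_vfield[OF Y] _ f]) (simp add: proj_act p)
    then have "hl X (pact P p a) (\<lambda>q. hl Y q f) = hl X p (\<lambda>q. hl Y (pact P q a) f)"
      by (rule hlift_translate_apply[OF X p])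
    also have "\<dots> = hl X p (\<lambda>q. hl Y q (\<lambda>q. f (pact P q a)))"
      by (rule E.tangent_cong[OF hlift_tangent_on[OF X p] oN])
        (use N p hlift_translate_apply[OF Y] in auto)
    finally show ?thesis .
  qed
  show "bracketP (hl X) (hl Y) (pact P p a) f
      = push (patlas P) (pact P p a) (\<lambda>q. pact P q a) (bracketP (hl X) (hl Y) p) f"
    by (simp add: push_apply[OF f] E.lie_bracket_apply f fa it[OF X Y] it[OF Y X])
qed

lemma F_equivariant:
  assumes X: "vfield A U X" and Y: "vfield A U Y" and p: "\<pi> p \<in> U"
  shows "F X Y (pact P p a) = Ad G (inv\<^bsub>G\<^esub> a) (F X Y p)"
proof -
  have "F X Y (pact P p a) = - Ad G (inv\<^bsub>G\<^esub> a) (\<theta> p (bracketP (hl X) (hl Y) p))"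
    using F_eq[OF X Y, of "pact P p a"]
    by (simp add: proj_act p bracket_hlift_translate[OF X Y p]
        theta_translate[OF hlift_bracket_tangent[OF X Y p]])
  then show ?thesis using linear_neg[OF Ad_linear] by (simp add: F_eq[OF X Y p])
qed

lemma F_section: "vfield A U X \<Longrightarrow> vfield A U Y \<Longrightarrow> ad_section G P U (F X Y)"
  unfolding ad_section_def using M.vfield_open F_smooth F_equivariant by blast

text \<open>The infinitesimal form of the invariance of lifts: \<open>f (pact P q a)\<close> is
  differentiated in \<open>q\<close> and in \<open>a\<close>, in either order.\<close>

lemma hlift_vert_commute:
  assumes X: "vfield A U X" and p: "\<pi> p \<in> U" and f: "smooth_at (patlas P) p f"
  shows "hl X p (\<lambda>q. vert \<xi> q f) = vert \<xi> p (\<lambda>q. hl X q f)"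
proof -
  obtain N where N: "open N" "p \<in> N" "\<And>y. y \<in> N \<Longrightarrow> smooth_at (patlas P) y f"
    using E.smooth_at_neighbourhood[OF f] by blast
  have "hl X p (\<lambda>q. vert \<xi> q f) = hl X p (\<lambda>q. lalg G \<xi> (\<lambda>a. f (pact P q a)))"
    by (rule E.tangent_cong[OF hlift_tangent_on[OF X p] N(1,2)]) (simp add: vert_apply N(3))
  also have "\<dots> = lalg G \<xi> (\<lambda>a. hl X p (\<lambda>q. f (pact P q a)))"
    using EG.mixed_derivative[OF act_smooth_at[OF f] hlift_tangent_on[OF X p] lalg_tangent, of \<xi>]
    by simp
  also have "\<dots> = lalg G \<xi> (\<lambda>a. hl X (pact P p a) f)"
    by (rule LM.tangent_cong[OF lalg_tangent, of "(\<lambda>a. pact P p a) -` N"])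
      (use smooth_map_preimage_open[OF orbit_smooth N(1), of p] N hlift_translate_apply[OF X p]
        in \<open>auto simp: act_one\<close>)
  also have "\<dots> = vert \<xi> p (\<lambda>q. hl X q f)"
    by (rule vert_apply[symmetric], rule E.vfield_smooth_at[OF hlift_vfield[OF X] _ f]) (simp add: p)
  finally show ?thesis .
qed

lemma vert_field_vfield:
  assumes k: "smooth_fun (patlas P) W k" shows "vfield (patlas P) W (\<lambda>q. vert (k q) q)"
proof -
  have W: "open W" by (rule smooth_fun_open[OF k])
  have "vfield (patlas P) W (\<lambda>q f. \<Sum>i\<in>lb. (k q \<bullet> i) * vert i q f)"
    by (intro E.vfield_lin_sum[OF W] E.vfield_subset[OF vert_vfield W] subset_UNIV
        E.smooth_fun_bounded_linear[OF k] bounded_linear_inner_left)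
  then show ?thesis by (rule E.vfield_cong) (rule ext, rule vert_expand[symmetric])
qed

text \<open>The lift commutes with the fundamental fields of basis elements, so only the
  coefficients of \<open>k\<close> get differentiated.\<close>

lemma bracket_hlift_vert:
  assumes X: "vfield A U X" and p: "\<pi> p \<in> U" and k: "smooth_fun (patlas P) (\<pi> -` U) k"
  shows "bracketP (hl X) (\<lambda>q. vert (k q) q) p = vert (tder (hl X p) k) p"
proof (rule E.tangent_eqI)
  have pU: "p \<in> \<pi> -` U" using p by simp
  show "bracketP (hl X) (\<lambda>q. vert (k q) q) p \<in> tangent_space (patlas P) p"
    by (rule E.lie_bracket_tangent[OF hlift_vfield[OF X] vert_field_vfield[OF k] pU])
  show "vert (tder (hl X p) k) p \<in> tangent_space (patlas P) p" by (rule vert_tangent)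
  fix f :: "'p \<Rightarrow> real" assume f: "smooth_at (patlas P) p f"
  have T: "hl X p \<in> tangent_space (patlas P) p" by (rule hlift_tangent_on[OF X p])
  have sk: "smooth_at (patlas P) p (\<lambda>q. k q \<bullet> i)" for i
    by (rule E.smooth_at_inner[OF smooth_atI[OF k pU]])
  have sv: "smooth_at (patlas P) p (\<lambda>q. vert i q f)" for i
    by (rule E.vfield_smooth_at[OF vert_vfield UNIV_I f])
  have "hl X p (\<lambda>q. vert (k q) q f) = hl X p (\<lambda>q. \<Sum>i\<in>lb. (k q \<bullet> i) * vert i q f)"
    by (subst vert_expand) (rule refl)
  also have "\<dots> = (\<Sum>i\<in>lb. hl X p (\<lambda>q. (k q \<bullet> i) * vert i q f))"
    by (rule E.tangent_sum[OF T E.smooth_at_mult[OF sk sv]])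
  also have "\<dots> = (\<Sum>i\<in>lb. (tder (hl X p) k \<bullet> i) * vert i p f + (k p \<bullet> i) * vert i p (\<lambda>q. hl X q f))"
    by (simp add: E.tangent_mult[OF T sk sv] hlift_vert_commute[OF X p f]
        E.tder_inner[OF lie_basis T smooth_atI[OF k pU]])
  also have "\<dots> = vert (tder (hl X p) k) p f + vert (k p) p (\<lambda>q. hl X q f)"
    unfolding vert_expand[of "tder (hl X p) k"] vert_expand[of "k p"] by (simp add: sum.distrib)
  finally show "bracketP (hl X) (\<lambda>q. vert (k q) q) p f = vert (tder (hl X p) k) p f"
    by (simp add: E.lie_bracket_apply[OF f])
qed

text \<open>Insert \<open>[hl Y, hl Z] = hl [Y, Z] - vert F(Y, Z)\<close> into the outer bracket and
  apply \<open>\<theta>\<close>: the first part is a curvature, the second the derivative of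
  one.\<close>

lemma theta_iterated_bracket:
  assumes X: "vfield A U X" and Y: "vfield A U Y" and Z: "vfield A U Z" and p: "\<pi> p \<in> U"
  shows "bracketP (hl X) (bracketP (hl Y) (hl Z)) p \<in> tangent_space (patlas P) p"
    and "\<theta> p (bracketP (hl X) (bracketP (hl Y) (hl Z)) p)
      = - F X (lie_bracket A Y Z) p - d\<theta> X (F Y Z) p"
proof -
  have YZ: "vfield A U (lie_bracket A Y Z)" by (rule M.lie_bracket_vfield[OF Y Z])
  have pU: "p \<in> \<pi> -` U" using p by simp
  note vX = hlift_vfield[OF X] and vYZ = hlift_vfield[OF YZ] and vV = vert_field_vfield[OF F_smooth[OF Y Z]]
  note B = E.lie_bracket_vfield[OF hlift_vfield[OF Y] hlift_vfield[OF Z]]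
  show "bracketP (hl X) (bracketP (hl Y) (hl Z)) p \<in> tangent_space (patlas P) p"
    by (rule E.lie_bracket_tangent[OF vX B pU])
  have eq: "bracketP (hl Y) (hl Z) q
      = tlin (-1) (vert (F Y Z q) q) 1 (hl (lie_bracket A Y Z) q)" if "q \<in> \<pi> -` U" for q
    using bracket_hlift[OF Y Z, of q] that by (auto simp: tlin_def)
  have "bracketP (hl X) (bracketP (hl Y) (hl Z)) p
      = bracketP (hl X) (\<lambda>q. tlin (-1) (vert (F Y Z q) q) 1 (hl (lie_bracket A Y Z) q)) p"
    by (rule E.lie_bracket_cong_on[OF vX B pU refl eq])
  also have "\<dots> = tlin (-1) (bracketP (hl X) (\<lambda>q. vert (F Y Z q) q) p) 1
      (tlin (hl X p (\<lambda>q. -1)) (vert (F Y Z p) p) 1 (bracketP (hl X) (hl (lie_bracket A Y Z)) p))"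
    by (rule E.lie_bracket_leibniz[OF vX vV vYZ E.smooth_fun_const[OF E.vfield_open[OF vX]] pU])
  also have "\<dots> = tlin (-1) (vert (tder (hl X p) (F Y Z)) p) 1 (bracketP (hl X) (hl (lie_bracket A Y Z)) p)"
    by (simp add: bracket_hlift_vert[OF X p F_smooth[OF Y Z]] E.tangent_const[OF hlift_tangent_on[OF X p]] tlin_def)
  finally show "\<theta> p (bracketP (hl X) (bracketP (hl Y) (hl Z)) p)
      = - F X (lie_bracket A Y Z) p - d\<theta> X (F Y Z) p"
    by (simp add: theta_lin vert_tangent hlift_bracket_tangent[OF X YZ p] theta_vert d_theta_def
        F_eq[OF X YZ p])
qed

text \<open>\<open>\<theta>\<close> applied to the Jacobi identity of three horizontal lifts. The
  form with brackets of vector fields involves no connection on the tangent bundle.\<close>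

lemma bianchi_F:
  assumes X: "vfield A U X" and Y: "vfield A U Y" and Z: "vfield A U Z" and p: "\<pi> p \<in> U"
  shows "d\<theta> X (F Y Z) p + d\<theta> Y (F Z X) p + d\<theta> Z (F X Y) p
    + F X (lie_bracket A Y Z) p + F Y (lie_bracket A Z X) p + F Z (lie_bracket A X Y) p = 0"
proof -
  let ?b = "\<lambda>X Y Z. bracketP (hl X) (bracketP (hl Y) (hl Z)) p"
  note t = theta_iterated_bracket[OF X Y Z p] theta_iterated_bracket[OF Y Z X p]
    theta_iterated_bracket[OF Z X Y p]
  have "?b X Y Z f + ?b Y Z X f + ?b Z X Y f = 0" for f
    by (rule E.jacobi_identity[OF hlift_vfield[OF X] hlift_vfield[OF Y] hlift_vfield[OF Z]])
      (use p in simp)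
  then have "tlin 1 (?b X Y Z) 1 (tlin 1 (?b Y Z X) 1 (?b Z X Y)) = (\<lambda>_. 0)"
    by (auto simp: tlin_def add.assoc)
  then have "\<theta> p (?b X Y Z) + (\<theta> p (?b Y Z X) + \<theta> p (?b Z X Y)) = 0"
    using theta_lin[OF t(1) E.tangent_tlin[OF t(3,5)], of 1 1 1 1] theta_lin[OF t(3,5), of 1 1]
    by (simp add: theta_zero)
  then have "- (\<theta> p (?b X Y Z) + (\<theta> p (?b Y Z X) + \<theta> p (?b Z X Y))) = 0" by simp
  then show ?thesis unfolding t(2,4,6) by (simp add: algebra_simps)
qed

section \<open>Sections of the adjoint bundle\<close>

lemma ad_section_smooth_at: "ad_section G P U r \<Longrightarrow> \<pi> p \<in> U \<Longrightarrow> smooth_at (patlas P) p r"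
  unfolding ad_section_def by (rule smooth_atI) auto

lemma ad_section_equivariant:
  "ad_section G P U r \<Longrightarrow> \<pi> p \<in> U \<Longrightarrow> r (pact P p a) = Ad G (inv\<^bsub>G\<^esub> a) (r p)"
  unfolding ad_section_def by blast

lemma ad_section_open: "ad_section G P U r \<Longrightarrow> open U"
  unfolding ad_section_def by blast

lemma ad_section_subset:
  assumes r: "ad_section G P U r" and "open V" "V \<subseteq> U" shows "ad_section G P V r"
proof -
  have "smooth_fun (patlas P) (\<pi> -` V) r"
    by (rule E.smooth_fun_subset[OF _ proj_open[OF assms(2)], of "\<pi> -` U"])
      (use r assms(3) in \<open>auto simp: ad_section_def\<close>)
  then show ?thesis using r assms unfolding ad_section_def by blast
qed

lemma d_theta_inner:
  assumes X: "vfield A U X" and r: "smooth_at (patlas P) p r" and p: "\<pi> p \<in> U"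
  shows "d\<theta> X r p \<bullet> z = hl X p (\<lambda>q. r q \<bullet> z)"
  unfolding d_theta_def by (rule E.tder_inner[OF lie_basis hlift_tangent_on[OF X p] r])

lemma d_theta_smooth_at:
  assumes X: "vfield A U X" and r: "ad_section G P U r" and p: "\<pi> p \<in> U"
  shows "smooth_at (patlas P) p (d\<theta> X r)"
proof -
  have s: "smooth_at (patlas P) p (\<lambda>q. \<Sum>i\<in>lb. hl X q (\<lambda>q. r q \<bullet> i) *\<^sub>R i)"
    by (intro E.smooth_at_sum E.smooth_at_scaleR E.smooth_at_const
        E.vfield_smooth_at[OF hlift_vfield[OF X]] E.smooth_at_inner ad_section_smooth_at[OF r p])
      (simp add: p)
  show ?thesis
  proof (rule E.smooth_at_cong[OF s proj_open[OF M.vfield_open[OF X]]])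
    fix q assume q: "q \<in> \<pi> -` U"
    have "(\<Sum>i\<in>lb. hl X q (\<lambda>q. r q \<bullet> i) *\<^sub>R i) = (\<Sum>i\<in>lb. (d\<theta> X r q \<bullet> i) *\<^sub>R i)"
      by (rule sum.cong) (use q d_theta_inner[OF X ad_section_smooth_at[OF r]] in auto)
    then show "(\<Sum>i\<in>lb. hl X q (\<lambda>q. r q \<bullet> i) *\<^sub>R i) = d\<theta> X r q"
      by (simp only: orthobasis_sum[OF lie_basis])
  qed (use p in simp)
qed

text \<open>Equivariance of the derivative: lifts are invariant under translation, and the fixed
  linear map \<open>Ad G (inv a)\<close> commutes with differentiation.\<close>

lemma d_theta_section:
  assumes X: "vfield A U X" and r: "ad_section G P U r"
  shows "ad_section G P U (d\<theta> X r)"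
  unfolding ad_section_def
proof (intro conjI allI impI)
  show "open U" by (rule ad_section_open[OF r])
  show "smooth_fun (patlas P) (\<pi> -` U) (d\<theta> X r)"
    by (rule E.smooth_fun_local[OF _ proj_open[OF ad_section_open[OF r]]])
      (auto intro!: d_theta_smooth_at[OF X r])
  fix p a assume p: "\<pi> p \<in> U"
  let ?L = "Ad G (inv\<^bsub>G\<^esub> a)"
  have bl: "bounded_linear ?L" by (rule orthobasis_linear_bounded[OF lie_basis Ad_linear])
  have rp: "smooth_at (patlas P) p r" by (rule ad_section_smooth_at[OF r p])
  have T: "hl X p \<in> tangent_space (patlas P) p" by (rule hlift_tangent_on[OF X p])
  have pa: "\<pi> (pact P p a) \<in> U" by (simp add: proj_act p)
  have "d\<theta> X r (pact P p a) \<bullet> z = ?L (d\<theta> X r p) \<bullet> z" for z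
  proof -
    have "d\<theta> X r (pact P p a) \<bullet> z = hl X p (\<lambda>q. r (pact P q a) \<bullet> z)"
      using hlift_translate_apply[OF X p E.smooth_at_inner[OF ad_section_smooth_at[OF r pa]]]
      by (simp add: d_theta_inner[OF X ad_section_smooth_at[OF r pa] pa])
    also have "\<dots> = hl X p (\<lambda>q. ?L (r q) \<bullet> z)"
      by (rule E.tangent_cong[OF T proj_open[OF ad_section_open[OF r]]])
        (use p ad_section_equivariant[OF r] in auto)
    also have "\<dots> = hl X p (\<lambda>q. \<Sum>i\<in>lb. (?L i \<bullet> z) * (r q \<bullet> i))"
    proof -
      have "?L v \<bullet> z = (\<Sum>i\<in>lb. (?L i \<bullet> z) * (v \<bullet> i))" for v
      proof -
        have "?L v = ?L (\<Sum>i\<in>lb. (v \<bullet> i) *\<^sub>R i)" by (simp only: orthobasis_sum[OF lie_basis])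
        then show ?thesis
          by (simp add: linear_sum[OF Ad_linear] linear_scale[OF Ad_linear] inner_sum_left mult.commute)
      qed
      then have "(\<lambda>q. ?L (r q) \<bullet> z) = (\<lambda>q. \<Sum>i\<in>lb. (?L i \<bullet> z) * (r q \<bullet> i))" by blast
      then show ?thesis by (rule arg_cong)
    qed
    also have "\<dots> = (\<Sum>i\<in>lb. (?L i \<bullet> z) * (d\<theta> X r p \<bullet> i))"
      by (simp add: E.tangent_sum[OF T] E.smooth_at_mult E.smooth_at_const E.smooth_at_inner rp
          E.tangent_cmult[OF T] d_theta_inner[OF X rp p])
    also have "\<dots> = ?L (\<Sum>i\<in>lb. (d\<theta> X r p \<bullet> i) *\<^sub>R i) \<bullet> z"
      by (simp add: linear_sum[OF Ad_linear] linear_scale[OF Ad_linear] inner_sum_left mult.commute)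
    finally show ?thesis by (simp only: orthobasis_sum[OF lie_basis])
  qed
  then show "d\<theta> X r (pact P p a) = ?L (d\<theta> X r p)" by (metis vector_eq_rdot)
qed

lemma d_theta_diff:
  assumes X: "vfield A U X" and p: "\<pi> p \<in> U" and r: "smooth_at (patlas P) p r"
    and t: "smooth_at (patlas P) p t"
  shows "d\<theta> X (\<lambda>q. r q - t q) p = d\<theta> X r p - d\<theta> X t p"
  unfolding d_theta_def by (rule E.tder_diff[OF lie_basis hlift_tangent_on[OF X p] r t])

text \<open>By \<open>bracket_hlift\<close> the commutator of lifts exceeds the lift of the bracket
  by \<open>- vert F\<close>. The right-hand side is the bracket of \<open>F\<close> with
  \<open>r\<close> in the guise of a vertical derivative; its linearity in \<open>F\<close> is what
  contraction with the spinor will use.\<close>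

lemma d_theta_curvature:
  assumes X: "vfield A U X" and Y: "vfield A U Y" and r: "ad_section G P U r" and p: "\<pi> p \<in> U"
  shows "d\<theta> X (d\<theta> Y r) p - d\<theta> Y (d\<theta> X r) p - d\<theta> (lie_bracket A X Y) r p
    = - tder (vert (F X Y p) p) r"
proof -
  have it: "d\<theta> X (d\<theta> Y r) p \<bullet> z = hl X p (\<lambda>q. hl Y q (\<lambda>q. r q \<bullet> z))"
    if X: "vfield A U X" and Y: "vfield A U Y" for X Y z
  proof -
    have "d\<theta> X (d\<theta> Y r) p \<bullet> z = hl X p (\<lambda>q. d\<theta> Y r q \<bullet> z)"
      by (rule d_theta_inner[OF X d_theta_smooth_at[OF Y r p] p])
    also have "\<dots> = hl X p (\<lambda>q. hl Y q (\<lambda>q. r q \<bullet> z))"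
      by (rule E.tangent_cong[OF hlift_tangent_on[OF X p] proj_open[OF M.vfield_open[OF X]]])
        (use p d_theta_inner[OF Y ad_section_smooth_at[OF r]] in auto)
    finally show ?thesis .
  qed
  have rp: "smooth_at (patlas P) p r" by (rule ad_section_smooth_at[OF r p])
  have "(d\<theta> X (d\<theta> Y r) p - d\<theta> Y (d\<theta> X r) p - d\<theta> (lie_bracket A X Y) r p) \<bullet> z
      = (- tder (vert (F X Y p) p) r) \<bullet> z" for z
    using bracket_hlift[OF X Y p, of "\<lambda>q. r q \<bullet> z"]
    by (simp add: inner_diff_left it[OF X Y] it[OF Y X] d_theta_inner[OF M.lie_bracket_vfield[OF X Y] rp p]
        E.tder_inner[OF lie_basis vert_tangent rp] E.lie_bracket_apply[OF E.smooth_at_inner[OF rp]])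
  then show ?thesis by (metis vector_eq_rdot)
qed

lemma tder_vert_linear:
  fixes r :: "'p \<Rightarrow> 'l"
  assumes r: "smooth_at (patlas P) p r"
  shows "linear (\<lambda>\<xi>. tder (vert \<xi> p) r)"
proof (rule linearI)
  fix \<xi> \<zeta> :: 'l and k :: real
  have "tder (vert (\<xi> + \<zeta>) p) r \<bullet> z = (tder (vert \<xi> p) r + tder (vert \<zeta> p) r) \<bullet> z" for z
    by (simp add: inner_add_left E.tder_inner[OF lie_basis vert_tangent[of _ p] r] linear_add[OF vert_linear])
  then show "tder (vert (\<xi> + \<zeta>) p) r = tder (vert \<xi> p) r + tder (vert \<zeta> p) r"
    by (metis vector_eq_rdot)
  have "tder (vert (k *\<^sub>R \<xi>) p) r \<bullet> z = (k *\<^sub>R tder (vert \<xi> p) r) \<bullet> z" for z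
    by (simp add: E.tder_inner[OF lie_basis vert_tangent[of _ p] r] linear_scale[OF vert_linear])
  then show "tder (vert (k *\<^sub>R \<xi>) p) r = k *\<^sub>R tder (vert \<xi> p) r"
    by (metis vector_eq_rdot)
qed

end

section \<open>The invariant pairing on ad P\<close>

locale paired = principal G lb A P \<theta>
  for G :: "('k::{t2_space, second_countable_topology}, 'l::real_inner) lie_data" and lb
    and A :: "('m::{t2_space, second_countable_topology}, real^'n) atlas"
    and P :: "('p::{t2_space, second_countable_topology}, 'ep::euclidean_space, 'm, 'k) pbundle"
    and \<theta> +
  fixes B :: "'l \<Rightarrow> 'l \<Rightarrow> real"
  assumes form: "biinvariant_form G B"
begin

lemma B_bilinear: "bilinear B" and B_commute: "B \<xi> \<zeta> = B \<zeta> \<xi>"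
  and B_Ad: "B (Ad G a \<xi>) (Ad G a \<zeta>) = B \<xi> \<zeta>"
  using form by (simp_all add: biinvariant_form_def)

text \<open>Points of one fibre differ by a group element and \<open>B\<close> is Ad-invariant, so
  the point chosen in \<open>ad_pair\<close> may be replaced by any other.\<close>

lemma pair_eq:
  assumes r: "ad_section G P U r" and t: "ad_section G P U t" and p: "\<pi> p \<in> U"
  shows "ad_pair P B r t (\<pi> p) = B (r p) (t p)"
proof -
  have "\<pi> (SOME q. \<pi> q = \<pi> p) = \<pi> p" by (rule someI[of "\<lambda>q. \<pi> q = \<pi> p" p]) simp
  then obtain a where "(SOME q. \<pi> q = \<pi> p) = pact P p a" using act_transitive by metis
  then show ?thesis
    by (simp add: ad_pair_def ad_section_equivariant[OF r p] ad_section_equivariant[OF t p] B_Ad)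
qed

lemma pair_smooth:
  assumes r: "ad_section G P U r" and t: "ad_section G P U t"
  shows "smooth_fun A U (ad_pair P B r t)"
proof (rule M.smooth_fun_local[OF _ ad_section_open[OF r]])
  fix x assume x: "x \<in> U"
  obtain V s \<tau> where *: "x \<in> V" "smooth_map A (patlas P) V s" "\<And>y. y \<in> V \<Longrightarrow> \<pi> (s y) = y"
    "smooth_map (patlas P) (latlas G) (\<pi> -` V) \<tau>" "\<And>q. \<pi> q \<in> V \<Longrightarrow> pact P (s (\<pi> q)) (\<tau> q) = q"
    by (rule local_section[of x], rule that)
  have sx: "\<pi> (s x) \<in> U" using * x by simp
  have "smooth_at (patlas P) (s x) (\<lambda>p. B (r p) (t p))"
    by (rule E.smooth_at_bilinear[OF lie_basis lie_basis B_bilinear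
          ad_section_smooth_at[OF r sx] ad_section_smooth_at[OF t sx]])
  from smooth_at_compose[OF M.manifold_axioms E.manifold_axioms *(2,1) this]
  show "smooth_at A x (ad_pair P B r t)"
  proof (rule M.smooth_at_cong)
    show "open (V \<inter> U)" using smooth_map_open[OF *(2)] ad_section_open[OF r] by blast
    fix y assume "y \<in> V \<inter> U"
    then show "B (r (s y)) (t (s y)) = ad_pair P B r t y"
      using pair_eq[OF r t, of "s y"] *(3) by simp
  qed (use x * in blast)
qed

text \<open>Lifted to P, the derivative runs along the horizontal lift, and there \<open>B\<close>
  is a fixed bilinear form on a fixed vector space.\<close>

lemma pair_derivative:
  assumes X: "vfield A U X" and r: "ad_section G P U r" and t: "ad_section G P U t" and x: "x \<in> U"
  shows "X x (ad_pair P B r t) = ad_pair P B (d\<theta> X r) t x + ad_pair P B r (d\<theta> X t) x"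
proof -
  obtain p where p: "\<pi> p = x" using proj_surj .
  have pU: "\<pi> p \<in> U" using p x by simp
  note s = ad_section_smooth_at[OF r pU] ad_section_smooth_at[OF t pU]
  note T = hlift_tangent_on[OF X pU]
  have "X x (ad_pair P B r t) = hl X p (\<lambda>q. ad_pair P B r t (\<pi> q))"
    using hlift_proj_on[OF X pU smooth_atI[OF pair_smooth[OF r t] pU]] p by simp
  also have "\<dots> = hl X p (\<lambda>q. B (r q) (t q))"
    by (rule E.tangent_cong[OF T proj_open[OF M.vfield_open[OF X]]])
      (use pU pair_eq[OF r t] in auto)
  also have "\<dots> = B (tder (hl X p) r) (t p) + B (r p) (tder (hl X p) t)"
    using E.tder_bilinear[OF lie_basis lie_basis B_bilinear T s]
      E.tder_real[OF T E.smooth_at_bilinear[OF lie_basis lie_basis B_bilinear s]] by simp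
  finally show ?thesis
    using pair_eq[OF d_theta_section[OF X r] t pU] pair_eq[OF r d_theta_section[OF X t] pU] p
    by (simp add: d_theta_def)
qed

end

section \<open>Riemannian metrics and orthonormal frames\<close>

text \<open>Linearity over smooth functions at \<open>x\<close>, together with locality. Locality is
  a separate clause because fields are total functions with arbitrary values outside their
  domain.\<close>

definition (in manifold) tensorial :: "'m \<Rightarrow> ('m field \<Rightarrow> 'v::real_vector) \<Rightarrow> bool" where
  "tensorial x T \<longleftrightarrow>
     (\<forall>V f Y Y'. vfield A V Y \<and> vfield A V Y' \<and> smooth_fun A V f \<and> x \<in> V \<longrightarrow>
        T (\<lambda>y. tlin (f y) (Y y) 1 (Y' y)) = f x *\<^sub>R T Y + T Y') \<and>
     (\<forall>V Y Y'. vfield A V Y \<and> x \<in> V \<and> (\<forall>y\<in>V. Y y = Y' y) \<longrightarrow> T Y = T Y')"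

text \<open>Local orthonormal frames enter as an assumption; the gauges of the spin structure supply
  them.\<close>

locale riemannian = manifold A Basis
  for A :: "('m::{t2_space, second_countable_topology}, real^'n) atlas" +
  fixes g :: "'m metric" and nab :: "'m conn"
  assumes metric: "riemannian_metric A g" and levi_civita: "levi_civita A g nab"
    and frames: "\<exists>U e. x \<in> U \<and> on_frame A g U e"
begin

abbreviation "T x \<equiv> tangent_space A x"

lemma g_sym: "u \<in> T x \<Longrightarrow> v \<in> T x \<Longrightarrow> g x u v = g x v u"
  using metric unfolding riemannian_metric_def by blast

lemma g_lin1:
  "u \<in> T x \<Longrightarrow> v \<in> T x \<Longrightarrow> w \<in> T x \<Longrightarrow> g x (tlin a u b v) w = a * g x u w + b * g x v w"
  using metric unfolding riemannian_metric_def by blast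

lemma g_lin2:
  "u \<in> T x \<Longrightarrow> v \<in> T x \<Longrightarrow> w \<in> T x \<Longrightarrow> g x w (tlin a u b v) = a * g x w u + b * g x w v"
  using g_lin1[of u x v w a b] g_sym[of w x] tangent_tlin by simp

lemma g_zero1: "w \<in> T x \<Longrightarrow> g x (\<lambda>_. 0) w = 0"
  using g_lin1[OF tangent_zero tangent_zero, of w x 0 0] by (simp add: tlin_def)

lemma g_smooth: "vfield A U X \<Longrightarrow> vfield A U Y \<Longrightarrow> smooth_fun A U (\<lambda>x. g x (X x) (Y x))"
  using metric unfolding riemannian_metric_def by blast

lemma g_smooth_at:
  "vfield A U X \<Longrightarrow> vfield A U Y \<Longrightarrow> x \<in> U \<Longrightarrow> smooth_at A x (\<lambda>x. g x (X x) (Y x))"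
  by (rule smooth_atI[OF g_smooth])

lemma g_sum1:
  assumes "\<And>i. i \<in> I \<Longrightarrow> v i \<in> T x" "w \<in> T x" "finite I"
  shows "g x (\<lambda>f. \<Sum>i\<in>I. k i * v i f) w = (\<Sum>i\<in>I. k i * g x (v i) w)"
  using assms(3,1)
proof (induction I)
  case empty
  then show ?case by (simp add: g_zero1 assms(2))
next
  case (insert i I)
  have "g x (tlin (k i) (v i) 1 (\<lambda>f. \<Sum>i\<in>I. k i * v i f)) w
      = k i * g x (v i) w + 1 * g x (\<lambda>f. \<Sum>i\<in>I. k i * v i f) w"
    by (rule g_lin1[OF _ tangent_lin_sum[of I v x k] assms(2)]) (use insert.prems in auto)
  then show ?case using insert by (simp add: tlin_def)
qed

lemma frame_vfield: "on_frame A g U e \<Longrightarrow> vfield A U (e i)"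
  by (simp add: on_frame_def)

lemma frame_open: "on_frame A g U e \<Longrightarrow> open U"
  by (rule vfield_open[OF frame_vfield])

lemma frame_tangent: "on_frame A g U e \<Longrightarrow> x \<in> U \<Longrightarrow> e i x \<in> T x"
  by (rule vfield_tangent[OF frame_vfield])

lemma frame_orth: "on_frame A g U e \<Longrightarrow> x \<in> U \<Longrightarrow> g x (e i x) (e j x) = (if i = j then 1 else 0)"
  by (simp add: on_frame_def)

lemma frame_subset: "on_frame A g U e \<Longrightarrow> open V \<Longrightarrow> V \<subseteq> U \<Longrightarrow> on_frame A g V e"
  using vfield_subset unfolding on_frame_def by blast

text \<open>\<open>n\<close> orthonormal vectors span, since the chart identifies the tangent space with \<open>real^'n\<close>.\<close>

lemma orthonormal_expand:
  fixes e :: "'n \<Rightarrow> 'm tvec"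
  assumes eT: "\<And>i. e i \<in> T x" and orth: "\<And>i j. g x (e i) (e j) = (if i = j then 1 else 0)"
    and v: "v \<in> T x"
  shows "v f = (\<Sum>i\<in>UNIV. g x v (e i) * e i f)"
proof -
  obtain U \<phi> where c: "(U, \<phi>) \<in> A" "x \<in> U" using chart_exists .
  have "\<exists>a. e i = tvec_of U \<phi> x a" for i
    using tangent_rep[OF eT c] by metis
  then obtain a where a: "\<And>i. e i = tvec_of U \<phi> x (a i)" by metis
  define L where "L = (\<lambda>k::real^'n. \<Sum>i\<in>UNIV. (k $ i) *\<^sub>R a i)"
  have "linear L" unfolding L_def
    by (rule linearI) (simp_all add: scaleR_add_left sum.distrib scaleR_sum_right)
  have Lt: "tvec_of U \<phi> x (L k) = (\<lambda>f. \<Sum>i\<in>UNIV. (k $ i) * e i f)" for k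
  proof
    fix f show "tvec_of U \<phi> x (L k) f = (\<Sum>i\<in>UNIV. (k $ i) * e i f)"
    proof (cases "smooth_at A x f")
      case True
      have "pd U \<phi> (L k) f x = (\<Sum>i\<in>UNIV. (k $ i) * pd U \<phi> (a i) f x)"
        unfolding L_def by (simp add: linear_sum[OF pd_linear[OF c True]] linear_scale[OF pd_linear[OF c True]])
      then show ?thesis using True by (simp add: tvec_of_def a)
    qed (simp add: tvec_of_def a)
  qed
  have gL: "g x (tvec_of U \<phi> x (L k)) (e j) = k $ j" for k j
  proof -
    have "g x (tvec_of U \<phi> x (L k)) (e j) = (\<Sum>i\<in>UNIV. (k $ i) * g x (e i) (e j))"
      unfolding Lt by (rule g_sum1) (use eT in auto)
    also have "\<dots> = (\<Sum>i\<in>UNIV. if i = j then k $ i else 0)"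
      by (rule sum.cong) (auto simp: orth)
    finally show ?thesis by simp
  qed
  have "inj L"
  proof (rule injI)
    fix k k' assume "L k = L k'"
    then have "k $ j = k' $ j" for j using gL[of k j] gL[of k' j] by simp
    then show "k = k'" by (simp add: vec_eq_iff)
  qed
  then have "surj L" using linear_injective_imp_surjective[OF \<open>linear L\<close>] by blast
  obtain w where w: "v = tvec_of U \<phi> x w" using tangent_rep[OF v c] .
  obtain k where "w = L k" using \<open>surj L\<close> by (metis surjD)
  then have vk: "v = (\<lambda>f. \<Sum>i\<in>UNIV. (k $ i) * e i f)" "g x v (e j) = k $ j" for j
    using Lt gL w by simp_all
  show ?thesis by (simp only: vk(2)) (simp add: vk(1))
qed

lemma orthonormal_eqI:
  fixes e :: "'n \<Rightarrow> 'm tvec"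
  assumes eT: "\<And>i. e i \<in> T x" and orth: "\<And>i j. g x (e i) (e j) = (if i = j then 1 else 0)"
    and u: "u \<in> T x" and v: "v \<in> T x" and eq: "\<And>i. g x u (e i) = g x v (e i)"
  shows "u = v"
proof
  fix f show "u f = v f"
    by (simp only: orthonormal_expand[OF eT orth u, of f] orthonormal_expand[OF eT orth v, of f] eq)
qed

lemma orthonormal_inner:
  fixes e :: "'n \<Rightarrow> 'm tvec"
  assumes eT: "\<And>i. e i \<in> T x" and orth: "\<And>i j. g x (e i) (e j) = (if i = j then 1 else 0)"
    and u: "u \<in> T x" and v: "v \<in> T x"
  shows "g x u v = (\<Sum>i\<in>UNIV. g x u (e i) * g x v (e i))"
proof -
  have "g x u v = g x (\<lambda>f. \<Sum>i\<in>UNIV. g x u (e i) * e i f) v"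
    by (rule arg_cong[of u _ "\<lambda>u. g x u v"], rule ext, rule orthonormal_expand[OF eT orth u])
  also have "\<dots> = (\<Sum>i\<in>UNIV. g x u (e i) * g x (e i) v)"
    by (rule g_sum1[OF eT v]) auto
  finally show ?thesis by (simp add: g_sym[OF eT v])
qed

lemma frame_expand:
  "on_frame A g U e \<Longrightarrow> x \<in> U \<Longrightarrow> v \<in> T x \<Longrightarrow> v f = (\<Sum>i\<in>UNIV. g x v (e i x) * e i x f)"
  by (rule orthonormal_expand[of "\<lambda>i. e i x"]) (simp_all add: frame_tangent frame_orth)

lemma frame_eqI:
  "on_frame A g U e \<Longrightarrow> x \<in> U \<Longrightarrow> u \<in> T x \<Longrightarrow> v \<in> T x \<Longrightarrow>
    (\<And>i. g x u (e i x) = g x v (e i x)) \<Longrightarrow> u = v"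
  by (rule orthonormal_eqI[of "\<lambda>i. e i x"]) (simp_all add: frame_tangent frame_orth)

lemma frame_inner:
  "on_frame A g U e \<Longrightarrow> x \<in> U \<Longrightarrow> u \<in> T x \<Longrightarrow> v \<in> T x \<Longrightarrow>
    g x u v = (\<Sum>i\<in>UNIV. g x u (e i x) * g x v (e i x))"
  by (rule orthonormal_inner[of "\<lambda>i. e i x"]) (simp_all add: frame_tangent frame_orth)

text \<open>Testing against local vector fields rather than single vectors, because the identities
  to be compared are available for fields only.\<close>

lemma metric_eqI:
  assumes u: "u \<in> T x" and v: "v \<in> T x" and U: "open U" "x \<in> U"
    and eq: "\<And>V W. vfield A V W \<Longrightarrow> x \<in> V \<Longrightarrow> V \<subseteq> U \<Longrightarrow> g x u (W x) = g x v (W x)"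
  shows "u = v"
proof -
  obtain V e where e: "x \<in> V" "on_frame A g V e" using frames by blast
  have o: "open (V \<inter> U)" using frame_open[OF e(2)] U by blast
  have f: "on_frame A g (V \<inter> U) e" by (rule frame_subset[OF e(2) o]) blast
  show ?thesis
    by (rule frame_eqI[OF f _ u v eq[OF frame_vfield[OF f]]]) (use e U in auto)
qed

text \<open>Reduces a vector-valued contraction with the spinor to real ones, obtained by pairing
  with a field \<open>Y\<close>. The TM-valued parts of the result are all proved in this
  way.\<close>

lemma double_sum_tangent_zero:
  fixes \<alpha> :: "'n \<Rightarrow> 'n \<Rightarrow> 'm tvec"
  assumes \<alpha>: "\<And>i j. \<alpha> i j \<in> T x" and U: "open U" "x \<in> U"
    and eq: "\<And>V Y. vfield A V Y \<Longrightarrow> x \<in> V \<Longrightarrow> V \<subseteq> U \<Longrightarrow>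
      (\<Sum>i\<in>UNIV. \<Sum>j\<in>UNIV. k i j * g x (\<alpha> i j) (Y x)) = 0"
  shows "(\<Sum>i\<in>UNIV. \<Sum>j\<in>UNIV. k i j * \<alpha> i j f) = 0"
proof -
  define \<beta> where "\<beta> i = (\<lambda>f. \<Sum>j\<in>UNIV. k i j * \<alpha> i j f)" for i
  have \<beta>: "\<beta> i \<in> T x" for i unfolding \<beta>_def by (rule tangent_lin_sum) (rule \<alpha>)
  have "(\<lambda>f. \<Sum>i\<in>UNIV. 1 * \<beta> i f) = (\<lambda>_. 0)"
  proof (rule metric_eqI[OF _ tangent_zero U])
    show "(\<lambda>f. \<Sum>i\<in>UNIV. 1 * \<beta> i f) \<in> T x" by (rule tangent_lin_sum) (rule \<beta>)
    fix V Y assume Y: "vfield A V Y" "x \<in> V" "V \<subseteq> U"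
    note YT = vfield_tangent[OF Y(1,2)]
    have "g x (\<lambda>f. \<Sum>i\<in>UNIV. 1 * \<beta> i f) (Y x) = (\<Sum>i\<in>UNIV. 1 * g x (\<beta> i) (Y x))"
      by (rule g_sum1[OF \<beta> YT finite])
    also have "\<dots> = (\<Sum>i\<in>UNIV. \<Sum>j\<in>UNIV. k i j * g x (\<alpha> i j) (Y x))"
      by (simp add: \<beta>_def g_sum1[OF \<alpha> YT finite])
    finally show "g x (\<lambda>f. \<Sum>i\<in>UNIV. 1 * \<beta> i f) (Y x) = g x (\<lambda>_. 0) (Y x)"
      by (simp add: eq[OF Y] g_zero1[OF YT])
  qed
  from fun_cong[OF this, of f] show ?thesis by (simp add: \<beta>_def)
qed

section \<open>Tensoriality and raising of indices\<close>

lemma tensorial_cong: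
  "tensorial x \<tau> \<Longrightarrow> vfield A V Y \<Longrightarrow> x \<in> V \<Longrightarrow> (\<And>y. y \<in> V \<Longrightarrow> Y y = Y' y) \<Longrightarrow> \<tau> Y = \<tau> Y'"
  unfolding tensorial_def by blast

lemma tensorial_lin:
  "tensorial x \<tau> \<Longrightarrow> vfield A V Y \<Longrightarrow> vfield A V Y' \<Longrightarrow> smooth_fun A V f \<Longrightarrow> x \<in> V \<Longrightarrow>
    \<tau> (\<lambda>y. tlin (f y) (Y y) 1 (Y' y)) = f x *\<^sub>R \<tau> Y + \<tau> Y'"
  unfolding tensorial_def by blast

text \<open>On a common domain \<open>Y\<close> is a combination of the frame with smooth
  coefficients, and linearity is applied term by term. The induction starts at the zero field, whose
  image equals twice itself.\<close>

lemma tensorial_expand: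
  assumes \<tau>: "tensorial x \<tau>" and e: "on_frame A g U e" "x \<in> U" and Y: "vfield A V Y" "x \<in> V"
  shows "\<tau> Y = (\<Sum>i\<in>UNIV. g x (Y x) (e i x) *\<^sub>R \<tau> (e i))"
proof -
  let ?W = "U \<inter> V"
  have W: "open ?W" "x \<in> ?W" using frame_open[OF e(1)] vfield_open[OF Y(1)] e Y by blast+
  have eW: "vfield A ?W (e i)" for i by (rule vfield_subset[OF frame_vfield[OF e(1)] W(1)]) blast
  have YW: "vfield A ?W Y" by (rule vfield_subset[OF Y(1) W(1)]) blast
  let ?k = "\<lambda>i y. g y (Y y) (e i y)"
  have k: "smooth_fun A ?W (?k i)" for i by (rule g_smooth[OF YW eW])
  have "\<tau> (\<lambda>y f. \<Sum>i\<in>I. ?k i y * e i y f) = (\<Sum>i\<in>I. ?k i x *\<^sub>R \<tau> (e i))" for I :: "'n set"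
    using finite[of I]
  proof (induction I)
    case empty
    have z: "vfield A ?W (\<lambda>y f. 0)" by (rule vfield_zero[OF W(1)])
    have "\<tau> (\<lambda>y. tlin 1 ((\<lambda>f. 0)) 1 (\<lambda>f. 0)) = 1 *\<^sub>R \<tau> (\<lambda>y f. 0) + \<tau> (\<lambda>y f. 0)"
      by (rule tensorial_lin[OF \<tau> z z smooth_fun_const[OF W(1)] W(2)])
    then show ?case by (simp add: tlin_def)
  next
    case (insert i I)
    have "\<tau> (\<lambda>y. tlin (?k i y) (e i y) 1 (\<lambda>f. \<Sum>i\<in>I. ?k i y * e i y f))
        = ?k i x *\<^sub>R \<tau> (e i) + \<tau> (\<lambda>y f. \<Sum>i\<in>I. ?k i y * e i y f)"
      by (rule tensorial_lin[OF \<tau> eW vfield_lin_sum[OF W(1) eW k] k W(2)])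
    then show ?case using insert by (simp add: tlin_def)
  qed
  moreover have "\<tau> Y = \<tau> (\<lambda>y f. \<Sum>i\<in>UNIV. ?k i y * e i y f)"
    by (rule tensorial_cong[OF \<tau> YW W(2)], rule ext, rule frame_expand[OF e(1)])
      (use vfield_tangent[OF Y(1)] in auto)
  ultimately show ?thesis by simp
qed

lemma sharp_eqI:
  assumes v: "v \<in> T x" and eq: "\<And>U W. vfield A U W \<Longrightarrow> x \<in> U \<Longrightarrow> g x v (W x) = \<omega> W"
  shows "sharp A g \<omega> x = v"
  unfolding sharp_def
proof (rule the_equality)
  show "v \<in> T x \<and> (\<forall>U W. vfield A U W \<and> x \<in> U \<longrightarrow> g x v (W x) = \<omega> W)" using assms by blast
  fix u assume u: "u \<in> T x \<and> (\<forall>U W. vfield A U W \<and> x \<in> U \<longrightarrow> g x u (W x) = \<omega> W)"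
  show "u = v" by (rule metric_eqI[of u x v UNIV]) (use u assms in auto)
qed

text \<open>Exhibits the vector that the definite description in \<open>sharp\<close> asks for; the
  formula also yields smoothness.\<close>

lemma sharp_frame:
  assumes \<omega>: "tensorial x \<omega>" and e: "on_frame A g U e" "x \<in> U"
  shows "sharp A g \<omega> x = (\<lambda>f. \<Sum>i\<in>UNIV. \<omega> (e i) * e i x f)"
proof (rule sharp_eqI)
  show "(\<lambda>f. \<Sum>i\<in>UNIV. \<omega> (e i) * e i x f) \<in> T x"
    by (rule tangent_lin_sum) (rule frame_tangent[OF e])
  fix V W assume W: "vfield A V W" "x \<in> V"
  have Wx: "W x \<in> T x" by (rule vfield_tangent[OF W])
  have "g x (\<lambda>f. \<Sum>i\<in>UNIV. \<omega> (e i) * e i x f) (W x) = (\<Sum>i\<in>UNIV. \<omega> (e i) * g x (e i x) (W x))"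
    by (rule g_sum1) (use frame_tangent[OF e] Wx in auto)
  then show "g x (\<lambda>f. \<Sum>i\<in>UNIV. \<omega> (e i) * e i x f) (W x) = \<omega> W"
    using tensorial_expand[OF \<omega> e W] by (simp add: g_sym[OF frame_tangent[OF e] Wx] mult.commute)
qed

lemma sharp_tangent: "tensorial x \<omega> \<Longrightarrow> sharp A g \<omega> x \<in> T x"
  and sharp_inner: "tensorial x \<omega> \<Longrightarrow> vfield A V W \<Longrightarrow> x \<in> V \<Longrightarrow> g x (sharp A g \<omega> x) (W x) = \<omega> W"
proof -
  assume \<omega>: "tensorial x \<omega>"
  obtain U e where e: "x \<in> U" "on_frame A g U e" using frames by blast
  note s = sharp_frame[OF \<omega> e(2,1)]
  show "sharp A g \<omega> x \<in> T x"
    unfolding s by (rule tangent_lin_sum) (rule frame_tangent[OF e(2,1)])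
  assume W: "vfield A V W" "x \<in> V"
  have Wx: "W x \<in> T x" by (rule vfield_tangent[OF W])
  have "g x (\<lambda>f. \<Sum>i\<in>UNIV. \<omega> (e i) * e i x f) (W x) = (\<Sum>i\<in>UNIV. \<omega> (e i) * g x (e i x) (W x))"
    by (rule g_sum1) (use frame_tangent[OF e(2,1)] Wx in auto)
  then show "g x (sharp A g \<omega> x) (W x) = \<omega> W"
    unfolding s using tensorial_expand[OF \<omega> e(2,1) W]
    by (simp add: g_sym[OF frame_tangent[OF e(2,1)] Wx] mult.commute)
qed

lemma sharp_vfield:
  assumes U: "open U" and \<omega>: "\<And>x. x \<in> U \<Longrightarrow> tensorial x (\<omega> x)"
    and sm: "\<And>V W. V \<subseteq> U \<Longrightarrow> vfield A V W \<Longrightarrow> smooth_fun A V (\<lambda>x. \<omega> x W)"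
  shows "vfield A U (\<lambda>x. sharp A g (\<omega> x) x)"
proof (rule vfield_local[OF U])
  fix x assume x: "x \<in> U"
  obtain V e where e: "x \<in> V" "on_frame A g V e" using frames by blast
  have o: "open (V \<inter> U)" using frame_open[OF e(2)] U by blast
  have f: "on_frame A g (V \<inter> U) e" by (rule frame_subset[OF e(2) o]) blast
  have "vfield A (V \<inter> U) (\<lambda>x f. \<Sum>i\<in>UNIV. \<omega> x (e i) * e i x f)"
    by (rule vfield_lin_sum[OF o frame_vfield[OF f] sm[OF _ frame_vfield[OF f]]]) auto
  then have "vfield A (V \<inter> U) (\<lambda>x. sharp A g (\<omega> x) x)"
    by (rule vfield_cong) (use sharp_frame[OF \<omega> f] in auto)
  with e(1) x show "\<exists>V. x \<in> V \<and> vfield A V (\<lambda>x. sharp A g (\<omega> x) x)"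
    by (intro exI[of _ "V \<inter> U"] conjI IntI)
qed

section \<open>Metric connections with skew torsion\<close>

lemma affine: "affine_connection A nab"
  using levi_civita by (simp add: levi_civita_def)

lemma nab_vfield: "vfield A U X \<Longrightarrow> vfield A U Y \<Longrightarrow> vfield A U (nab X Y)"
  using affine[unfolded affine_connection_def, THEN conjunct1] by blast

lemma nab_lin1:
  "vfield A U X \<Longrightarrow> vfield A U X' \<Longrightarrow> vfield A U Y \<Longrightarrow> smooth_fun A U f \<Longrightarrow> x \<in> U \<Longrightarrow>
    nab (\<lambda>y. tlin (f y) (X y) 1 (X' y)) Y x = tlin (f x) (nab X Y x) 1 (nab X' Y x)"
  using affine[unfolded affine_connection_def, THEN conjunct2, THEN conjunct1] by blast

lemma nab_leibniz:
  "vfield A U X \<Longrightarrow> vfield A U Y \<Longrightarrow> vfield A U Y' \<Longrightarrow> smooth_fun A U f \<Longrightarrow> x \<in> U \<Longrightarrow>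
    nab X (\<lambda>y. tlin (f y) (Y y) 1 (Y' y)) x
      = tlin (X x f) (Y x) 1 (tlin (f x) (nab X Y x) 1 (nab X Y' x))"
  using affine[unfolded affine_connection_def, THEN conjunct2, THEN conjunct2, THEN conjunct1] by blast

lemma nab_cong:
  assumes X: "vfield A U X" and Y: "vfield A U Y" and x: "x \<in> U"
    and eq: "\<And>y. y \<in> U \<Longrightarrow> X y = X' y" "\<And>y. y \<in> U \<Longrightarrow> Y y = Y' y"
  shows "nab X Y x = nab X' Y' x"
proof -
  have "\<forall>U X Y X' Y'. vfield A U X \<and> vfield A U Y \<and> vfield A U X' \<and> vfield A U Y' \<and>
        (\<forall>x\<in>U. X x = X' x \<and> Y x = Y' x) \<longrightarrow> (\<forall>x\<in>U. nab X Y x = nab X' Y' x)"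
    by (rule affine[unfolded affine_connection_def, THEN conjunct2, THEN conjunct2, THEN conjunct2])
  moreover have "vfield A U X'" "vfield A U Y'"
    by (rule vfield_cong[OF X eq(1)], assumption, rule vfield_cong[OF Y eq(2)])
  ultimately show ?thesis using assms by blast
qed

lemma nab_torsion_free:
  assumes "vfield A U X" "vfield A U Y" "x \<in> U"
  shows "lie_bracket A X Y x = tlin 1 (nab X Y x) (-1) (nab Y X x)"
  using levi_civita[unfolded levi_civita_def, THEN conjunct2, THEN conjunct1] assms by force

lemma nab_metric:
  assumes "vfield A U X" "vfield A U Y" "vfield A U Z" "x \<in> U"
  shows "X x (\<lambda>y. g y (Y y) (Z y)) = g x (nab X Y x) (Z x) + g x (Y x) (nab X Z x)"
  using levi_civita[unfolded levi_civita_def, THEN conjunct2, THEN conjunct2] assms by blast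

lemma nab_zero: assumes "vfield A U Y" "x \<in> U" shows "nab (\<lambda>y f. 0) Y x f = 0"
proof -
  have z: "vfield A U (\<lambda>y f. 0)" by (rule vfield_zero[OF vfield_open[OF assms(1)]])
  have "nab (\<lambda>y. tlin 1 ((\<lambda>f. 0)) 1 (\<lambda>f. 0)) Y x = tlin 1 (nab (\<lambda>y f. 0) Y x) 1 (nab (\<lambda>y f. 0) Y x)"
    by (rule nab_lin1[OF z z assms(1) smooth_fun_const[OF vfield_open[OF assms(1)]] assms(2)])
  then have "nab (\<lambda>y f. 0) Y x f = nab (\<lambda>y f. 0) Y x f + nab (\<lambda>y f. 0) Y x f"
    by (auto simp: tlin_def dest: fun_cong[where x = f])
  then show ?thesis by simp
qed

lemma nab_bracket_antisym:
  assumes X: "vfield A U X" and Y: "vfield A U Y" and Z: "vfield A U Z" and x: "x \<in> U"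
  shows "nab (lie_bracket A Y X) Z x f = - nab (lie_bracket A X Y) Z x f"
proof -
  have z: "vfield A U (\<lambda>y f. 0)" by (rule vfield_zero[OF vfield_open[OF X]])
  have "(\<lambda>y. tlin (-1) (lie_bracket A X Y y) 1 (\<lambda>f. 0)) = lie_bracket A Y X"
    by (intro ext) (simp add: tlin_def lie_bracket_antisym[of X Y])
  moreover have "nab (\<lambda>y. tlin (-1) (lie_bracket A X Y y) 1 (\<lambda>f. 0)) Z x
      = tlin (-1) (nab (lie_bracket A X Y) Z x) 1 (nab (\<lambda>y f. 0) Z x)"
    by (rule nab_lin1[OF lie_bracket_vfield[OF X Y] z Z smooth_fun_const[OF vfield_open[OF X]] x])
  ultimately show ?thesis by (simp add: tlin_def nab_zero[OF Z x])
qed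

end

locale torsion_geometry = riemannian A g nab
  for A :: "('m::{t2_space, second_countable_topology}, real^'n) atlas" and g and nab +
  fixes H :: "'m \<Rightarrow> 'm tvec \<Rightarrow> 'm tvec \<Rightarrow> 'm tvec \<Rightarrow> real"
  assumes three_form: "three_form A H"
begin

lemma H_swap12: "u \<in> T x \<Longrightarrow> v \<in> T x \<Longrightarrow> w \<in> T x \<Longrightarrow> H x v u w = - H x u v w"
  using three_form[unfolded three_form_def, THEN conjunct1, rule_format, of u x v w, THEN conjunct1]
  by simp

lemma H_swap23: "u \<in> T x \<Longrightarrow> v \<in> T x \<Longrightarrow> w \<in> T x \<Longrightarrow> H x u w v = - H x u v w"
  using three_form[unfolded three_form_def, THEN conjunct1, rule_format, of u x v w,
      THEN conjunct2, THEN conjunct1] by simp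

lemma H_cyc: "u \<in> T x \<Longrightarrow> v \<in> T x \<Longrightarrow> w \<in> T x \<Longrightarrow> H x w u v = H x u v w"
  using H_swap12[of u x w v] H_swap23[of u x v w] by simp

lemma H_lin1:
  "u \<in> T x \<Longrightarrow> u' \<in> T x \<Longrightarrow> v \<in> T x \<Longrightarrow> w \<in> T x \<Longrightarrow>
    H x (tlin a u b u') v w = a * H x u v w + b * H x u' v w"
  using three_form[unfolded three_form_def, THEN conjunct1, rule_format, of u x v w,
      THEN conjunct2, THEN conjunct2] by blast

lemma H_lin3:
  "u \<in> T x \<Longrightarrow> v \<in> T x \<Longrightarrow> w \<in> T x \<Longrightarrow> w' \<in> T x \<Longrightarrow>
    H x u v (tlin a w b w') = a * H x u v w + b * H x u v w'"
  using H_lin1[of w x w' u v a b] H_cyc[of u x v] tangent_tlin[of w x w' a b] by simp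

lemma H_smooth:
  "vfield A U X \<Longrightarrow> vfield A U Y \<Longrightarrow> vfield A U Z \<Longrightarrow> smooth_fun A U (\<lambda>x. H x (X x) (Y x) (Z x))"
  using three_form[unfolded three_form_def, THEN conjunct2] by blast

lemma H_tensorial:
  assumes "u \<in> T x" "v \<in> T x" shows "tensorial x (\<lambda>W. H x u v (W x))"
  unfolding tensorial_def
proof (intro conjI allI impI, elim conjE)
  fix V f Y Y' assume Y: "vfield A V Y" "vfield A V Y'" "x \<in> V"
  show "H x u v (tlin (f x) (Y x) 1 (Y' x)) = f x *\<^sub>R H x u v (Y x) + H x u v (Y' x)"
    using H_lin3[OF assms vfield_tangent[OF Y(1,3)] vfield_tangent[OF Y(2,3)]] by simp
qed auto

abbreviation "N t \<equiv> torsion_conn A g H nab t"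

abbreviation "tors X Y x \<equiv> sharp A g (\<lambda>W. H x (X x) (Y x) (W x)) x"

text \<open>Constant coefficients in a local frame. \<open>sharp\<close> is specified by pairings
  with fields, and this gives its pairing with a single vector.\<close>

lemma tangent_extend:
  assumes w: "w \<in> T x" obtains V W where "vfield A V W" "x \<in> V" "W x = w"
proof -
  obtain U e where e: "x \<in> U" "on_frame A g U e" using frames by blast
  have "vfield A U (\<lambda>y f. \<Sum>i\<in>UNIV. g x w (e i x) * e i y f)"
    by (rule vfield_lin_sum[OF frame_open[OF e(2)] frame_vfield[OF e(2)]
          smooth_fun_const[OF frame_open[OF e(2)]]])
  moreover have "(\<lambda>f. \<Sum>i\<in>UNIV. g x w (e i x) * e i x f) = w"
    by (rule ext, rule frame_expand[OF e(2,1) w, symmetric])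
  ultimately show ?thesis using that e(1) by blast
qed

lemma tors_tangent: "X x \<in> T x \<Longrightarrow> Y x \<in> T x \<Longrightarrow> tors X Y x \<in> T x"
  by (rule sharp_tangent[OF H_tensorial])

lemma tors_inner:
  assumes "X x \<in> T x" "Y x \<in> T x" "w \<in> T x" shows "g x (tors X Y x) w = H x (X x) (Y x) w"
proof -
  obtain V W where W: "vfield A V W" "x \<in> V" "W x = w" using tangent_extend[OF assms(3)] .
  show ?thesis using sharp_inner[OF H_tensorial[OF assms(1,2)] W(1,2)] W(3) by simp
qed

lemma tors_vfield:
  assumes X: "vfield A U X" and Y: "vfield A U Y" shows "vfield A U (\<lambda>x. tors X Y x)"
proof (rule sharp_vfield[OF vfield_open[OF X]])
  show "tensorial x (\<lambda>W. H x (X x) (Y x) (W x))" if "x \<in> U" for x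
    by (rule H_tensorial[OF vfield_tangent[OF X that] vfield_tangent[OF Y that]])
  show "smooth_fun A V (\<lambda>x. H x (X x) (Y x) (W x))" if "V \<subseteq> U" "vfield A V W" for V W
    using vfield_subset[OF X vfield_open[OF that(2)] that(1)]
      vfield_subset[OF Y vfield_open[OF that(2)] that(1)] that(2) by (rule H_smooth)
qed

lemma N_vfield: "vfield A U X \<Longrightarrow> vfield A U Y \<Longrightarrow> vfield A U (N t X Y)"
  unfolding torsion_conn_def[abs_def] by (rule vfield_tlin_const[OF nab_vfield tors_vfield])

lemma N_tangent: "vfield A U X \<Longrightarrow> vfield A U Y \<Longrightarrow> x \<in> U \<Longrightarrow> N t X Y x \<in> T x"
  by (rule vfield_tangent[OF N_vfield])

lemma nab_tangent: "vfield A U X \<Longrightarrow> vfield A U Y \<Longrightarrow> x \<in> U \<Longrightarrow> nab X Y x \<in> T x"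
  by (rule vfield_tangent[OF nab_vfield])

lemma N_inner:
  assumes X: "vfield A U X" and Y: "vfield A U Y" and x: "x \<in> U" and w: "w \<in> T x"
  shows "g x (N t X Y x) w = g x (nab X Y x) w + t * H x (X x) (Y x) w"
proof -
  note XY = vfield_tangent[of U X x, OF X x] vfield_tangent[of U Y x, OF Y x]
  show ?thesis unfolding torsion_conn_def
    by (simp add: g_lin1[OF nab_tangent[OF X Y x] tors_tangent[of X x Y, OF XY] w]
        tors_inner[of X x Y, OF XY w])
qed

lemma N_cong:
  assumes X: "vfield A U X" and Y: "vfield A U Y" and x: "x \<in> U"
    and eq: "\<And>y. y \<in> U \<Longrightarrow> X y = X' y" "\<And>y. y \<in> U \<Longrightarrow> Y y = Y' y"
  shows "N t X Y x = N t X' Y' x"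
  unfolding torsion_conn_def using nab_cong[OF X Y x eq] eq[OF x] by simp

lemma N_leibniz:
  assumes X: "vfield A U X" and Y: "vfield A U Y" and Y': "vfield A U Y'"
    and f: "smooth_fun A U f" and x: "x \<in> U"
  shows "N t X (\<lambda>y. tlin (f y) (Y y) 1 (Y' y)) x
      = tlin (X x f) (Y x) 1 (tlin (f x) (N t X Y x) 1 (N t X Y' x))"
proof -
  have Z: "vfield A U (\<lambda>y. tlin (f y) (Y y) 1 (Y' y))"
    by (rule vfield_tlin[OF Y Y' f smooth_fun_const[OF vfield_open[OF X]]])
  have t: "X x \<in> T x" "Y x \<in> T x" "Y' x \<in> T x"
    using X Y Y' x vfield_tangent by blast+
  have n: "nab X Y x \<in> T x" "nab X Y' x \<in> T x" "N t X Y x \<in> T x" "N t X Y' x \<in> T x"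
    by (intro nab_tangent[OF X _ x] N_tangent[OF X _ x] Y Y')+
  show ?thesis
  proof (rule metric_eqI[OF _ _ vfield_open[OF X] x])
    show "N t X (\<lambda>y. tlin (f y) (Y y) 1 (Y' y)) x \<in> T x" by (rule N_tangent[OF X Z x])
    show "tlin (X x f) (Y x) 1 (tlin (f x) (N t X Y x) 1 (N t X Y' x)) \<in> T x"
      by (intro tangent_tlin t n)
    fix V W assume "vfield A V W" "x \<in> V"
    then have w: "W x \<in> T x" by (rule vfield_tangent)
    have "H x (X x) (tlin (f x) (Y x) 1 (Y' x)) (W x) = f x * H x (X x) (Y x) (W x) + H x (X x) (Y' x) (W x)"
      using H_lin3[OF t(1) w t(2,3), of "f x" 1] H_swap23[OF t(1) _ w] tangent_tlin[OF t(2,3)] t by simp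
    then show "g x (N t X (\<lambda>y. tlin (f y) (Y y) 1 (Y' y)) x) (W x)
        = g x (tlin (X x f) (Y x) 1 (tlin (f x) (N t X Y x) 1 (N t X Y' x))) (W x)"
      by (simp add: N_inner[OF X Z x w] N_inner[OF X Y x w] N_inner[OF X Y' x w]
          nab_leibniz[OF X Y Y' f x] g_lin1 t n w tangent_tlin algebra_simps)
  qed
qed

lemma N_add:
  assumes X: "vfield A U X" and Y: "vfield A U Y" and Z: "vfield A U Z" and x: "x \<in> U"
  shows "N t X (\<lambda>y. tlin 1 (Y y) 1 (Z y)) x f = N t X Y x f + N t X Z x f"
  using N_leibniz[OF X Y Z smooth_fun_const[OF vfield_open[OF X]] x, of t 1]
    tangent_const[OF vfield_tangent[OF X x]] by (simp add: tlin_def)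

text \<open>The torsion contributions cancel because \<open>H\<close> is skew in its last two
  slots.\<close>

lemma N_metric:
  assumes X: "vfield A U X" and Y: "vfield A U Y" and Z: "vfield A U Z" and x: "x \<in> U"
  shows "X x (\<lambda>y. g y (Y y) (Z y)) = g x (N t X Y x) (Z x) + g x (Y x) (N t X Z x)"
proof -
  have t: "X x \<in> T x" "Y x \<in> T x" "Z x \<in> T x" using X Y Z x vfield_tangent by blast+
  show ?thesis
    using nab_metric[OF X Y Z x] N_inner[OF X Y x t(3), of t] N_inner[OF X Z x t(2), of t]
      g_sym[OF t(2) N_tangent[OF X Z x]] g_sym[OF t(2) nab_tangent[OF X Z x]] H_swap23[OF t]
    by simp
qed

text \<open>\<open>H\<close> is skew in its first two slots, so reversing the torsion amounts to
  swapping the arguments, up to the bracket coming from the torsion-free connection. This links the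
  \<open>\<nabla>\<^sup>-\<close> inside \<open>D\<close> with the \<open>\<nabla>\<^sup>+\<close>
  of the second equation.\<close>

lemma N_exchange:
  assumes X: "vfield A U X" and Y: "vfield A U Y" and x: "x \<in> U"
  shows "N (-t) X Y x f = N t Y X x f + lie_bracket A X Y x f"
proof -
  have t: "X x \<in> T x" "Y x \<in> T x" using X Y x vfield_tangent by blast+
  have b: "lie_bracket A X Y x \<in> T x" by (rule lie_bracket_tangent[OF X Y x])
  have "N (-t) X Y x = tlin 1 (N t Y X x) 1 (lie_bracket A X Y x)"
  proof (rule metric_eqI[OF N_tangent[OF X Y x] _ vfield_open[OF X] x])
    show "tlin 1 (N t Y X x) 1 (lie_bracket A X Y x) \<in> T x"
      by (rule tangent_tlin[OF N_tangent[OF Y X x] b])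
    fix V W assume "vfield A V W" "x \<in> V"
    then have w: "W x \<in> T x" by (rule vfield_tangent)
    have "g x (lie_bracket A X Y x) (W x) = g x (nab X Y x) (W x) - g x (nab Y X x) (W x)"
      by (simp add: nab_torsion_free[OF X Y x] g_lin1[OF nab_tangent[OF X Y x] nab_tangent[OF Y X x] w])
    then show "g x (N (-t) X Y x) (W x) = g x (tlin 1 (N t Y X x) 1 (lie_bracket A X Y x)) (W x)"
      using H_swap12[OF t w]
      by (simp add: g_lin1[OF N_tangent[OF Y X x] b w] N_inner[OF X Y x w] N_inner[OF Y X x w])
  qed
  then show ?thesis by (simp add: tlin_def)
qed

lemma N_zero: "N 0 = nab"
  by (intro ext) (simp add: torsion_conn_def tlin_def)

section \<open>Curvature of connections with skew torsion\<close>

abbreviation "R t \<equiv> conn_curvature A (N t)"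

lemma R_tlin:
  "R t X Y Z x = tlin 1 (N t X (N t Y Z) x) (-1) (tlin 1 (N t Y (N t X Z) x) 1 (N t (lie_bracket A X Y) Z x))"
  by (simp add: conn_curvature_def tlin_def fun_eq_iff)

lemma R_tangent:
  assumes "vfield A U X" "vfield A U Y" "vfield A U Z" "x \<in> U" shows "R t X Y Z x \<in> T x"
  unfolding R_tlin using assms by (intro tangent_tlin N_tangent N_vfield lie_bracket_vfield)

lemma R_inner:
  assumes X: "vfield A U X" and Y: "vfield A U Y" and Z: "vfield A U Z" and x: "x \<in> U" and w: "w \<in> T x"
  shows "g x (R t X Y Z x) w
    = g x (N t X (N t Y Z) x) w - g x (N t Y (N t X Z) x) w - g x (N t (lie_bracket A X Y) Z x) w"
proof -
  note n = N_tangent[OF X N_vfield[OF Y Z] x, of t t] N_tangent[OF Y N_vfield[OF X Z] x, of t t]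
    N_tangent[OF lie_bracket_vfield[OF X Y] Z x, of t]
  show ?thesis unfolding R_tlin by (simp add: g_lin1 n w tangent_tlin)
qed

text \<open>Metric compatibility turns second covariant derivatives into derivatives of scalar
  functions and products of first ones. Both the comparison of different torsions and the curvature
  of the spinor start here.\<close>

lemma R_formula:
  assumes X: "vfield A U X" and Y: "vfield A U Y" and Z: "vfield A U Z" and W: "vfield A U W" and x: "x \<in> U"
  shows "g x (R t X Y Z x) (W x)
    = X x (\<lambda>y. g y (N t Y Z y) (W y)) - g x (N t Y Z x) (N t X W x)
      - Y x (\<lambda>y. g y (N t X Z y) (W y)) + g x (N t X Z x) (N t Y W x)
      - g x (N t (lie_bracket A X Y) Z x) (W x)"
  using R_inner[OF X Y Z x vfield_tangent[OF W x], of t]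
    N_metric[OF X N_vfield[OF Y Z] W x, of t t] N_metric[OF Y N_vfield[OF X Z] W x, of t t] by simp

lemma R_antisym12:
  assumes X: "vfield A U X" and Y: "vfield A U Y" and Z: "vfield A U Z" and x: "x \<in> U"
  shows "R 0 Y X Z x f = - R 0 X Y Z x f"
  using nab_bracket_antisym[OF X Y Z x, of f] by (simp add: conn_curvature_def N_zero)

text \<open>On the scalar function \<open>g(Z, W)\<close> the bracket is the commutator of
  derivatives; expanding by metric compatibility leaves the symmetrised curvature.\<close>

lemma R_antisym34:
  assumes X: "vfield A U X" and Y: "vfield A U Y" and Z: "vfield A U Z" and W: "vfield A U W" and x: "x \<in> U"
  shows "g x (R t X Y Z x) (W x) = - g x (R t X Y W x) (Z x)"
proof -
  have s: "smooth_at A x (\<lambda>y. g y (Z y) (W y))" by (rule g_smooth_at[OF Z W x])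
  have 1: "X x (\<lambda>y. Y y (\<lambda>y. g y (Z y) (W y)))
      = X x (\<lambda>y. g y (N t Y Z y) (W y)) + X x (\<lambda>y. g y (N t Y W y) (Z y))"
    if X: "vfield A U X" and Y: "vfield A U Y" for X Y
  proof -
    have "X x (\<lambda>y. Y y (\<lambda>y. g y (Z y) (W y)))
        = X x (\<lambda>y. g y (N t Y Z y) (W y) + g y (N t Y W y) (Z y))"
      by (rule tangent_cong[OF vfield_tangent[OF X x] vfield_open[OF X] x])
        (simp add: N_metric[OF Y Z W, of _ t] g_sym[OF vfield_tangent[OF Z] N_tangent[OF Y W]])
    also have "\<dots> = X x (\<lambda>y. g y (N t Y Z y) (W y)) + X x (\<lambda>y. g y (N t Y W y) (Z y))"
      by (rule tangent_add[OF vfield_tangent[OF X x]])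
        (rule g_smooth_at[OF N_vfield[OF Y Z] W x] g_smooth_at[OF N_vfield[OF Y W] Z x])+
    finally show ?thesis .
  qed
  have b: "lie_bracket A X Y x (\<lambda>y. g y (Z y) (W y))
      = g x (N t (lie_bracket A X Y) Z x) (W x) + g x (N t (lie_bracket A X Y) W x) (Z x)"
    using N_metric[OF lie_bracket_vfield[OF X Y] Z W x, of t]
      g_sym[OF vfield_tangent[OF Z x] N_tangent[OF lie_bracket_vfield[OF X Y] W x]] by simp
  show ?thesis
    using R_formula[OF X Y Z W x, of t] R_formula[OF X Y W Z x, of t] 1[OF X Y] 1[OF Y X] b
      lie_bracket_apply[OF s, of X Y]
      g_sym[OF N_tangent[OF X Z x] N_tangent[OF Y W x]] g_sym[OF N_tangent[OF Y Z x] N_tangent[OF X W x]]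
    by (simp add: g_sym[OF N_tangent[OF X Z x] N_tangent[OF Y W x]]
        g_sym[OF N_tangent[OF Y Z x] N_tangent[OF X W x]])
qed

lemma nab_bracket:
  assumes X: "vfield A U X" and Y: "vfield A U Y" and Z: "vfield A U Z" and x: "x \<in> U"
  shows "nab X (lie_bracket A Y Z) x f = nab X (nab Y Z) x f - nab X (nab Z Y) x f"
proof -
  note YZ = nab_vfield[OF Y Z] nab_vfield[OF Z Y]
  have eq: "lie_bracket A Y Z y = tlin (-1) (nab Z Y y) 1 (nab Y Z y)" if "y \<in> U" for y
    by (simp add: nab_torsion_free[OF Y Z that] tlin_def fun_eq_iff)
  have "nab X (lie_bracket A Y Z) x = nab X (\<lambda>y. tlin (-1) (nab Z Y y) 1 (nab Y Z y)) x"
    by (rule nab_cong[OF X lie_bracket_vfield[OF Y Z] x refl eq])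
  also have "\<dots> = tlin (X x (\<lambda>y. -1)) (nab Z Y x) 1 (tlin (-1) (nab X (nab Z Y) x) 1 (nab X (nab Y Z) x))"
    by (rule nab_leibniz[OF X YZ(2,1) smooth_fun_const[OF vfield_open[OF X]] x])
  finally show ?thesis using tangent_const[OF vfield_tangent[OF X x], of "-1"] by (simp add: tlin_def)
qed

text \<open>The Jacobi identity with every bracket rewritten through the torsion-free
  connection.\<close>

lemma first_bianchi:
  assumes X: "vfield A U X" and Y: "vfield A U Y" and Z: "vfield A U Z" and x: "x \<in> U"
  shows "R 0 X Y Z x f + R 0 Y Z X x f + R 0 Z X Y x f = 0"
proof -
  have b: "lie_bracket A X (lie_bracket A Y Z) x f
      = nab X (nab Y Z) x f - nab X (nab Z Y) x f - nab (lie_bracket A Y Z) X x f"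
    if X: "vfield A U X" and Y: "vfield A U Y" and Z: "vfield A U Z" for X Y Z
    using nab_torsion_free[OF X lie_bracket_vfield[OF Y Z] x] nab_bracket[OF X Y Z x, of f]
    by (simp add: tlin_def)
  show ?thesis
    using jacobi_identity[OF X Y Z x, of f] b[OF X Y Z] b[OF Y Z X] b[OF Z X Y]
    by (simp add: conn_curvature_def N_zero)
qed

text \<open>The classical octahedron argument: four Bianchi identities combined linearly by the skew
  symmetries. It is carried out for the torsion-free connection, whose Bianchi identity has no
  correction terms.\<close>

lemma R_pair_symmetry:
  assumes X: "vfield A U X" and Y: "vfield A U Y" and Z: "vfield A U Z" and W: "vfield A U W" and x: "x \<in> U"
  shows "g x (R 0 X Y Z x) (W x) = g x (R 0 Z W X x) (Y x)"
proof -
  let ?r = "\<lambda>X Y Z W. g x (R 0 X Y Z x) (W x)"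
  have a12: "?r Y X Z W = - ?r X Y Z W"
    if "vfield A U X" "vfield A U Y" "vfield A U Z" "vfield A U W" for X Y Z W
  proof -
    have "R 0 Y X Z x = tlin (-1) (R 0 X Y Z x) 0 (R 0 X Y Z x)"
      using R_antisym12[OF that(1-3) x] by (simp add: tlin_def fun_eq_iff)
    then show ?thesis
      using g_lin1[OF R_tangent[OF that(1-3) x] R_tangent[OF that(1-3) x] vfield_tangent[OF that(4) x]]
      by simp
  qed
  have bi: "?r X Y Z W + ?r Y Z X W + ?r Z X Y W = 0"
    if "vfield A U X" "vfield A U Y" "vfield A U Z" "vfield A U W" for X Y Z W
  proof -
    note t = R_tangent[OF that(1,2,3) x, of 0] R_tangent[OF that(2,3,1) x, of 0] R_tangent[OF that(3,1,2) x, of 0]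
    have "tlin 1 (R 0 X Y Z x) 1 (tlin 1 (R 0 Y Z X x) 1 (R 0 Z X Y x)) = (\<lambda>_. 0)"
      using first_bianchi[OF that(1-3) x] by (simp add: tlin_def fun_eq_iff add.assoc)
    then show ?thesis
      using g_lin1[OF t(1) tangent_tlin[OF t(2,3)] vfield_tangent[OF that(4) x], of 1 1 1 1]
        g_lin1[OF t(2,3) vfield_tangent[OF that(4) x], of 1 1] g_zero1[OF vfield_tangent[OF that(4) x]]
      by simp
  qed
  note a34 = R_antisym34[where t = 0, OF _ _ _ _ x]
  show ?thesis
    using bi[OF X Y Z W] bi[OF Y Z W X] bi[OF Z W X Y] bi[OF W X Y Z]
      a12[OF X Y Z W] a12[OF X Z Y W] a12[OF Y W Z X] a12[OF W X Y Z] a12[OF Z W X Y] a12[OF Y Z X W]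
      a12[OF Y Z W X] a12[OF Z W Y X] a12[OF W X Z Y] a12[OF X Y W Z] a12[OF Z X Y W] a12[OF W Y X Z]
      a34[OF X Y Z W] a34[OF Y Z X W] a34[OF Z X Y W] a34[OF Y Z W X] a34[OF Z W X Y] a34[OF W X Y Z]
      a34[OF W Y Z X] a34[OF W Y X Z] a34[OF X Z Y W]
    by linarith
qed

lemma g_N_N:
  assumes X: "vfield A U X" and Y: "vfield A U Y" and Z: "vfield A U Z" and W: "vfield A U W" and x: "x \<in> U"
  shows "g x (N t X Y x) (N t Z W x) = g x (nab X Y x) (nab Z W x) + t * H x (Z x) (W x) (nab X Y x)
    + t * H x (X x) (Y x) (nab Z W x) + t * t * g x (tors X Y x) (tors Z W x)"
proof -
  have t: "X x \<in> T x" "Y x \<in> T x" "Z x \<in> T x" "W x \<in> T x" using X Y Z W x vfield_tangent by blast+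
  have s: "tors X Y x \<in> T x" "tors Z W x \<in> T x" using t by (auto intro: tors_tangent)
  have n: "nab X Y x \<in> T x" "nab Z W x \<in> T x" using nab_tangent X Y Z W x by blast+
  have "g x (nab X Y x) (tors Z W x) = H x (Z x) (W x) (nab X Y x)"
    using g_sym[OF n(1) s(2)] tors_inner[of Z x W, OF t(3,4) n(1)] by simp
  then show ?thesis unfolding torsion_conn_def
    using tors_inner[of X x Y, OF t(1,2) n(2)]
    by (simp add: g_lin1 g_lin2 n s tangent_tlin algebra_simps)
qed

text \<open>\<open>R_formula\<close> is a polynomial of degree two in \<open>t\<close>. The linear
  part collects derivatives of \<open>H\<close>, the quadratic part products of torsion
  vectors.\<close>

lemma R_torsion:
  assumes X: "vfield A U X" and Y: "vfield A U Y" and Z: "vfield A U Z" and W: "vfield A U W" and x: "x \<in> U"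
  shows "g x (R t X Y Z x) (W x) = g x (R 0 X Y Z x) (W x)
    + t * (X x (\<lambda>y. H y (Y y) (Z y) (W y)) - Y x (\<lambda>y. H y (X y) (Z y) (W y))
      - H x (X x) (W x) (nab Y Z x) - H x (Y x) (Z x) (nab X W x)
      + H x (Y x) (W x) (nab X Z x) + H x (X x) (Z x) (nab Y W x) - H x (lie_bracket A X Y x) (Z x) (W x))
    - t * t * (g x (tors Y Z x) (tors X W x) - g x (tors X Z x) (tors Y W x))"
proof -
  have d: "X x (\<lambda>y. g y (N t Y Z y) (W y))
      = X x (\<lambda>y. g y (nab Y Z y) (W y)) + t * X x (\<lambda>y. H y (Y y) (Z y) (W y))"
    if X: "vfield A U X" and Y: "vfield A U Y" for X Y
  proof -
    note Xx = vfield_tangent[OF X x]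
    have s: "smooth_at A x (\<lambda>y. g y (nab Y Z y) (W y))" "smooth_at A x (\<lambda>y. H y (Y y) (Z y) (W y))"
      by (rule g_smooth_at[OF nab_vfield[OF Y Z] W x], rule smooth_atI[OF H_smooth[OF Y Z W] x])
    have "X x (\<lambda>y. g y (N t Y Z y) (W y))
        = X x (\<lambda>y. g y (nab Y Z y) (W y) + t * H y (Y y) (Z y) (W y))"
      by (rule tangent_cong[OF Xx vfield_open[OF X] x]) (simp add: N_inner[OF Y Z] vfield_tangent[OF W])
    also have "\<dots> = X x (\<lambda>y. g y (nab Y Z y) (W y)) + t * X x (\<lambda>y. H y (Y y) (Z y) (W y))"
      by (simp add: tangent_add[OF Xx s(1) smooth_at_mult[OF smooth_at_const s(2)]] tangent_cmult[OF Xx s(2)])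
    finally show ?thesis .
  qed
  have b: "g x (N t (lie_bracket A X Y) Z x) (W x)
      = g x (nab (lie_bracket A X Y) Z x) (W x) + t * H x (lie_bracket A X Y x) (Z x) (W x)"
    by (rule N_inner[OF lie_bracket_vfield[OF X Y] Z x vfield_tangent[OF W x]])
  show ?thesis
    using R_formula[OF X Y Z W x, of t] R_formula[OF X Y Z W x, of 0] d[OF X Y] d[OF Y X] b
      g_N_N[OF Y Z X W x, of t] g_N_N[OF X Z Y W x, of t]
    by (simp add: N_zero algebra_simps)
qed

text \<open>The torsion term of \<open>\<nabla>\<^sup>+\<close> and \<open>\<nabla>\<^sup>-\<close> has opposite signs, so the quadratic terms agree after
  exchanging the pairs and the linear ones assemble to \<open>dH\<close>.\<close>

lemma curvature_exchange:
  assumes X: "vfield A U X" and Y: "vfield A U Y" and Z: "vfield A U Z" and W: "vfield A U W" and x: "x \<in> U"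
  shows "g x (R (1/2) X Y Z x) (W x) = g x (R (-1/2) Z W X x) (Y x) + 1/2 * ext_d3 A H X Y Z W x"
proof -
  have t: "X x \<in> T x" "Y x \<in> T x" "Z x \<in> T x" "W x \<in> T x" using X Y Z W x vfield_tangent by blast+
  have d: "Z x (\<lambda>y. H y (W y) (X y) (Y y)) = Z x (\<lambda>y. H y (X y) (Y y) (W y))"
    if "vfield A U X" "vfield A U Y" "vfield A U Z" "vfield A U W" for X Y Z W
    by (rule tangent_cong[OF vfield_tangent[OF that(3) x] vfield_open[OF that(3)] x])
      (rule H_cyc; rule vfield_tangent, rule that, assumption)
  have c: "H x (C x) (D x) (nab E F x) = H x (nab E F x) (C x) (D x)"
    and sw: "H x (nab E F x) (D x) (C x) = - H x (nab E F x) (C x) (D x)"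
    and br: "H x (lie_bracket A E F x) (C x) (D x) = H x (nab E F x) (C x) (D x) - H x (nab F E x) (C x) (D x)"
    if "vfield A U C" "vfield A U D" "vfield A U E" "vfield A U F" for C D E F
  proof -
    have v: "C x \<in> T x" "D x \<in> T x" "nab E F x \<in> T x" "nab F E x \<in> T x"
      using that x vfield_tangent nab_tangent by blast+
    show "H x (C x) (D x) (nab E F x) = H x (nab E F x) (C x) (D x)"
      by (rule H_cyc[OF v(1,2,3), symmetric])
    show "H x (nab E F x) (D x) (C x) = - H x (nab E F x) (C x) (D x)"
      by (rule H_swap23[OF v(3,1,2)])
    show "H x (lie_bracket A E F x) (C x) (D x) = H x (nab E F x) (C x) (D x) - H x (nab F E x) (C x) (D x)"
      by (simp add: nab_torsion_free[OF that(3,4) x] H_lin1 v)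
  qed
  have q: "g x (tors C D x) (tors E F x) = g x (tors F E x) (tors D C x)"
    if "vfield A U C" "vfield A U D" "vfield A U E" "vfield A U F" for C D E F
  proof -
    have v: "C x \<in> T x" "D x \<in> T x" "E x \<in> T x" "F x \<in> T x"
      using that x vfield_tangent by blast+
    have w: "tors E F x \<in> T x" "tors D C x \<in> T x" using v by (auto intro: tors_tangent)
    show ?thesis
      using tors_inner[of C x D, OF v(1,2) w(1)] tors_inner[of D x C, OF v(2,1) w(1)]
        H_swap12[OF v(1,2) w(1)] g_sym[OF w] tors_inner[of E x F, OF v(3,4) w(2)]
        tors_inner[of F x E, OF v(4,3) w(2)] H_swap12[OF v(3,4) w(2)] by simp
  qed
  have tT: "tors X Z x \<in> T x" "tors Y W x \<in> T x" using t by (auto intro: tors_tangent)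
  \<comment> \<open>Pair symmetry settles the part without torsion. The facts \<open>br\<close>,
    \<open>c\<close> and \<open>sw\<close> bring all linear terms to the shape
    \<open>H (nab E F) C D\<close>, and \<open>q\<close> matches the quadratic ones.\<close>
  show ?thesis
    using R_torsion[OF X Y Z W x, of "1/2"] R_torsion[OF Z W X Y x, of "-1/2"] R_pair_symmetry[OF X Y Z W x]
      d[OF X Y Z W] d[OF X Y W Z] q[OF W X Z Y] q[OF Z X W Y] g_sym[OF tT]
      br[OF Z W X Y] br[OF Y W X Z] br[OF Y Z X W] br[OF X W Y Z] br[OF X Z Y W] br[OF X Y Z W]
      c[OF X W Y Z] c[OF Y Z X W] c[OF Y W X Z] c[OF X Z Y W]
      c[OF Z Y W X] c[OF W X Z Y] c[OF W Y Z X] c[OF Z X W Y]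
      sw[OF Y Z W X] sw[OF X W Z Y] sw[OF Y W Z X] sw[OF X Z W Y]
    by (simp add: ext_d3_def Let_def field_simps)
qed

section \<open>Tensoriality of the curvature\<close>

lemma N_N_leibniz:
  assumes X: "vfield A U X" and Y: "vfield A U Y" and Z: "vfield A U Z" and Z': "vfield A U Z'"
    and f: "smooth_fun A U f" and x: "x \<in> U"
  shows "N t X (N t Y (\<lambda>y. tlin (f y) (Z y) 1 (Z' y))) x h
    = X x (\<lambda>y. Y y f) * Z x h + Y x f * N t X Z x h + X x f * N t Y Z x h
      + f x * N t X (N t Y Z) x h + N t X (N t Y Z') x h"
proof -
  have oU: "open U" by (rule vfield_open[OF X])
  have ZZ: "vfield A U (\<lambda>y. tlin (f y) (Z y) 1 (Z' y))"
    by (rule vfield_tlin[OF Z Z' f smooth_fun_const[OF oU]])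
  have Yf: "smooth_fun A U (\<lambda>y. Y y f)"
    by (rule smooth_fun_local[OF vfield_smooth_at[OF Y _ smooth_atI[OF f]] oU])
  note n = N_vfield[OF Y Z, of t] N_vfield[OF Y Z', of t]
  have I: "vfield A U (\<lambda>y. tlin (f y) (N t Y Z y) 1 (N t Y Z' y))"
    by (rule vfield_tlin[OF n f smooth_fun_const[OF oU]])
  have e1: "N t X (N t Y (\<lambda>y. tlin (f y) (Z y) 1 (Z' y))) x
      = N t X (\<lambda>y. tlin (Y y f) (Z y) 1 (tlin (f y) (N t Y Z y) 1 (N t Y Z' y))) x"
    by (rule N_cong[OF X N_vfield[OF Y ZZ] x refl N_leibniz[OF Y Z Z' f]])
  have e2: "N t X (\<lambda>y. tlin (Y y f) (Z y) 1 (tlin (f y) (N t Y Z y) 1 (N t Y Z' y))) x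
      = tlin (X x (\<lambda>y. Y y f)) (Z x) 1
      (tlin (Y x f) (N t X Z x) 1 (N t X (\<lambda>y. tlin (f y) (N t Y Z y) 1 (N t Y Z' y)) x))"
    by (rule N_leibniz[OF X Z I Yf x])
  have e3: "N t X (\<lambda>y. tlin (f y) (N t Y Z y) 1 (N t Y Z' y)) x
      = tlin (X x f) (N t Y Z x) 1 (tlin (f x) (N t X (N t Y Z) x) 1 (N t X (N t Y Z') x))"
    by (rule N_leibniz[OF X n f x])
  show ?thesis unfolding e1 e2 e3 by (simp add: tlin_def)
qed

text \<open>Of the terms of \<open>N_N_leibniz\<close> that differentiate \<open>f\<close>, those
  with one derivative are symmetric in \<open>X\<close> and \<open>Y\<close>, and those with two are
  removed by the bracket term. Needed to move from the gauge frame to an arbitrary one.\<close>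

lemma R_tensorial:
  assumes X: "vfield A U X" and Y: "vfield A U Y" and x: "x \<in> U" and w: "w \<in> T x"
  shows "tensorial x (\<lambda>Z. g x (R t X Y Z x) w)"
  unfolding tensorial_def
proof (intro conjI allI impI; elim conjE)
  fix V and f :: "'m \<Rightarrow> real" and Z Z'
  assume Z: "vfield A V Z" and Z': "vfield A V Z'" and f: "smooth_fun A V f" and xV: "x \<in> V"
  let ?W = "U \<inter> V"
  have W: "open ?W" "x \<in> ?W" using vfield_open[OF X] vfield_open[OF Z] x xV by auto
  have r: "vfield A ?W X" "vfield A ?W Y" "vfield A ?W Z" "vfield A ?W Z'"
    using vfield_subset[OF X W(1)] vfield_subset[OF Y W(1)] vfield_subset[OF Z W(1)]
      vfield_subset[OF Z' W(1)] by simp_all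
  have fW: "smooth_fun A ?W f" by (rule smooth_fun_subset[OF f W(1)]) simp
  have "R t X Y (\<lambda>y. tlin (f y) (Z y) 1 (Z' y)) x = tlin (f x) (R t X Y Z x) 1 (R t X Y Z' x)"
  proof
    fix h
    show "R t X Y (\<lambda>y. tlin (f y) (Z y) 1 (Z' y)) x h = tlin (f x) (R t X Y Z x) 1 (R t X Y Z' x) h"
      unfolding conn_curvature_def N_N_leibniz[OF r(1-4) fW W(2)] N_N_leibniz[OF r(2,1,3,4) fW W(2)]
        N_leibniz[OF lie_bracket_vfield[OF r(1,2)] r(3,4) fW W(2)]
      unfolding tlin_def lie_bracket_apply[OF smooth_atI[OF fW W(2)]]
      by (simp add: algebra_simps)
  qed
  then show "g x (R t X Y (\<lambda>y. tlin (f y) (Z y) 1 (Z' y)) x) w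
      = f x *\<^sub>R g x (R t X Y Z x) w + g x (R t X Y Z' x) w"
    by (simp add: g_lin1 R_tangent[OF r(1,2,3) W(2)] R_tangent[OF r(1,2,4) W(2)] w)
next
  fix V Z Z' assume Z: "vfield A V Z" and xV: "x \<in> V" and eq: "\<forall>y\<in>V. Z y = Z' y"
  let ?W = "U \<inter> V"
  have W: "open ?W" "x \<in> ?W" using vfield_open[OF X] vfield_open[OF Z] x xV by auto
  have r: "vfield A ?W X" "vfield A ?W Y" "vfield A ?W Z"
    using vfield_subset[OF X W(1)] vfield_subset[OF Y W(1)] vfield_subset[OF Z W(1)] by simp_all
  have e1: "N t P Z y = N t P Z' y" if "vfield A ?W P" "y \<in> ?W" for P y
    by (rule N_cong[OF that(1) r(3) that(2)]) (use eq in auto)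
  have e2: "N t P (N t P' Z) x = N t P (N t P' Z') x" if "vfield A ?W P" "vfield A ?W P'" for P P'
    by (rule N_cong[OF that(1) N_vfield[OF that(2) r(3)] W(2) refl e1[OF that(2)]])
  have "R t X Y Z x = R t X Y Z' x"
    by (simp add: conn_curvature_def e2[OF r(1,2)] e2[OF r(2,1)] e1[OF lie_bracket_vfield[OF r(1,2)] W(2)])
  then show "g x (R t X Y Z x) w = g x (R t X Y Z' x) w" by simp
qed

end

section \<open>Clifford multiplication\<close>

text \<open>Only the Clifford relations are recorded, so that the algebra applies both to the
  constant matrices of the module and to multiplication by any orthonormal frame at a point.\<close>

locale clifford_frame =
  fixes E :: "'i::finite \<Rightarrow> 'v::real_vector \<Rightarrow> 'v"
  assumes E_linear: "linear (E a)"
    and E_anticommute: "E a (E b \<sigma>) = (if a = b then - 2 else 0) *\<^sub>R \<sigma> - E b (E a \<sigma>)"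
begin

text \<open>The spin representation of a skew matrix, with the normalisation used for the action of
  two-forms.\<close>

definition spin_op :: "('i \<Rightarrow> 'i \<Rightarrow> real) \<Rightarrow> 'v \<Rightarrow> 'v" where
  "spin_op p \<sigma> = (1/4) *\<^sub>R (\<Sum>a\<in>UNIV. \<Sum>b\<in>UNIV. p a b *\<^sub>R E a (E b \<sigma>))"

lemmas E_simps = linear_add[OF E_linear] linear_diff[OF E_linear] linear_scale[OF E_linear]
  linear_sum[OF E_linear] linear_0[OF E_linear] linear_neg[OF E_linear]

lemma spin_op_linear: "linear (spin_op p)"
  by (rule linearI) (simp_all add: spin_op_def E_simps scaleR_add_right sum.distrib scaleR_sum_right
      mult.commute)

text \<open>Two uses of the Clifford relation move \<open>E c\<close> to the front; the corrections
  -2 and 2 add up to 4 by skewness and cancel the 1/4. In other words, \<open>spin_op p\<close> acts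
  on vectors as the matrix \<open>p\<close>.\<close>

lemma spin_op_commutator:
  assumes anti: "\<And>a b. p b a = - p a b"
  shows "spin_op p (E c \<sigma>) = E c (spin_op p \<sigma>) + (\<Sum>b\<in>UNIV. p c b *\<^sub>R E b \<sigma>)"
proof -
  have t: "E a (E b (E c \<sigma>)) = E c (E a (E b \<sigma>)) + (if b = c then -2 else 0) *\<^sub>R E a \<sigma>
      + (if a = c then 2 else 0) *\<^sub>R E b \<sigma>" for a b
    using E_anticommute[of b c \<sigma>] E_anticommute[of a c "E b \<sigma>"] by (auto simp: E_simps)
  have e1: "(\<Sum>a\<in>UNIV. \<Sum>b\<in>UNIV. p a b *\<^sub>R E a (E b (E c \<sigma>)))
      = (\<Sum>a\<in>UNIV. \<Sum>b\<in>UNIV. p a b *\<^sub>R E c (E a (E b \<sigma>)))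
      + (\<Sum>a\<in>UNIV. \<Sum>b\<in>UNIV. (if b = c then (-2 * p a b) *\<^sub>R E a \<sigma> else 0))
      + (\<Sum>a\<in>UNIV. \<Sum>b\<in>UNIV. (if a = c then (2 * p a b) *\<^sub>R E b \<sigma> else 0))"
    unfolding sum.distrib[symmetric] t
    by (intro sum.cong refl) (auto simp: scaleR_add_right)
  have e2: "(\<Sum>a\<in>UNIV. \<Sum>b\<in>UNIV. (if b = c then (-2 * p a b) *\<^sub>R E a \<sigma> else 0))
      = (\<Sum>b\<in>UNIV. (2 * p c b) *\<^sub>R E b \<sigma>)"
    by (simp add: anti[of c])
  have e3: "(\<Sum>a\<in>UNIV. \<Sum>b\<in>UNIV. (if a = c then (2 * p a b) *\<^sub>R E b \<sigma> else 0))
      = (\<Sum>b\<in>UNIV. (2 * p c b) *\<^sub>R E b \<sigma>)"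
    by (subst sum.swap) simp
  have "(\<Sum>a\<in>UNIV. \<Sum>b\<in>UNIV. p a b *\<^sub>R E a (E b (E c \<sigma>)))
      = (\<Sum>a\<in>UNIV. \<Sum>b\<in>UNIV. p a b *\<^sub>R E c (E a (E b \<sigma>))) + 4 *\<^sub>R (\<Sum>b\<in>UNIV. p c b *\<^sub>R E b \<sigma>)"
    unfolding e1 e2 e3
    by (simp add: scaleR_sum_right sum.distrib[symmetric] scaleR_add_left[symmetric] add.assoc)
  then show ?thesis by (simp add: spin_op_def E_simps scaleR_add_right)
qed

text \<open>\<open>spin_op p\<close> is a derivation with respect to Clifford products, so it
  suffices to let it act on each \<open>E a (E b \<sigma>)\<close> in \<open>spin_op q\<close>. By
  skewness the matrix on the right is the commutator \<open>q p - p q\<close>.\<close>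

lemma spin_op_bracket:
  assumes p: "\<And>a b. p b a = - p a b" and q: "\<And>a b. q b a = - q a b"
  shows "spin_op p (spin_op q \<sigma>) - spin_op q (spin_op p \<sigma>)
    = spin_op (\<lambda>a b. \<Sum>c\<in>UNIV. p a c * q b c - q a c * p b c) \<sigma>"
proof -
  let ?S = "\<lambda>f. \<Sum>a\<in>UNIV. \<Sum>b\<in>UNIV. \<Sum>c\<in>UNIV. f a b c"
  have t: "spin_op p (E a (E b \<sigma>)) = E a (E b (spin_op p \<sigma>))
      + (\<Sum>c\<in>UNIV. p b c *\<^sub>R E a (E c \<sigma>)) + (\<Sum>c\<in>UNIV. p a c *\<^sub>R E c (E b \<sigma>))" for a b
    by (simp add: spin_op_commutator[OF p] E_simps)
  have "4 *\<^sub>R spin_op p (spin_op q \<sigma>) = (\<Sum>a\<in>UNIV. \<Sum>b\<in>UNIV. q a b *\<^sub>R spin_op p (E a (E b \<sigma>)))"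
    unfolding spin_op_def[of q]
    by (simp add: linear_scale[OF spin_op_linear] linear_sum[OF spin_op_linear])
  also have "\<dots> = 4 *\<^sub>R spin_op q (spin_op p \<sigma>)
      + ?S (\<lambda>a b c. (q a b * p b c) *\<^sub>R E a (E c \<sigma>)) + ?S (\<lambda>a b c. (q a b * p a c) *\<^sub>R E c (E b \<sigma>))"
    unfolding t spin_op_def[of q]
    by (simp add: scaleR_add_right sum.distrib scaleR_sum_right)
  finally have e1: "4 *\<^sub>R spin_op p (spin_op q \<sigma>) = 4 *\<^sub>R spin_op q (spin_op p \<sigma>)
      + ?S (\<lambda>a b c. (q a b * p b c) *\<^sub>R E a (E c \<sigma>)) + ?S (\<lambda>a b c. (q a b * p a c) *\<^sub>R E c (E b \<sigma>))" .
  \<comment> \<open>Indices are renamed until the operators read \<open>E a (E b \<sigma>)\<close>.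
    One use of skewness produces the sign here; in \<open>e3\<close> two uses cancel.\<close>
  have e2: "?S (\<lambda>a b c. (q a b * p b c) *\<^sub>R E a (E c \<sigma>))
      = ?S (\<lambda>a b c. (- q a c * p b c) *\<^sub>R E a (E b \<sigma>))"
  proof (rule sum.cong[OF refl])
    fix a
    have "(\<Sum>b\<in>UNIV. \<Sum>c\<in>UNIV. (q a b * p b c) *\<^sub>R E a (E c \<sigma>))
        = (\<Sum>c\<in>UNIV. \<Sum>b\<in>UNIV. (q a b * p b c) *\<^sub>R E a (E c \<sigma>))" by (rule sum.swap)
    also have "\<dots> = (\<Sum>c\<in>UNIV. \<Sum>b\<in>UNIV. (- q a b * p c b) *\<^sub>R E a (E c \<sigma>))"
    proof (intro sum.cong refl)
      fix c b
      show "(q a b * p b c) *\<^sub>R E a (E c \<sigma>) = (- q a b * p c b) *\<^sub>R E a (E c \<sigma>)"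
        using p[of b c] by simp
    qed
    finally show "(\<Sum>b\<in>UNIV. \<Sum>c\<in>UNIV. (q a b * p b c) *\<^sub>R E a (E c \<sigma>))
        = (\<Sum>b\<in>UNIV. \<Sum>c\<in>UNIV. (- q a c * p b c) *\<^sub>R E a (E b \<sigma>))" .
  qed
  have e3: "?S (\<lambda>a b c. (q a b * p a c) *\<^sub>R E c (E b \<sigma>))
      = ?S (\<lambda>a b c. (p a c * q b c) *\<^sub>R E a (E b \<sigma>))"
  proof -
    have "?S (\<lambda>a b c. (q a b * p a c) *\<^sub>R E c (E b \<sigma>))
        = (\<Sum>a\<in>UNIV. \<Sum>c\<in>UNIV. \<Sum>b\<in>UNIV. (q a b * p a c) *\<^sub>R E c (E b \<sigma>))"
      by (intro sum.cong refl sum.swap)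
    also have "\<dots> = (\<Sum>c\<in>UNIV. \<Sum>a\<in>UNIV. \<Sum>b\<in>UNIV. (q a b * p a c) *\<^sub>R E c (E b \<sigma>))"
      by (rule sum.swap)
    also have "\<dots> = (\<Sum>c\<in>UNIV. \<Sum>b\<in>UNIV. \<Sum>a\<in>UNIV. (q a b * p a c) *\<^sub>R E c (E b \<sigma>))"
      by (intro sum.cong refl sum.swap)
    also have "\<dots> = (\<Sum>c\<in>UNIV. \<Sum>b\<in>UNIV. \<Sum>a\<in>UNIV. (p c a * q b a) *\<^sub>R E c (E b \<sigma>))"
    proof (intro sum.cong refl)
      fix c b a
      show "(q a b * p a c) *\<^sub>R E c (E b \<sigma>) = (p c a * q b a) *\<^sub>R E c (E b \<sigma>)"
        using p[of a c] q[of a b] by simp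
    qed
    finally show ?thesis .
  qed
  have "4 *\<^sub>R (spin_op p (spin_op q \<sigma>) - spin_op q (spin_op p \<sigma>))
      = ?S (\<lambda>a b c. (- q a c * p b c) *\<^sub>R E a (E b \<sigma>)) + ?S (\<lambda>a b c. (p a c * q b c) *\<^sub>R E a (E b \<sigma>))"
    unfolding scaleR_diff_right e1 e2 e3 by simp
  also have "\<dots> = 4 *\<^sub>R spin_op (\<lambda>a b. \<Sum>c\<in>UNIV. p a c * q b c - q a c * p b c) \<sigma>"
    by (simp add: spin_op_def scaleR_sum_left sum.distrib[symmetric] scaleR_left_diff_distrib)
  finally show ?thesis by simp
qed

end

section \<open>Spinors\<close>

lemma (in manifold) tder_linear:
  fixes L :: "'a::euclidean_space \<Rightarrow> 'b::euclidean_space"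
  assumes L: "linear L" and v: "v \<in> tangent_space A x" and f: "smooth_at A x f"
  shows "tder v (\<lambda>y. L (f y)) = L (tder v f)"
proof (rule tder_eqI)
  fix z
  show "L (tder v f) \<bullet> z = v (\<lambda>y. L (f y) \<bullet> z)"
    using tder_inner[OF orthobasis_Basis v f, of "adjoint L z"] by (simp add: adjoint_works[OF L])
qed

lemma bilinear_scaleR: "bilinear (\<lambda>r (v::'a::real_vector). r *\<^sub>R v)"
  unfolding bilinear_def by (auto intro!: linearI simp: algebra_simps)

lemma (in manifold) tder_scaleR:
  fixes f :: "'m \<Rightarrow> real" and h :: "'m \<Rightarrow> 'l::euclidean_space"
  assumes v: "v \<in> tangent_space A x" and f: "smooth_at A x f" and h: "smooth_at A x h"
  shows "tder v (\<lambda>y. f y *\<^sub>R h y) = v f *\<^sub>R h x + f x *\<^sub>R tder v h"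
  using tder_bilinear[OF orthobasis_Basis orthobasis_Basis bilinear_scaleR v f h]
  by (simp add: tder_real[OF v f])

lemma matrix_inv_eqI:
  fixes h :: "real^'n^'n"
  assumes "h ** h' = mat 1" "h' ** h = mat 1" shows "matrix_inv h = h'"
proof -
  have "h ** matrix_inv h = mat 1 \<and> matrix_inv h ** h = mat 1"
    unfolding matrix_inv_def by (rule someI[of _ h']) (use assms in simp)
  then have h: "h ** matrix_inv h = mat 1" by blast
  have "matrix_inv h = (h' ** h) ** matrix_inv h" by (simp add: assms(2))
  also have "\<dots> = h' ** (h ** matrix_inv h)" by (rule matrix_mul_assoc[symmetric])
  also have "\<dots> = h'" by (simp add: h)
  finally show ?thesis .
qed

text \<open>Discharges the frame assumption of \<open>riemannian\<close>: a gauge pulls the frame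
  map back to an orthonormal frame.\<close>

lemma frames_of_spin_structure:
  assumes "spin_structure A g Q" shows "\<exists>U e. x \<in> U \<and> on_frame A g U e"
proof -
  have 1: "(\<Union>(U, s)\<in>sgauge Q. U) = UNIV"
    and 2: "\<forall>(U, s)\<in>sgauge Q. open U \<and> (\<forall>x\<in>U. sproj Q (s x) = x) \<and> (\<forall>i. vfield A U (\<lambda>x. sframe Q (s x) i))"
    and 3: "\<forall>q i j. g (sproj Q q) (sframe Q q i) (sframe Q q j) = (if i = j then 1 else 0)"
    using assms unfolding spin_structure_def by - (elim conjE, assumption)+
  have "x \<in> (\<Union>(U, s)\<in>sgauge Q. U)" by (simp only: 1 UNIV_I)
  then obtain U s where s: "(U, s) \<in> sgauge Q" "x \<in> U" by auto
  have p: "sproj Q (s y) = y" if "y \<in> U" for y using bspec[OF 2 s(1)] that by simp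
  have "on_frame A g U (\<lambda>i y. sframe Q (s y) i)"
    unfolding on_frame_def
  proof (intro conjI allI ballI)
    show "vfield A U (\<lambda>y. sframe Q (s y) i)" for i using bspec[OF 2 s(1)] by simp
    show "g y (sframe Q (s y) i) (sframe Q (s y) j) = (if i = j then 1 else 0)" if "y \<in> U" for y i j
      using 3[rule_format, of "s y" i j] p[OF that] by simp
  qed
  then show ?thesis using s(2) by (intro exI conjI)
qed

locale spin_geometry = torsion_geometry A g nab H
  for A :: "('m::{t2_space, second_countable_topology}, real^'n) atlas" and g and nab and H +
  fixes Q :: "('q, 'm, 'n::finite, 's::finite) spin_data" and \<eta> :: "'q \<Rightarrow> real^'s"
  assumes spin: "spin_structure A g Q" and spinor: "spinor A Q \<eta>"
begin

abbreviation "c \<equiv> sclif Q"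

lemma clifford_rep: "clifford_rep c"
  using spin unfolding spin_structure_def by (elim conjE)

lemma c_linear: "linear c" and c_square: "c v ** c v = - ((v \<bullet> v) *\<^sub>R mat 1)"
  using clifford_rep by (simp_all add: clifford_rep_def)

lemma sframe_tangent: "sframe Q q i \<in> T (sproj Q q)"
proof -
  have "\<forall>q i. sframe Q q i \<in> T (sproj Q q)"
    using spin unfolding spin_structure_def by (elim conjE)
  then show ?thesis by simp
qed

lemma sframe_orth: "g (sproj Q q) (sframe Q q i) (sframe Q q j) = (if i = j then 1 else 0)"
proof -
  have "\<forall>q i j. g (sproj Q q) (sframe Q q i) (sframe Q q j) = (if i = j then 1 else 0)"
    using spin unfolding spin_structure_def by (elim conjE)
  then show ?thesis by simp
qed

lemma sact_proj: "h \<in> spin_group c \<Longrightarrow> sproj Q (sact Q q h) = sproj Q q"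
proof -
  have "\<forall>q. \<forall>h\<in>spin_group c. sproj Q (sact Q q h) = sproj Q q"
    using spin unfolding spin_structure_def by (elim conjE)
  then show "h \<in> spin_group c \<Longrightarrow> sproj Q (sact Q q h) = sproj Q q" by simp
qed

lemma sact_transitive:
  assumes "sproj Q q = sproj Q q'" shows "\<exists>h\<in>spin_group c. q' = sact Q q h"
proof -
  have "\<forall>q q'. sproj Q q = sproj Q q' \<longrightarrow> (\<exists>!h. h \<in> spin_group c \<and> q' = sact Q q h)"
    using spin unfolding spin_structure_def by (elim conjE)
  then show ?thesis using assms by blast
qed

lemma sact_frame: "h \<in> spin_group c \<Longrightarrow>
    sframe Q (sact Q q h) i = (\<lambda>f. \<Sum>j\<in>UNIV. spin_rotation c h (axis i 1) $ j * sframe Q q j f)"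
proof -
  have "\<forall>q i. \<forall>h\<in>spin_group c. sframe Q (sact Q q h) i =
        (\<lambda>f. \<Sum>j\<in>UNIV. spin_rotation c h (axis i 1) $ j * sframe Q q j f)"
    using spin unfolding spin_structure_def by (elim conjE)
  then show "h \<in> spin_group c \<Longrightarrow>
    sframe Q (sact Q q h) i = (\<lambda>f. \<Sum>j\<in>UNIV. spin_rotation c h (axis i 1) $ j * sframe Q q j f)"
    by blast
qed

lemma spinor_equivariant: "h \<in> spin_group c \<Longrightarrow> \<eta> (sact Q q h) = matrix_inv h *v \<eta> q"
  using spinor unfolding spinor_def by blast

lemma gauge_exists: obtains U s where "(U, s) \<in> sgauge Q" "x \<in> U"
proof -
  have "(\<Union>(U, s)\<in>sgauge Q. U) = UNIV" using spin unfolding spin_structure_def by (elim conjE)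
  then have "x \<in> (\<Union>(U, s)\<in>sgauge Q. U)" by (simp only: UNIV_I)
  then show ?thesis using that by auto
qed

lemma gauge: assumes "(U, s) \<in> sgauge Q"
  shows gauge_open: "open U" and gauge_proj: "x \<in> U \<Longrightarrow> sproj Q (s x) = x"
    and gauge_vfield: "vfield A U (\<lambda>x. sframe Q (s x) i)"
proof -
  have 1: "\<forall>(U, s)\<in>sgauge Q. open U \<and> (\<forall>x\<in>U. sproj Q (s x) = x) \<and> (\<forall>i. vfield A U (\<lambda>x. sframe Q (s x) i))"
    using spin unfolding spin_structure_def by (elim conjE)
  have 2: "open U \<and> (\<forall>x\<in>U. sproj Q (s x) = x) \<and> (\<forall>i. vfield A U (\<lambda>x. sframe Q (s x) i))"
    using bspec[OF 1 assms] by simp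
  show "open U" "x \<in> U \<Longrightarrow> sproj Q (s x) = x" "vfield A U (\<lambda>x. sframe Q (s x) i)"
    using 2 by simp_all
qed

lemma gauge_frame: assumes s: "(U, s) \<in> sgauge Q" shows "on_frame A g U (\<lambda>i y. sframe Q (s y) i)"
  unfolding on_frame_def
proof (intro conjI allI ballI)
  show "vfield A U (\<lambda>y. sframe Q (s y) i)" for i by (rule gauge_vfield[OF s])
  show "g x (sframe Q (s x) i) (sframe Q (s x) j) = (if i = j then 1 else 0)" if "x \<in> U" for x i j
    using sframe_orth[of "s x" i j] gauge_proj[OF s that] by simp
qed

lemma gauge_spinor: "(U, s) \<in> sgauge Q \<Longrightarrow> smooth_fun A U (\<lambda>y. \<eta> (s y))"
  using spinor unfolding spinor_def by (auto simp: o_def)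

lemma c_vec_linear: "linear (\<lambda>v. c v *v \<sigma>)"
  by (rule linearI)
    (simp_all add: linear_add[OF c_linear] linear_scale[OF c_linear] matrix_vector_mult_add_rdistrib
      scaleR_matrix_vector_assoc[symmetric])

lemma c_square_vec: "c v *v (c v *v \<sigma>) = (- (v \<bullet> v)) *\<^sub>R \<sigma>"
proof -
  have "c v *v (c v *v \<sigma>) = (- ((v \<bullet> v) *\<^sub>R mat 1)) *v \<sigma>"
    unfolding matrix_vector_mul_assoc c_square ..
  also have "- ((v \<bullet> v) *\<^sub>R mat 1 :: real^'s^'s) = (- (v \<bullet> v)) *\<^sub>R mat 1" by simp
  finally show ?thesis by (simp only: scaleR_matrix_vector_assoc[symmetric] matrix_vector_mul_lid)
qed

text \<open>Polarisation: compare \<open>c_square_vec\<close> at \<open>u + v\<close>,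
  \<open>u\<close> and \<open>v\<close>.\<close>

lemma c_anticommute_vec: "c u *v (c v *v \<sigma>) = (- 2 * (u \<bullet> v)) *\<^sub>R \<sigma> - c v *v (c u *v \<sigma>)"
proof -
  have "c (u + v) *v (c (u + v) *v \<sigma>) = (- ((u + v) \<bullet> (u + v))) *\<^sub>R \<sigma>" by (rule c_square_vec)
  moreover have "c (u + v) *v (c (u + v) *v \<sigma>)
      = (- (u \<bullet> u)) *\<^sub>R \<sigma> + c u *v (c v *v \<sigma>) + (c v *v (c u *v \<sigma>) + (- (v \<bullet> v)) *\<^sub>R \<sigma>)"
    by (simp only: linear_add[OF c_vec_linear] matrix_vector_right_distrib c_square_vec)
      (simp add: algebra_simps)
  moreover have "- ((u + v) \<bullet> (u + v)) = - (u \<bullet> u) + - 2 * (u \<bullet> v) + - (v \<bullet> v)"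
    by (simp add: inner_add_left inner_add_right inner_commute)
  ultimately have "(- (u \<bullet> u)) *\<^sub>R \<sigma> + c u *v (c v *v \<sigma>) + (c v *v (c u *v \<sigma>) + (- (v \<bullet> v)) *\<^sub>R \<sigma>)
      = (- (u \<bullet> u)) *\<^sub>R \<sigma> + (- 2 * (u \<bullet> v)) *\<^sub>R \<sigma> + (- (v \<bullet> v)) *\<^sub>R \<sigma>"
    by (simp only: scaleR_add_left)
  moreover have "x = w - y" if "a + x + (y + b) = a + w + b" for a b w x y :: "real^'s"
    using that by (simp add: algebra_simps)
  ultimately show ?thesis by blast
qed

definition comps :: "'q \<Rightarrow> 'm tvec \<Rightarrow> real^'n" where
  "comps q v = (\<chi> i. g (sproj Q q) v (sframe Q q i))"

lemma clif_comps: "clif g Q q v \<sigma> = c (comps q v) *v \<sigma>"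
  by (simp add: clif_def comps_def)

lemma comps_sum:
  "(\<And>i. i \<in> I \<Longrightarrow> v i \<in> T (sproj Q q)) \<Longrightarrow> finite I \<Longrightarrow>
    comps q (\<lambda>f. \<Sum>i\<in>I. k i * v i f) = (\<Sum>i\<in>I. k i *\<^sub>R comps q (v i))"
  by (simp add: comps_def vec_eq_iff g_sum1 sframe_tangent sum_component)

lemma comps_inner:
  "u \<in> T (sproj Q q) \<Longrightarrow> v \<in> T (sproj Q q) \<Longrightarrow> comps q u \<bullet> comps q v = g (sproj Q q) u v"
  using orthonormal_inner[OF sframe_tangent sframe_orth, of u q v] by (simp add: comps_def inner_vec_def)

lemma clif_linear: "linear (clif g Q q v)"
  unfolding clif_comps[abs_def] by (rule matrix_vector_mul_linear)

lemma clif_sum: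
  "(\<And>i. i \<in> I \<Longrightarrow> v i \<in> T (sproj Q q)) \<Longrightarrow> finite I \<Longrightarrow>
    clif g Q q (\<lambda>f. \<Sum>i\<in>I. k i * v i f) \<sigma> = (\<Sum>i\<in>I. k i *\<^sub>R clif g Q q (v i) \<sigma>)"
  by (simp add: clif_comps comps_sum linear_sum[OF c_vec_linear] linear_scale[OF c_vec_linear])

lemma clif_expand_frame:
  assumes e: "on_frame A g V e" "sproj Q q \<in> V" and v: "v \<in> T (sproj Q q)"
  shows "clif g Q q v \<sigma>
    = (\<Sum>k\<in>UNIV. g (sproj Q q) v (e k (sproj Q q)) *\<^sub>R clif g Q q (e k (sproj Q q)) \<sigma>)"
proof -
  have "v = (\<lambda>f. \<Sum>k\<in>UNIV. g (sproj Q q) v (e k (sproj Q q)) * e k (sproj Q q) f)"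
    by (rule ext) (rule frame_expand[OF e v])
  then have "clif g Q q v \<sigma> = clif g Q q (\<lambda>f. \<Sum>k\<in>UNIV. g (sproj Q q) v (e k (sproj Q q)) * e k (sproj Q q) f) \<sigma>"
    by (rule arg_cong)
  then show ?thesis by (simp add: clif_sum frame_tangent[OF e])
qed

lemma clif_anticommute:
  "u \<in> T (sproj Q q) \<Longrightarrow> v \<in> T (sproj Q q) \<Longrightarrow>
    clif g Q q u (clif g Q q v \<sigma>) = (- 2 * g (sproj Q q) u v) *\<^sub>R \<sigma> - clif g Q q v (clif g Q q u \<sigma>)"
  unfolding clif_comps using c_anticommute_vec[of "comps q u" "comps q v" \<sigma>] comps_inner[of u q v] by simp

lemma clifford_frame_at:
  assumes "\<And>i. e i \<in> T (sproj Q q)" "\<And>i j. g (sproj Q q) (e i) (e j) = (if i = j then 1 else 0)"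
  shows "clifford_frame (\<lambda>i::'n. clif g Q q (e i))"
  unfolding clifford_frame_def
proof (intro conjI allI, rule clif_linear)
  fix a b :: 'n and \<sigma> :: "real^'s"
  have "(- 2 * g (sproj Q q) (e a) (e b)) *\<^sub>R \<sigma> = (if a = b then - 2 else 0) *\<^sub>R \<sigma>"
    by (simp add: assms(2))
  then show "clif g Q q (e a) (clif g Q q (e b) \<sigma>)
      = (if a = b then - 2 else 0) *\<^sub>R \<sigma> - clif g Q q (e b) (clif g Q q (e a) \<sigma>)"
    using clif_anticommute[OF assms(1)[of a] assms(1)[of b], of \<sigma>] by simp
qed

lemma c_neg_vec: "c (- u) *v \<sigma> = - (c u *v \<sigma>)"
  by (rule linear_neg[OF c_vec_linear])

section \<open>The spin group and changes of point in a fibre\<close>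

lemma c_unit_inverse: assumes "norm u = 1" shows "c u ** c (- u) = mat 1" "c (- u) ** c u = mat 1"
proof -
  have "u \<bullet> u = 1" using assms by (simp add: dot_square_norm)
  then have "c u *v (c (- u) *v \<sigma>) = \<sigma>" "c (- u) *v (c u *v \<sigma>) = \<sigma>" for \<sigma>
    by (simp_all add: c_neg_vec linear_neg[OF matrix_vector_mul_linear] c_square_vec)
  then show "c u ** c (- u) = mat 1" "c (- u) ** c u = mat 1"
    by (simp_all add: matrix_eq matrix_vector_mul_assoc[symmetric])
qed

lemma c_reflect: "\<exists>w. c w = c u ** c v ** c (- u)"
proof -
  \<comment> \<open>For a unit vector \<open>u\<close> this is minus the reflection of
    \<open>v\<close> in the hyperplane orthogonal to \<open>u\<close>; it results from anticommuting
    \<open>c v\<close> past \<open>c u\<close>.\<close>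
  let ?w = "(2 * (u \<bullet> v)) *\<^sub>R u - (u \<bullet> u) *\<^sub>R v"
  have "c ?w *v \<sigma> = c u *v (c v *v (c (- u) *v \<sigma>))" for \<sigma>
  proof -
    have "c u *v (c v *v (c (- u) *v \<sigma>)) = - (c u *v (c v *v (c u *v \<sigma>)))"
      by (simp only: c_neg_vec linear_neg[OF matrix_vector_mul_linear])
    also have "c u *v (c v *v (c u *v \<sigma>)) = (- 2 * (u \<bullet> v)) *\<^sub>R (c u *v \<sigma>) - c v *v (c u *v (c u *v \<sigma>))"
      by (rule c_anticommute_vec)
    also have "\<dots> = (- 2 * (u \<bullet> v)) *\<^sub>R (c u *v \<sigma>) + (u \<bullet> u) *\<^sub>R (c v *v \<sigma>)"
      by (simp only: c_square_vec linear_scale[OF matrix_vector_mul_linear]) simp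
    finally show ?thesis
      by (simp add: linear_diff[OF c_vec_linear] linear_scale[OF c_vec_linear])
  qed
  then have "c ?w = c u ** c v ** c (- u)" by (simp add: matrix_eq matrix_vector_mul_assoc[symmetric])
  then show ?thesis by blast
qed

text \<open>Each unit vector conjugates vectors to vectors, and conjugations compose. The induction
  runs over products of any length, since splitting off one factor changes the parity.\<close>

lemma spin_group_conj:
  assumes "h \<in> spin_group c"
  shows "\<exists>h'. h ** h' = mat 1 \<and> h' ** h = mat 1 \<and> (\<forall>v. \<exists>w. c w = h ** c v ** h')"
proof -
  have "\<exists>h'. foldr (\<lambda>v h. c v ** h) vs (mat 1) ** h' = mat 1 \<and> h' ** foldr (\<lambda>v h. c v ** h) vs (mat 1) = mat 1 \<and>
      (\<forall>v. \<exists>w. c w = foldr (\<lambda>v h. c v ** h) vs (mat 1) ** c v ** h')"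
    if "\<forall>v\<in>set vs. norm v = 1" for vs
    using that
  proof (induction vs)
    case Nil
    show ?case by (rule exI[of _ "mat 1"]) auto
  next
    case (Cons u vs)
    let ?H = "foldr (\<lambda>v h. c v ** h) vs (mat 1)"
    obtain k where k: "?H ** k = mat 1" "k ** ?H = mat 1" "\<And>v. \<exists>w. c w = ?H ** c v ** k"
      using Cons by auto
    have u: "c u ** c (- u) = mat 1" "c (- u) ** c u = mat 1" by (rule c_unit_inverse, use Cons.prems in simp)+
    show ?case
    proof (intro exI[of _ "k ** c (- u)"] conjI allI)
      have "(c u ** ?H) ** (k ** c (- u)) = c u ** (?H ** k) ** c (- u)" by (simp only: matrix_mul_assoc)
      then show "foldr (\<lambda>v h. c v ** h) (u # vs) (mat 1) ** (k ** c (- u)) = mat 1"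
        by (simp add: k(1) u(1))
      have "(k ** c (- u)) ** (c u ** ?H) = k ** (c (- u) ** c u) ** ?H" by (simp only: matrix_mul_assoc)
      then show "(k ** c (- u)) ** foldr (\<lambda>v h. c v ** h) (u # vs) (mat 1) = mat 1"
        by (simp add: k(2) u(2))
      fix v
      obtain w where w: "c w = ?H ** c v ** k" using k(3) by blast
      obtain w' where "c w' = c u ** c w ** c (- u)" using c_reflect by blast
      then show "\<exists>w. c w = foldr (\<lambda>v h. c v ** h) (u # vs) (mat 1) ** c v ** (k ** c (- u))"
        unfolding w by (intro exI[of _ w']) (simp add: matrix_mul_assoc)
    qed
  qed
  then show ?thesis using assms unfolding spin_group_def by blast
qed

lemma spin_group_inv:
  assumes "h \<in> spin_group c"
  shows "h ** matrix_inv h = mat 1" "matrix_inv h ** h = mat 1"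
    and "\<exists>w. c w = h ** c v ** matrix_inv h"
proof -
  obtain h' where h': "h ** h' = mat 1" "h' ** h = mat 1" "\<And>v. \<exists>w. c w = h ** c v ** h'"
    using spin_group_conj[OF assms] by blast
  then show "h ** matrix_inv h = mat 1" "matrix_inv h ** h = mat 1"
    and "\<exists>w. c w = h ** c v ** matrix_inv h"
    unfolding matrix_inv_eqI[OF h'(1,2)] by blast+
qed

lemma c_inject: assumes "c v = c w" shows "v = w"
proof -
  have "c (v - w) = 0" using assms by (simp add: linear_diff[OF c_linear])
  then have "(- ((v - w) \<bullet> (v - w))) *\<^sub>R (1 :: real^'s) = 0"
    using c_square_vec[of "v - w" 1] by simp
  then show ?thesis by simp
qed

text \<open>Resolves the definite description in \<open>spin_rotation\<close>: conjugation yields a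
  vector, and \<open>c\<close> is injective.\<close>

lemma c_rotation:
  assumes "h \<in> spin_group c" shows "c (spin_rotation c h v) = h ** c v ** matrix_inv h"
proof -
  obtain w where w: "c w = h ** c v ** matrix_inv h" using spin_group_inv(3)[OF assms] by blast
  show ?thesis unfolding spin_rotation_def
    by (rule theI[of "\<lambda>w. c w = h ** c v ** matrix_inv h", OF w]) (rule c_inject, simp add: w)
qed

lemma vec_expand: "(\<Sum>i\<in>UNIV. (x $ i) *\<^sub>R axis i 1) = (x :: real^'n)"
  using basis_expansion[of x] by (simp add: scalar_mult_eq_scaleR)

lemma comps_sframe: "comps q (sframe Q q j) = axis j 1"
  by (simp add: comps_def vec_eq_iff sframe_orth axis_def)

text \<open>Clifford multiplication is well defined on the associated bundle: rotating the frame by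
  \<open>h\<close> compensates the conjugation by \<open>h\<close> in the module.\<close>

lemma clif_sact:
  assumes h: "h \<in> spin_group c" and v: "v \<in> T (sproj Q q)"
  shows "clif g Q (sact Q q h) v (matrix_inv h *v \<sigma>) = matrix_inv h *v clif g Q q v \<sigma>"
proof -
  let ?q = "sact Q q h" and ?k = "matrix_inv h"
  let ?v = "comps ?q v"
  let ?R = "\<lambda>i. spin_rotation c h (axis i 1)"
  have pq: "sproj Q ?q = sproj Q q" by (rule sact_proj[OF h])
  have fT: "sframe Q ?q i \<in> T (sproj Q q)" for i using sframe_tangent[of ?q i] by (simp add: pq)
  have cR: "comps q (sframe Q ?q i) = ?R i" for i
    unfolding sact_frame[OF h]
    by (simp add: comps_sum sframe_tangent comps_sframe vec_expand)
  have "v = (\<lambda>f. \<Sum>i\<in>UNIV. (?v $ i) * sframe Q ?q i f)"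
    using orthonormal_expand[OF sframe_tangent sframe_orth, of v ?q] v by (auto simp: pq comps_def)
  then have "comps q v = comps q (\<lambda>f. \<Sum>i\<in>UNIV. (?v $ i) * sframe Q ?q i f)" by (rule arg_cong)
  then have cv: "comps q v = (\<Sum>i\<in>UNIV. (?v $ i) *\<^sub>R ?R i)"
    by (simp add: comps_sum fT cR)
  have "clif g Q q v \<sigma> = (\<Sum>i\<in>UNIV. (?v $ i) *\<^sub>R (c (?R i) *v \<sigma>))"
    unfolding clif_comps cv by (simp add: linear_sum[OF c_vec_linear] linear_scale[OF c_vec_linear])
  also have "\<dots> = (\<Sum>i\<in>UNIV. (?v $ i) *\<^sub>R (h *v (c (axis i 1) *v (?k *v \<sigma>))))"
    by (simp add: c_rotation[OF h] matrix_vector_mul_assoc matrix_mul_assoc)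
  also have "\<dots> = h *v (c (\<Sum>i\<in>UNIV. (?v $ i) *\<^sub>R axis i 1) *v (?k *v \<sigma>))"
    by (simp add: linear_sum[OF c_vec_linear] linear_scale[OF c_vec_linear]
        linear_sum[OF matrix_vector_mul_linear] linear_scale[OF matrix_vector_mul_linear])
  also have "\<dots> = h *v clif g Q ?q v (?k *v \<sigma>)" by (simp only: vec_expand clif_comps)
  finally have "?k *v clif g Q q v \<sigma> = (?k ** h) *v clif g Q ?q v (?k *v \<sigma>)"
    by (simp add: matrix_vector_mul_assoc)
  then show ?thesis by (simp add: spin_group_inv(2)[OF h])
qed

text \<open>The matrix \<open>M\<close> is the same for all \<open>u\<close> and \<open>v\<close>,
  so a linear relation among such products at one point of the fibre holds at every other.\<close>

lemma change_point:
  assumes "sproj Q q = x" "sproj Q q' = x"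
  obtains M where "\<And>u v. u \<in> T x \<Longrightarrow> v \<in> T x \<Longrightarrow>
    clif g Q q' u (clif g Q q' v (\<eta> q')) = M *v clif g Q q u (clif g Q q v (\<eta> q))"
proof -
  obtain h where h: "h \<in> spin_group c" "q' = sact Q q h"
    using sact_transitive[of q q'] assms by auto
  show ?thesis
  proof (rule that)
    fix u v assume "u \<in> T x" "v \<in> T x"
    then show "clif g Q q' u (clif g Q q' v (\<eta> q')) = matrix_inv h *v clif g Q q u (clif g Q q v (\<eta> q))"
      unfolding h(2) spinor_equivariant[OF h(1)]
      by (simp add: clif_sact[OF h(1)] assms(1))
  qed
qed

text \<open>In the frame of a gauge, Clifford multiplication is given by constant matrices, which
  pass through derivatives.\<close>

definition E :: "'n \<Rightarrow> real^'s \<Rightarrow> real^'s" where "E a \<sigma> = c (axis a 1) *v \<sigma>"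

lemma E_clifford: "clifford_frame E"
  unfolding clifford_frame_def
proof (intro conjI allI)
  fix a b :: 'n and \<sigma> :: "real^'s"
  show "linear (E a)" unfolding E_def[abs_def] by (rule matrix_vector_mul_linear)
  have "axis a 1 \<bullet> (axis b 1 :: real^'n) = (if a = b then 1 else 0)" by (simp add: inner_axis_axis)
  then show "E a (E b \<sigma>) = (if a = b then - 2 else 0) *\<^sub>R \<sigma> - E b (E a \<sigma>)"
    using c_anticommute_vec[of "axis a 1" "axis b 1" \<sigma>] by (simp add: E_def)
qed

sublocale CF: clifford_frame E
  by (rule E_clifford)

lemma E_bounded: "bounded_linear (E a)"
  using CF.E_linear linear_conv_bounded_linear by blast

lemma clif_sframe: "clif g Q q (sframe Q q a) \<sigma> = E a \<sigma>"
  by (simp add: clif_comps comps_sframe E_def)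

lemma clif_expand_E: "clif g Q q v \<sigma> = (\<Sum>a\<in>UNIV. g (sproj Q q) v (sframe Q q a) *\<^sub>R E a \<sigma>)"
proof -
  have "clif g Q q v \<sigma> = c (\<Sum>a\<in>UNIV. (comps q v $ a) *\<^sub>R axis a 1) *v \<sigma>"
    by (simp only: clif_comps vec_expand)
  then show ?thesis
    by (simp add: linear_sum[OF c_vec_linear] linear_scale[OF c_vec_linear] E_def comps_def)
qed

end

section \<open>Parallel spinors\<close>

locale gauged = spin_geometry A g nab H Q \<eta>
  for A :: "('m::{t2_space, second_countable_topology}, real^'n) atlas" and g and nab and H
    and Q :: "('q, 'm, 'n::finite, 's::finite) spin_data" and \<eta> +
  fixes U :: "'m set" and s :: "'m \<Rightarrow> 'q"
  assumes in_gauge: "(U, s) \<in> sgauge Q"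
    and parallel: "spin_parallel A g Q (torsion_conn A g H nab (1/2)) \<eta>"
begin

abbreviation "\<epsilon> a y \<equiv> sframe Q (s y) a"
abbreviation "\<psi> y \<equiv> \<eta> (s y)"
abbreviation "Np \<equiv> N (1/2)"

text \<open>The connection matrix in the gauge frame; the spin lift of the connection is the
  derivative plus its image under \<open>spin_op\<close>.\<close>

definition \<Gamma> :: "'m field \<Rightarrow> 'm \<Rightarrow> 'n \<Rightarrow> 'n \<Rightarrow> real" where
  "\<Gamma> X x a b = g x (Np X (\<epsilon> a) x) (\<epsilon> b x)"

abbreviation "\<omega> X x \<equiv> CF.spin_op (\<Gamma> X x)"

lemma \<epsilon>_frame: "on_frame A g U (\<lambda>a. \<epsilon> a)"
  by (rule gauge_frame[OF in_gauge])

lemma \<epsilon>_vfield: "open W \<Longrightarrow> W \<subseteq> U \<Longrightarrow> vfield A W (\<epsilon> a)"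
  by (rule vfield_subset[OF gauge_vfield[OF in_gauge]])

lemma s_proj: "x \<in> U \<Longrightarrow> sproj Q (s x) = x"
  by (rule gauge_proj[OF in_gauge])

lemma \<psi>_smooth: "x \<in> U \<Longrightarrow> smooth_at A x (\<lambda>y. \<psi> y)"
  by (rule smooth_atI[OF gauge_spinor[OF in_gauge]])

lemma \<epsilon>_tangent: "x \<in> U \<Longrightarrow> \<epsilon> a x \<in> T x"
  by (rule frame_tangent[OF \<epsilon>_frame])

lemma frame_connection_antisym:
  assumes X: "vfield A W X" and e: "on_frame A g W e" and x: "x \<in> W"
  shows "g x (N t X (e b) x) (e a x) = - g x (N t X (e a) x) (e b x)"
proof -
  have "X x (\<lambda>y. g y (e a y) (e b y)) = X x (\<lambda>y. if a = b then 1 else 0)"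
    by (rule tangent_cong[OF vfield_tangent[OF X x] vfield_open[OF X] x]) (rule frame_orth[OF e])
  then have "g x (N t X (e a) x) (e b x) + g x (e a x) (N t X (e b) x) = 0"
    using N_metric[OF X frame_vfield[OF e] frame_vfield[OF e] x, of a b t]
      tangent_const[OF vfield_tangent[OF X x]] by simp
  then show ?thesis
    using g_sym[OF frame_tangent[OF e x] N_tangent[OF X frame_vfield[OF e] x], of a t b] by simp
qed

lemma \<Gamma>_antisym:
  assumes X: "vfield A W X" and W: "W \<subseteq> U" and x: "x \<in> W" shows "\<Gamma> X x b a = - \<Gamma> X x a b"
  unfolding \<Gamma>_def
  by (rule frame_connection_antisym[OF X frame_subset[OF \<epsilon>_frame vfield_open[OF X] W] x])

lemma spin_nabla_\<omega>:
  assumes "x \<in> U"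
  shows "spin_nabla g Q Np s X \<eta> x = tder (X x) (\<lambda>y. \<psi> y) + \<omega> X x (\<psi> x)"
  using assms by (simp add: spin_nabla_def CF.spin_op_def \<Gamma>_def clif_sframe o_def)

lemma tder_\<psi>:
  assumes X: "vfield A W X" and W: "W \<subseteq> U" and x: "x \<in> W"
  shows "tder (X x) (\<lambda>y. \<psi> y) = - \<omega> X x (\<psi> x)"
proof -
  have "\<forall>V X. V \<subseteq> U \<and> vfield A V X \<longrightarrow> (\<forall>x\<in>V. spin_nabla g Q Np s X \<eta> x = 0)"
    using bspec[OF parallel[unfolded spin_parallel_def] in_gauge] by simp
  then have "spin_nabla g Q Np s X \<eta> x = 0" using X W x by blast
  then show ?thesis using spin_nabla_\<omega>[of x X] W x by (auto simp: eq_neg_iff_add_eq_0)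
qed

lemma clif_smooth:
  assumes Y: "vfield A W Y" and W: "W \<subseteq> U" and x: "x \<in> W" and \<phi>: "smooth_at A x \<phi>"
  shows "smooth_at A x (\<lambda>y. clif g Q (s y) (Y y) (\<phi> y))"
proof -
  have "smooth_at A x (\<lambda>y. \<Sum>a\<in>UNIV. g y (Y y) (\<epsilon> a y) *\<^sub>R E a (\<phi> y))"
    by (intro smooth_at_sum smooth_at_scaleR smooth_at_bounded_linear[OF \<phi>]
        g_smooth_at[OF Y \<epsilon>_vfield[OF vfield_open[OF Y] W] x] E_bounded)
  then show ?thesis
    by (rule smooth_at_cong[OF _ vfield_open[OF Y] x])
      (use W s_proj in \<open>auto simp: clif_expand_E\<close>)
qed

text \<open>Clifford multiplication is parallel: differentiating the coefficients of
  \<open>Y\<close> produces a \<open>\<Gamma>\<close> term which cancels the one from commuting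
  \<open>\<omega>\<close> past \<open>E a\<close>. The spinor \<open>\<phi>\<close> is arbitrary so
  that the rule can be iterated on products of two vectors.\<close>

lemma clif_leibniz:
  assumes X: "vfield A W X" and Y: "vfield A W Y" and W: "W \<subseteq> U" and x: "x \<in> W" and \<phi>: "smooth_at A x \<phi>"
  shows "tder (X x) (\<lambda>y. clif g Q (s y) (Y y) (\<phi> y)) + \<omega> X x (clif g Q (s x) (Y x) (\<phi> x))
    = clif g Q (s x) (Np X Y x) (\<phi> x) + clif g Q (s x) (Y x) (tder (X x) \<phi> + \<omega> X x (\<phi> x))"
proof -
  have xU: "x \<in> U" using W x by blast
  have oW: "open W" by (rule vfield_open[OF X])
  have Xx: "X x \<in> T x" by (rule vfield_tangent[OF X x])
  have Yx: "Y x \<in> T x" by (rule vfield_tangent[OF Y x])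
  note \<epsilon>W = \<epsilon>_vfield[OF oW W]
  note Eb = E_bounded
  have sg: "smooth_at A x (\<lambda>y. g y (Y y) (\<epsilon> a y))" for a by (rule g_smooth_at[OF Y \<epsilon>W x])
  have sE: "smooth_at A x (\<lambda>y. E a (\<phi> y))" for a by (rule smooth_at_bounded_linear[OF \<phi> Eb])
  have d: "X x (\<lambda>y. g y (Y y) (\<epsilon> a y)) = g x (Np X Y x) (\<epsilon> a x)
      + (\<Sum>b\<in>UNIV. g x (Y x) (\<epsilon> b x) * \<Gamma> X x a b)" for a
    using N_metric[OF X Y \<epsilon>W x, of a "1/2"]
      frame_inner[OF \<epsilon>_frame xU Yx N_tangent[OF X \<epsilon>W x]]
    by (simp add: \<Gamma>_def)
  have "tder (X x) (\<lambda>y. clif g Q (s y) (Y y) (\<phi> y))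
      = tder (X x) (\<lambda>y. \<Sum>a\<in>UNIV. g y (Y y) (\<epsilon> a y) *\<^sub>R E a (\<phi> y))"
    by (rule tder_cong[OF Xx oW x]) (use W s_proj in \<open>auto simp: clif_expand_E\<close>)
  also have "\<dots> = (\<Sum>a\<in>UNIV. X x (\<lambda>y. g y (Y y) (\<epsilon> a y)) *\<^sub>R E a (\<phi> x)
      + g x (Y x) (\<epsilon> a x) *\<^sub>R E a (tder (X x) \<phi>))"
    by (simp add: tder_sum[OF orthobasis_Basis Xx smooth_at_scaleR[OF sg sE]]
        tder_scaleR[OF Xx sg sE] tder_linear[OF CF.E_linear Xx \<phi>])
  also have "\<dots> = clif g Q (s x) (Np X Y x) (\<phi> x) + clif g Q (s x) (Y x) (tder (X x) \<phi>)
      + (\<Sum>a\<in>UNIV. \<Sum>b\<in>UNIV. (g x (Y x) (\<epsilon> b x) * \<Gamma> X x a b) *\<^sub>R E a (\<phi> x))"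
    by (simp add: d scaleR_add_left scaleR_sum_left sum.distrib clif_expand_E s_proj[OF xU] add_ac)
  finally have 1: "tder (X x) (\<lambda>y. clif g Q (s y) (Y y) (\<phi> y))
      = clif g Q (s x) (Np X Y x) (\<phi> x) + clif g Q (s x) (Y x) (tder (X x) \<phi>)
      + (\<Sum>a\<in>UNIV. \<Sum>b\<in>UNIV. (g x (Y x) (\<epsilon> b x) * \<Gamma> X x a b) *\<^sub>R E a (\<phi> x))" .
  have "\<omega> X x (clif g Q (s x) (Y x) (\<phi> x))
      = (\<Sum>a\<in>UNIV. g x (Y x) (\<epsilon> a x) *\<^sub>R \<omega> X x (E a (\<phi> x)))"
    by (simp add: clif_expand_E s_proj[OF xU] linear_sum[OF CF.spin_op_linear] linear_scale[OF CF.spin_op_linear])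
  also have "\<dots> = (\<Sum>a\<in>UNIV. g x (Y x) (\<epsilon> a x) *\<^sub>R (E a (\<omega> X x (\<phi> x))
      + (\<Sum>b\<in>UNIV. \<Gamma> X x a b *\<^sub>R E b (\<phi> x))))"
    by (simp only: CF.spin_op_commutator[OF \<Gamma>_antisym[OF X W x]])
  also have "\<dots> = clif g Q (s x) (Y x) (\<omega> X x (\<phi> x))
      + (\<Sum>b\<in>UNIV. \<Sum>a\<in>UNIV. (g x (Y x) (\<epsilon> b x) * \<Gamma> X x b a) *\<^sub>R E a (\<phi> x))"
    by (simp add: clif_expand_E s_proj[OF xU] scaleR_add_right sum.distrib scaleR_sum_right)
  finally have 2: "\<omega> X x (clif g Q (s x) (Y x) (\<phi> x)) = clif g Q (s x) (Y x) (\<omega> X x (\<phi> x))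
      + (\<Sum>b\<in>UNIV. \<Sum>a\<in>UNIV. (g x (Y x) (\<epsilon> b x) * \<Gamma> X x b a) *\<^sub>R E a (\<phi> x))" .
  \<comment> \<open>Skewness of \<open>\<Gamma>\<close> makes this the exact opposite of the last
    sum in \<open>1\<close>.\<close>
  have 3: "(\<Sum>b\<in>UNIV. \<Sum>a\<in>UNIV. (g x (Y x) (\<epsilon> b x) * \<Gamma> X x b a) *\<^sub>R E a (\<phi> x))
      = - (\<Sum>a\<in>UNIV. \<Sum>b\<in>UNIV. (g x (Y x) (\<epsilon> b x) * \<Gamma> X x a b) *\<^sub>R E a (\<phi> x))"
  proof -
    have "(g x (Y x) (\<epsilon> b x) * \<Gamma> X x b a) *\<^sub>R E a (\<phi> x)
        = - ((g x (Y x) (\<epsilon> b x) * \<Gamma> X x a b) *\<^sub>R E a (\<phi> x))" for a b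
      using \<Gamma>_antisym[OF X W x, of b a] by simp
    then show ?thesis by (subst sum.swap) (simp add: sum_negf)
  qed
  show ?thesis unfolding 1 2 3 by (simp add: linear_add[OF clif_linear])
qed

text \<open>A parallel spinor satisfies \<open>X \<psi> = - \<omega> X \<psi>\<close>.
  Differentiating again and using that derivatives commute up to the bracket gives a zero-order
  relation, whose coefficient matrix is the curvature in the gauge frame.\<close>

lemma spin_curvature:
  assumes X: "vfield A W X" and Y: "vfield A W Y" and W: "W \<subseteq> U" and x: "x \<in> W"
  shows "CF.spin_op (\<lambda>a b. g x (R (1/2) X Y (\<epsilon> a) x) (\<epsilon> b x)) (\<psi> x) = 0"
proof -
  have xU: "x \<in> U" using W x by blast
  have oW: "open W" by (rule vfield_open[OF X])
  note \<epsilon>W = \<epsilon>_vfield[OF oW W]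
  note Eb = E_bounded
  have D: "tder (X x) (\<lambda>y. tder (Y y) (\<lambda>y. \<psi> y))
      = \<omega> Y x (\<omega> X x (\<psi> x)) - CF.spin_op (\<lambda>a b. X x (\<lambda>y. \<Gamma> Y y a b)) (\<psi> x)"
    and sm: "smooth_at A x (\<lambda>y. tder (Y y) (\<lambda>y. \<psi> y))"
    if X: "vfield A W X" and Y: "vfield A W Y" for X Y
  proof -
    have Xx: "X x \<in> T x" by (rule vfield_tangent[OF X x])
    have sG: "smooth_at A x (\<lambda>y. \<Gamma> Y y a b)" for a b
      unfolding \<Gamma>_def by (rule g_smooth_at[OF N_vfield[OF Y \<epsilon>W] \<epsilon>W x])
    have sE: "smooth_at A x (\<lambda>y. E a (E b (\<psi> y)))" for a b
      by (intro smooth_at_bounded_linear[OF smooth_at_bounded_linear[OF \<psi>_smooth[OF xU] Eb] Eb])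
    have eq: "- \<omega> Y y (\<psi> y) = - ((1/4) *\<^sub>R (\<Sum>a\<in>UNIV. \<Sum>b\<in>UNIV. \<Gamma> Y y a b *\<^sub>R E a (E b (\<psi> y))))" for y
      by (simp add: CF.spin_op_def)
    have sS: "smooth_at A x (\<lambda>y. \<Sum>a\<in>UNIV. \<Sum>b\<in>UNIV. \<Gamma> Y y a b *\<^sub>R E a (E b (\<psi> y)))"
      by (intro smooth_at_sum smooth_at_scaleR sG sE)
    have sS4: "smooth_at A x (\<lambda>y. (1/4) *\<^sub>R (\<Sum>a\<in>UNIV. \<Sum>b\<in>UNIV. \<Gamma> Y y a b *\<^sub>R E a (E b (\<psi> y))))"
      by (intro smooth_at_scaleR smooth_at_const sS)
    show "smooth_at A x (\<lambda>y. tder (Y y) (\<lambda>y. \<psi> y))"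
      by (rule smooth_at_cong[OF smooth_at_minus[OF sS4] oW x])
        (simp add: tder_\<psi>[OF Y W] CF.spin_op_def)
    have "tder (X x) (\<lambda>y. tder (Y y) (\<lambda>y. \<psi> y))
        = tder (X x) (\<lambda>y. - ((1/4) *\<^sub>R (\<Sum>a\<in>UNIV. \<Sum>b\<in>UNIV. \<Gamma> Y y a b *\<^sub>R E a (E b (\<psi> y)))))"
      by (rule tder_cong[OF Xx oW x]) (simp add: tder_\<psi>[OF Y W] CF.spin_op_def)
    also have "\<dots> = - ((1/4) *\<^sub>R (\<Sum>a\<in>UNIV. \<Sum>b\<in>UNIV. X x (\<lambda>y. \<Gamma> Y y a b) *\<^sub>R E a (E b (\<psi> x))
        + \<Gamma> Y x a b *\<^sub>R E a (E b (tder (X x) (\<lambda>y. \<psi> y)))))"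
      by (simp add: tder_minus[OF orthobasis_Basis Xx sS4] tder_scaleR[OF Xx smooth_at_const sS]
          tangent_const[OF Xx] tder_sum[OF orthobasis_Basis Xx] smooth_at_sum smooth_at_scaleR sG sE
          tder_scaleR[OF Xx sG sE] tder_linear[OF linear_compose[OF CF.E_linear CF.E_linear] Xx \<psi>_smooth[OF xU], unfolded o_def])
    also have "\<dots> = \<omega> Y x (\<omega> X x (\<psi> x)) - CF.spin_op (\<lambda>a b. X x (\<lambda>y. \<Gamma> Y y a b)) (\<psi> x)"
      unfolding tder_\<psi>[OF X W x] CF.spin_op_def[of "\<Gamma> Y x"] CF.spin_op_def[of "\<lambda>a b. X x (\<lambda>y. \<Gamma> Y y a b)"]
      by (simp add: CF.E_simps sum.distrib sum_negf sum_subtractf scaleR_add_right scaleR_diff_right)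
    finally show "tder (X x) (\<lambda>y. tder (Y y) (\<lambda>y. \<psi> y))
        = \<omega> Y x (\<omega> X x (\<psi> x)) - CF.spin_op (\<lambda>a b. X x (\<lambda>y. \<Gamma> Y y a b)) (\<psi> x)" .
  qed
  have br: "tder (lie_bracket A X Y x) (\<lambda>y. \<psi> y)
      = tder (X x) (\<lambda>y. tder (Y y) (\<lambda>y. \<psi> y)) - tder (Y x) (\<lambda>y. tder (X y) (\<lambda>y. \<psi> y))"
  proof (rule tder_eqI)
    fix z
    have it: "tder (X x) (\<lambda>y. tder (Y y) (\<lambda>y. \<psi> y)) \<bullet> z = X x (\<lambda>y. Y y (\<lambda>y. \<psi> y \<bullet> z))"
      if X: "vfield A W X" and Y: "vfield A W Y" for X Y
    proof -
      have "tder (X x) (\<lambda>y. tder (Y y) (\<lambda>y. \<psi> y)) \<bullet> z = X x (\<lambda>y. tder (Y y) (\<lambda>y. \<psi> y) \<bullet> z)"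
        by (rule tder_inner[OF orthobasis_Basis vfield_tangent[OF X x] sm[OF X Y]])
      also have "\<dots> = X x (\<lambda>y. Y y (\<lambda>y. \<psi> y \<bullet> z))"
        by (rule tangent_cong[OF vfield_tangent[OF X x] oW x])
          (use W in \<open>auto intro!: tder_inner[OF orthobasis_Basis vfield_tangent[OF Y] \<psi>_smooth]\<close>)
      finally show ?thesis .
    qed
    show "(tder (X x) (\<lambda>y. tder (Y y) (\<lambda>y. \<psi> y)) - tder (Y x) (\<lambda>y. tder (X y) (\<lambda>y. \<psi> y))) \<bullet> z
        = lie_bracket A X Y x (\<lambda>y. \<psi> y \<bullet> z)"
      by (simp add: inner_diff_left it[OF X Y] it[OF Y X]
          lie_bracket_apply[OF smooth_at_inner[OF \<psi>_smooth[OF xU]]])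
  qed
  let ?K = "\<lambda>a b. \<Sum>c\<in>UNIV. \<Gamma> X x a c * \<Gamma> Y x b c - \<Gamma> Y x a c * \<Gamma> X x b c"
  \<comment> \<open>The structure equation for the connection matrix. Expanding the products of
    first derivatives in the frame gives \<open>?K\<close>, which is precisely the matrix in
    \<open>spin_op_bracket\<close>.\<close>
  have r: "g x (R (1/2) X Y (\<epsilon> a) x) (\<epsilon> b x)
      = X x (\<lambda>y. \<Gamma> Y y a b) - Y x (\<lambda>y. \<Gamma> X y a b) - \<Gamma> (lie_bracket A X Y) x a b + ?K a b" for a b
  proof -
    have i: "g x (Np X (\<epsilon> a) x) (Np Y (\<epsilon> b) x) = (\<Sum>c\<in>UNIV. \<Gamma> X x a c * \<Gamma> Y x b c)"
      if X: "vfield A W X" and Y: "vfield A W Y" for X Y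
      unfolding \<Gamma>_def
      by (rule frame_inner[OF \<epsilon>_frame xU N_tangent[OF X \<epsilon>W x] N_tangent[OF Y \<epsilon>W x]])
    show ?thesis
      using R_formula[OF X Y \<epsilon>W \<epsilon>W x, of "1/2" a b] i[OF X Y] i[OF Y X]
      by (simp add: \<Gamma>_def sum_subtractf)
  qed
  have lin: "CF.spin_op (\<lambda>a b. p a b - q a b - r a b + k a b) \<sigma>
      = CF.spin_op p \<sigma> - CF.spin_op q \<sigma> - CF.spin_op r \<sigma> + CF.spin_op k \<sigma>" for p q r k \<sigma>
    by (simp add: CF.spin_op_def scaleR_add_left scaleR_diff_left sum.distrib sum_subtractf
        scaleR_add_right scaleR_diff_right)
  have "CF.spin_op (\<lambda>a b. g x (R (1/2) X Y (\<epsilon> a) x) (\<epsilon> b x)) (\<psi> x)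
      = CF.spin_op (\<lambda>a b. X x (\<lambda>y. \<Gamma> Y y a b)) (\<psi> x) - CF.spin_op (\<lambda>a b. Y x (\<lambda>y. \<Gamma> X y a b)) (\<psi> x)
      - \<omega> (lie_bracket A X Y) x (\<psi> x) + (\<omega> X x (\<omega> Y x (\<psi> x)) - \<omega> Y x (\<omega> X x (\<psi> x)))"
    unfolding r lin CF.spin_op_bracket[OF \<Gamma>_antisym[OF X W x] \<Gamma>_antisym[OF Y W x]] ..
  then show ?thesis
    using br tder_\<psi>[OF lie_bracket_vfield[OF X Y] W x] D[OF X Y] D[OF Y X] by (simp add: algebra_simps)
qed

end

section \<open>Arbitrary frames and fibre points\<close>

text \<open>Frees \<open>spin_curvature\<close> from the gauge: tensoriality in the third slot
  replaces the gauge frame by \<open>e\<close>, and \<open>change_point\<close> replaces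
  \<open>s x\<close> by \<open>q\<close>.\<close>

lemma (in spin_geometry) curvature_kills:
  assumes par: "spin_parallel A g Q (torsion_conn A g H nab (1/2)) \<eta>"
    and X: "vfield A W X" and Y: "vfield A W Y" and x: "x \<in> W"
    and e: "on_frame A g V e" "x \<in> V" and q: "sproj Q q = x"
  shows "(\<Sum>i\<in>UNIV. \<Sum>j\<in>UNIV. g x (R (1/2) X Y (e i) x) (e j x) *\<^sub>R
    clif g Q q (e i x) (clif g Q q (e j x) (\<eta> q))) = 0"
proof -
  obtain U s where U: "(U, s) \<in> sgauge Q" "x \<in> U" using gauge_exists .
  interpret gauged A g nab H Q \<eta> U s by unfold_locales (rule U(1), rule par)
  let ?W = "W \<inter> U"
  have oW: "open ?W" using vfield_open[OF X] gauge_open[OF U(1)] by blast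
  have XW: "vfield A ?W X" and YW: "vfield A ?W Y"
    by (rule vfield_subset[OF X oW], simp, rule vfield_subset[OF Y oW], simp)
  have xW: "x \<in> ?W" using x U(2) by blast
  have eW: "vfield A V (e i)" for i by (rule frame_vfield[OF e(1)])
  have eT: "e i x \<in> T x" for i by (rule frame_tangent[OF e])
  have sx: "sproj Q (s x) = x" by (rule s_proj[OF U(2)])
  let ?r = "\<lambda>a b. g x (R (1/2) X Y (\<epsilon> a) x) (\<epsilon> b x)"
  let ?c = "\<lambda>i. clif g Q (s x) (e i x)"
  let ?g = "\<lambda>a i. g x (\<epsilon> a x) (e i x)"
  have rT: "R (1/2) X Y (\<epsilon> a) x \<in> T x" for a
    by (rule R_tangent[OF XW YW \<epsilon>_vfield[OF oW] xW]) simp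
  have r: "g x (R (1/2) X Y (e i) x) (e j x) = (\<Sum>a\<in>UNIV. \<Sum>b\<in>UNIV. ?g a i * (?g b j * ?r a b))" for i j
  proof -
    have "g x (R (1/2) X Y (e i) x) (e j x)
        = (\<Sum>a\<in>UNIV. g x (e i x) (\<epsilon> a x) *\<^sub>R g x (R (1/2) X Y (\<epsilon> a) x) (e j x))"
      by (rule tensorial_expand[OF R_tensorial[OF X Y x eT] \<epsilon>_frame U(2) eW e(2)])
    also have "\<dots> = (\<Sum>a\<in>UNIV. ?g a i * (\<Sum>b\<in>UNIV. ?r a b * ?g b j))"
      by (simp add: frame_inner[OF \<epsilon>_frame U(2) rT eT] g_sym[OF eT \<epsilon>_tangent[OF U(2)]])
    finally show ?thesis by (simp add: sum_distrib_left mult.commute)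
  qed
  have Ee: "E a \<sigma> = (\<Sum>i\<in>UNIV. ?g a i *\<^sub>R ?c i \<sigma>)" for a \<sigma>
  proof -
    have "\<epsilon> a x = (\<lambda>f. \<Sum>i\<in>UNIV. ?g a i * e i x f)"
      by (rule ext) (rule frame_expand[OF e \<epsilon>_tangent[OF U(2)]])
    then have "clif g Q (s x) (\<epsilon> a x) \<sigma> = clif g Q (s x) (\<lambda>f. \<Sum>i\<in>UNIV. ?g a i * e i x f) \<sigma>"
      by (rule arg_cong)
    then show ?thesis by (simp add: clif_sframe clif_sum sx eT)
  qed
  have "(\<Sum>a\<in>UNIV. \<Sum>b\<in>UNIV. ?r a b *\<^sub>R E a (E b (\<psi> x))) = 0"
    using spin_curvature[OF XW YW _ xW] by (simp add: CF.spin_op_def)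
  also have "(\<Sum>a\<in>UNIV. \<Sum>b\<in>UNIV. ?r a b *\<^sub>R E a (E b (\<psi> x)))
      = (\<Sum>a\<in>UNIV. \<Sum>b\<in>UNIV. \<Sum>i\<in>UNIV. \<Sum>j\<in>UNIV. (?g a i * (?g b j * ?r a b)) *\<^sub>R ?c i (?c j (\<psi> x)))"
    by (simp add: Ee linear_sum[OF clif_linear] linear_scale[OF clif_linear] scaleR_sum_right mult_ac)
  \<comment> \<open>The sums are reordered until those over the gauge frame are innermost, where
    they contract to the curvature in the frame \<open>e\<close>.\<close>
  also have "\<dots> = (\<Sum>a\<in>UNIV. \<Sum>i\<in>UNIV. \<Sum>b\<in>UNIV. \<Sum>j\<in>UNIV. (?g a i * (?g b j * ?r a b)) *\<^sub>R ?c i (?c j (\<psi> x)))"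
    by (intro sum.cong refl sum.swap)
  also have "\<dots> = (\<Sum>i\<in>UNIV. \<Sum>a\<in>UNIV. \<Sum>b\<in>UNIV. \<Sum>j\<in>UNIV. (?g a i * (?g b j * ?r a b)) *\<^sub>R ?c i (?c j (\<psi> x)))"
    by (rule sum.swap)
  also have "\<dots> = (\<Sum>i\<in>UNIV. \<Sum>a\<in>UNIV. \<Sum>j\<in>UNIV. \<Sum>b\<in>UNIV. (?g a i * (?g b j * ?r a b)) *\<^sub>R ?c i (?c j (\<psi> x)))"
    by (intro sum.cong refl sum.swap)
  also have "\<dots> = (\<Sum>i\<in>UNIV. \<Sum>j\<in>UNIV. \<Sum>a\<in>UNIV. \<Sum>b\<in>UNIV. (?g a i * (?g b j * ?r a b)) *\<^sub>R ?c i (?c j (\<psi> x)))"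
    by (intro sum.cong refl sum.swap)
  also have "\<dots> = (\<Sum>i\<in>UNIV. \<Sum>j\<in>UNIV. g x (R (1/2) X Y (e i) x) (e j x) *\<^sub>R ?c i (?c j (\<psi> x)))"
    by (simp add: r scaleR_sum_left)
  finally have 0: "(\<Sum>i\<in>UNIV. \<Sum>j\<in>UNIV. g x (R (1/2) X Y (e i) x) (e j x) *\<^sub>R ?c i (?c j (\<psi> x))) = 0" .
  obtain M where M: "\<And>u v. u \<in> T x \<Longrightarrow> v \<in> T x \<Longrightarrow>
      clif g Q q u (clif g Q q v (\<eta> q)) = M *v clif g Q (s x) u (clif g Q (s x) v (\<eta> (s x)))"
    by (rule change_point[OF sx q]) (rule that)
  have "M *v (\<Sum>i\<in>UNIV. \<Sum>j\<in>UNIV. g x (R (1/2) X Y (e i) x) (e j x) *\<^sub>R ?c i (?c j (\<psi> x))) = 0"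
    unfolding 0 by simp
  then show ?thesis
    by (simp add: M eT linear_sum[OF matrix_vector_mul_linear] linear_scale[OF matrix_vector_mul_linear])
qed

lemma functional_expand:
  fixes L :: "real^'s \<Rightarrow> real"
  assumes "linear L" shows "L v = (\<Sum>a\<in>UNIV. (v $ a) * L (axis a 1))"
proof -
  have "L v = L (\<Sum>a\<in>UNIV. (v $ a) *\<^sub>R axis a 1)"
    using basis_expansion[of v] by (simp add: scalar_mult_eq_scaleR)
  then show ?thesis by (simp add: linear_sum[OF assms] linear_scale[OF assms])
qed

text \<open>Moving the skew coefficients from the spinor factor to the factor \<open>F\<close> costs
  a sign. For the connection coefficients of a frame this is the cancellation behind the second
  equation; \<open>antisym_contract2\<close> does the other slot.\<close>

lemma antisym_contract1:
  fixes F :: "'n::finite \<Rightarrow> 'n \<Rightarrow> 'l::real_vector"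
  assumes "\<And>i k. \<gamma> k i = - \<gamma> i k"
  shows "(\<Sum>i\<in>UNIV. \<Sum>j\<in>UNIV. (\<Sum>k\<in>UNIV. \<gamma> i k * l k j) *\<^sub>R F i j)
    = - (\<Sum>i\<in>UNIV. \<Sum>j\<in>UNIV. l i j *\<^sub>R (\<Sum>k\<in>UNIV. \<gamma> i k *\<^sub>R F k j))"
proof -
  have "(\<Sum>i\<in>UNIV. \<Sum>j\<in>UNIV. (\<Sum>k\<in>UNIV. \<gamma> i k * l k j) *\<^sub>R F i j)
      = (\<Sum>i\<in>UNIV. \<Sum>k\<in>UNIV. \<Sum>j\<in>UNIV. (\<gamma> i k * l k j) *\<^sub>R F i j)"
    unfolding scaleR_sum_left by (intro sum.cong refl sum.swap)
  also have "\<dots> = (\<Sum>k\<in>UNIV. \<Sum>i\<in>UNIV. \<Sum>j\<in>UNIV. (\<gamma> i k * l k j) *\<^sub>R F i j)"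
    by (rule sum.swap)
  also have "\<dots> = (\<Sum>k\<in>UNIV. \<Sum>j\<in>UNIV. \<Sum>i\<in>UNIV. (\<gamma> i k * l k j) *\<^sub>R F i j)"
    by (intro sum.cong refl sum.swap)
  also have "\<dots> = (\<Sum>k\<in>UNIV. \<Sum>j\<in>UNIV. \<Sum>i\<in>UNIV. - ((l k j * \<gamma> k i) *\<^sub>R F i j))"
  proof (intro sum.cong refl)
    fix k j i
    show "(\<gamma> i k * l k j) *\<^sub>R F i j = - ((l k j * \<gamma> k i) *\<^sub>R F i j)"
      using assms[of i k] by simp
  qed
  finally show ?thesis by (simp add: sum_negf scaleR_sum_right)
qed

lemma antisym_contract2:
  fixes F :: "'n::finite \<Rightarrow> 'n \<Rightarrow> 'l::real_vector"
  assumes "\<And>i k. \<gamma> k i = - \<gamma> i k"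
  shows "(\<Sum>i\<in>UNIV. \<Sum>j\<in>UNIV. (\<Sum>k\<in>UNIV. \<gamma> j k * l i k) *\<^sub>R F i j)
    = - (\<Sum>i\<in>UNIV. \<Sum>j\<in>UNIV. l i j *\<^sub>R (\<Sum>k\<in>UNIV. \<gamma> j k *\<^sub>R F i k))"
proof -
  have "(\<Sum>i\<in>UNIV. \<Sum>j\<in>UNIV. (\<Sum>k\<in>UNIV. \<gamma> j k * l i k) *\<^sub>R F i j)
      = (\<Sum>i\<in>UNIV. \<Sum>k\<in>UNIV. \<Sum>j\<in>UNIV. (\<gamma> j k * l i k) *\<^sub>R F i j)"
    unfolding scaleR_sum_left by (intro sum.cong refl sum.swap)
  also have "\<dots> = (\<Sum>i\<in>UNIV. \<Sum>k\<in>UNIV. \<Sum>j\<in>UNIV. - ((l i k * \<gamma> k j) *\<^sub>R F i j))"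
  proof (intro sum.cong refl)
    fix i k j
    show "(\<gamma> j k * l i k) *\<^sub>R F i j = - ((l i k * \<gamma> k j) *\<^sub>R F i j)"
      using assms[of j k] by simp
  qed
  finally show ?thesis by (simp add: sum_negf scaleR_sum_right)
qed

section \<open>The coupled instanton system\<close>

locale coupled = spin_geometry A g nab H Q \<eta> + paired G lb A P \<theta> B
  for A :: "('m::{t2_space, second_countable_topology}, real^'n) atlas" and g and nab and H
    and Q :: "('q, 'm, 'n::finite, 's::finite) spin_data" and \<eta>
    and G :: "('k::{t2_space, second_countable_topology}, 'l::real_inner) lie_data" and lb
    and P :: "('p::{t2_space, second_countable_topology}, 'ep::euclidean_space, 'm, 'k) pbundle"
    and \<theta> and B +
  assumes parallel_spinor: "spin_parallel A g Q (torsion_conn A g H nab (1/2)) \<eta>"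
    and F_instanton: "annihilates_ad A g P Q \<eta> UNIV (F_theta A G P \<theta>)"
    and bianchi: "bianchi_identity A G B P H \<theta>"
begin

abbreviation "\<Psi> q e i j \<equiv> clif g Q q (e i (sproj Q q)) (clif g Q q (e j (sproj Q q)) (\<eta> q))"

lemma F_kills_component:
  assumes "on_frame A g V e" "sproj Q q \<in> V" "\<pi> p = sproj Q q"
  shows "(\<Sum>i\<in>UNIV. \<Sum>j\<in>UNIV. (\<Psi> q e i j $ a) *\<^sub>R F (e i) (e j) p) = 0"
  using F_instanton[unfolded annihilates_ad_def, rule_format, of V e q p a] assms
  by (simp add: Let_def)

text \<open>Arbitrary functionals instead of components, because differentiating produces the
  functional \<open>L \<circ> \<omega>\<close>.\<close>

lemma F_kills:
  fixes L :: "real^'s \<Rightarrow> real"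
  assumes L: "linear L" and e: "on_frame A g V e" "sproj Q q \<in> V" "\<pi> p = sproj Q q"
  shows "(\<Sum>i\<in>UNIV. \<Sum>j\<in>UNIV. L (\<Psi> q e i j) *\<^sub>R F (e i) (e j) p) = 0"
proof -
  have "(\<Sum>i\<in>UNIV. \<Sum>j\<in>UNIV. L (\<Psi> q e i j) *\<^sub>R F (e i) (e j) p)
      = (\<Sum>i\<in>UNIV. \<Sum>j\<in>UNIV. \<Sum>a\<in>UNIV. L (axis a 1) *\<^sub>R ((\<Psi> q e i j $ a) *\<^sub>R F (e i) (e j) p))"
    by (subst functional_expand[OF L]) (simp add: scaleR_sum_left mult.commute)
  also have "\<dots> = (\<Sum>i\<in>UNIV. \<Sum>a\<in>UNIV. \<Sum>j\<in>UNIV. L (axis a 1) *\<^sub>R ((\<Psi> q e i j $ a) *\<^sub>R F (e i) (e j) p))"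
    by (intro sum.cong refl sum.swap)
  also have "\<dots> = (\<Sum>a\<in>UNIV. \<Sum>i\<in>UNIV. \<Sum>j\<in>UNIV. L (axis a 1) *\<^sub>R ((\<Psi> q e i j $ a) *\<^sub>R F (e i) (e j) p))"
    by (rule sum.swap)
  also have "\<dots> = (\<Sum>a\<in>UNIV. L (axis a 1) *\<^sub>R
      (\<Sum>i\<in>UNIV. \<Sum>j\<in>UNIV. (\<Psi> q e i j $ a) *\<^sub>R F (e i) (e j) p))"
    by (simp only: scaleR_sum_right)
  finally show ?thesis by (simp only: F_kills_component[OF e] scaleR_zero_right sum.neutral_const)
qed

text \<open>The dual reading: a functional of the Lie algebra turns \<open>F\<close> into a real
  two-form annihilating the spinor. It is used with \<open>B\<close> against a section and with the
  inner product against a test vector.\<close>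

lemma F_kills_spinor:
  assumes \<kappa>: "linear \<kappa>" and e: "on_frame A g V e" "sproj Q q \<in> V" "\<pi> p = sproj Q q"
  shows "(\<Sum>i\<in>UNIV. \<Sum>j\<in>UNIV. \<kappa> (F (e i) (e j) p) *\<^sub>R \<Psi> q e i j) = 0"
proof -
  have "(\<Sum>i\<in>UNIV. \<Sum>j\<in>UNIV. \<kappa> (F (e i) (e j) p) *\<^sub>R \<Psi> q e i j) $ a
      = \<kappa> (\<Sum>i\<in>UNIV. \<Sum>j\<in>UNIV. (\<Psi> q e i j $ a) *\<^sub>R F (e i) (e j) p)" for a
    by (simp add: linear_sum[OF \<kappa>] linear_scale[OF \<kappa>] mult.commute)
  then show ?thesis unfolding F_kills_component[OF e] by (simp add: vec_eq_iff linear_0[OF \<kappa>])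
qed

lemma F_tensorial:
  assumes X: "vfield A W X" and x: "x \<in> W" and p: "\<pi> p = x"
  shows "tensorial x (\<lambda>Y. F X Y p)"
  unfolding tensorial_def
proof (intro conjI allI impI; elim conjE)
  fix V and f :: "'m \<Rightarrow> real" and Y Y'
  assume Y: "vfield A V Y" "vfield A V Y'" and f: "smooth_fun A V f" and xV: "x \<in> V"
  have o: "open (W \<inter> V)" using vfield_open[OF X] vfield_open[OF Y(1)] by blast
  show "F X (\<lambda>y. tlin (f y) (Y y) 1 (Y' y)) p = f x *\<^sub>R F X Y p + F X Y' p"
    using F_leibniz[OF vfield_subset[OF X o] vfield_subset[OF Y(1) o] vfield_subset[OF Y(2) o]
        smooth_fun_subset[OF f o], of p] p x xV by simp
next
  fix V Y Y' assume Y: "vfield A V Y" and xV: "x \<in> V" and eq: "\<forall>y\<in>V. Y y = Y' y"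
  have o: "open (W \<inter> V)" using vfield_open[OF X] vfield_open[OF Y] by blast
  show "F X Y p = F X Y' p"
    by (rule F_cong[OF vfield_subset[OF X o] vfield_subset[OF Y o]]) (use p x xV eq in auto)
qed

lemma F_expand2:
  assumes "vfield A W X" "x \<in> W" "\<pi> p = x" "on_frame A g V e" "x \<in> V" "vfield A U Y" "x \<in> U"
  shows "F X Y p = (\<Sum>k\<in>UNIV. g x (Y x) (e k x) *\<^sub>R F X (e k) p)"
  by (rule tensorial_expand[OF F_tensorial[OF assms(1-3)] assms(4-7)])

lemma F_expand1:
  assumes X: "vfield A W X" "x \<in> W" and Y: "vfield A W Y" and p: "\<pi> p = x"
    and e: "on_frame A g W e"
  shows "F X Y p = (\<Sum>k\<in>UNIV. g x (X x) (e k x) *\<^sub>R F (e k) Y p)"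
proof -
  have pW: "\<pi> p \<in> W" using p X by simp
  have "F X Y p = - (\<Sum>k\<in>UNIV. g x (X x) (e k x) *\<^sub>R F Y (e k) p)"
    using F_antisym[OF Y X(1) pW] F_expand2[OF Y X(2) p e X(2) X(1) X(2)] by simp
  also have "\<dots> = (\<Sum>k\<in>UNIV. g x (X x) (e k x) *\<^sub>R F (e k) Y p)"
    by (simp add: F_antisym[OF Y frame_vfield[OF e] pW] sum_negf)
  finally show ?thesis .
qed

section \<open>The adjoint of the curvature\<close>

abbreviation "Fd \<equiv> F_dagger A G B P g \<theta>"
abbreviation "pr \<equiv> ad_pair P B"

lemma B_linear: "linear (\<lambda>\<xi>. B \<xi> \<zeta>)" "linear (B \<zeta>)"
  using B_bilinear unfolding bilinear_def by auto

lemma pair_tensorial: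
  assumes X: "vfield A U X" and x: "x \<in> U" shows "tensorial x (\<lambda>W. pr (F X W) r x)"
proof -
  let ?p = "SOME p. \<pi> p = x"
  have p: "\<pi> ?p = x" using someI_ex[of "\<lambda>p. \<pi> p = x"] proj_surj[of x] by blast
  note \<tau> = F_tensorial[OF X x p]
  show ?thesis unfolding tensorial_def ad_pair_def Let_def
  proof (intro conjI allI impI; elim conjE)
    fix V and f :: "'m \<Rightarrow> real" and Y Y'
    assume "vfield A V Y" "vfield A V Y'" "smooth_fun A V f" "x \<in> V"
    then show "B (F X (\<lambda>y. tlin (f y) (Y y) 1 (Y' y)) ?p) (r ?p)
        = f x *\<^sub>R B (F X Y ?p) (r ?p) + B (F X Y' ?p) (r ?p)"
      by (simp add: tensorial_lin[OF \<tau>] linear_add[OF B_linear(1)] linear_scale[OF B_linear(1)])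
  next
    fix V Y Y' assume "vfield A V Y" "x \<in> V" "\<forall>y\<in>V. Y y = Y' y"
    then show "B (F X Y ?p) (r ?p) = B (F X Y' ?p) (r ?p)"
      using tensorial_cong[OF \<tau>, of V Y Y'] by simp
  qed
qed

text \<open>Written through \<open>tlin\<close> so that the linearity rules for tangent vectors,
  metric and fields apply to the sign.\<close>

lemma Fd_eq: "Fd X r x = tlin (-1) (sharp A g (\<lambda>W. pr (F X W) r x) x) 0 (\<lambda>_. 0)"
  by (simp add: F_dagger_def tlin_def)

lemma Fd_tangent: "vfield A U X \<Longrightarrow> x \<in> U \<Longrightarrow> Fd X r x \<in> T x"
  unfolding Fd_eq by (rule tangent_tlin[OF sharp_tangent[OF pair_tensorial] tangent_zero])

lemma Fd_inner:
  assumes X: "vfield A U X" "x \<in> U" and W: "vfield A V W" "x \<in> V"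
  shows "g x (Fd X r x) (W x) = - pr (F X W) r x"
  unfolding Fd_eq
  using g_lin1[OF sharp_tangent[OF pair_tensorial[OF X, of r]] tangent_zero vfield_tangent[OF W], of "-1" 0]
    sharp_inner[OF pair_tensorial[OF X, of r] W] by simp

lemma Fd_vfield:
  assumes X: "vfield A U X" and r: "ad_section G P U r" shows "vfield A U (Fd X r)"
proof -
  have "vfield A U (\<lambda>x. sharp A g (\<lambda>W. pr (F X W) r x) x)"
  proof (rule sharp_vfield[OF vfield_open[OF X] pair_tensorial[OF X]])
    fix V W assume V: "V \<subseteq> U" and W: "vfield A V W"
    note o = vfield_open[OF W]
    show "smooth_fun A V (\<lambda>x. pr (F X W) r x)"
      by (rule pair_smooth[OF F_section[OF vfield_subset[OF X o V] W] ad_section_subset[OF r o V]])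
  qed
  from vfield_tlin_const[OF this vfield_zero[OF vfield_open[OF X]], of "-1" 0]
  show ?thesis by (rule vfield_cong) (rule Fd_eq[symmetric])
qed

lemma Fd_diff:
  assumes X: "vfield A U X" and x: "x \<in> U"
  shows "Fd X (\<lambda>p. r p - t p) x f = Fd X r x f - Fd X t x f"
proof -
  have "Fd X (\<lambda>p. r p - t p) x = tlin 1 (Fd X r x) (-1) (Fd X t x)"
  proof (rule metric_eqI[OF Fd_tangent[OF X x] tangent_tlin[OF Fd_tangent[OF X x] Fd_tangent[OF X x]]
        vfield_open[OF X] x])
    fix V W assume W: "vfield A V W" "x \<in> V"
    show "g x (Fd X (\<lambda>p. r p - t p) x) (W x) = g x (tlin 1 (Fd X r x) (-1) (Fd X t x)) (W x)"
      by (simp add: g_lin1[OF Fd_tangent[OF X x] Fd_tangent[OF X x] vfield_tangent[OF W]]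
          Fd_inner[OF X x W] ad_pair_def Let_def linear_diff[OF B_linear(2)])
  qed
  then show ?thesis by (simp add: tlin_def)
qed

abbreviation "nF \<equiv> nabla_F A G P \<theta> (N (1/2))"

lemma N_minus:
  assumes "vfield A U X" "vfield A U Y" "x \<in> U"
  shows "N (-1/2) X Y x f = N (1/2) Y X x f + lie_bracket A X Y x f"
  using N_exchange[OF assms, of "1/2" f] by simp

text \<open>Two versions that differ in the orientation of the bracket, since the cyclic Bianchi
  identity contains both orientations.\<close>

lemma F_N_minus:
  assumes X: "vfield A U X" and Y: "vfield A U Y" and W: "vfield A U W" and p: "\<pi> p \<in> U"
  shows "F Y (N (-1/2) X W) p = F Y (N (1/2) W X) p + F Y (lie_bracket A X W) p"
    and "F Y (N (-1/2) X W) p = F Y (N (1/2) W X) p - F Y (lie_bracket A W X) p"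
proof -
  have o: "open U" by (rule vfield_open[OF X])
  have 1: "N (-1/2) X W y = tlin 1 (lie_bracket A X W y) 1 (N (1/2) W X y)" if "y \<in> U" for y
    using N_minus[OF X W that] by (auto simp: tlin_def)
  have 2: "N (-1/2) X W y = tlin (-1) (lie_bracket A W X y) 1 (N (1/2) W X y)" if "y \<in> U" for y
    using N_minus[OF X W that] by (auto simp: tlin_def lie_bracket_antisym[of X W])
  show "F Y (N (-1/2) X W) p = F Y (N (1/2) W X) p + F Y (lie_bracket A X W) p"
    using F_cong[OF Y N_vfield[OF X W] p refl 1]
      F_leibniz[OF Y lie_bracket_vfield[OF X W] N_vfield[OF W X] smooth_fun_const[OF o] p] by simp
  show "F Y (N (-1/2) X W) p = F Y (N (1/2) W X) p - F Y (lie_bracket A W X) p"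
    using F_cong[OF Y N_vfield[OF X W] p refl 2]
      F_leibniz[OF Y lie_bracket_vfield[OF W X] N_vfield[OF W X] smooth_fun_const[OF o] p] by simp
qed

text \<open>The Bianchi identity trades the derivative along \<open>W\<close> for those along
  \<open>X\<close> and \<open>Y\<close>, and \<open>N_exchange\<close> trades
  \<open>\<nabla>\<^sup>+\<close> along \<open>W\<close> for \<open>\<nabla>\<^sup>-\<close> along
  \<open>X\<close> and \<open>Y\<close>. The result is the off-diagonal block in the curvature of
  \<open>D\<close>.\<close>

lemma nabla_F_eq:
  assumes X: "vfield A U X" and Y: "vfield A U Y" and W: "vfield A U W" and p: "\<pi> p \<in> U"
  shows "nF W X Y p = - d\<theta> X (F Y W) p + F Y (N (-1/2) X W) p + d\<theta> Y (F X W) p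
    - F X (N (-1/2) Y W) p + F (lie_bracket A X Y) W p"
proof -
  have "d\<theta> Y (F W X) p = - d\<theta> Y (F X W) p"
  proof -
    have "d\<theta> Y (F W X) p = tder (hl Y p) (\<lambda>q. - F X W q)"
      unfolding d_theta_def
      by (rule E.tder_cong[OF hlift_tangent_on[OF Y p] proj_open[OF vfield_open[OF X]]])
        (use p F_antisym[OF X W] in auto)
    also have "\<dots> = - d\<theta> Y (F X W) p"
      unfolding d_theta_def
      by (rule E.tder_minus[OF lie_basis hlift_tangent_on[OF Y p] ad_section_smooth_at[OF F_section[OF X W] p]])
    finally show ?thesis .
  qed
  then have 0: "d\<theta> X (F Y W) p - d\<theta> Y (F X W) p + d\<theta> W (F X Y) p + F X (lie_bracket A Y W) p
      + F Y (lie_bracket A W X) p - F (lie_bracket A X Y) W p = 0"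
    using bianchi_F[OF X Y W p] F_antisym[OF lie_bracket_vfield[OF X Y] W p] by simp
  \<comment> \<open>Solving the Bianchi identity \<open>0\<close> for the derivative along
    \<open>W\<close>: the difference of the two sides is its left-hand side.\<close>
  have "d\<theta> W (F X Y) p - (- d\<theta> X (F Y W) p + d\<theta> Y (F X W) p - F X (lie_bracket A Y W) p
      - F Y (lie_bracket A W X) p + F (lie_bracket A X Y) W p)
    = d\<theta> X (F Y W) p - d\<theta> Y (F X W) p + d\<theta> W (F X Y) p + F X (lie_bracket A Y W) p
      + F Y (lie_bracket A W X) p - F (lie_bracket A X Y) W p"
    by simp
  from trans[OF this 0] have 1: "d\<theta> W (F X Y) p = - d\<theta> X (F Y W) p + d\<theta> Y (F X W) p - F X (lie_bracket A Y W) p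
      - F Y (lie_bracket A W X) p + F (lie_bracket A X Y) W p"
    by (simp only: right_minus_eq)
  have 2: "F Y (N (1/2) W X) p = - F (N (1/2) W X) Y p"
    by (rule F_antisym[OF N_vfield[OF W X] Y p])
  show ?thesis
    unfolding nabla_F_def F_N_minus(2)[OF X Y W p] F_N_minus(1)[OF Y X W p] 1 2 by simp
qed

text \<open>Differentiate \<open>F\<^sub>\<theta> \<cdot> \<eta> = 0\<close> in a frame; the spinor is parallel, and the connection
  coefficients of the frame cancel because they are skew.\<close>

lemma nabla_F_kills:
  assumes Z: "vfield A W Z" and e: "on_frame A g W e" and p: "\<pi> p \<in> W" and q: "sproj Q q = \<pi> p"
  shows "(\<Sum>i\<in>UNIV. \<Sum>j\<in>UNIV. (\<Psi> q e i j $ a) *\<^sub>R nF Z (e i) (e j) p) = 0"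
proof -
  define x where "x = \<pi> p"
  obtain U s where U: "(U, s) \<in> sgauge Q" "x \<in> U" using gauge_exists .
  interpret gauged A g nab H Q \<eta> U s by unfold_locales (rule U(1), rule parallel_spinor)
  define V where "V = W \<inter> U"
  have oV: "open V" unfolding V_def using vfield_open[OF Z] gauge_open[OF U(1)] by blast
  have VU: "V \<subseteq> U" and VW: "V \<subseteq> W" and xV: "x \<in> V" using U p unfolding V_def x_def by auto
  have ZV: "vfield A V Z" by (rule vfield_subset[OF Z oV VW])
  have eV: "on_frame A g V e" by (rule frame_subset[OF e oV VW])
  note ev = frame_vfield[OF eV]
  have sx: "sproj Q (s x) = x" by (rule s_proj[OF U(2)])
  have pV: "\<pi> p \<in> V" using xV by (simp add: x_def)
  define \<kappa> where "\<kappa> i j y = clif g Q (s y) (e i y) (clif g Q (s y) (e j y) (\<psi> y))" for i j y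
  define \<gamma> where "\<gamma> i k = g x (Np Z (e i) x) (e k x)" for i k
  have \<gamma>: "\<gamma> k i = - \<gamma> i k" for i k
    unfolding \<gamma>_def by (rule frame_connection_antisym[OF ZV eV xV])
  have Zx: "Z x \<in> T x" by (rule vfield_tangent[OF ZV xV])
  have sm1: "smooth_at A x (\<lambda>y. clif g Q (s y) (e j y) (\<psi> y))" for j
    by (rule clif_smooth[OF ev VU xV \<psi>_smooth[OF U(2)]])
  have sm: "smooth_at A x (\<kappa> i j)" for i j
    unfolding \<kappa>_def by (rule clif_smooth[OF ev VU xV sm1])
  have clN: "clif g Q (s x) (Np Z (e i) x) \<sigma> = (\<Sum>k\<in>UNIV. \<gamma> i k *\<^sub>R clif g Q (s x) (e k x) \<sigma>)" for i \<sigma>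
    using clif_expand_frame[OF eV, of "s x" "Np Z (e i) x"] xV N_tangent[OF ZV ev xV]
    by (simp add: sx \<gamma>_def)
  have d: "tder (Z x) (\<kappa> i j) = (\<Sum>k\<in>UNIV. \<gamma> i k *\<^sub>R \<kappa> k j x) + (\<Sum>k\<in>UNIV. \<gamma> j k *\<^sub>R \<kappa> i k x)
      - \<omega> Z x (\<kappa> i j x)" for i j
  proof -
    have "tder (Z x) (\<lambda>y. \<psi> y) + \<omega> Z x (\<psi> x) = 0" using tder_\<psi>[OF ZV VU xV] by simp
    then have 1: "tder (Z x) (\<lambda>y. clif g Q (s y) (e j y) (\<psi> y)) + \<omega> Z x (clif g Q (s x) (e j x) (\<psi> x))
        = (\<Sum>k\<in>UNIV. \<gamma> j k *\<^sub>R clif g Q (s x) (e k x) (\<psi> x))"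
      using clif_leibniz[OF ZV ev VU xV \<psi>_smooth[OF U(2)], of j]
      by (simp add: clN linear_0[OF clif_linear])
    have "tder (Z x) (\<kappa> i j) + \<omega> Z x (\<kappa> i j x)
        = (\<Sum>k\<in>UNIV. \<gamma> i k *\<^sub>R \<kappa> k j x) + (\<Sum>k\<in>UNIV. \<gamma> j k *\<^sub>R \<kappa> i k x)"
      using clif_leibniz[OF ZV ev VU xV sm1, of i j, unfolded 1]
      by (simp add: \<kappa>_def[abs_def] clN linear_sum[OF clif_linear] linear_scale[OF clif_linear])
    then show ?thesis by (simp add: algebra_simps)
  qed
  \<comment> \<open>A functional \<open>L\<close> makes the spinor factor a real function of the
    base point, so that it can be lifted to P and differentiated together with
    \<open>F\<close>.\<close>
  have main: "(\<Sum>i\<in>UNIV. \<Sum>j\<in>UNIV. L (\<kappa> i j x) *\<^sub>R nF Z (e i) (e j) p) = 0"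
    if L: "linear L" for L :: "real^'s \<Rightarrow> real"
  proof -
    let ?F = "\<lambda>i j. F (e i) (e j)"
    note hT = hlift_tangent_on[OF ZV pV]
    have bL: "bounded_linear L" by (rule orthobasis_linear_bounded[OF orthobasis_Basis L])
    have sF: "smooth_at (patlas P) p (?F i j)" for i j
      by (rule ad_section_smooth_at[OF F_section[OF ev ev] pV])
    have sL: "smooth_at (patlas P) p (\<lambda>p'. L (\<kappa> i j (\<pi> p')))" for i j
      by (rule smooth_at_proj) (use smooth_at_bounded_linear[OF sm bL] in \<open>simp add: x_def\<close>)
    have sB: "smooth_at (patlas P) p (\<lambda>p'. L (\<kappa> i j (\<pi> p')) *\<^sub>R ?F i j p')" for i j
      by (rule E.smooth_at_scaleR[OF sL sF])
    have dL: "tder (hl Z p) (\<lambda>p'. L (\<kappa> i j (\<pi> p'))) = L (tder (Z x) (\<kappa> i j))" for i j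
    proof -
      have "tder (hl Z p) (\<lambda>p'. L (\<kappa> i j (\<pi> p'))) = Z (\<pi> p) (\<lambda>y. L (\<kappa> i j y))"
        using E.tder_real[OF hT sL] hlift_proj_on[OF ZV pV, of "\<lambda>y. L (\<kappa> i j y)"]
          smooth_at_bounded_linear[OF sm bL] by (simp add: x_def)
      also have "\<dots> = tder (Z x) (\<lambda>y. L (\<kappa> i j y))"
        using tder_real[OF Zx smooth_at_bounded_linear[OF sm bL]] by (simp add: x_def)
      also have "\<dots> = L (tder (Z x) (\<kappa> i j))" by (rule tder_linear[OF L Zx sm])
      finally show ?thesis .
    qed
    \<comment> \<open>The contraction vanishes at every point over \<open>V\<close>, hence so does
      its horizontal derivative at \<open>p\<close>.\<close>
    have "tder (hl Z p) (\<lambda>p'. \<Sum>i\<in>UNIV. \<Sum>j\<in>UNIV. L (\<kappa> i j (\<pi> p')) *\<^sub>R ?F i j p') = tder (hl Z p) (\<lambda>p'. 0)"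
    proof (rule E.tder_cong[OF hT proj_open[OF oV]])
      fix p' assume "p' \<in> \<pi> -` V"
      then have "\<pi> p' \<in> V" by simp
      with VU have "sproj Q (s (\<pi> p')) = \<pi> p'" "\<pi> p' \<in> V" by (auto intro: s_proj)
      then show "(\<Sum>i\<in>UNIV. \<Sum>j\<in>UNIV. L (\<kappa> i j (\<pi> p')) *\<^sub>R ?F i j p') = 0"
        using F_kills[OF L eV, of "s (\<pi> p')" p'] by (simp add: \<kappa>_def)
    qed (use pV in simp)
    then have 0: "(\<Sum>i\<in>UNIV. \<Sum>j\<in>UNIV. L (tder (Z x) (\<kappa> i j)) *\<^sub>R ?F i j p
        + L (\<kappa> i j x) *\<^sub>R d\<theta> Z (?F i j) p) = 0"
      by (simp add: E.tder_const[OF hT] E.tder_sum[OF lie_basis hT E.smooth_at_sum[OF sB]]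
          E.tder_sum[OF lie_basis hT sB] dL d_theta_def
          E.tder_bilinear[OF orthobasis_Basis lie_basis bilinear_scaleR hT sL sF] x_def[symmetric])
    have 1: "(\<Sum>i\<in>UNIV. \<Sum>j\<in>UNIV. L (tder (Z x) (\<kappa> i j)) *\<^sub>R ?F i j p)
      = (\<Sum>i\<in>UNIV. \<Sum>j\<in>UNIV. (\<Sum>k\<in>UNIV. \<gamma> i k * L (\<kappa> k j x)) *\<^sub>R ?F i j p)
      + (\<Sum>i\<in>UNIV. \<Sum>j\<in>UNIV. (\<Sum>k\<in>UNIV. \<gamma> j k * L (\<kappa> i k x)) *\<^sub>R ?F i j p)
      - (\<Sum>i\<in>UNIV. \<Sum>j\<in>UNIV. L (\<omega> Z x (\<kappa> i j x)) *\<^sub>R ?F i j p)"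
      by (simp add: d linear_add[OF L] linear_diff[OF L] linear_sum[OF L] linear_scale[OF L]
          scaleR_add_left scaleR_diff_left sum.distrib sum_subtractf)
    \<comment> \<open>\<open>L\<close> composed with \<open>\<omega> Z x\<close> is again a linear
      functional, so this contribution dies by the hypothesis on \<open>F\<close>.\<close>
    have 2: "(\<Sum>i\<in>UNIV. \<Sum>j\<in>UNIV. L (\<omega> Z x (\<kappa> i j x)) *\<^sub>R ?F i j p) = 0"
      using F_kills[OF linear_compose[OF CF.spin_op_linear L] eV, of "s x" p] xV
      by (simp add: sx \<kappa>_def x_def[symmetric] o_def)
    have 3: "F (Np Z (e i)) (e j) p = (\<Sum>k\<in>UNIV. \<gamma> i k *\<^sub>R ?F k j p)" for i j
      unfolding \<gamma>_def by (rule F_expand1[OF N_vfield[OF ZV ev] xV ev x_def[symmetric] eV])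
    have 4: "F (e i) (Np Z (e j)) p = (\<Sum>k\<in>UNIV. \<gamma> j k *\<^sub>R ?F i k p)" for i j
      unfolding \<gamma>_def by (rule F_expand2[OF ev xV x_def[symmetric] eV xV N_vfield[OF ZV ev] xV])
    \<comment> \<open>The rotation of the frame enters once through the spinor factor and once
      through the arguments of \<open>F\<close>; the skew contractions make the two
      opposite.\<close>
    show ?thesis
      using 0 unfolding nabla_F_def 3 4 sum.distrib 1 2 antisym_contract1[of \<gamma>, OF \<gamma>] antisym_contract2[of \<gamma>, OF \<gamma>]
      by (simp add: scaleR_diff_right sum_subtractf algebra_simps sum.distrib)
  qed
  have qx: "sproj Q q = x" using q by (simp add: x_def)
  obtain M where M: "\<And>u v. u \<in> T x \<Longrightarrow> v \<in> T x \<Longrightarrow>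
      clif g Q q u (clif g Q q v (\<eta> q)) = M *v clif g Q (s x) u (clif g Q (s x) v (\<eta> (s x)))"
    by (rule change_point[OF sx qx]) (rule that)
  \<comment> \<open>The functional that reads off component \<open>a\<close> at \<open>q\<close>
    after the transport by \<open>M\<close>.\<close>
  have "linear (\<lambda>\<sigma>. (M *v \<sigma>) $ a)"
    by (rule linearI) (simp_all add: linear_add[OF matrix_vector_mul_linear] linear_scale[OF matrix_vector_mul_linear])
  from main[OF this] show ?thesis
    by (simp add: \<kappa>_def M[OF frame_tangent[OF eV xV] frame_tangent[OF eV xV]] qx)
qed

text \<open>The bracket is linear in its first argument, so the contraction can be performed inside
  it.\<close>

lemma bracket_F_kills:
  assumes e: "on_frame A g W e" and p: "\<pi> p \<in> W" and q: "sproj Q q = \<pi> p"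
  shows "(\<Sum>i\<in>UNIV. \<Sum>j\<in>UNIV. (\<Psi> q e i j $ a) *\<^sub>R lbr G (F (e i) (e j) p) \<zeta>) = 0"
proof -
  have "(\<Sum>i\<in>UNIV. \<Sum>j\<in>UNIV. (\<Psi> q e i j $ a) *\<^sub>R lbr G (F (e i) (e j) p) \<zeta>)
      = lbr G (\<Sum>i\<in>UNIV. \<Sum>j\<in>UNIV. (\<Psi> q e i j $ a) *\<^sub>R F (e i) (e j) p) \<zeta>"
    by (simp only: linear_sum[OF lbr_linear] linear_scale[OF lbr_linear])
  also have "\<dots> = 0"
    using F_kills_component[OF e _ q[symmetric], of a] p q by (simp add: linear_0[OF lbr_linear])
  finally show ?thesis .
qed

text \<open>Paired with a fixed vector, \<open>FFd\<close> is the commutator of two elements of the spin Lie algebra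
  that annihilate \<open>\<eta>\<close>.\<close>

lemma FFd_kills:
  assumes r: "ad_section G P W r" and e: "on_frame A g W e" and p: "\<pi> p \<in> W" and q: "sproj Q q = \<pi> p"
  shows "(\<Sum>i\<in>UNIV. \<Sum>j\<in>UNIV. (\<Psi> q e i j $ a) *\<^sub>R FFd A G B P g \<theta> (e i) (e j) r p) = 0"
proof -
  note ev = frame_vfield[OF e]
  have qW: "sproj Q q \<in> W" using p q by simp
  interpret CE: clifford_frame "\<lambda>i. clif g Q q (e i (sproj Q q))"
    by (rule clifford_frame_at) (simp_all add: frame_tangent[OF e qW] frame_orth[OF e qW])
  define f where "f i j = B (F (e i) (e j) p) (r p)" for i j
  have f: "f j i = - f i j" for i j
    using F_antisym[OF ev[of i] ev[of j] p] by (simp add: f_def linear_neg[OF B_linear(1)])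
  \<comment> \<open>Expanding the adjoint in the frame turns composition with it into a matrix
    product with \<open>f\<close>; this is where the commutator will come from.\<close>
  have Ff: "F (e i) (Fd (e j) r) p = - (\<Sum>k\<in>UNIV. f j k *\<^sub>R F (e i) (e k) p)" for i j
    unfolding F_expand2[OF ev p refl e p Fd_vfield[OF ev r] p]
    by (simp add: Fd_inner[OF ev p ev p] pair_eq[OF F_section[OF ev ev] r p] f_def sum_negf)
  have "(\<Sum>i\<in>UNIV. \<Sum>j\<in>UNIV. (\<Psi> q e i j $ a) *\<^sub>R FFd A G B P g \<theta> (e i) (e j) r p) \<bullet> z = 0" for z
  proof -
    define \<phi> where "\<phi> i j = F (e i) (e j) p \<bullet> z" for i j
    have \<phi>: "\<phi> j i = - \<phi> i j" for i j
      using F_antisym[OF ev[of i] ev[of j] p] by (simp add: \<phi>_def)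
    have "CE.spin_op f (\<eta> q) = 0"
      using F_kills_spinor[OF B_linear(1)[of "r p"] e qW q[symmetric]]
      by (simp add: CE.spin_op_def f_def)
    moreover have "CE.spin_op \<phi> (\<eta> q) = 0"
      using F_kills_spinor[OF bounded_linear.linear[OF bounded_linear_inner_left[of z]] e qW q[symmetric]]
      by (simp add: CE.spin_op_def \<phi>_def)
    \<comment> \<open>Both \<open>spin_op f\<close> and \<open>spin_op \<phi>\<close> annihilate the
      spinor, hence so does their commutator.\<close>
    ultimately have "CE.spin_op (\<lambda>i j. \<Sum>k\<in>UNIV. f i k * \<phi> j k - \<phi> i k * f j k) (\<eta> q) = 0"
      using CE.spin_op_bracket[of f \<phi> "\<eta> q", OF f \<phi>] by (simp add: linear_0[OF CE.spin_op_linear])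
    moreover define c where "c i j = (\<Sum>k\<in>UNIV. f i k * \<phi> j k - \<phi> i k * f j k)" for i j
    ultimately have "(\<Sum>i\<in>UNIV. \<Sum>j\<in>UNIV. c i j *\<^sub>R \<Psi> q e i j) $ a = 0"
      by (simp add: CE.spin_op_def)
    then have "(\<Sum>i\<in>UNIV. \<Sum>j\<in>UNIV. (\<Psi> q e i j $ a) * c i j) = 0"
      by (simp add: mult.commute)
    moreover have "FFd A G B P g \<theta> (e i) (e j) r p \<bullet> z = c i j" for i j
      by (simp add: FFd_def Ff inner_sum_left inner_diff_left \<phi>_def c_def sum_subtractf mult.commute)
    ultimately show ?thesis by (simp add: inner_sum_left)
  qed
  \<comment> \<open>A vector orthogonal to every \<open>z\<close> is orthogonal to itself.\<close>
  from this[of "\<Sum>i\<in>UNIV. \<Sum>j\<in>UNIV. (\<Psi> q e i j $ a) *\<^sub>R FFd A G B P g \<theta> (e i) (e j) r p"]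
  show ?thesis by (simp only: inner_eq_zero_iff)
qed

section \<open>The curvature equation on the tangent bundle\<close>

lemma FdF_tlin: "FdF A G B P g \<theta> X Y Z x = tlin 1 (Fd X (F Y Z) x) (-1) (Fd Y (F X Z) x)"
  by (simp add: FdF_def tlin_def)

lemma FdF_tangent: "vfield A U X \<Longrightarrow> vfield A U Y \<Longrightarrow> x \<in> U \<Longrightarrow> FdF A G B P g \<theta> X Y Z x \<in> T x"
  unfolding FdF_tlin by (intro tangent_tlin Fd_tangent)

text \<open>The exchange formula brings \<open>X\<close> and \<open>Y\<close> into positions where
  the spinor can act: on the right they are the endomorphism slots of a curvature and the form slots
  of \<open>F\<close>, each of which annihilates the spinor.\<close>

lemma curvature_minus_FdF:
  assumes X: "vfield A U X" and Y: "vfield A U Y" and Z: "vfield A U Z" and W: "vfield A U W"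
    and p: "\<pi> p \<in> U"
  shows "g (\<pi> p) (tlin 1 (R (-1/2) X Y Z (\<pi> p)) (-1) (FdF A G B P g \<theta> X Y Z (\<pi> p))) (W (\<pi> p))
    = g (\<pi> p) (R (1/2) Z W X (\<pi> p)) (Y (\<pi> p)) - B (F Z W p) (F X Y p)"
proof -
  note S = F_section[OF X Y] F_section[OF X Z] F_section[OF X W] F_section[OF Y Z] F_section[OF Y W]
    F_section[OF Z W] F_section[OF Z X] F_section[OF Z Y] F_section[OF W X] F_section[OF W Y]
  note an = F_antisym[OF Z X p] F_antisym[OF Z Y p] F_antisym[OF W X p] F_antisym[OF W Y p]
  note Bn = linear_neg[OF B_linear(1)] linear_neg[OF B_linear(2)]
  have "ext_d3 A H Z W X Y (\<pi> p) = FF_wedge A G B P \<theta> Z W X Y (\<pi> p)"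
    using bianchi[unfolded bianchi_identity_def, rule_format, of U Z W X Y "\<pi> p"] X Y Z W p by simp
  \<comment> \<open>The six shuffles coincide in pairs by symmetry of \<open>B\<close>; the factor 2
    meets the 1/2 of \<open>curvature_exchange\<close>.\<close>
  also have "\<dots> = 2 * B (F Z W p) (F X Y p) - 2 * B (F Z X p) (F W Y p) + 2 * B (F Z Y p) (F W X p)"
    unfolding FF_wedge_def Let_def
    by (simp add: pair_eq[OF _ _ p] S B_commute[of "F W X p"] B_commute[of "F W Y p"] B_commute[of "F X Y p"])
  finally have 1: "g (\<pi> p) (R (1/2) Z W X (\<pi> p)) (Y (\<pi> p)) = g (\<pi> p) (R (-1/2) X Y Z (\<pi> p)) (W (\<pi> p))
      + (B (F Z W p) (F X Y p) - B (F Z X p) (F W Y p) + B (F Z Y p) (F W X p))"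
    using curvature_exchange[OF Z W X Y p] by (simp add: field_simps)
  have 2: "g (\<pi> p) (FdF A G B P g \<theta> X Y Z (\<pi> p)) (W (\<pi> p)) = - B (F W X p) (F Z Y p) + B (F W Y p) (F Z X p)"
    unfolding FdF_tlin
    by (simp add: g_lin1 Fd_tangent[OF X p] Fd_tangent[OF Y p] vfield_tangent[OF W p]
        Fd_inner[OF X p W p] Fd_inner[OF Y p W p] pair_eq[OF _ _ p] S an Bn)
  show ?thesis
    unfolding g_lin1[OF R_tangent[OF X Y Z p] FdF_tangent[OF X Y p] vfield_tangent[OF W p]] 1 2
    by (simp add: B_commute[of "F W X p"] B_commute[of "F W Y p"])
qed

lemma curvature_FdF_kills:
  assumes Z: "vfield A W Z" and e: "on_frame A g W e" and x: "sproj Q q \<in> W"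
  shows "(\<Sum>i\<in>UNIV. \<Sum>j\<in>UNIV. (\<Psi> q e i j $ a) *
    tlin 1 (R (-1/2) (e i) (e j) Z (sproj Q q)) (-1) (FdF A G B P g \<theta> (e i) (e j) Z (sproj Q q)) f) = 0"
proof (rule double_sum_tangent_zero[where f = f and \<alpha> = "\<lambda>i j. tlin 1 (R (-1/2) (e i) (e j) Z (sproj Q q)) (-1)
      (FdF A G B P g \<theta> (e i) (e j) Z (sproj Q q))", OF _ vfield_open[OF Z] x])
  fix i j
  show "tlin 1 (R (-1/2) (e i) (e j) Z (sproj Q q)) (-1) (FdF A G B P g \<theta> (e i) (e j) Z (sproj Q q))
      \<in> T (sproj Q q)"
    by (rule tangent_tlin[OF R_tangent FdF_tangent, OF frame_vfield[OF e] frame_vfield[OF e] Z x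
          frame_vfield[OF e] frame_vfield[OF e] x])
next
  fix V Y assume Y: "vfield A V Y" and xV: "sproj Q q \<in> V" and V: "V \<subseteq> W"
  obtain p where p: "\<pi> p = sproj Q q" using proj_surj .
  have oV: "open V" by (rule vfield_open[OF Y])
  have eV: "on_frame A g V e" by (rule frame_subset[OF e oV V])
  have ZV: "vfield A V Z" by (rule vfield_subset[OF Z oV V])
  define x where "x = sproj Q q"
  define k where "k i j = \<Psi> q e i j $ a" for i j
  have "g x (tlin 1 (R (-1/2) (e i) (e j) Z x) (-1) (FdF A G B P g \<theta> (e i) (e j) Z x)) (Y x)
      = g x (R (1/2) Z Y (e i) x) (e j x) - B (F Z Y p) (F (e i) (e j) p)" for i j
    using curvature_minus_FdF[OF frame_vfield[OF eV] frame_vfield[OF eV] ZV Y, of p i j] xV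
    by (simp add: p x_def)
  then have 1: "(\<Sum>i\<in>UNIV. \<Sum>j\<in>UNIV. k i j
        * g x (tlin 1 (R (-1/2) (e i) (e j) Z x) (-1) (FdF A G B P g \<theta> (e i) (e j) Z x)) (Y x))
      = (\<Sum>i\<in>UNIV. \<Sum>j\<in>UNIV. k i j * g x (R (1/2) Z Y (e i) x) (e j x))
        - B (F Z Y p) (\<Sum>i\<in>UNIV. \<Sum>j\<in>UNIV. k i j *\<^sub>R F (e i) (e j) p)"
    by (simp add: linear_sum[OF B_linear(2)] linear_scale[OF B_linear(2)] right_diff_distrib sum_subtractf)
  have 2: "(\<Sum>i\<in>UNIV. \<Sum>j\<in>UNIV. k i j *\<^sub>R F (e i) (e j) p) = 0"
    unfolding k_def by (rule F_kills_component[OF eV xV p])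
  have 3: "(\<Sum>i\<in>UNIV. \<Sum>j\<in>UNIV. g x (R (1/2) Z Y (e i) x) (e j x) *\<^sub>R \<Psi> q e i j) = 0"
    unfolding x_def by (rule curvature_kills[OF parallel_spinor ZV Y xV eV xV refl])
  have "(\<Sum>i\<in>UNIV. \<Sum>j\<in>UNIV. k i j * g x (R (1/2) Z Y (e i) x) (e j x))
      = (\<Sum>i\<in>UNIV. \<Sum>j\<in>UNIV. g x (R (1/2) Z Y (e i) x) (e j x) *\<^sub>R \<Psi> q e i j) $ a"
    by (simp add: k_def mult.commute)
  then have 4: "(\<Sum>i\<in>UNIV. \<Sum>j\<in>UNIV. k i j * g x (R (1/2) Z Y (e i) x) (e j x)) = 0"
    unfolding 3 by simp
  from 1 have "(\<Sum>i\<in>UNIV. \<Sum>j\<in>UNIV. k i j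
        * g x (tlin 1 (R (-1/2) (e i) (e j) Z x) (-1) (FdF A G B P g \<theta> (e i) (e j) Z x)) (Y x)) = 0"
    unfolding 2 4 by (simp add: linear_0[OF B_linear(2)])
  then show "(\<Sum>i\<in>UNIV. \<Sum>j\<in>UNIV. (\<Psi> q e i j $ a) * g (sproj Q q) (tlin 1 (R (-1/2) (e i) (e j) Z (sproj Q q))
      (-1) (FdF A G B P g \<theta> (e i) (e j) Z (sproj Q q))) (Y (sproj Q q))) = 0"
    unfolding k_def x_def .
qed

section \<open>The curvature of D\<close>

abbreviation "Nm \<equiv> N (-1/2)"

text \<open>The block of the curvature of \<open>D\<close> that maps ad P to TM.\<close>

abbreviation "mixed X Y r x \<equiv> tlin 1 (tlin 1 (Nm X (Fd Y r) x) 1 (Fd X (d\<theta> Y r) x))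
  (-1) (tlin 1 (tlin 1 (Nm Y (Fd X r) x) 1 (Fd Y (d\<theta> X r) x)) 1 (Fd (lie_bracket A X Y) r x))"

abbreviation "DD \<equiv> D_curvature A G B P g H nab \<theta>"

lemma D_curvature_fst:
  assumes X: "vfield A U X" and Y: "vfield A U Y" and Z: "vfield A U Z" and r: "ad_section G P U r"
    and x: "x \<in> U"
  shows "fst (DD X Y (Z, r)) x f
    = tlin 1 (R (-1/2) X Y Z x) (-1) (FdF A G B P g \<theta> X Y Z x) f + mixed X Y r x f"
proof -
  have 1: "fst (D_conn A G B P g H nab \<theta> X (D_conn A G B P g H nab \<theta> Y (Z, r))) x f
      = Nm X (Nm Y Z) x f + Nm X (Fd Y r) x f + Fd X (d\<theta> Y r) x f - Fd X (F Y Z) x f"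
    if X: "vfield A U X" and Y: "vfield A U Y" for X Y
    using N_add[OF X N_vfield[OF Y Z] Fd_vfield[OF Y r] x, of "-1/2" "-1/2" f]
      Fd_diff[OF X x, of "d\<theta> Y r" "F Y Z" f]
    by (simp add: D_conn_def tlin_apply)
  show ?thesis
    unfolding D_curvature_def Let_def fst_conv 1[OF X Y] 1[OF Y X]
    by (simp add: D_conn_def tlin_def conn_curvature_def FdF_def)
qed

text \<open>The block from TM to ad P is \<open>nF Z X Y\<close> by \<open>nabla_F_eq\<close>; the
  diagonal block keeps the curvature of \<open>d\<theta>\<close> as a vertical derivative.\<close>

lemma D_curvature_snd:
  assumes X: "vfield A U X" and Y: "vfield A U Y" and Z: "vfield A U Z" and r: "ad_section G P U r"
    and p: "\<pi> p \<in> U"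
  shows "snd (DD X Y (Z, r)) p
    = nF Z X Y p - tder (vert (F X Y p) p) r - FFd A G B P g \<theta> X Y r p"
proof -
  have 1: "snd (D_conn A G B P g H nab \<theta> X (D_conn A G B P g H nab \<theta> Y (Z, r))) p
      = d\<theta> X (d\<theta> Y r) p - d\<theta> X (F Y Z) p - F X (Nm Y Z) p - F X (Fd Y r) p"
    if X: "vfield A U X" and Y: "vfield A U Y" for X Y
    using F_add[OF X N_vfield[OF Y Z] Fd_vfield[OF Y r] p, of "-1/2"]
      d_theta_diff[OF X p d_theta_smooth_at[OF Y r p] ad_section_smooth_at[OF F_section[OF Y Z] p]]
    by (simp add: D_conn_def)
  have 2: "d\<theta> (lie_bracket A X Y) r p = d\<theta> X (d\<theta> Y r) p - d\<theta> Y (d\<theta> X r) p + tder (vert (F X Y p) p) r"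
    using d_theta_curvature[OF X Y r p] by (simp add: algebra_simps)
  show ?thesis
    unfolding D_curvature_def Let_def snd_conv 1[OF X Y] 1[OF Y X] nabla_F_eq[OF X Y Z p] FFd_def
    by (simp add: D_conn_def 2)
qed

text \<open>The pairing identifies this block with the derivative of \<open>F\<close>: the terms
  that differentiate \<open>r\<close> cancel, and what remains is again the right-hand side of
  \<open>nabla_F_eq\<close>.\<close>

lemma mixed_inner:
  assumes X: "vfield A U X" and Y: "vfield A U Y" and W: "vfield A U W" and r: "ad_section G P U r"
    and p: "\<pi> p \<in> U"
  shows "mixed X Y r (\<pi> p) \<in> T (\<pi> p)"
    and "g (\<pi> p) (mixed X Y r (\<pi> p)) (W (\<pi> p)) = B (nF W X Y p) (r p)"
proof -
  let ?x = "\<pi> p"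
  note XY = lie_bracket_vfield[OF X Y]
  note WT = vfield_tangent[OF W p]
  note t = N_tangent[OF X Fd_vfield[OF Y r] p] N_tangent[OF Y Fd_vfield[OF X r] p]
    Fd_tangent[OF X p] Fd_tangent[OF Y p] Fd_tangent[OF XY p]
  have t1: "tlin 1 (Nm X (Fd Y r) ?x) 1 (Fd X (d\<theta> Y r) ?x) \<in> T ?x"
    "tlin 1 (Nm Y (Fd X r) ?x) 1 (Fd Y (d\<theta> X r) ?x) \<in> T ?x"
    by (rule tangent_tlin[OF t(1,3)], rule tangent_tlin[OF t(2,4)])
  have t2: "tlin 1 (tlin 1 (Nm Y (Fd X r) ?x) 1 (Fd Y (d\<theta> X r) ?x)) 1 (Fd (lie_bracket A X Y) r ?x) \<in> T ?x"
    by (rule tangent_tlin[OF t1(2) t(5)])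
  show "mixed X Y r ?x \<in> T ?x" by (rule tangent_tlin[OF t1(1) t2])
  \<comment> \<open>Metric compatibility of \<open>\<nabla>\<^sup>-\<close> moves the derivative
    onto the scalar \<open>- pr (F Y W) r\<close>, where \<open>pair_derivative\<close>
    applies.\<close>
  have 1: "g ?x (Nm X (Fd Y r) ?x) (W ?x)
      = - B (d\<theta> X (F Y W) p) (r p) - B (F Y W p) (d\<theta> X r p) + B (F Y (Nm X W) p) (r p)"
    if X: "vfield A U X" and Y: "vfield A U Y" for X Y
  proof -
    have "X ?x (\<lambda>y. g y (Fd Y r y) (W y)) = X ?x (\<lambda>y. - pr (F Y W) r y)"
      by (rule tangent_cong[OF vfield_tangent[OF X p] vfield_open[OF X] p]) (rule Fd_inner[OF Y _ W])
    also have "\<dots> = - X ?x (pr (F Y W) r)"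
      by (rule tangent_minus[OF vfield_tangent[OF X p] smooth_atI[OF pair_smooth[OF F_section[OF Y W] r] p]])
    also have "X ?x (pr (F Y W) r) = B (d\<theta> X (F Y W) p) (r p) + B (F Y W p) (d\<theta> X r p)"
      unfolding pair_derivative[OF X F_section[OF Y W] r p]
        pair_eq[OF d_theta_section[OF X F_section[OF Y W]] r p]
        pair_eq[OF F_section[OF Y W] d_theta_section[OF X r] p] ..
    finally have "X ?x (\<lambda>y. g y (Fd Y r y) (W y))
        = - (B (d\<theta> X (F Y W) p) (r p) + B (F Y W p) (d\<theta> X r p))" .
    moreover have "g ?x (Fd Y r ?x) (Nm X W ?x) = - B (F Y (Nm X W) p) (r p)"
      using Fd_inner[OF Y p N_vfield[OF X W] p, of r "-1/2"] pair_eq[OF F_section[OF Y N_vfield[OF X W]] r p, of "-1/2"]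
      by simp
    ultimately show ?thesis
      using N_metric[OF X Fd_vfield[OF Y r] W p, of "-1/2"] by simp
  qed
  have 2: "g ?x (Fd X t ?x) (W ?x) = - B (F X W p) (t p)"
    if X: "vfield A U X" and t: "ad_section G P U t" for X t
    using Fd_inner[OF X p W p, of t] pair_eq[OF F_section[OF X W] t p] by simp
  show "g ?x (mixed X Y r ?x) (W ?x) = B (nF W X Y p) (r p)"
    unfolding g_lin1[OF t1(1) t2 WT] g_lin1[OF t(1,3) WT] g_lin1[OF t1(2) t(5) WT] g_lin1[OF t(2,4) WT]
      1[OF X Y] 1[OF Y X] 2[OF X d_theta_section[OF Y r]] 2[OF Y d_theta_section[OF X r]] 2[OF XY r]
      nabla_F_eq[OF X Y W p]
    by (simp add: linear_add[OF B_linear(1)] linear_diff[OF B_linear(1)] linear_neg[OF B_linear(1)])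
qed

lemma mixed_kills:
  assumes r: "ad_section G P W r" and e: "on_frame A g W e" and x: "sproj Q q \<in> W"
  shows "(\<Sum>i\<in>UNIV. \<Sum>j\<in>UNIV. (\<Psi> q e i j $ a) * mixed (e i) (e j) r (sproj Q q) f) = 0"
proof -
  obtain p where p: "\<pi> p = sproj Q q" using proj_surj .
  have pW: "\<pi> p \<in> W" using x p by simp
  note ev = frame_vfield[OF e]
  show ?thesis
  proof (rule double_sum_tangent_zero[where f = f and \<alpha> = "\<lambda>i j. mixed (e i) (e j) r (sproj Q q)",
        OF _ frame_open[OF e] x])
    show "mixed (e i) (e j) r (sproj Q q) \<in> T (sproj Q q)" for i j
      using mixed_inner(1)[OF ev ev ev r pW] by (simp add: p)
    fix V Y assume Y: "vfield A V Y" and xV: "sproj Q q \<in> V" and V: "V \<subseteq> W"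
    have oV: "open V" by (rule vfield_open[OF Y])
    have eV: "on_frame A g V e" by (rule frame_subset[OF e oV V])
    have pV: "\<pi> p \<in> V" using xV p by simp
    have "g (sproj Q q) (mixed (e i) (e j) r (sproj Q q)) (Y (sproj Q q)) = B (nF Y (e i) (e j) p) (r p)" for i j
      using mixed_inner(2)[OF frame_vfield[OF eV] frame_vfield[OF eV] Y ad_section_subset[OF r oV V] pV, of i j]
      by (simp only: p)
    then have "(\<Sum>i\<in>UNIV. \<Sum>j\<in>UNIV. (\<Psi> q e i j $ a)
          * g (sproj Q q) (mixed (e i) (e j) r (sproj Q q)) (Y (sproj Q q)))
        = B (\<Sum>i\<in>UNIV. \<Sum>j\<in>UNIV. (\<Psi> q e i j $ a) *\<^sub>R nF Y (e i) (e j) p) (r p)"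
      by (simp only: linear_sum[OF B_linear(1)] linear_scale[OF B_linear(1)] real_scaleR_def)
    also have "\<dots> = 0"
      unfolding nabla_F_kills[OF Y eV pV p[symmetric]] by (rule linear_0[OF B_linear(1)])
    finally show "(\<Sum>i\<in>UNIV. \<Sum>j\<in>UNIV. (\<Psi> q e i j $ a)
          * g (sproj Q q) (mixed (e i) (e j) r (sproj Q q)) (Y (sproj Q q))) = 0" .
  qed
qed

text \<open>A vertical derivative of \<open>r\<close> is linear in its parameter, so the contraction
  moves inside and meets \<open>F\<close> alone.\<close>

lemma vert_F_kills:
  assumes r: "ad_section G P W r" and e: "on_frame A g W e" and p: "\<pi> p \<in> W" and q: "sproj Q q = \<pi> p"
  shows "(\<Sum>i\<in>UNIV. \<Sum>j\<in>UNIV. (\<Psi> q e i j $ a) *\<^sub>R tder (vert (F (e i) (e j) p) p) r) = 0"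
proof -
  note lin = tder_vert_linear[OF ad_section_smooth_at[OF r p]]
  have "(\<Sum>i\<in>UNIV. \<Sum>j\<in>UNIV. (\<Psi> q e i j $ a) *\<^sub>R tder (vert (F (e i) (e j) p) p) r)
      = tder (vert (\<Sum>i\<in>UNIV. \<Sum>j\<in>UNIV. (\<Psi> q e i j $ a) *\<^sub>R F (e i) (e j) p) p) r"
    by (simp only: linear_sum[OF lin] linear_scale[OF lin])
  also have "\<dots> = 0"
    using F_kills_component[OF e _ q[symmetric], of a] p q linear_0[OF lin] by simp
  finally show ?thesis .
qed

lemma D_annihilates_spinor: "D_instanton A G B P Q g H nab \<theta> \<eta>"
  unfolding D_instanton_def
proof (intro allI impI, elim conjE, intro conjI)
  fix U Z and r :: "'p \<Rightarrow> 'l" assume Z: "vfield A U Z" and r: "ad_section G P U r"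
  show "annihilates_T A g Q \<eta> U (\<lambda>X Y. fst (DD X Y (Z, r)))"
    unfolding annihilates_T_def Let_def
  proof (intro allI impI ext, elim conjE)
    fix V e q a f assume V: "V \<subseteq> U" and e: "on_frame A g V e" and x: "sproj Q q \<in> V"
    note o = frame_open[OF e]
    note ZV = vfield_subset[OF Z o V] and rV = ad_section_subset[OF r o V] and ev = frame_vfield[OF e]
    have "(\<Sum>i\<in>UNIV. \<Sum>j\<in>UNIV. (\<Psi> q e i j $ a) * fst (DD (e i) (e j) (Z, r)) (sproj Q q) f) = 0"
      unfolding D_curvature_fst[OF ev ev ZV rV x] distrib_left sum.distrib
        curvature_FdF_kills[OF ZV e x] mixed_kills[OF rV e x] by simp
    then show "1 / 4 * (\<Sum>i\<in>UNIV. \<Sum>j\<in>UNIV. (\<Psi> q e i j $ a) * fst (DD (e i) (e j) (Z, r)) (sproj Q q) f) = 0"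
      by simp
  qed
  show "annihilates_ad A g P Q \<eta> U (\<lambda>X Y. snd (DD X Y (Z, r)))"
    unfolding annihilates_ad_def Let_def
  proof (intro allI impI, elim conjE)
    fix V e p q a assume V: "V \<subseteq> U" and e: "on_frame A g V e" and x: "sproj Q q \<in> V" and p: "\<pi> p = sproj Q q"
    note o = frame_open[OF e]
    note ZV = vfield_subset[OF Z o V] and rV = ad_section_subset[OF r o V] and ev = frame_vfield[OF e]
    have pV: "\<pi> p \<in> V" using x p by simp
    show "(1 / 4) *\<^sub>R (\<Sum>i\<in>UNIV. \<Sum>j\<in>UNIV. (\<Psi> q e i j $ a) *\<^sub>R snd (DD (e i) (e j) (Z, r)) p) = 0"
      unfolding D_curvature_snd[OF ev ev ZV rV pV] scaleR_diff_right sum_subtractf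
        nabla_F_kills[OF ZV e pV p[symmetric]] vert_F_kills[OF rV e pV p[symmetric]]
        FFd_kills[OF rV e pV p[symmetric]] by simp
  qed
qed

lemma coupled_system: "coupled_instanton A G B P Q g H nab \<theta> \<eta>"
  unfolding coupled_instanton_def
proof (intro conjI allI impI bianchi)
  fix U Z assume Z: "vfield A U Z"
  show "annihilates_T A g Q \<eta> U (\<lambda>X Y x. tlin 1 (R (-1/2) X Y Z x) (-1) (FdF A G B P g \<theta> X Y Z x))"
    unfolding annihilates_T_def Let_def
  proof (intro allI impI ext, elim conjE)
    fix V e q a f assume V: "V \<subseteq> U" and e: "on_frame A g V e" and x: "sproj Q q \<in> V"
    note ZV = vfield_subset[OF Z frame_open[OF e] V]
    show "1 / 4 * (\<Sum>i\<in>UNIV. \<Sum>j\<in>UNIV. (\<Psi> q e i j $ a) * tlin 1 (R (-1/2) (e i) (e j) Z (sproj Q q)) (-1)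
        (FdF A G B P g \<theta> (e i) (e j) Z (sproj Q q)) f) = 0"
      unfolding curvature_FdF_kills[OF ZV e x] by simp
  qed
  show "annihilates_ad A g P Q \<eta> U (nF Z)"
    unfolding annihilates_ad_def Let_def
  proof (intro allI impI, elim conjE)
    fix V e p q a assume V: "V \<subseteq> U" and e: "on_frame A g V e" and x: "sproj Q q \<in> V" and p: "\<pi> p = sproj Q q"
    have pV: "\<pi> p \<in> V" using x p by simp
    show "(1 / 4) *\<^sub>R (\<Sum>i\<in>UNIV. \<Sum>j\<in>UNIV. (\<Psi> q e i j $ a) *\<^sub>R nF Z (e i) (e j) p) = 0"
      unfolding nabla_F_kills[OF vfield_subset[OF Z frame_open[OF e] V] e pV p[symmetric]] by simp
  qed
next
  fix U and r :: "'p \<Rightarrow> 'l" assume r: "ad_section G P U r"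
  show "annihilates_ad A g P Q \<eta> U (\<lambda>X Y p. lbr G (F X Y p) (r p) - FFd A G B P g \<theta> X Y r p)"
    unfolding annihilates_ad_def Let_def
  proof (intro allI impI, elim conjE)
    fix V e p q a assume V: "V \<subseteq> U" and e: "on_frame A g V e" and x: "sproj Q q \<in> V" and p: "\<pi> p = sproj Q q"
    have pV: "\<pi> p \<in> V" using x p by simp
    show "(1 / 4) *\<^sub>R (\<Sum>i\<in>UNIV. \<Sum>j\<in>UNIV. (\<Psi> q e i j $ a) *\<^sub>R
        (lbr G (F (e i) (e j) p) (r p) - FFd A G B P g \<theta> (e i) (e j) r p)) = 0"
      unfolding scaleR_diff_right sum_subtractf bracket_F_kills[OF e pV p[symmetric]]
        FFd_kills[OF ad_section_subset[OF r frame_open[OF e] V] e pV p[symmetric]] by simp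
  qed
qed

end

theorem theorem2p32:
  fixes A :: "('m::{t2_space, second_countable_topology}, real^'n) atlas"
    and G :: "('k::{t2_space, second_countable_topology}, 'l::real_inner) lie_data"
    and B :: "'l \<Rightarrow> 'l \<Rightarrow> real"
    and P :: "('p::{t2_space, second_countable_topology}, 'ep::euclidean_space, 'm, 'k) pbundle"
    and Q :: "('q, 'm, 'n::finite, 's::finite) spin_data"
    and g :: "'m metric"
    and H :: "'m \<Rightarrow> 'm tvec \<Rightarrow> 'm tvec \<Rightarrow> 'm tvec \<Rightarrow> real"
    and nab :: "'m conn"
    and \<theta> :: "'p \<Rightarrow> 'p tvec \<Rightarrow> 'l"
    and \<eta> :: "'q \<Rightarrow> real^'s"
  assumes "smooth_atlas A" and "oriented_atlas A"
    and "lie_group G" and "biinvariant_form G B"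
    and "principal_bundle A G P"
    and "riemannian_metric A g"
    and "levi_civita A g nab"
    and "spin_structure A g Q"
    and "three_form A H"
    and "principal_connection G P \<theta>"
    and "spinor A Q \<eta>"
  shows
    "(spin_parallel A g Q (torsion_conn A g H nab (1/2)) \<eta> \<and>
      annihilates_ad A g P Q \<eta> UNIV (F_theta A G P \<theta>) \<and>
      bianchi_identity A G B P H \<theta>
      \<longrightarrow> coupled_instanton A G B P Q g H nab \<theta> \<eta> \<and>
          D_instanton A G B P Q g H nab \<theta> \<eta>) \<and>
     (\<forall>\<zeta> \<mu>. one_form A \<zeta> \<and>
      spin_parallel A g Q (torsion_conn A g H nab (1/2)) \<eta> \<and>
      annihilates_ad A g P Q \<eta> UNIV (F_theta A G P \<theta>) \<and>
      dirac_eigen A g Q (torsion_conn A g H nab (1/6)) \<zeta> \<mu> \<eta> \<and>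
      bianchi_identity A G B P H \<theta>
      \<longrightarrow> coupled_instanton A G B P Q g H nab \<theta> \<eta>)"
proof -
  \<comment> \<open>The Lie algebra comes with a finite spanning set; the locales want an orthobasis
    of it.\<close>
  obtain S :: "'l set" where "finite S" "span S = UNIV"
    using assms(3) unfolding lie_group_def by blast
  then obtain lb :: "'l set" where lb: "orthobasis lb" using orthobasis_exists by blast
  have "coupled_instanton A G B P Q g H nab \<theta> \<eta> \<and> D_instanton A G B P Q g H nab \<theta> \<eta>"
    if "spin_parallel A g Q (torsion_conn A g H nab (1/2)) \<eta>"
      "annihilates_ad A g P Q \<eta> UNIV (F_theta A G P \<theta>)" "bianchi_identity A G B P H \<theta>"
  proof -
    interpret coupled A g nab H Q \<eta> G lb P \<theta> B
      by unfold_locales (use assms lb that orthobasis_Basis frames_of_spin_structure[OF assms(8)] in auto)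
    show ?thesis using coupled_system D_annihilates_spinor by blast
  qed
  then show ?thesis by blast
qed

end
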